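(* Let $(P_k)_{k\in\mathbb N}$ be a random fragmentation law, and let $N$, $V$ and the cumulative occupancy counts $K_{n,j}(\cdot)$ of the associated nested occupancy scheme be as in the context. Let $W=(W(s))_{s\ge 0}$ be a centered Gaussian process with $W(0)=0$ which is a.s. locally Hölder continuous with some exponent $\beta>0$. Assume that: (i) $b_0+b_1t^{\omega-\varepsilon_1}\le V(t)-ct^{\omega}\le a_0+a_1t^{\omega-\varepsilon_2}$ for all $t\ge 0$ and some constants $c,\omega,a_0,a_1>0$, $0<\varepsilon_1,\varepsilon_2\le\omega$ and $b_0,b_1\in\mathbb R$; (ii) $\mathbb E\sup_{s\in[0,t]}(N(s)-V(s))^2=O(t^{2\gamma})$ as $t\to\infty$, for some $\gamma\in(\omega-\min(1,\varepsilon_1,\varepsilon_2),\,\omega)$; (iii) for some $a>0$, $\left(\dfrac{N(ts)-c(ts)^{\omega}}{at^{\gamma}}\right)_{s\ge0}\Rightarrow (W(s))_{s\ge 0}$ as $t\to\infty$ weakly in the $J_1$-topology on $D[0,\infty)$. Then $$\left(\left(\frac{K_{n,j}(s)-c_j(s\log n)^{\omega j}}{a\,c_{j-1}(\log n)^{\gamma+\omega(j-1)}}\right)_{s\in[0,1]}\right)_{j\in\mathbb N}\ \Rightarrow\ \left((R^{(\omega)}_j(s))_{s\in[0,1]}\right)_{j\in\mathbb N},\qquad n\to\infty,$$ weakly in the (product) $J_1$-topology on $D[0,1]^{\mathbb N}$, where $$c_j:=\frac{(c\,\Gamma(\omega+1))^j}{\Gamma(\omega j+1)},\quad j\ge 0,$$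 $\Gamma$ is the gamma function, $R^{(\omega)}_1(s):=W(s)$ and, for $j\ge 2$, $R^{(\omega)}_j(s):=\int_{[0,s]}(s-y)^{\omega(j-1)}\,dW(y)$, understood as $\omega(j-1)\int_0^s(s-y)^{\omega(j-1)-1}W(y)\,dy$.
   Context: Fragmentation law and nested occupancy scheme. A fragmentation law is a sequence of random variables $(P_k)_{k\in\mathbb N}$ with arbitrary joint distribution, $P_k>0$ and $\sum_kP_k=1$ a.s. Let $\mathbb V_j$ be the set of words of length $j$ over the alphabet $\mathbb N$, $\mathbb V_0=\{\varnothing\}$, $\mathbb V=\bigcup_{j\ge0}\mathbb V_j$. Let $(P^{(v)}_k)_{k\in\mathbb N}$, $v\in\mathbb V$, be independent copies of $(P_k)_{k\in\mathbb N}$, and define recursively $P(\varnothing)=1$, $P(vk)=P(v)P^{(v)}_k$ for $v\in\mathbb V$, $k\in\mathbb N$. Each $v\in\mathbb V$ is a box, whose sub-boxes are $v1,v2,\dots$. Given $(P(v))_{v\in\mathbb V}$, balls are thrown independently; each ball falls, at every level $j$, into exactly one box of $\mathbb V_j$, hitting box $v$ with probability $P(v)$, in a nested way (a ball in box $v$ goes to sub-box $vk$ with conditional probability $P^{(v)}_k$). For $j,r\in\mathbb N$, $K_{n,j,r}$ is the number of boxes in $\mathbb V_j$ containing exactly $r$ of the first $n$ balls, and $$K_{n,j}(s):=\sum_{r=\lceil n^{1-s}\rceil}^nK_{n,j,r},\quad s\in[0,1].$$ Counting functions: $N(t):=\#\{k\in\mathbb N:P_k\ge e^{-t}\}$ and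 $V(t):=\mathbb EN(t)$ for $t\in\mathbb R$. $D[0,\infty)$ and $D[0,1]$ denote the Skorokhod spaces of càdlàg functions; $\Rightarrow$ is weak convergence. *)

theory Defs
  imports "HOL-Probability.Probability"
begin

section \<open>Skorokhod spaces\<close>

text \<open>
  Paths on an interval \<open>I\<close> (here \<open>{0..1}\<close> or \<open>{0..}\<close>) are functions that are
  \<open>undefined\<close> outside \<open>I\<close>, so that equality of paths is equality on \<open>I\<close>.
\<close>

definition cadlag_paths :: "real set \<Rightarrow> (real \<Rightarrow> real) set" where
  "cadlag_paths I = {f \<in> extensional I. \<forall>t\<in>I.
     (f \<longlongrightarrow> f t) (at t within I \<inter> {t<..}) \<and> (\<exists>l. (f \<longlongrightarrow> l) (at t within I \<inter> {..<t}))}"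

text \<open>Increasing bijections of an interval onto itself are automatically homeomorphisms.\<close>

definition time_changes :: "real set \<Rightarrow> (real \<Rightarrow> real) set" where
  "time_changes I = {\<tau>. strict_mono_on I \<tau> \<and> bij_betw \<tau> I I}"

definition J1_nbhd :: "real set \<Rightarrow> (real \<Rightarrow> real) \<Rightarrow> real \<Rightarrow> real \<Rightarrow> (real \<Rightarrow> real) set" where
  "J1_nbhd I f e T = {g \<in> cadlag_paths I. \<exists>\<tau>\<in>time_changes I.
     (\<forall>s\<in>I. \<bar>\<tau> s - s\<bar> < e) \<and> (\<forall>s\<in>I. s \<le> T \<longrightarrow> \<bar>g (\<tau> s) - f s\<bar> < e)}"

text \<open>
  The \<open>J\<^sub>1\<close>-topology.  The sets \<^const>\<open>J1_nbhd\<close> are neighbourhood bases for the usual notion of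
  Skorokhod convergence: \<open>g\<^sub>n\<close> converges to \<open>f\<close> iff there are time changes \<open>\<tau>\<^sub>n\<close> such that
  \<open>\<tau>\<^sub>n\<close> converges to the identity uniformly on \<open>I\<close> and \<open>g\<^sub>n \<circ> \<tau>\<^sub>n\<close> converges to \<open>f\<close> uniformly
  on \<open>I \<inter> {..T}\<close> for every \<open>T\<close> (Billingsley, Convergence of Probability Measures, Theorem 16.1;
  Jacod and Shiryaev, Theorem VI.1.14).  For \<open>I = {0..1}\<close> every \<open>T \<ge> 1\<close> gives
  the ball of radius essentially \<open>e\<close> in the classical Skorokhod metric.
\<close>

definition J1_topology :: "real set \<Rightarrow> (real \<Rightarrow> real) topology" where
  "J1_topology I = topology (\<lambda>U. U \<subseteq> cadlag_paths I \<and>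
     (\<forall>f\<in>U. \<exists>e>0. \<exists>T. J1_nbhd I f e T \<subseteq> U))"

lemma J1_nbhd_mono:
  assumes "e \<le> e'" "T' \<le> T"
  shows "J1_nbhd I f e T \<subseteq> J1_nbhd I f e' T'"
proof
  fix g assume "g \<in> J1_nbhd I f e T"
  then obtain l where l: "g \<in> cadlag_paths I" "l \<in> time_changes I" "\<forall>s\<in>I. \<bar>l s - s\<bar> < e"
    "\<forall>s\<in>I. s \<le> T \<longrightarrow> \<bar>g (l s) - f s\<bar> < e"
    unfolding J1_nbhd_def by blast
  have "\<forall>s\<in>I. \<bar>l s - s\<bar> < e'" using l(3) assms(1) by fastforce
  moreover have "\<forall>s\<in>I. s \<le> T' \<longrightarrow> \<bar>g (l s) - f s\<bar> < e'" using l(4) assms by fastforce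
  ultimately show "g \<in> J1_nbhd I f e' T'"
    unfolding J1_nbhd_def using l(1,2) by blast
qed

lemma istopology_J1:
  "istopology (\<lambda>U. U \<subseteq> cadlag_paths I \<and> (\<forall>f\<in>U. \<exists>e>0. \<exists>T. J1_nbhd I f e T \<subseteq> U))"
  unfolding istopology_def
proof (intro conjI allI impI)
  fix S U assume S: "S \<subseteq> cadlag_paths I \<and> (\<forall>f\<in>S. \<exists>e>0. \<exists>T. J1_nbhd I f e T \<subseteq> S)"
    and U: "U \<subseteq> cadlag_paths I \<and> (\<forall>f\<in>U. \<exists>e>0. \<exists>T. J1_nbhd I f e T \<subseteq> U)"
  show "S \<inter> U \<subseteq> cadlag_paths I" using S by blast
  show "\<forall>f\<in>S \<inter> U. \<exists>e>0. \<exists>T. J1_nbhd I f e T \<subseteq> S \<inter> U"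
  proof
    fix f assume "f \<in> S \<inter> U"
    then obtain e1 T1 e2 T2 where *: "e1 > 0" "J1_nbhd I f e1 T1 \<subseteq> S" "e2 > 0" "J1_nbhd I f e2 T2 \<subseteq> U"
      using S U by (meson IntD1 IntD2)
    have "J1_nbhd I f (min e1 e2) (max T1 T2) \<subseteq> S \<inter> U"
      using J1_nbhd_mono[of "min e1 e2" e1 T1 "max T1 T2" I f]
        J1_nbhd_mono[of "min e1 e2" e2 T2 "max T1 T2" I f] * by auto
    then show "\<exists>e>0. \<exists>T. J1_nbhd I f e T \<subseteq> S \<inter> U" using * by (metis min_less_iff_conj)
  qed
next
  fix K assume K: "\<forall>U\<in>K. U \<subseteq> cadlag_paths I \<and> (\<forall>f\<in>U. \<exists>e>0. \<exists>T. J1_nbhd I f e T \<subseteq> U)"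
  show "\<Union>K \<subseteq> cadlag_paths I" using K by blast
  show "\<forall>f\<in>\<Union>K. \<exists>e>0. \<exists>T. J1_nbhd I f e T \<subseteq> \<Union>K"
    using K by (meson Union_iff Sup_upper order_trans)
qed

lemma openin_J1_topology:
  "openin (J1_topology I) U \<longleftrightarrow>
     U \<subseteq> cadlag_paths I \<and> (\<forall>f\<in>U. \<exists>e>0. \<exists>T. J1_nbhd I f e T \<subseteq> U)"
  unfolding J1_topology_def by (simp add: topology_inverse'[OF istopology_J1])

lemma topspace_J1_topology [simp]: "topspace (J1_topology I) = cadlag_paths I"
proof -
  have "openin (J1_topology I) (cadlag_paths I)"
    unfolding openin_J1_topology J1_nbhd_def by (auto intro: exI[of _ "1::real"])
  then show ?thesis
    unfolding topspace_def using openin_J1_topology by blast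
qed

section \<open>Weak convergence of random elements of a topological space\<close>

definition borel_of_topology :: "'a topology \<Rightarrow> 'a measure" where
  "borel_of_topology T = sigma (topspace T) {U. openin T U}"

text \<open>
  Some of the processes have paths in the Skorokhod space only almost surely.  Therefore weak
  convergence is formulated through genuine (Borel measurable) random elements that agree
  almost surely with the given ones; the integrals do not depend on their choice.
\<close>

definition random_element_version ::
  "'w measure \<Rightarrow> 'a topology \<Rightarrow> ('w \<Rightarrow> 'a) \<Rightarrow> ('w \<Rightarrow> 'a) \<Rightarrow> bool" where
  "random_element_version M T X X' \<longleftrightarrow>
     X' \<in> M \<rightarrow>\<^sub>M borel_of_topology T \<and> (AE \<omega> in M. X \<omega> = X' \<omega>)"

definition converges_weakly ::
  "'a topology \<Rightarrow> 'i filter \<Rightarrow> 'w measure \<Rightarrow> ('i \<Rightarrow> 'w \<Rightarrow> 'a) \<Rightarrow> 'v measure \<Rightarrow> ('v \<Rightarrow> 'a) \<Rightarrow> bool"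
where
  "converges_weakly T F M X N Y \<longleftrightarrow>
     (\<exists>X' Y'. (\<forall>\<^sub>F i in F. random_element_version M T (X i) (X' i)) \<and>
        random_element_version N T Y Y' \<and>
        (\<forall>f. continuous_map T euclideanreal f \<and> bounded (f ` topspace T) \<longrightarrow>
           ((\<lambda>i. \<integral>\<omega>. f (X' i \<omega>) \<partial>M) \<longlongrightarrow> (\<integral>\<omega>. f (Y' \<omega>) \<partial>N)) F))"

section \<open>Gaussian processes and Hoelder continuity\<close>

text \<open>Degenerate Gaussian variables are included.\<close>

definition centered_gaussian :: "'v measure \<Rightarrow> ('v \<Rightarrow> real) \<Rightarrow> bool" where
  "centered_gaussian M X \<longleftrightarrow> X \<in> borel_measurable M \<and>
     ((AE \<omega> in M. X \<omega> = 0) \<or> (\<exists>\<sigma>>0. distributed M lborel X (normal_density 0 \<sigma>)))"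

definition centered_gaussian_process :: "'v measure \<Rightarrow> real set \<Rightarrow> (real \<Rightarrow> 'v \<Rightarrow> real) \<Rightarrow> bool" where
  "centered_gaussian_process M I W \<longleftrightarrow> prob_space M \<and>
     (\<forall>S u. finite S \<and> S \<subseteq> I \<longrightarrow> centered_gaussian M (\<lambda>\<omega>. \<Sum>s\<in>S. u s * W s \<omega>))"

definition locally_hoelder :: "real \<Rightarrow> (real \<Rightarrow> real) \<Rightarrow> bool" where
  "locally_hoelder \<beta> w \<longleftrightarrow>
     (\<forall>T>0. \<exists>C. \<forall>s\<in>{0..T}. \<forall>t\<in>{0..T}. \<bar>w s - w t\<bar> \<le> C * \<bar>s - t\<bar> powr \<beta>)"

section \<open>Fragmentation laws\<close>

text \<open>The index set of the fragments is \<open>{0, 1, 2, \<dots>}\<close> instead of \<open>{1, 2, 3, \<dots>}\<close>.\<close>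

definition fragmentation_law :: "'f measure \<Rightarrow> (nat \<Rightarrow> 'f \<Rightarrow> real) \<Rightarrow> bool" where
  "fragmentation_law M P \<longleftrightarrow> prob_space M \<and> (\<forall>k. P k \<in> borel_measurable M) \<and>
     (AE \<omega> in M. (\<forall>k. P k \<omega> > 0) \<and> (\<lambda>k. P k \<omega>) sums 1)"

definition frag_count :: "(nat \<Rightarrow> 'f \<Rightarrow> real) \<Rightarrow> real \<Rightarrow> 'f \<Rightarrow> real" where
  "frag_count P t \<omega> = real (card {k. P k \<omega> \<ge> exp (- t)})"

text \<open>
  For a fragmentation law, \<^term>\<open>frag_count P t\<close> is almost surely at most \<open>exp t\<close>, so
  that this expectation is always finite.
\<close>

definition mean_frag_count :: "'f measure \<Rightarrow> (nat \<Rightarrow> 'f \<Rightarrow> real) \<Rightarrow> real \<Rightarrow> real" where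
  "mean_frag_count M P t = (\<integral>\<omega>. frag_count P t \<omega> \<partial>M)"

section \<open>Nested occupancy scheme\<close>

text \<open>
  \<open>Q v k\<close> is the factor \<open>P\<^sup>(\<^sup>v\<^sup>)\<^sub>k\<close>.  Letters are appended at the end of
  a word, so the letter \<open>v ! i\<close> refers to the fragmentation of the box \<open>take i v\<close>.
\<close>

definition box_prob :: "(nat list \<Rightarrow> nat \<Rightarrow> 'w \<Rightarrow> real) \<Rightarrow> nat list \<Rightarrow> 'w \<Rightarrow> real" where
  "box_prob Q v \<omega> = (\<Prod>i<length v. Q (take i v) (v ! i) \<omega>)"

lemma box_prob_Nil: "box_prob Q [] \<omega> = 1"
  by (simp add: box_prob_def)

lemma box_prob_snoc: "box_prob Q (v @ [k]) \<omega> = box_prob Q v \<omega> * Q v k \<omega>"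
  by (simp add: box_prob_def nth_append)

text \<open>
  \<open>X i m\<close> is the letter chosen by ball \<open>i\<close> when it passes from level \<open>m\<close> to level \<open>m + 1\<close>;
  thus every ball is in exactly one box at each level and the boxes are nested.
\<close>

definition ball_box :: "(nat \<Rightarrow> nat \<Rightarrow> 'w \<Rightarrow> nat) \<Rightarrow> nat \<Rightarrow> nat \<Rightarrow> 'w \<Rightarrow> nat list" where
  "ball_box X i j \<omega> = map (\<lambda>m. X i m \<omega>) [0..<j]"

definition env_algebra :: "'w measure \<Rightarrow> (nat list \<Rightarrow> nat \<Rightarrow> 'w \<Rightarrow> real) \<Rightarrow> 'w measure" where
  "env_algebra M Q =
     vimage_algebra (space M) (\<lambda>\<omega> v. box_prob Q v \<omega>) (\<Pi>\<^sub>M v\<in>UNIV. (borel :: real measure))"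

text \<open>
  The last clause says that, given the box probabilities, the balls are independent and each of
  them hits the box \<open>v\<close> with probability \<open>P(v)\<close>.
\<close>

definition nested_occupancy_scheme ::
  "'f measure \<Rightarrow> (nat \<Rightarrow> 'f \<Rightarrow> real) \<Rightarrow> 'w measure \<Rightarrow> (nat list \<Rightarrow> nat \<Rightarrow> 'w \<Rightarrow> real) \<Rightarrow>
   (nat \<Rightarrow> nat \<Rightarrow> 'w \<Rightarrow> nat) \<Rightarrow> bool" where
  "nested_occupancy_scheme M0 P M Q X \<longleftrightarrow>
     prob_space M \<and>
     prob_space.indep_vars M (\<lambda>_. \<Pi>\<^sub>M k\<in>UNIV. (borel :: real measure)) (\<lambda>v \<omega> k. Q v k \<omega>) UNIV \<and>
     (\<forall>v. distr M (\<Pi>\<^sub>M k\<in>UNIV. borel) (\<lambda>\<omega> k. Q v k \<omega>) =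
          distr M0 (\<Pi>\<^sub>M k\<in>UNIV. borel) (\<lambda>\<omega> k. P k \<omega>)) \<and>
     (\<forall>i m. X i m \<in> M \<rightarrow>\<^sub>M count_space UNIV) \<and>
     (\<forall>n (v :: nat \<Rightarrow> nat list). AE \<omega> in M.
        real_cond_exp M (env_algebra M Q)
          (indicator {\<omega> \<in> space M. \<forall>i<n. ball_box X i (length (v i)) \<omega> = v i}) \<omega>
        = (\<Prod>i<n. box_prob Q (v i) \<omega>))"

definition occupancy_count :: "(nat \<Rightarrow> nat \<Rightarrow> 'w \<Rightarrow> nat) \<Rightarrow> nat \<Rightarrow> nat \<Rightarrow> nat \<Rightarrow> 'w \<Rightarrow> nat" where
  "occupancy_count X n j r \<omega> =
     card {v. length v = j \<and> card {i. i < n \<and> ball_box X i j \<omega> = v} = r}"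

definition cum_occupancy :: "(nat \<Rightarrow> nat \<Rightarrow> 'w \<Rightarrow> nat) \<Rightarrow> nat \<Rightarrow> nat \<Rightarrow> real \<Rightarrow> 'w \<Rightarrow> real" where
  "cum_occupancy X n j s \<omega> =
     (\<Sum>r = nat \<lceil>real n powr (1 - s)\<rceil>..n. real (occupancy_count X n j r \<omega>))"

section \<open>Constants and limit processes\<close>

text \<open>The power \<open>t\<^sup>x\<close> for \<open>t \<ge> 0\<close> with \<open>0\<^sup>0 = 1\<close>, whereas \<^term>\<open>0 powr 0 = (0::real)\<close>.\<close>

definition rpow :: "real \<Rightarrow> real \<Rightarrow> real" where
  "rpow t x = (if x = 0 then 1 else t powr x)"

definition lim_const :: "real \<Rightarrow> real \<Rightarrow> nat \<Rightarrow> real" where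
  "lim_const c \<omega> j = (c * Gamma (\<omega> + 1)) ^ j / Gamma (\<omega> * real j + 1)"

text \<open>The path of \<open>R\<^sub>j\<close>, \<open>j \<ge> 1\<close>, as a function of the path \<open>w\<close> of the Gaussian process.\<close>

definition lim_path :: "real \<Rightarrow> nat \<Rightarrow> (real \<Rightarrow> real) \<Rightarrow> real \<Rightarrow> real" where
  "lim_path \<omega> j w s =
     (if j = 1 then w s
      else \<omega> * (real j - 1) * (LBINT y:{0..s}. (s - y) powr (\<omega> * (real j - 1) - 1) * w y))"

end

theory Submission
  imports Defs
begin

text \<open>
  With \<open>t = ln n\<close>, the number of boxes of level \<open>j\<close> with at least \<open>n powr (1 - s)\<close> balls differs from
  the number \<open>N\<^sub>j (s t)\<close> of boxes with \<open>P(v) \<ge> exp (- s t)\<close> only by a shift of \<open>s t\<close> of order \<open>ln t\<close>,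
  simultaneously for all \<open>s\<close>: by Chebyshev and Markov, given the environment, no box that
  matters deviates from its mean by more than a factor which is a power of \<open>t\<close>.  Replacing the subtrees below the first level by their means is a telescoping sum of
  conditionally centred orthogonal terms, whose variance is smaller than the squared norming by a factor
  \<open>t powr (- \<omega>)\<close>; so the comparison holds on a grid that is fine enough for the monotone
  counting functions.  What remains is \<open>\<Sum>\<^sub>k V\<^sub>j\<^sub>-\<^sub>1 (s t + ln P\<^sub>k)\<close>, and \<open>V\<^sub>j\<^sub>-\<^sub>1 (x)\<close> is \<open>c\<^sub>j\<^sub>-\<^sub>1 x powr (\<omega> (j - 1))\<close>
  up to a negligible error, so this sum is a fractional integral of the first-level counting function.  Hence
  all levels are, up to small errors in the uniform norm, Lipschitz functionals of one process, which converges
  by assumption to a limit with continuous paths.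
\<close>

section \<open>Counting sums and fractional integrals\<close>

text \<open>The norming \<open>t powr (\<gamma> + \<omega> * (j - 1))\<close> stands against a mean
  of order \<open>t powr (\<omega> * j)\<close>, so relative errors must be below
  \<open>t powr (\<gamma> - \<omega>)\<close>. The hypothesis \<open>\<omega> - 1 < \<gamma>\<close>
  makes a shift of the argument by \<open>ln t\<close> harmless,
  \<open>\<omega> - \<epsilon> < \<gamma>\<close> does the same for the error in the mean. A grid
  needs more than \<open>t powr (\<omega> - \<gamma>)\<close> points for a negligible drift between
  neighbours and fewer than \<open>t powr \<omega>\<close> for a union bound; both are possible
  because \<open>\<gamma> > 0\<close>. The limit theorem for the first level lives on another
  probability space than the scheme, and only the law of the root fragmentation is common to both.
  The passage to the limit is therefore one-sided: a bounded continuous functional is approximated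
  from below by its infima on a countable family of uniform tubes, and the root process is tested
  only on the corresponding events. The bound for a functional and for its negative gives
  convergence; the constant functional gives the equicontinuity that the sandwich between grid
  points requires.\<close>

text \<open>
  Writing \<open>q i = exp (- T i)\<close>, this is the sum of \<open>\<phi> (u - T i)\<close> over the points \<open>T i \<le> u\<close>; thus \<open>\<phi>\<close> is only
  evaluated on \<open>{0..}\<close>.
\<close>

definition log_sum :: "(real \<Rightarrow> real) \<Rightarrow> 'i set \<Rightarrow> ('i \<Rightarrow> real) \<Rightarrow> real \<Rightarrow> real" where
  "log_sum \<phi> I q u = (\<Sum>i\<in>{i\<in>I. q i \<ge> exp (- u)}. \<phi> (u + ln (q i)))"

text \<open>Only finite partial sums are constrained, so the same notion serves the fragments of one
  box and the infinitely many boxes of a level, without a sum over an arbitrary index set.\<close>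

definition subprob :: "'i set \<Rightarrow> ('i \<Rightarrow> real) \<Rightarrow> bool" where
  "subprob I q \<longleftrightarrow> (\<forall>i\<in>I. 0 < q i) \<and> (\<forall>S. finite S \<and> S \<subseteq> I \<longrightarrow> sum q S \<le> 1)"

abbreviation cnt :: "(nat \<Rightarrow> real) \<Rightarrow> real \<Rightarrow> real" where
  "cnt q \<equiv> log_sum (\<lambda>_. 1) UNIV q"

lemma subprob_le_1:
  assumes "subprob I q" "i \<in> I" shows "q i \<le> 1"
proof -
  have "sum q {i} \<le> 1" using assms unfolding subprob_def by blast
  then show ?thesis by simp
qed

text \<open>Each index above the threshold takes at least \<open>exp (- u)\<close> of a total mass
  of at most one. Finiteness is not known beforehand, so the bound is first proved for finite
  subsets.\<close>

lemma subprob_finite: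
  assumes "subprob I q"
  shows "finite {i\<in>I. q i \<ge> exp (- u)}" "real (card {i\<in>I. q i \<ge> exp (- u)}) \<le> exp u"
proof -
  have bd: "real (card G) \<le> exp u" if "G \<subseteq> {i\<in>I. q i \<ge> exp (- u)}" "finite G" for G
  proof -
    have "real (card G) * exp (-u) = (\<Sum>i\<in>G. exp (-u))" by simp
    also have "\<dots> \<le> sum q G" by (rule sum_mono) (use that in auto)
    also have "\<dots> \<le> 1" using assms that unfolding subprob_def by blast
    finally show ?thesis by (simp add: exp_minus field_simps)
  qed
  have "finite {i\<in>I. q i \<ge> exp (- u)} \<and> card {i\<in>I. q i \<ge> exp (- u)} \<le> nat \<lfloor>exp u\<rfloor>"
    by (rule finite_if_finite_subsets_card_bdd) (use bd in \<open>auto simp: le_nat_floor\<close>)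
  then show f: "finite {i\<in>I. q i \<ge> exp (- u)}" by blast
  show "real (card {i\<in>I. q i \<ge> exp (- u)}) \<le> exp u" by (rule bd) (use f in auto)
qed

lemma exp_le_iff_ln: "0 < x \<Longrightarrow> exp (- u) \<le> x \<longleftrightarrow> 0 \<le> u + ln (x::real)"
  using ln_ge_iff[of x "- u"] by linarith

lemma log_sum_1: "log_sum (\<lambda>_. 1) I q u = real (card {i\<in>I. q i \<ge> exp (- u)})"
  by (simp add: log_sum_def)

lemma cnt_nonneg: "0 \<le> log_sum (\<lambda>_. 1) I q u"
  by (simp add: log_sum_1)

lemma log_sum_abs_le:
  assumes "subprob I q" "\<And>x. 0 \<le> x \<Longrightarrow> x \<le> u \<Longrightarrow> \<bar>\<phi> x\<bar> \<le> B"
  shows "\<bar>log_sum \<phi> I q u\<bar> \<le> B * log_sum (\<lambda>_. 1) I q u"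
proof -
  have "\<bar>log_sum \<phi> I q u\<bar> \<le> (\<Sum>i\<in>{i\<in>I. q i \<ge> exp (- u)}. \<bar>\<phi> (u + ln (q i))\<bar>)"
    unfolding log_sum_def by (rule sum_abs)
  also have "\<dots> \<le> (\<Sum>i\<in>{i\<in>I. q i \<ge> exp (- u)}. B)"
  proof (rule sum_mono)
    fix i assume i: "i \<in> {i\<in>I. exp (- u) \<le> q i}"
    then have "0 < q i" "q i \<le> 1" using assms(1) subprob_le_1[OF assms(1)] by (auto simp: subprob_def)
    then show "\<bar>\<phi> (u + ln (q i))\<bar> \<le> B"
      using i by (intro assms(2)) (auto simp: exp_le_iff_ln)
  qed
  also have "\<dots> = B * log_sum (\<lambda>_. 1) I q u" by (simp add: log_sum_1)
  finally show ?thesis .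
qed

lemma log_sum_nonneg: "(\<And>x. 0 \<le> \<phi> x) \<Longrightarrow> 0 \<le> log_sum \<phi> I q u"
  unfolding log_sum_def by (rule sum_nonneg) auto

lemma log_sum_mono:
  assumes q: "subprob I q" and \<phi>: "mono \<phi>" "\<And>x. 0 \<le> \<phi> x"
  shows "mono (log_sum \<phi> I q)"
proof (rule monoI)
  fix u u' :: real assume "u \<le> u'"
  have "log_sum \<phi> I q u \<le> (\<Sum>i\<in>{i\<in>I. q i \<ge> exp (- u)}. \<phi> (u' + ln (q i)))"
    unfolding log_sum_def using \<open>u \<le> u'\<close> \<phi>(1) by (intro sum_mono) (auto intro: monoD)
  also have "\<dots> \<le> log_sum \<phi> I q u'"
    unfolding log_sum_def
    by (rule sum_mono2[OF subprob_finite(1)[OF q]]) (use \<open>u \<le> u'\<close> \<phi>(2) in \<open>auto intro: order_trans[rotated]\<close>)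
  finally show "log_sum \<phi> I q u \<le> log_sum \<phi> I q u'" .
qed

lemma cnt_mono: "subprob I q \<Longrightarrow> mono (log_sum (\<lambda>_. 1) I q)"
  by (rule log_sum_mono) (auto intro: monoI)

lemma cnt_borel [measurable (raw)]: "subprob I q \<Longrightarrow> log_sum (\<lambda>_. 1) I q \<in> borel_measurable borel"
  by (intro borel_measurable_mono cnt_mono)

lemma log_sum_add: "log_sum (\<lambda>x. f x + g x) I q u = log_sum f I q u + log_sum g I q u"
  by (simp add: log_sum_def sum.distrib)

lemma log_sum_cmult: "log_sum (\<lambda>x. b * f x) I q u = b * log_sum f I q u"
  by (simp add: log_sum_def sum_distrib_left)

text \<open>Only finitely many points lie in \<open>(u, u + 1]\<close>, so a gap follows
  \<open>u\<close>. This form of right-continuity later reduces uniform deviations to rational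
  times.\<close>

lemma cnt_right_const:
  assumes q: "subprob I q"
  shows "\<exists>d>0. \<forall>u'. u \<le> u' \<and> u' < u + d \<longrightarrow> log_sum (\<lambda>_. 1) I q u' = log_sum (\<lambda>_. 1) I q u"
proof -
  let ?A = "{i\<in>I. q i \<ge> exp (- (u + 1))}" let ?B = "{i\<in>?A. u < - ln (q i)}"
  have f: "finite ?B" by (rule finite_subset[OF _ subprob_finite(1)[OF q, of "u+1"]]) auto
  define d where "d = Min (insert 1 ((\<lambda>i. - ln (q i) - u) ` ?B))"
  have d: "d > 0" "d \<le> 1" "\<And>i. i \<in> ?B \<Longrightarrow> d \<le> - ln (q i) - u"
    unfolding d_def using f by (auto simp: Min_gr_iff)
  have eq: "{i\<in>I. q i \<ge> exp (- u')} = {i\<in>I. q i \<ge> exp (- u)}" if u': "u \<le> u'" "u' < u + d" for u'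
  proof (intro set_eqI iffI)
    fix i assume i: "i \<in> {i\<in>I. q i \<ge> exp (- u')}"
    then have q0: "0 < q i" using q unfolding subprob_def by auto
    have "exp (-(u+1)) \<le> exp (-u')" using u' d by simp
    then have "exp (-(u+1)) \<le> q i" using i by (auto intro: order_trans)
    with i have A: "i \<in> ?A" by auto
    show "i \<in> {i\<in>I. q i \<ge> exp (- u)}"
    proof (rule ccontr)
      assume "i \<notin> {i\<in>I. q i \<ge> exp (- u)}"
      then have "u < - ln (q i)" using i q0 by (auto simp: exp_le_iff_ln)
      then have "d \<le> - ln (q i) - u" using A d(3) by auto
      moreover have "0 \<le> u' + ln (q i)" using i q0 by (simp add: exp_le_iff_ln)
      ultimately show False using u' by linarith
    qed
  next
    fix i assume i: "i \<in> {i\<in>I. q i \<ge> exp (- u)}"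
    then have "exp (-u') \<le> q i" using u' i order_trans[of "exp (-u')" "exp (-u)" "q i"] by auto
    then show "i \<in> {i\<in>I. q i \<ge> exp (- u')}" using i by auto
  qed
  show ?thesis
  proof (intro exI[of _ d] conjI allI impI d(1))
    fix u' assume "u \<le> u' \<and> u' < u + d"
    then show "log_sum (\<lambda>_. 1) I q u' = log_sum (\<lambda>_. 1) I q u"
      unfolding log_sum_1 by (subst eq) auto
  qed
qed

text \<open>For \<open>p > 0\<close> this is \<open>Gamma (p + 1)\<close> times the
  Riemann-Liouville integral of order \<open>p\<close>. With this normalisation it is, by parts, the
  integral of \<open>(u - y) powr p\<close> against the jumps of a counting function
  \<open>f\<close>.\<close>

definition frac_int :: "real \<Rightarrow> (real \<Rightarrow> real) \<Rightarrow> real \<Rightarrow> real" where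
  "frac_int p f u = p * (LBINT y:{0..u}. (u - y) powr (p - 1) * f y)"

lemma lim_path_eq: "lim_path \<omega> j w s = (if j = 1 then w s else frac_int (\<omega> * (real j - 1)) w s)"
  by (simp add: lim_path_def frac_int_def)

text \<open>The substitution \<open>y = u * x\<close> takes \<open>u\<close> out of the singular
  kernel and leaves a fixed weight on the unit interval. Bounds, continuity in \<open>u\<close> and
  the rescaling of time are all read off from this form.\<close>

lemma frac_int_scale:
  assumes "u \<ge> 0" "p > 0"
  shows "frac_int p f u = u powr p * (LBINT x:{0..1}. p * (1 - x) powr (p - 1) * f (u * x))"
proof (cases "u = 0")
  case True
  have "(LBINT y:{0..0::real}. (0 - y) powr (p - 1) * f y) = 0"
    unfolding set_lebesgue_integral_def
    by (rule integral_eq_zero_AE)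
       (rule AE_mp[OF AE_lborel_singleton[of 0]], auto simp: indicator_def)
  then show ?thesis using True assms by (simp add: frac_int_def)
next
  case False
  then have u: "u > 0" using assms by simp
  have "(LBINT y:{0..u}. (u - y) powr (p - 1) * f y) =
      u * (\<integral>x. indicator {0..u} (0 + u * x) *\<^sub>R ((u - (0 + u * x)) powr (p - 1) * f (0 + u * x)) \<partial>lborel)"
    unfolding set_lebesgue_integral_def using u
    by (subst lborel_integral_real_affine[of u _ 0]) auto
  also have "\<dots> = u * (\<integral>x. u powr (p - 1) * (indicator {0..1} x *\<^sub>R ((1 - x) powr (p - 1) * f (u * x))) \<partial>lborel)"
  proof (intro arg_cong[where f = "\<lambda>x. u * x"] Bochner_Integration.integral_cong refl)
    fix x :: real
    show "indicator {0..u} (0 + u * x) *\<^sub>R ((u - (0 + u * x)) powr (p - 1) * f (0 + u * x)) =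
      u powr (p - 1) * (indicator {0..1} x *\<^sub>R ((1 - x) powr (p - 1) * f (u * x)))"
    proof (cases "x \<in> {0..1}")
      case True
      then have "u * x \<in> {0..u}" using u by (auto simp: mult_le_cancel_left1)
      moreover have "(u - u * x) powr (p - 1) = u powr (p-1) * (1 - x) powr (p - 1)"
        using True u by (subst powr_mult[symmetric]) (auto simp: algebra_simps)
      ultimately show ?thesis using True by simp
    next
      case False
      then have "u * x \<notin> {0..u}" using u by (auto simp: mult_le_cancel_left1 zero_le_mult_iff)
      then show ?thesis using False by simp
    qed
  qed
  also have "\<dots> = (u * u powr (p - 1)) * (LBINT x:{0..1}. (1 - x) powr (p - 1) * f (u * x))"
    by (simp add: set_lebesgue_integral_def)
  also have "u * u powr (p - 1) = u powr p" using u by (simp add: powr_diff)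
  finally show ?thesis
    unfolding frac_int_def by (simp add: mult.assoc)
qed

section \<open>Beta integrals and the normalised weight on the unit interval\<close>

lemma Beta_integrable:
  assumes "a > 0" "b > (0::real)"
  shows "set_integrable lborel {0..1} (\<lambda>x. x powr (a - 1) * (1 - x) powr (b - 1))"
    "(LBINT x:{0..1}. x powr (a - 1) * (1 - x) powr (b - 1)) = Beta a b"
proof -
  have h: "((\<lambda>t. t powr (a - 1) * (1 - t) powr (b - 1)) has_integral Beta a b) {0..1}"
    using has_integral_Beta_real[OF assms] by simp
  have "(\<lambda>t. t powr (a - 1) * (1 - t) powr (b - 1)) absolutely_integrable_on {0..1}"
    using h by (intro nonnegative_absolutely_integrable_1) (auto simp: has_integral_integrable)
  then show i: "set_integrable lborel {0..1} (\<lambda>x. x powr (a - 1) * (1 - x) powr (b - 1))"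
    unfolding set_integrable_def by (subst (asm) integrable_completion) auto
  show "(LBINT x:{0..1}. x powr (a - 1) * (1 - x) powr (b - 1)) = Beta a b"
    using set_borel_integral_eq_integral(2)[OF i] h by (simp add: integral_unique)
qed

abbreviation frac_weight :: "real \<Rightarrow> real \<Rightarrow> real" where
  "frac_weight p x \<equiv> p * (1 - x) powr (p - 1)"

lemma frac_weight:
  assumes "p > 0"
  shows "set_integrable lborel {0..1} (frac_weight p)" "(LBINT x:{0..1}. frac_weight p x) = 1"
proof -
  have A: "AE x in lborel. x \<in> {0..1} \<longrightarrow> x powr (1-1) * (1 - x) powr (p - 1) = (1 - x) powr (p - 1)"
    by (rule AE_mp[OF AE_lborel_singleton[of 0]]) auto
  \<comment> \<open>\<open>0 powr 0\<close> is \<open>0\<close>, so the factor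
    \<open>x powr (1 - 1)\<close> equals one only off the null set \<open>{0}\<close>.\<close>
  have A': "AE x in lborel. indicator {0..1} x *\<^sub>R (x powr (1-1) * (1 - x) powr (p - 1)) = indicator {0..1} x *\<^sub>R (1 - x) powr (p - 1)"
    by (rule AE_mp[OF AE_lborel_singleton[of 0]]) (auto simp: indicator_def)
  have i: "set_integrable lborel {0..1} (\<lambda>x. (1 - x) powr (p - 1))"
    using Beta_integrable(1)[of 1 p] assms A' unfolding set_integrable_def
    by (subst (asm) integrable_cong_AE[OF _ _ A']) auto
  then show "set_integrable lborel {0..1} (frac_weight p)"
    by simp
  have "(LBINT x:{0..1}. (1 - x) powr (p - 1)) = Beta 1 p"
    using Beta_integrable(2)[of 1 p] assms unfolding set_lebesgue_integral_def
    by (subst (asm) integral_cong_AE[OF _ _ A']) auto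
  also have "Beta 1 p = 1 / p"
    using assms Gamma_plus1[of p] by (simp add: Beta_def add.commute[of 1 p] nonpos_Ints_def Gamma_eq_zero_iff)
  finally show "(LBINT x:{0..1}. frac_weight p x) = 1" using assms by simp
qed

lemma frac_weight_bounded_integrable:
  assumes "p > 0" "g \<in> borel_measurable borel" "\<And>x. 0 \<le> x \<Longrightarrow> x \<le> 1 \<Longrightarrow> \<bar>g x\<bar> \<le> B"
  shows "set_integrable lborel {0..1} (\<lambda>x. frac_weight p x * g x)"
proof (rule set_integrable_bound)
  show "set_integrable lborel {0..1} (\<lambda>x. B * frac_weight p x)"
    using set_integrable_mult_right[of B, OF frac_weight(1)[OF assms(1)]] by simp
  show "set_borel_measurable lborel {0..1} (\<lambda>x. frac_weight p x * g x)"
    unfolding set_borel_measurable_def using assms(2) by measurable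
  have "norm (frac_weight p x * g x) \<le> norm (B * frac_weight p x)" if "x \<in> {0..1}" for x
  proof -
    have "\<bar>g x\<bar> \<le> \<bar>B\<bar>" using assms(3)[of x] that by auto
    then show ?thesis using assms(1) by (simp add: abs_mult mult.commute mult_right_mono)
  qed
  then show "AE x in lborel. x \<in> {0..1} \<longrightarrow> norm (frac_weight p x * g x) \<le> norm (B * frac_weight p x)"
    by auto
qed

lemma frac_int_bound:
  assumes "p > 0" "u \<ge> 0" "f \<in> borel_measurable borel"
    "\<And>y. 0 \<le> y \<Longrightarrow> y \<le> u \<Longrightarrow> \<bar>f y\<bar> \<le> B"
  shows "\<bar>frac_int p f u\<bar> \<le> u powr p * B"
proof -
  have ux: "0 \<le> u * x \<and> u * x \<le> u" if "0 \<le> x" "x \<le> 1" for x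
    using that assms(2) by (simp add: mult_left_le)
  have i: "set_integrable lborel {0..1} (\<lambda>x. frac_weight p x * f (u * x))"
    using assms ux by (intro frac_weight_bounded_integrable[where B = B]) auto
  have "\<bar>LBINT x:{0..1}. frac_weight p x * f (u * x)\<bar> \<le> (LBINT x:{0..1}. \<bar>frac_weight p x * f (u * x)\<bar>)"
    using set_integral_norm_bound[OF i] by simp
  also have "\<dots> \<le> (LBINT x:{0..1}. B * frac_weight p x)"
  proof (rule set_integral_mono)
    show "set_integrable lborel {0..1} (\<lambda>x. \<bar>frac_weight p x * f (u * x)\<bar>)" using set_integrable_abs[OF i] .
    show "set_integrable lborel {0..1} (\<lambda>x. B * frac_weight p x)"
      using set_integrable_mult_right[of B, OF frac_weight(1)[OF assms(1)]] by simp
    show "\<bar>frac_weight p x * f (u * x)\<bar> \<le> B * frac_weight p x" if "x \<in> {0..1}" for x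
      using assms(4)[of "u*x"] ux[of x] that assms(1) by (simp add: abs_mult mult.commute mult_right_mono)
  qed
  also have "\<dots> = B" using frac_weight(2)[OF assms(1)] by (subst set_integral_mult_right) simp
  finally show ?thesis
    using assms(1,2) by (simp add: frac_int_scale abs_mult mult_left_mono)
qed

lemma frac_int_add_cmult:
  assumes "p > 0" "u \<ge> 0" "f \<in> borel_measurable borel" "g \<in> borel_measurable borel"
    "\<And>y. 0 \<le> y \<Longrightarrow> y \<le> u \<Longrightarrow> \<bar>f y\<bar> \<le> B" "\<And>y. 0 \<le> y \<Longrightarrow> y \<le> u \<Longrightarrow> \<bar>g y\<bar> \<le> B'"
  shows "frac_int p (\<lambda>y. f y + b * g y) u = frac_int p f u + b * frac_int p g u"
proof -
  have ux: "0 \<le> u * x \<and> u * x \<le> u" if "0 \<le> x" "x \<le> 1" for x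
    using that assms(2) by (simp add: mult_left_le)
  have i: "set_integrable lborel {0..1} (\<lambda>x. frac_weight p x * f (u * x))"
    "set_integrable lborel {0..1} (\<lambda>x. frac_weight p x * g (u * x))"
    by (rule frac_weight_bounded_integrable[where B = B, OF assms(1)]; (intro assms(5))?; (use assms(3) ux in simp)?)
      (rule frac_weight_bounded_integrable[where B = B', OF assms(1)]; (intro assms(6))?; (use assms(4) ux in simp)?)
  have "(LBINT x:{0..1}. frac_weight p x * (f (u * x) + b * g (u * x))) = 
     (LBINT x:{0..1}. frac_weight p x * f (u * x) + b * (frac_weight p x * g (u * x)))"
    by (simp add: algebra_simps)
  also have "\<dots> = (LBINT x:{0..1}. frac_weight p x * f (u * x)) + b * (LBINT x:{0..1}. frac_weight p x * g (u * x))"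
    by (subst set_integral_add(2)) (use i in \<open>auto intro!: set_integrable_mult_right\<close>)
  finally show ?thesis using assms(1,2) by (simp add: frac_int_scale algebra_simps)
qed

lemma frac_int_cmult:
  "frac_int p (\<lambda>y. b * g y) u = b * frac_int p g u"
  unfolding frac_int_def by (subst set_integral_mult_right[symmetric]) (simp add: ac_simps)

text \<open>A Beta integral. With \<open>w = \<omega>\<close> and \<open>p = \<omega> * m\<close>
  the quotient of Gamma values is, up to the factor \<open>c\<close>, the ratio of consecutive
  constants \<open>lim_const\<close>.\<close>

lemma frac_int_powr:
  assumes "p > 0" "u \<ge> 0" "w > 0"
  shows "frac_int p (\<lambda>y. y powr w) u = Gamma (w + 1) * Gamma (p + 1) / Gamma (p + w + 1) * u powr (p + w)"
proof -
  have "(LBINT x:{0..1}. frac_weight p x * (u * x) powr w) = 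
      (LBINT x:{0..1}. (p * u powr w) * (x powr (w + 1 - 1) * (1 - x) powr (p - 1)))"
    by (rule set_lebesgue_integral_cong) (use assms in \<open>auto simp: powr_mult\<close>)
  also have "\<dots> = p * u powr w * Beta (w + 1) p"
    using Beta_integrable(2)[of "w+1" p] assms by (subst set_integral_mult_right) simp
  also have "\<dots> = u powr w * (Gamma (w + 1) * Gamma (p + 1) / Gamma (p + w + 1))"
    using assms Gamma_plus1[of p] by (simp add: Beta_def add_ac nonpos_Ints_def)
  finally show ?thesis using assms by (simp add: frac_int_scale powr_add)
qed

lemma frac_int_rescale:
  assumes "p > 0" "u \<ge> 0" "t > 0"
  shows "frac_int p f (t * u) = t powr p * frac_int p (\<lambda>y. f (t * y)) u"
  using assms by (simp add: frac_int_scale powr_mult mult.assoc)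

lemma frac_int_cong:
  assumes "\<And>y. 0 \<le> y \<Longrightarrow> y \<le> u \<Longrightarrow> f y = g y"
  shows "frac_int p f u = frac_int p g u"
  unfolding frac_int_def by (intro arg_cong[where f = "\<lambda>x. p * x"] set_lebesgue_integral_cong) (use assms in auto)

text \<open>In the scaled form only the argument of \<open>f\<close> depends on \<open>u\<close>,
  and the integrable weight dominates.\<close>

lemma frac_int_continuous:
  assumes "p > 0" "continuous_on UNIV f"
  shows "continuous_on {0..b} (frac_int p f)"
proof -
  have fm [measurable]: "f \<in> borel_measurable borel" using assms(2) by (rule borel_measurable_continuous_onI)
  obtain B where B: "\<And>y. y \<in> {0..b} \<Longrightarrow> \<bar>f y\<bar> \<le> B"
  proof -
    have "bounded (f ` {0..b})"
      by (intro compact_imp_bounded compact_continuous_image continuous_on_subset[OF assms(2)]) auto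
    then show ?thesis using that unfolding bounded_iff by (auto simp del: atLeastAtMost_iff)
  qed
  have "continuous_on {0..b} (\<lambda>u. LBINT x:{0..1}. frac_weight p x * f (u * x))"
  proof (rule continuous_on_sequentiallyI)
    fix u a assume u: "\<forall>n. u n \<in> {0..b}" and a: "a \<in> {0..b}" and l: "u \<longlonglongrightarrow> a"
    show "(\<lambda>n. LBINT x:{0..1}. frac_weight p x * f (u n * x)) \<longlonglongrightarrow> (LBINT x:{0..1}. frac_weight p x * f (a * x))"
      unfolding set_lebesgue_integral_def
    proof (rule integral_dominated_convergence[where w = "\<lambda>x. indicator {0..1} x *\<^sub>R (B * frac_weight p x)"])
      show "integrable lborel (\<lambda>x. indicator {0..1} x *\<^sub>R (B * frac_weight p x))"
        using set_integrable_mult_right[of B lborel "{0..1}" "frac_weight p"] frac_weight(1)[OF assms(1)]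
        unfolding set_integrable_def by simp
      show "AE x in lborel. (\<lambda>n. indicator {0..1} x *\<^sub>R (frac_weight p x * f (u n * x)))
         \<longlonglongrightarrow> indicator {0..1} x *\<^sub>R (frac_weight p x * f (a * x))"
      proof (rule AE_I2)
        fix x
        have "isCont f (a * x)" using assms(2) by (simp add: continuous_on_eq_continuous_at)
        moreover have "(\<lambda>n. u n * x) \<longlonglongrightarrow> a * x" by (intro tendsto_mult_right l)
        ultimately have "(\<lambda>n. f (u n * x)) \<longlonglongrightarrow> f (a * x)" by (rule isCont_tendsto_compose)
        then show "(\<lambda>n. indicator {0..1} x *\<^sub>R (frac_weight p x * f (u n * x)))
         \<longlonglongrightarrow> indicator {0..1} x *\<^sub>R (frac_weight p x * f (a * x))" by (intro tendsto_intros)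
      qed
      show "AE x in lborel. norm (indicator {0..1} x *\<^sub>R (frac_weight p x * f (u n * x))) \<le> indicator {0..1} x *\<^sub>R (B * frac_weight p x)" for n
      proof (rule AE_I2)
        fix x :: real
        have "\<bar>f (u n * x)\<bar> \<le> B" if "x \<in> {0..1}"
        proof (rule B)
          have "u n * x \<le> b * 1" using u that by (intro mult_mono) auto
          then show "u n * x \<in> {0..b}" using u that by auto
        qed
        then show "norm (indicator {0..1} x *\<^sub>R (frac_weight p x * f (u n * x))) \<le> indicator {0..1} x *\<^sub>R (B * frac_weight p x)"
          using assms(1) by (auto simp: indicator_def abs_mult mult.commute mult_right_mono)
      qed
    qed simp_all
  qed
  then have "continuous_on {0..b} (\<lambda>u. u powr p * (LBINT x:{0..1}. frac_weight p x * f (u * x)))"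
    using assms(1) by (intro continuous_on_mult continuous_on_powr' continuous_intros) auto
  then show ?thesis
    by (rule continuous_on_eq) (use assms(1) in \<open>auto simp: frac_int_scale\<close>)
qed

lemma frac_int_step:
  assumes "p > 0" "0 \<le> T" "T \<le> u"
  shows "frac_int p (indicator {T..}) u = (u - T) powr p"
proof -
  have "(LBINT y:{0..u}. (u - y) powr (p - 1) * indicator {T..} y) = 
     (\<integral>y. indicator {T..u} y *\<^sub>R (u - y) powr (p - 1) \<partial>lborel)"
    unfolding set_lebesgue_integral_def
    by (intro Bochner_Integration.integral_cong) (use assms in \<open>auto simp: indicator_def\<close>)
  also have "\<dots> = (\<integral>x. indicator {T..u} (T + 1 * x) *\<^sub>R (u - (T + 1 * x)) powr (p - 1) \<partial>lborel)"
    by (subst lborel_integral_real_affine[of 1 _ T]) auto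
  also have "\<dots> = (LBINT x:{0..u-T}. (u - T - x) powr (p - 1))"
    unfolding set_lebesgue_integral_def
    by (intro Bochner_Integration.integral_cong) (auto simp: indicator_def algebra_simps)
  finally have "frac_int p (indicator {T..}) u = frac_int p (\<lambda>_. 1) (u - T)"
    unfolding frac_int_def by simp
  also have "\<dots> = (u - T) powr p"
    using assms frac_weight(2)[of p] by (subst frac_int_scale) auto
  finally show ?thesis .
qed

lemma frac_int_sum:
  assumes "p > 0" "u \<ge> 0" "finite K" "\<And>k. k \<in> K \<Longrightarrow> f k \<in> borel_measurable borel"
    "\<And>k y. k \<in> K \<Longrightarrow> 0 \<le> y \<Longrightarrow> y \<le> u \<Longrightarrow> \<bar>f k y\<bar> \<le> 1"
  shows "frac_int p (\<lambda>y. \<Sum>k\<in>K. f k y) u = (\<Sum>k\<in>K. frac_int p (f k) u)"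
  using assms(3,4,5)
proof (induction K rule: finite_induct)
  case empty
  then show ?case by (simp add: frac_int_def)
next
  case (insert k K)
  have "frac_int p (\<lambda>y. f k y + 1 * (\<Sum>k\<in>K. f k y)) u = frac_int p (f k) u + 1 * frac_int p (\<lambda>y. \<Sum>k\<in>K. f k y) u"
  proof (rule frac_int_add_cmult[OF assms(1,2), where B = 1 and B' = "real (card K)"])
    show "\<bar>\<Sum>k\<in>K. f k y\<bar> \<le> real (card K)" if "0 \<le> y" "y \<le> u" for y
    proof -
      have "\<bar>\<Sum>k\<in>K. f k y\<bar> \<le> (\<Sum>k\<in>K. \<bar>f k y\<bar>)" by (rule sum_abs)
      also have "\<dots> \<le> (\<Sum>k\<in>K. 1)" using insert.prems that by (intro sum_mono) auto
      finally show ?thesis by simp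
    qed
  qed (use insert.prems in auto)
  then show ?case using insert by simp
qed

text \<open>A point \<open>T = - ln (q k)\<close> contributes \<open>(u - T) powr p\<close>, which
  is the fractional integral of the unit step at \<open>T\<close>. Summation turns a sum over random
  points into a linear functional of the counting function; this is what makes higher levels
  functionals of the first. Points beyond \<open>u\<close> do not affect \<open>[0, u]\<close>, so
  one finite sum represents the count on the whole interval.\<close>

lemma log_sum_powr:
  assumes q: "subprob I q" and "p > 0" "u \<ge> 0"
  shows "log_sum (\<lambda>x. x powr p) I q u = frac_int p (log_sum (\<lambda>_. 1) I q) u"
proof -
  let ?K = "{i\<in>I. q i \<ge> exp (- u)}"
  have K: "finite ?K" by (rule subprob_finite(1)[OF q])
  have qk: "0 < q k \<and> q k \<le> 1" if "k \<in> ?K" for k using q subprob_le_1[OF q] that unfolding subprob_def by auto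
  have "frac_int p (log_sum (\<lambda>_. 1) I q) u = frac_int p (\<lambda>y. \<Sum>k\<in>?K. indicator {- ln (q k)..} y) u"
  proof (rule frac_int_cong)
    fix y assume y: "0 \<le> y" "y \<le> u"
    have eq: "{i\<in>I. q i \<ge> exp (- y)} = {k\<in>?K. - ln (q k) \<le> y}"
    proof (intro set_eqI iffI)
      fix i assume i: "i \<in> {i\<in>I. q i \<ge> exp (- y)}"
      then have "0 < q i" using q unfolding subprob_def by auto
      moreover have "exp (-u) \<le> q i" using y i order_trans[of "exp (-u)" "exp (-y)" "q i"] by auto
      ultimately show "i \<in> {k\<in>?K. - ln (q k) \<le> y}" using i exp_le_iff_ln[of "q i" y] by auto
    next
      fix i assume "i \<in> {k\<in>?K. - ln (q k) \<le> y}"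
      then show "i \<in> {i\<in>I. q i \<ge> exp (- y)}" using qk[of i] exp_le_iff_ln[of "q i" y] by auto
    qed
    have "(\<Sum>k\<in>?K. indicator {- ln (q k)..} y) = (\<Sum>k\<in>{k\<in>?K. - ln (q k) \<le> y}. 1::real)"
      by (rule sum.mono_neutral_cong_right) (use K in \<open>auto simp: indicator_def\<close>)
    then show "log_sum (\<lambda>_. 1) I q y = (\<Sum>k\<in>?K. indicator {- ln (q k)..} y)"
      unfolding log_sum_1 eq by simp
  qed
  also have "\<dots> = (\<Sum>k\<in>?K. frac_int p (indicator {- ln (q k)..}) u)"
    by (rule frac_int_sum[OF assms(2,3) K]) (auto simp: indicator_def)
  also have "\<dots> = (\<Sum>k\<in>?K. (u + ln (q k)) powr p)"
  proof (rule sum.cong[OF refl])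
    fix k assume k: "k \<in> ?K"
    have "frac_int p (indicator {- ln (q k)..}) u = (u - (- ln (q k))) powr p"
      using qk[OF k] k exp_le_iff_ln[of "q k" u] by (intro frac_int_step assms) auto
    then show "frac_int p (indicator {- ln (q k)..}) u = (u + ln (q k)) powr p" by simp
  qed
  finally show ?thesis by (simp add: log_sum_def)
qed

section \<open>Moments of a fragmentation law\<close>

text \<open>The index set depends on \<open>q\<close>, so the sum is obtained as a limit of
  measurable partial sums. If infinitely many indices qualify, a sum over an infinite set is
  \<open>0\<close> by convention, hence the case split.\<close>

lemma log_sum_measurable [measurable (raw)]:
  fixes q :: "'a \<Rightarrow> nat \<Rightarrow> real"
  assumes [measurable]: "\<phi> \<in> borel_measurable borel" "\<And>k. (\<lambda>z. q z k) \<in> borel_measurable N" "U \<in> borel_measurable N"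
  shows "(\<lambda>z. log_sum \<phi> UNIV (q z) (U z) :: real) \<in> borel_measurable N"
proof -
  define f where "f n z = (\<Sum>k<n. if q z k \<ge> exp (- U z) then \<phi> (U z + ln (q z k)) else 0)" for n :: nat and z
  have [measurable]: "f n \<in> borel_measurable N" for n unfolding f_def by measurable
  have "log_sum \<phi> UNIV (q z) (U z) = (if \<exists>n. \<forall>k\<ge>n. q z k < exp (- U z) then lim (\<lambda>n. f n z) else 0)" for z
  proof (cases "\<exists>n. \<forall>k\<ge>n. q z k < exp (- U z)")
    case True
    then obtain n where n: "\<And>k. k \<ge> n \<Longrightarrow> q z k < exp (- U z)" by blast
    have eq: "f m z = log_sum \<phi> UNIV (q z) (U z)" if "m \<ge> n" for m
    proof -
      have "{k. q z k \<ge> exp (- U z)} = {k\<in>{..<m}. q z k \<ge> exp (- U z)}"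
        using n that by (force simp: not_le[symmetric])
      then show ?thesis unfolding log_sum_def f_def by (simp add: sum.inter_filter[symmetric])
    qed
    have "eventually (\<lambda>m. f m z = log_sum \<phi> UNIV (q z) (U z)) sequentially"
      using eq by (auto simp: eventually_sequentially)
    then have "(\<lambda>m. f m z) \<longlonglongrightarrow> log_sum \<phi> UNIV (q z) (U z)" by (rule tendsto_eventually)
    then show ?thesis using True by (simp add: limI)
  next
    case False
    then have "infinite {k. q z k \<ge> exp (- U z)}"
      unfolding infinite_nat_iff_unbounded_le by (auto simp: not_less)
    then have "log_sum \<phi> UNIV (q z) (U z) = 0" by (simp add: log_sum_def)
    then show ?thesis using False by (simp only: if_False)
  qed
  then show ?thesis by simp
qed

text \<open>
  \<open>level_mean \<mu> m x\<close> is the mean number of boxes of level \<open>m\<close> with probability at least \<open>exp (- x)\<close>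
  for \<open>x \<ge> 0\<close>; the value \<open>1\<close> at \<open>m = 0\<close> and \<open>x < 0\<close> is never used.
\<close>

primrec level_mean :: "(nat \<Rightarrow> real) measure \<Rightarrow> nat \<Rightarrow> real \<Rightarrow> real" where
  "level_mean \<mu> 0 x = 1"
| "level_mean \<mu> (Suc m) x = (\<integral>q. log_sum (level_mean \<mu> m) UNIV q x \<partial>\<mu>)"

declare level_mean.simps(2) [simp del]

lemma level_mean_0: "level_mean \<mu> 0 = (\<lambda>_. 1)"
  by (simp add: fun_eq_iff)

lemma abs_integral_le:
  fixes f g :: "'a \<Rightarrow> real"
  assumes "integrable N f" "integrable N g" "AE x in N. \<bar>f x\<bar> \<le> g x"
  shows "\<bar>integral\<^sup>L N f\<bar> \<le> integral\<^sup>L N g"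
proof -
  have "\<bar>integral\<^sup>L N f\<bar> \<le> (\<integral>x. \<bar>f x\<bar> \<partial>N)" using integral_norm_bound[of N f] by simp
  also have "\<dots> \<le> integral\<^sup>L N g" by (intro integral_mono_AE assms integrable_abs)
  finally show ?thesis .
qed

text \<open>The supremum in the second-moment hypothesis need not be measurable, and the integral of
  a non-measurable function is a supremum over simple functions below it. The hypothesis is
  therefore carried by the measurable minorants \<open>G\<close>. Everything is stated for a law
  \<open>\<mu>\<close> on sequences because every box of the tree carries an independent copy. One
  \<open>\<epsilon>\<close> will stand for the smaller of the two exponents in the bounds for the
  mean.\<close>

locale fragmentation = prob_space \<mu> for \<mu> :: "(nat \<Rightarrow> real) measure" +
  fixes c \<omega> \<epsilon> \<gamma> :: real
  assumes sets_mu [measurable_cong]: "sets \<mu> = sets (\<Pi>\<^sub>M k\<in>UNIV. borel)"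
    and AE_subprob: "AE q in \<mu>. subprob UNIV q \<and> (\<forall>k. q k < 1)"
    and pos: "0 < c" "0 < \<omega>" "0 < \<epsilon>" "\<epsilon> \<le> \<omega>"
    and gamma: "\<omega> - \<epsilon> < \<gamma>" "\<omega> - 1 < \<gamma>" "\<gamma> < \<omega>"
    and mean: "\<exists>C. \<forall>t\<ge>0. \<bar>(\<integral>q. cnt q t \<partial>\<mu>) - c * t powr \<omega>\<bar> \<le> C * (1 + t) powr (\<omega> - \<epsilon>)"
    and second_moment: "\<exists>C. \<forall>\<^sub>F t in at_top. \<forall>G \<in> borel_measurable \<mu>.
      (AE q in \<mu>. G q \<le> (SUP s\<in>{0..t}. ennreal ((cnt q s - (\<integral>q. cnt q s \<partial>\<mu>))\<^sup>2))) \<longrightarrow>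
      (\<integral>\<^sup>+q. G q \<partial>\<mu>) \<le> ennreal (C * t powr (2 * \<gamma>))"
begin

abbreviation V where "V \<equiv> level_mean \<mu>"
abbreviation cc where "cc \<equiv> lim_const c \<omega>"

lemma gamma_pos: "0 < \<gamma>" using gamma(1) pos by linarith

lemma cc_0: "cc 0 = 1" by (simp add: lim_const_def)

lemma cc_pos: "0 < cc m"
  unfolding lim_const_def using pos
  by (intro divide_pos_pos zero_less_power mult_pos_pos Gamma_real_pos add_nonneg_pos) auto

text \<open>Monotonicity is part of the induction because it supplies the measurability of
  \<open>V m\<close> for the next integral.\<close>

lemma V_props: "mono (V m) \<and> (\<forall>x. 0 \<le> V m x)"
proof (induction m)
  case 0
  then show ?case by (auto intro: monoI)
next
  case (Suc m)
  then have [measurable]: "V m \<in> borel_measurable borel" by (intro borel_measurable_mono) auto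
  have i: "integrable \<mu> (\<lambda>q. log_sum (V m) UNIV q x)" for x
  proof (rule integrable_const_bound[where B = "V m x * exp x"])
    show "AE q in \<mu>. norm (log_sum (V m) UNIV q x) \<le> V m x * exp x"
      using AE_subprob
    proof eventually_elim
      case (elim q)
      then have q: "subprob UNIV q" by auto
      have "\<bar>log_sum (V m) UNIV q x\<bar> \<le> V m x * cnt q x"
        by (rule log_sum_abs_le[OF q]) (use Suc in \<open>auto dest: monoD\<close>)
      also have "\<dots> \<le> V m x * exp x"
        using subprob_finite(2)[OF q, of x] Suc by (intro mult_left_mono) (auto simp: log_sum_1)
      finally show ?case by simp
    qed
  qed measurable
  have "V (Suc m) x \<le> V (Suc m) y" if "x \<le> y" for x y
    unfolding level_mean.simps
  proof (rule integral_mono_AE[OF i i])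
    show "AE q in \<mu>. log_sum (V m) UNIV q x \<le> log_sum (V m) UNIV q y"
      using AE_subprob by eventually_elim (use log_sum_mono[of UNIV _ "V m"] Suc that in \<open>auto dest: monoD\<close>)
  qed
  then have "mono (V (Suc m))" by (rule monoI)
  moreover have "0 \<le> V (Suc m) x" for x
    using Suc by (simp add: log_sum_nonneg level_mean.simps)
  ultimately show ?case by blast
qed

lemma V_mono: "x \<le> y \<Longrightarrow> V m x \<le> V m y" using V_props by (auto dest: monoD)
lemma V_nonneg [simp]: "0 \<le> V m x" using V_props by auto
lemma V_borel [measurable]: "V m \<in> borel_measurable borel" using V_props by (intro borel_measurable_mono) auto

lemma cnt_le_exp: "subprob I q \<Longrightarrow> log_sum (\<lambda>_. 1) I q x \<le> exp x"
  using subprob_finite(2)[of I q x] by (simp add: log_sum_1)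

lemma log_sum_V_bound:
  assumes "subprob I q" shows "\<bar>log_sum (V m) I q x\<bar> \<le> V m x * exp x"
proof -
  have "\<bar>log_sum (V m) I q x\<bar> \<le> V m x * log_sum (\<lambda>_. 1) I q x"
    by (rule log_sum_abs_le[OF assms]) (auto intro: V_mono)
  also have "\<dots> \<le> V m x * exp x" by (intro mult_left_mono cnt_le_exp assms) auto
  finally show ?thesis .
qed

lemma log_sum_V_integrable: "integrable \<mu> (\<lambda>q. log_sum (V m) UNIV q x)"
proof (rule integrable_const_bound[where B = "V m x * exp x"])
  show "AE q in \<mu>. norm (log_sum (V m) UNIV q x) \<le> V m x * exp x"
    using AE_subprob by eventually_elim (simp add: log_sum_V_bound)
qed measurable

lemma V_1: "V 1 x = (\<integral>q. cnt q x \<partial>\<mu>)"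
  by (simp add: level_mean.simps level_mean_0)

text \<open>Fubini's theorem; the bound \<open>exp x\<close>, uniform over all counting functions,
  makes the integrand integrable on the product.\<close>

lemma frac_int_mean:
  assumes "p > 0" "x \<ge> 0"
  shows "integrable \<mu> (\<lambda>q. frac_int p (cnt q) x)" "(\<integral>q. frac_int p (cnt q) x \<partial>\<mu>) = frac_int p (V 1) x"
proof -
  interpret L: pair_sigma_finite \<mu> lborel ..
  define f where "f = (\<lambda>(q, z). indicator {0..1} z *\<^sub>R (frac_weight p z * cnt q (x * z)))"
  have fm [measurable]: "f \<in> borel_measurable (\<mu> \<Otimes>\<^sub>M lborel)" unfolding f_def by measurable
  have xz: "x * z \<le> x" if "z \<in> {0..1}" for z using that assms by (simp add: mult_left_le)
  have wi: "integrable lborel (\<lambda>z. indicator {0..1} z *\<^sub>R (exp x * frac_weight p z))"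
    using set_integrable_mult_right[of "exp x", OF frac_weight(1)[OF assms(1)]] by (simp add: set_integrable_def)
  have le: "norm (f (q, z)) \<le> indicator {0..1} z *\<^sub>R (exp x * frac_weight p z)" if q: "subprob UNIV q" for q z
  proof (cases "z \<in> {0..1}")
    case True
    have "cnt q (x * z) \<le> exp x" using cnt_le_exp[OF q, of "x*z"] xz[OF True] by (meson exp_le_cancel_iff order_trans)
    then show ?thesis using True assms cnt_nonneg[of UNIV q "x*z"]
      by (simp add: f_def abs_mult mult.commute mult_right_mono)
  qed (simp add: f_def)
  have fi: "integrable lborel (\<lambda>z. f (q, z))" if q: "subprob UNIV q" for q
  proof (rule Bochner_Integration.integrable_bound[OF wi])
    have [measurable]: "cnt q \<in> borel_measurable borel" by (rule cnt_borel[OF q])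
    show "(\<lambda>z. f (q, z)) \<in> borel_measurable lborel" unfolding f_def prod.case by measurable
    show "AE z in lborel. norm (f (q, z)) \<le> norm (indicat_real {0..1} z *\<^sub>R (exp x * frac_weight p z))"
      by (intro AE_I2 order_trans[OF le[OF q]]) (simp only: real_norm_def abs_ge_self)
  qed
  have int: "integrable (\<mu> \<Otimes>\<^sub>M lborel) f"
  proof (rule L.Fubini_integrable[OF fm])
    show "AE q in \<mu>. integrable lborel (\<lambda>z. f (q, z))" using AE_subprob by eventually_elim (use fi in auto)
    show "integrable \<mu> (\<lambda>q. \<integral>z. norm (f (q, z)) \<partial>lborel)"
    proof (rule integrable_const_bound[where B = "exp x"])
      show "AE q in \<mu>. norm (\<integral>z. norm (f (q, z)) \<partial>lborel) \<le> exp x"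
        using AE_subprob
      proof eventually_elim
        case (elim q)
        then have q: "subprob UNIV q" by auto
        have "(\<integral>z. norm (f (q, z)) \<partial>lborel) \<le> (\<integral>z. indicator {0..1} z *\<^sub>R (exp x * frac_weight p z) \<partial>lborel)"
          by (intro integral_mono integrable_norm fi[OF q] wi le[OF q])
        also have "\<dots> = exp x * (LBINT z:{0..1}. frac_weight p z)"
          unfolding set_lebesgue_integral_def by (subst integral_mult_right_zero[symmetric]) (simp add: mult_ac)
        finally show ?case using frac_weight(2)[OF assms(1)] by simp
      qed
    qed measurable
  qed
  have eq: "frac_int p (cnt q) x = x powr p * (\<integral>z. f (q, z) \<partial>lborel)" for q
    using assms by (simp add: frac_int_scale f_def set_lebesgue_integral_def)
  show "integrable \<mu> (\<lambda>q. frac_int p (cnt q) x)" unfolding eq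
    using L.integrable_fst'[OF int] by simp
  have "(\<integral>q. frac_int p (cnt q) x \<partial>\<mu>) = x powr p * (\<integral>z. (\<integral>q. f (q, z) \<partial>\<mu>) \<partial>lborel)"
    unfolding eq using L.Fubini_integral[of "\<lambda>q z. f (q,z)"] int by (simp add: case_prod_beta')
  also have "(\<lambda>z. (\<integral>q. f (q, z) \<partial>\<mu>)) = (\<lambda>z. indicator {0..1} z *\<^sub>R (frac_weight p z * V 1 (x * z)))"
    unfolding f_def by (simp only: fun_eq_iff V_1 prod.case integral_scaleR_right integral_mult_right_zero) simp
  finally show "(\<integral>q. frac_int p (cnt q) x \<partial>\<mu>) = frac_int p (V 1) x"
    using assms by (simp add: frac_int_scale set_lebesgue_integral_def)
qed

section \<open>Power-law asymptotics of the mean counts\<close>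

definition V_err :: "nat \<Rightarrow> real \<Rightarrow> real" where
  "V_err m x = V m x - cc m * x powr (\<omega> * real m)"

lemma log_sum_V_decomp:
  assumes q: "subprob UNIV q" and "x \<ge> 0" "m \<ge> 1"
  shows "log_sum (V m) UNIV q x = cc m * frac_int (\<omega> * real m) (cnt q) x + log_sum (V_err m) UNIV q x"
proof -
  have "log_sum (V m) UNIV q x = log_sum (\<lambda>x. cc m * x powr (\<omega> * real m) + V_err m x) UNIV q x"
    by (simp add: V_err_def)
  also have "\<dots> = cc m * log_sum (\<lambda>x. x powr (\<omega> * real m)) UNIV q x + log_sum (V_err m) UNIV q x"
    by (simp only: log_sum_add log_sum_cmult)
  finally show ?thesis using log_sum_powr[OF q, of "\<omega> * real m" x] assms pos by simp
qed

lemma log_sum_V_err_le: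
  assumes q: "subprob UNIV q" and "x \<ge> 0" "\<omega> * real m - \<epsilon> \<ge> 0" 
    "\<And>x. 0 \<le> x \<Longrightarrow> \<bar>V_err m x\<bar> \<le> C * (1 + x) powr (\<omega> * real m - \<epsilon>)" "C \<ge> 0"
  shows "\<bar>log_sum (V_err m) UNIV q x\<bar> \<le> C * (1 + x) powr (\<omega> * real m - \<epsilon>) * cnt q x"
proof (rule log_sum_abs_le[OF q])
  fix y assume y: "0 \<le> y" "y \<le> x"
  have "\<bar>V_err m y\<bar> \<le> C * (1 + y) powr (\<omega> * real m - \<epsilon>)" using assms y by auto
  also have "\<dots> \<le> C * (1 + x) powr (\<omega> * real m - \<epsilon>)"
    using y assms by (intro mult_left_mono powr_mono2) auto
  finally show "\<bar>V_err m y\<bar> \<le> C * (1 + x) powr (\<omega> * real m - \<epsilon>)" .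
qed

lemma om_eps_nonneg: "m \<ge> 1 \<Longrightarrow> \<omega> * real m - \<epsilon> \<ge> 0"
  using pos mult_left_mono[of 1 "real m" \<omega>] by (simp add: order_trans)

lemma cc_Suc: "cc (Suc m) = cc m * (c * (Gamma (\<omega> + 1) * Gamma (\<omega> * real m + 1) / Gamma (\<omega> * real m + \<omega> + 1)))"
proof -
  have "Gamma (\<omega> * real m + 1) > 0" using pos by (intro Gamma_real_pos add_nonneg_pos) auto
  then show ?thesis by (simp add: lim_const_def algebra_simps)
qed

lemma V_upper_aux:
  assumes "C \<ge> 0" "\<And>x. 0 \<le> x \<Longrightarrow> \<bar>V_err m x\<bar> \<le> C * (1 + x) powr (\<omega> * real m - \<epsilon>)" "x \<ge> 0"
  shows "V m x \<le> (cc m + C) * (1 + x) powr (\<omega> * real m)"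
proof -
  have "V m x \<le> cc m * x powr (\<omega> * real m) + C * (1 + x) powr (\<omega> * real m - \<epsilon>)"
    using assms(2)[OF assms(3)] by (simp add: V_err_def)
  also have "\<dots> \<le> cc m * (1 + x) powr (\<omega> * real m) + C * (1 + x) powr (\<omega> * real m)"
    using assms pos cc_pos[of m] by (intro add_mono mult_left_mono powr_mono2 powr_mono) auto
  finally show ?thesis by (simp add: algebra_simps)
qed

text \<open>Averaging the decomposition of \<open>log_sum (V m)\<close> gives \<open>cc m\<close>
  times the fractional integral of \<open>V 1\<close>, and replacing \<open>V 1 y\<close> there by
  \<open>c * y powr \<omega>\<close> produces \<open>cc (Suc m)\<close>. Both errors lose
  \<open>\<epsilon>\<close> in the exponent: one is \<open>V_err m\<close> summed over on average
  \<open>O((1 + x) powr \<omega>)\<close> points, the other is the error of \<open>V 1\<close>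
  integrated against total weight \<open>x powr (\<omega> * m)\<close>.\<close>

lemma V_asymp:
  "m \<ge> 1 \<Longrightarrow> \<exists>C\<ge>0. \<forall>x\<ge>0. \<bar>V_err m x\<bar> \<le> C * (1 + x) powr (\<omega> * real m - \<epsilon>)"
proof (induction m rule: nat_induct_at_least)
  case base
  obtain C where C: "\<And>t. t \<ge> 0 \<Longrightarrow> \<bar>(\<integral>q. cnt q t \<partial>\<mu>) - c * t powr \<omega>\<bar> \<le> C * (1 + t) powr (\<omega> - \<epsilon>)"
    using mean by blast
  have "C \<ge> 0" using C[of 0] by simp
  moreover have "cc 1 = c"
  proof -
    have "Gamma (\<omega> + 1) > 0" using pos by (intro Gamma_real_pos) auto
    then show ?thesis by (simp add: lim_const_def)
  qed
  ultimately show ?case using C by (intro exI[of _ C]) (auto simp: V_err_def V_1[unfolded One_nat_def])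
next
  case (Suc m)
  let ?p = "\<omega> * real m"
  have p: "?p > 0" using pos Suc by simp
  obtain C where C: "C \<ge> 0" "\<And>x. 0 \<le> x \<Longrightarrow> \<bar>V_err m x\<bar> \<le> C * (1 + x) powr (?p - \<epsilon>)"
    using Suc by blast
  obtain D where D': "\<And>t. t \<ge> 0 \<Longrightarrow> \<bar>V 1 t - c * t powr \<omega>\<bar> \<le> D * (1 + t) powr (\<omega> - \<epsilon>)"
    using mean V_1 by auto
  have D0: "D \<ge> 0" using D'[of 0] V_nonneg[of "Suc 0" 0] by (simp del: V_nonneg)
  have V1: "V 1 x \<le> (c + D) * (1 + x) powr \<omega>" if "x \<ge> 0" for x
  proof -
    have "V 1 x \<le> c * x powr \<omega> + D * (1 + x) powr (\<omega> - \<epsilon>)" using D'[OF that] by simp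
    also have "\<dots> \<le> c * (1 + x) powr \<omega> + D * (1 + x) powr \<omega>"
      using D0 that pos by (intro add_mono mult_left_mono powr_mono2 powr_mono) auto
    finally show ?thesis by (simp add: algebra_simps)
  qed
  have "\<bar>V_err (Suc m) x\<bar> \<le> (cc m * D + C * (c + D)) * (1 + x) powr (\<omega> * real (Suc m) - \<epsilon>)" if x: "x \<ge> 0" for x
  proof -
    have iV: "\<bar>V 1 y\<bar> \<le> V 1 x" if "0 \<le> y" "y \<le> x" for y
      using that V_mono[of y x 1] by (simp del: level_mean.simps)
    have ei: "integrable \<mu> (\<lambda>q. log_sum (V m) UNIV q x - cc m * frac_int ?p (cnt q) x)"
      using log_sum_V_integrable frac_int_mean(1)[OF p x] by (intro Bochner_Integration.integrable_diff integrable_mult_right) auto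
    have ci: "integrable \<mu> (\<lambda>q. cnt q x)" using log_sum_V_integrable[of 0 x] by (simp add: level_mean_0)
    have "V (Suc m) x - cc m * frac_int ?p (V 1) x = (\<integral>q. log_sum (V m) UNIV q x - cc m * frac_int ?p (cnt q) x \<partial>\<mu>)"
      using log_sum_V_integrable frac_int_mean[OF p x] by (simp add: level_mean.simps(2)[of _ m])
    moreover have "\<bar>\<integral>q. log_sum (V m) UNIV q x - cc m * frac_int ?p (cnt q) x \<partial>\<mu>\<bar> \<le> (\<integral>q. C * (1 + x) powr (?p - \<epsilon>) * cnt q x \<partial>\<mu>)"
    proof (rule abs_integral_le[OF ei])
      show "integrable \<mu> (\<lambda>q. C * (1 + x) powr (?p - \<epsilon>) * cnt q x)"
        using ci by (intro integrable_mult_right)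
      show "AE q in \<mu>. \<bar>log_sum (V m) UNIV q x - cc m * frac_int ?p (cnt q) x\<bar> \<le> C * (1 + x) powr (?p - \<epsilon>) * cnt q x"
        using AE_subprob
      proof eventually_elim
        case (elim q)
        then have q: "subprob UNIV q" by auto
        show ?case
          using log_sum_V_decomp[OF q x Suc(1)] log_sum_V_err_le[OF q x om_eps_nonneg[OF Suc(1)] C(2,1)] by simp
      qed
    qed
    moreover have "(\<integral>q. C * (1 + x) powr (?p - \<epsilon>) * cnt q x \<partial>\<mu>) = C * (1 + x) powr (?p - \<epsilon>) * V 1 x"
      by (simp add: V_1[unfolded One_nat_def])
    moreover have "C * (1 + x) powr (?p - \<epsilon>) * V 1 x \<le> C * (1 + x) powr (?p - \<epsilon>) * ((c + D) * (1 + x) powr \<omega>)"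
      using V1[OF x] C(1) by (intro mult_left_mono) auto
    ultimately have "\<bar>V (Suc m) x - cc m * frac_int ?p (V 1) x\<bar> \<le> C * (1 + x) powr (?p - \<epsilon>) * ((c + D) * (1 + x) powr \<omega>)"
      by linarith
    then have 1: "\<bar>V (Suc m) x - cc m * frac_int ?p (V 1) x\<bar> \<le> C * (c + D) * ((1 + x) powr (?p - \<epsilon>) * (1 + x) powr \<omega>)"
      by (simp only: mult_ac)
    have pe: "?p - \<epsilon> + \<omega> = \<omega> * real (Suc m) - \<epsilon>" by (simp add: algebra_simps)
    have 2: "frac_int ?p (\<lambda>y. V 1 y + - c * y powr \<omega>) x = frac_int ?p (V 1) x + - c * frac_int ?p (\<lambda>y. y powr \<omega>) x"
      by (rule frac_int_add_cmult[OF p x, where B = "V 1 x" and B' = "(1 + x) powr \<omega>"])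
        (use iV pos x in \<open>auto intro: powr_mono2\<close>)
    have 3: "\<bar>frac_int ?p (\<lambda>y. V 1 y + - c * y powr \<omega>) x\<bar> \<le> x powr ?p * (D * (1 + x) powr (\<omega> - \<epsilon>))"
    proof (rule frac_int_bound[OF p x])
      fix y assume y: "0 \<le> y" "y \<le> x"
      have "\<bar>V 1 y + - c * y powr \<omega>\<bar> \<le> D * (1 + y) powr (\<omega> - \<epsilon>)" using D'[OF y(1)] by simp
      also have "\<dots> \<le> D * (1 + x) powr (\<omega> - \<epsilon>)" using D0 y pos by (intro mult_left_mono powr_mono2) auto
      finally show "\<bar>V 1 y + - c * y powr \<omega>\<bar> \<le> D * (1 + x) powr (\<omega> - \<epsilon>)" .
    qed measurable
    also have "x powr ?p * (D * (1 + x) powr (\<omega> - \<epsilon>)) \<le> (1 + x) powr ?p * (D * (1 + x) powr (\<omega> - \<epsilon>))"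
      using D0 x p by (intro mult_right_mono powr_mono2) auto
    also have "\<dots> = D * (1 + x) powr (?p + (\<omega> - \<epsilon>))" by (simp add: powr_add)
    also have "?p + (\<omega> - \<epsilon>) = \<omega> * real (Suc m) - \<epsilon>" by (simp add: algebra_simps)
    finally have 4: "\<bar>frac_int ?p (V 1) x - c * frac_int ?p (\<lambda>y. y powr \<omega>) x\<bar> \<le> D * (1 + x) powr (\<omega> * real (Suc m) - \<epsilon>)"
      unfolding 2 by simp
    have 5: "cc m * (c * frac_int ?p (\<lambda>y. y powr \<omega>) x) = cc (Suc m) * x powr (\<omega> * real (Suc m))"
      using frac_int_powr[OF p x pos(2)] by (simp add: cc_Suc algebra_simps)
    have "V_err (Suc m) x = (V (Suc m) x - cc m * frac_int ?p (V 1) x) + cc m * (frac_int ?p (V 1) x - c * frac_int ?p (\<lambda>y. y powr \<omega>) x)"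
      unfolding V_err_def 5[symmetric] by (simp add: algebra_simps)
    also have "\<bar>\<dots>\<bar> \<le> C * (c + D) * (1 + x) powr (\<omega> * real (Suc m) - \<epsilon>) + cc m * (D * (1 + x) powr (\<omega> * real (Suc m) - \<epsilon>))"
      using 1 4 cc_pos[of m] unfolding powr_add[symmetric] pe
      by (intro order_trans[OF abs_triangle_ineq] add_mono) (auto simp: abs_mult)
    finally show ?thesis by (simp add: algebra_simps)
  qed
  moreover have "cc m * D + C * (c + D) \<ge> 0" using C(1) D0 cc_pos[of m] pos by simp
  ultimately show ?case by blast
qed

lemma V_upper:
  "\<exists>C\<ge>0. \<forall>x\<ge>0. V m x \<le> C * (1 + x) powr (\<omega> * real m)"
proof (cases "m = 0")
  case True
  then show ?thesis by (intro exI[of _ 1]) auto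
next
  case False
  then obtain C where C: "C \<ge> 0" "\<And>x. 0 \<le> x \<Longrightarrow> \<bar>V_err m x\<bar> \<le> C * (1 + x) powr (\<omega> * real m - \<epsilon>)"
    using V_asymp[of m] by auto
  show ?thesis using V_upper_aux[OF C] C(1) cc_pos[of m] by (intro exI[of _ "cc m + C"]) auto
qed

text \<open>The supremum grows with \<open>t\<close>, so for small \<open>t\<close> it is enlarged
  to the fixed time \<open>t1\<close>, where the bound is available. With \<open>t1 \<ge> 1\<close>
  the loss is a constant factor relative to \<open>1 + t\<close>.\<close>

lemma second_moment_all:
  "\<exists>C\<ge>0. \<forall>t\<ge>0. \<forall>G \<in> borel_measurable \<mu>.
      (AE q in \<mu>. G q \<le> (SUP s\<in>{0..t}. ennreal ((cnt q s - V 1 s)\<^sup>2))) \<longrightarrow>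
      (\<integral>\<^sup>+q. G q \<partial>\<mu>) \<le> ennreal (C * (1 + t) powr (2 * \<gamma>))"
proof -
  obtain C t0 where C: "\<And>t G. t \<ge> t0 \<Longrightarrow> G \<in> borel_measurable \<mu> \<Longrightarrow>
      (AE q in \<mu>. G q \<le> (SUP s\<in>{0..t}. ennreal ((cnt q s - V 1 s)\<^sup>2))) \<Longrightarrow>
      (\<integral>\<^sup>+q. G q \<partial>\<mu>) \<le> ennreal (C * t powr (2 * \<gamma>))"
    using second_moment unfolding eventually_at_top_linorder V_1 by blast
  define t1 where "t1 = max t0 1"
  have "(\<integral>\<^sup>+q. G q \<partial>\<mu>) \<le> ennreal (\<bar>C\<bar> * t1 powr (2 * \<gamma>) * (1 + t) powr (2 * \<gamma>))"
    if t: "t \<ge> 0" and G: "G \<in> borel_measurable \<mu>" "AE q in \<mu>. G q \<le> (SUP s\<in>{0..t}. ennreal ((cnt q s - V 1 s)\<^sup>2))" for t G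
  proof -
    have "(\<integral>\<^sup>+q. G q \<partial>\<mu>) \<le> ennreal (C * (max t t1) powr (2 * \<gamma>))"
    proof (rule C[OF _ G(1)])
      show "AE q in \<mu>. G q \<le> (SUP s\<in>{0..max t t1}. ennreal ((cnt q s - V 1 s)\<^sup>2))"
        using G(2)
      proof eventually_elim
        case (elim q)
        also have "(SUP s\<in>{0..t}. ennreal ((cnt q s - V 1 s)\<^sup>2)) \<le> (SUP s\<in>{0..max t t1}. ennreal ((cnt q s - V 1 s)\<^sup>2))"
          by (rule SUP_subset_mono) auto
        finally show ?case .
      qed
    qed (simp add: t1_def)
    also have "C * (max t t1) powr (2 * \<gamma>) \<le> \<bar>C\<bar> * (t1 * (1 + t)) powr (2 * \<gamma>)"
    proof (intro mult_mono powr_mono2)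
      have "t \<le> t1 * t" "t1 * 0 \<le> t1 * t" using t by (auto simp: t1_def mult_le_cancel_right1 intro!: mult_left_mono)
      then show "max t t1 \<le> t1 * (1 + t)" using t by (auto simp: t1_def algebra_simps)
    qed (use t gamma_pos in \<open>auto simp: t1_def\<close>)
    also have "\<dots> = \<bar>C\<bar> * t1 powr (2 * \<gamma>) * (1 + t) powr (2 * \<gamma>)" 
      using t by (subst powr_mult) (auto simp: t1_def)
    finally show ?thesis by (simp add: ennreal_leI)
  qed
  then show ?thesis by (intro exI[of _ "\<bar>C\<bar> * t1 powr (2 * \<gamma>)"]) auto
qed

section \<open>Second moment of the centred contribution of one fragmentation\<close>

definition frag_dev :: "nat \<Rightarrow> real \<Rightarrow> (nat \<Rightarrow> real) \<Rightarrow> real" where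
  "frag_dev m x q = log_sum (V m) UNIV q x - V (Suc m) x"

text \<open>Deterministic on purpose: the bound is affine in a uniform bound \<open>s\<close> for
  the first-level deviation, so it can be solved for \<open>s\<close> and yield a measurable
  minorant of the supremum. The part free of \<open>s\<close> comes from \<open>V_err\<close>; its
  exponent \<open>\<omega> * m - \<epsilon> + \<omega>\<close> lies below
  \<open>\<omega> * m + \<gamma>\<close>.\<close>

lemma frag_dev_deviation:
  "\<exists>A>0. \<exists>B\<ge>0. \<forall>x\<ge>0. \<forall>q s. subprob UNIV q \<and> (\<forall>y\<in>{0..x}. \<bar>cnt q y - V 1 y\<bar> \<le> s) \<longrightarrow>
     \<bar>frag_dev m x q\<bar> \<le> A * (1 + x) powr (\<omega> * real m) * s + B * (1 + x) powr (\<omega> * real m + \<gamma>)"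
proof (cases "m = 0")
  case True
  then show ?thesis by (intro exI[of _ 1] conjI exI[of _ 0]) (auto simp: frag_dev_def level_mean_0 V_1[symmetric])
next
  case False
  then have m: "m \<ge> 1" by simp
  let ?p = "\<omega> * real m"
  have p: "?p > 0" using pos m by simp
  obtain C where C: "C \<ge> 0" "\<And>x. 0 \<le> x \<Longrightarrow> \<bar>V_err m x\<bar> \<le> C * (1 + x) powr (?p - \<epsilon>)"
    using V_asymp[OF m] by auto
  obtain D where D: "D \<ge> 0" "\<And>x. 0 \<le> x \<Longrightarrow> V 1 x \<le> D * (1 + x) powr \<omega>"
    using V_upper[of 1] by auto
  have "\<bar>frag_dev m x q\<bar> \<le> (cc m + C) * (1 + x) powr ?p * s + 2 * C * D * (1 + x) powr (?p + \<gamma>)"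
    if x: "x \<ge> 0" and q: "subprob UNIV q" and s: "\<And>y. y \<in> {0..x} \<Longrightarrow> \<bar>cnt q y - V 1 y\<bar> \<le> s" for x q s
  proof -
    have [measurable]: "cnt q \<in> borel_measurable borel" by (rule cnt_borel[OF q])
    let ?E = "C * (1 + x) powr (?p - \<epsilon>)"
    have s0: "s \<ge> 0" using s[of 0] x by auto
    have err: "\<bar>log_sum (V m) UNIV q x - cc m * frac_int ?p (cnt q) x\<bar> \<le> ?E * cnt q x" if "subprob UNIV q" for q
      using log_sum_V_decomp[OF that x m] log_sum_V_err_le[OF that x om_eps_nonneg[OF m] C(2,1)] by simp
    have ci: "integrable \<mu> (\<lambda>q. cnt q x)" using log_sum_V_integrable[of 0 x] by (simp add: level_mean_0)
    have Verr: "\<bar>V (Suc m) x - cc m * frac_int ?p (V 1) x\<bar> \<le> ?E * V 1 x"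
    proof -
      have eq: "V (Suc m) x - cc m * frac_int ?p (V 1) x = (\<integral>q. log_sum (V m) UNIV q x - cc m * frac_int ?p (cnt q) x \<partial>\<mu>)"
        using log_sum_V_integrable frac_int_mean[OF p x] by (simp add: level_mean.simps(2)[of _ m])
      have "\<bar>\<integral>q. log_sum (V m) UNIV q x - cc m * frac_int ?p (cnt q) x \<partial>\<mu>\<bar> \<le> (\<integral>q. ?E * cnt q x \<partial>\<mu>)"
      proof (rule abs_integral_le)
        show "AE q in \<mu>. \<bar>log_sum (V m) UNIV q x - cc m * frac_int ?p (cnt q) x\<bar> \<le> ?E * cnt q x"
          using AE_subprob by eventually_elim (use err in auto)
      qed (use log_sum_V_integrable frac_int_mean(1)[OF p x] ci in auto)
      then show ?thesis unfolding eq by (simp add: V_1[unfolded One_nat_def])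
    qed
    have fd: "frac_int ?p (\<lambda>y. cnt q y + - 1 * V 1 y) x = frac_int ?p (cnt q) x + - 1 * frac_int ?p (V 1) x"
    proof (rule frac_int_add_cmult[OF p x, where B = "cnt q x" and B' = "V 1 x"])
      show "\<bar>cnt q y\<bar> \<le> cnt q x" if "0 \<le> y" "y \<le> x" for y
        using monoD[OF cnt_mono[OF q] that(2)] cnt_nonneg[of UNIV q y] by simp
      show "\<bar>V 1 y\<bar> \<le> V 1 x" if "0 \<le> y" "y \<le> x" for y using V_mono[OF that(2), of 1] by simp
    qed measurable
    have fb: "\<bar>frac_int ?p (\<lambda>y. cnt q y + - 1 * V 1 y) x\<bar> \<le> x powr ?p * s"
      by (rule frac_int_bound[OF p x]) (use s in auto)
    from err[OF q] have "\<bar>frag_dev m x q\<bar> \<le> ?E * cnt q x + ?E * V 1 x + cc m * (x powr ?p * s)"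
    proof -
      have "frag_dev m x q = (log_sum (V m) UNIV q x - cc m * frac_int ?p (cnt q) x) - (V (Suc m) x - cc m * frac_int ?p (V 1) x)
          + cc m * frac_int ?p (\<lambda>y. cnt q y + - 1 * V 1 y) x"
        unfolding frag_dev_def fd by (simp add: algebra_simps)
      moreover have "\<bar>cc m * frac_int ?p (\<lambda>y. cnt q y + - 1 * V 1 y) x\<bar> \<le> cc m * (x powr ?p * s)"
        using fb cc_pos[of m] by (simp add: abs_mult)
      ultimately show ?thesis using err[OF q] Verr by linarith
    qed
    moreover have "?E * cnt q x \<le> ?E * s + ?E * V 1 x"
      using s[of x] x C(1) by (subst distrib_left[symmetric]) (intro mult_left_mono, auto)
    moreover have "?E * s \<le> C * (1 + x) powr ?p * s"
      using C(1) s0 x pos by (intro mult_left_mono mult_right_mono powr_mono) auto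
    moreover have "cc m * (x powr ?p * s) \<le> cc m * (1 + x) powr ?p * s"
      using x cc_pos[of m] s0 p by (subst mult.assoc) (intro mult_left_mono mult_right_mono powr_mono2, auto)
    moreover have "2 * (?E * V 1 x) \<le> 2 * ?E * (D * (1 + x) powr \<omega>)"
      using C(1) D(2)[OF x] by (simp add: mult_left_mono)
    ultimately have 1: "\<bar>frag_dev m x q\<bar> \<le> (C * (1 + x) powr ?p * s + cc m * (1 + x) powr ?p * s) + 2 * ?E * (D * (1 + x) powr \<omega>)"
      by linarith
    have 2: "2 * ?E * (D * (1 + x) powr \<omega>) = 2 * C * D * (1 + x) powr (?p - \<epsilon> + \<omega>)"
      by (simp only: powr_add mult_ac)
    have 3: "2 * C * D * (1 + x) powr (?p - \<epsilon> + \<omega>) \<le> 2 * C * D * (1 + x) powr (?p + \<gamma>)"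
      using x C(1) D(1) gamma by (intro mult_left_mono powr_mono) auto
    show ?thesis using 1 2 3 by (simp only: distrib_right)
  qed
  then show ?thesis using C(1) D(1) cc_pos[of m]
    by (intro exI[of _ "cc m + C"] conjI exI[of _ "2 * C * D"]) (auto simp del: One_nat_def)
qed

lemma frag_dev_measurable [measurable (raw)]:
  assumes [measurable]: "\<And>k. (\<lambda>z. q z k) \<in> borel_measurable N" "U \<in> borel_measurable N"
  shows "(\<lambda>z. frag_dev m (U z) (q z)) \<in> borel_measurable N"
  unfolding frag_dev_def by measurable

lemma frag_dev_bound: "subprob UNIV q \<Longrightarrow> x \<le> u \<Longrightarrow> \<bar>frag_dev m x q\<bar> \<le> V m u * exp u + V (Suc m) u"
proof -
  assume q: "subprob UNIV q" and x: "x \<le> u"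
  have "\<bar>frag_dev m x q\<bar> \<le> V m x * exp x + V (Suc m) x"
    using log_sum_V_bound[OF q, of m x] V_nonneg[of "Suc m" x] unfolding frag_dev_def by linarith
  also have "\<dots> \<le> V m u * exp u + V (Suc m) u"
    using x by (intro add_mono mult_mono V_mono) auto
  finally show ?thesis .
qed

lemma frag_dev_mean: "(\<integral>q. frag_dev m x q \<partial>\<mu>) = 0"
  unfolding frag_dev_def using log_sum_V_integrable[of m x] by (simp add: level_mean.simps(2)[of _ m] prob_space)

lemma frag_dev_second_moment:
  "\<exists>C\<ge>0. \<forall>x\<ge>0. (\<integral>\<^sup>+q. ennreal ((frag_dev m x q)\<^sup>2) \<partial>\<mu>) \<le> ennreal (C * (1 + x) powr (2 * (\<omega> * real m + \<gamma>)))"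
proof -
  obtain A B where AB: "A > 0" "B \<ge> 0" "\<forall>x\<ge>0. \<forall>q s. subprob UNIV q \<and> (\<forall>y\<in>{0..x}. \<bar>cnt q y - V 1 y\<bar> \<le> s) \<longrightarrow>
     \<bar>frag_dev m x q\<bar> \<le> A * (1 + x) powr (\<omega> * real m) * s + B * (1 + x) powr (\<omega> * real m + \<gamma>)"
    using frag_dev_deviation[of m] by (elim exE conjE) (rule that)
  obtain C where C: "C \<ge> 0" "\<And>t G. t \<ge> 0 \<Longrightarrow> G \<in> borel_measurable \<mu> \<Longrightarrow>
      (AE q in \<mu>. G q \<le> (SUP s\<in>{0..t}. ennreal ((cnt q s - V 1 s)\<^sup>2))) \<Longrightarrow>
      (\<integral>\<^sup>+q. G q \<partial>\<mu>) \<le> ennreal (C * (1 + t) powr (2 * \<gamma>))"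
    using second_moment_all by blast
  have "(\<integral>\<^sup>+q. ennreal ((frag_dev m x q)\<^sup>2) \<partial>\<mu>) \<le> ennreal ((2 * A\<^sup>2 * C + 2 * B\<^sup>2) * (1 + x) powr (2 * (\<omega> * real m + \<gamma>)))"
    if x: "x \<ge> 0" for x
  proof -
    define a where "a = A * (1 + x) powr (\<omega> * real m)"
    define b where "b = B * (1 + x) powr (\<omega> * real m + \<gamma>)"
    \<comment> \<open>The affine bound solved for \<open>s\<close>: a measurable function of
      \<open>q\<close> below the supremum of the first-level deviation.\<close>
    define L where "L q = max 0 ((\<bar>frag_dev m x q\<bar> - b) / a)" for q
    have a: "a > 0" and b: "b \<ge> 0" using AB(1,2) x by (auto simp: a_def b_def)
    have [measurable]: "L \<in> borel_measurable \<mu>" unfolding L_def by measurable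
    have 1: "(\<integral>\<^sup>+q. ennreal ((L q)\<^sup>2) \<partial>\<mu>) \<le> ennreal (C * (1 + x) powr (2 * \<gamma>))"
    proof (rule C(2)[OF x])
      show "AE q in \<mu>. ennreal ((L q)\<^sup>2) \<le> (SUP s\<in>{0..x}. ennreal ((cnt q s - V 1 s)\<^sup>2))"
        using AE_subprob
      proof eventually_elim
        case (elim q)
        then have q: "subprob UNIV q" by auto
        show ?case
        \<comment> \<open>A finite supremum has a square root that is an admissible
          \<open>s\<close>; an infinite one bounds anything.\<close>
        proof (cases "(SUP s\<in>{0..x}. ennreal ((cnt q s - V 1 s)\<^sup>2))")
          case (real S)
          have le: "(cnt q y - V 1 y)\<^sup>2 \<le> S" if "y \<in> {0..x}" for y
          proof -
            have "ennreal ((cnt q y - V 1 y)\<^sup>2) \<le> ennreal S"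
              unfolding real(2)[symmetric] using that by (rule SUP_upper)
            then show ?thesis using real(1) by simp
          qed
          then have "\<bar>cnt q y - V 1 y\<bar> \<le> sqrt S" if "y \<in> {0..x}" for y
            using le[OF that] real_sqrt_le_mono by fastforce
          with AB(3) x q have "\<bar>frag_dev m x q\<bar> \<le> a * sqrt S + b" by (simp add: a_def b_def)
          then have "L q \<le> sqrt S" using a real(1) by (auto simp: L_def field_simps)
          then have "(L q)\<^sup>2 \<le> (sqrt S)\<^sup>2" by (intro power_mono) (auto simp: L_def)
          then show ?thesis using real by (simp add: ennreal_leI)
        next
          case top
          then show ?thesis by (simp only: top_greatest)
        qed
      qed
    qed measurable
    have "(\<integral>\<^sup>+q. ennreal ((frag_dev m x q)\<^sup>2) \<partial>\<mu>) \<le> (\<integral>\<^sup>+q. ennreal (2 * a\<^sup>2) * ennreal ((L q)\<^sup>2) + ennreal (2 * b\<^sup>2) \<partial>\<mu>)"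
    proof (rule nn_integral_mono)
      fix q
      have "\<bar>frag_dev m x q\<bar> \<le> a * L q + b"
        using a by (auto simp: L_def max_def field_simps)
      then have "(\<bar>frag_dev m x q\<bar>)\<^sup>2 \<le> (a * L q + b)\<^sup>2" by (intro power_mono) auto
      also have "\<dots> \<le> 2 * a\<^sup>2 * (L q)\<^sup>2 + 2 * b\<^sup>2"
        using sum_squares_bound[of "a * L q" b] by (simp add: power2_sum power_mult_distrib)
      finally show "ennreal ((frag_dev m x q)\<^sup>2) \<le> ennreal (2 * a\<^sup>2) * ennreal ((L q)\<^sup>2) + ennreal (2 * b\<^sup>2)"
        by (simp add: ennreal_mult[symmetric] ennreal_plus[symmetric] ennreal_leI del: ennreal_plus)
    qed
    also have "\<dots> = ennreal (2 * a\<^sup>2) * (\<integral>\<^sup>+q. ennreal ((L q)\<^sup>2) \<partial>\<mu>) + ennreal (2 * b\<^sup>2)"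
      by (subst nn_integral_add) (auto simp: nn_integral_cmult emeasure_space_1)
    also have "\<dots> \<le> ennreal (2 * a\<^sup>2) * ennreal (C * (1 + x) powr (2 * \<gamma>)) + ennreal (2 * b\<^sup>2)"
      by (intro add_mono mult_left_mono 1) auto
    also have "\<dots> = ennreal (2 * a\<^sup>2 * (C * (1 + x) powr (2 * \<gamma>)) + 2 * b\<^sup>2)"
      using C(1) by (simp add: ennreal_mult[symmetric] ennreal_plus[symmetric] del: ennreal_plus)
    also have "2 * a\<^sup>2 * (C * (1 + x) powr (2 * \<gamma>)) + 2 * b\<^sup>2 = (2 * A\<^sup>2 * C + 2 * B\<^sup>2) * (1 + x) powr (2 * (\<omega> * real m + \<gamma>))"
    proof -
      have sq: "(z powr r)\<^sup>2 = z powr (2 * r)" for z r :: real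
        by (simp add: power2_eq_square powr_add[symmetric])
      show ?thesis unfolding a_def b_def power_mult_distrib sq
        by (simp add: distrib_left powr_add algebra_simps)
    qed
    finally show ?thesis .
  qed
  then show ?thesis using AB C by (intro exI[of _ "2 * A\<^sup>2 * C + 2 * B\<^sup>2"]) auto
qed

end

section \<open>The tree of fragmentations\<close>

text \<open>
  The exceptional set is existentially quantified because the events of interest are suprema over
  uncountably many arguments and need not be measurable.
\<close>

definition whp :: "'a measure \<Rightarrow> 'i filter \<Rightarrow> ('i \<Rightarrow> 'a \<Rightarrow> bool) \<Rightarrow> bool" where
  "whp M F A \<longleftrightarrow> (\<forall>e>0. \<forall>\<^sub>F i in F. \<exists>B\<in>sets M. measure M B < e \<and> (\<forall>z\<in>space M - B. A i z))"

lemma whpD: "whp M F A \<Longrightarrow> e > 0 \<Longrightarrow> \<forall>\<^sub>F i in F. \<exists>B\<in>sets M. measure M B < e \<and> (\<forall>z\<in>space M - B. A i z)"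
  unfolding whp_def by blast

lemma whp_mono:
  assumes "whp M F A" "\<forall>\<^sub>F i in F. \<forall>z\<in>space M. A i z \<longrightarrow> B i z"
  shows "whp M F B"
  unfolding whp_def
proof (intro allI impI)
  fix e :: real assume "e > 0"
  show "\<forall>\<^sub>F i in F. \<exists>Ba\<in>sets M. measure M Ba < e \<and> (\<forall>z\<in>space M - Ba. B i z)"
    using whpD[OF assms(1) \<open>e > 0\<close>] assms(2) by eventually_elim blast
qed

lemma (in prob_space) whp_conj:
  assumes "whp M F A" "whp M F B"
  shows "whp M F (\<lambda>i z. A i z \<and> B i z)"
  unfolding whp_def
proof (intro allI impI)
  fix e :: real assume "e > 0"
  then have e: "e / 2 > 0" by simp
  show "\<forall>\<^sub>F i in F. \<exists>Ba\<in>sets M. prob Ba < e \<and> (\<forall>z\<in>space M - Ba. A i z \<and> B i z)"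
    using whpD[OF assms(1) e] whpD[OF assms(2) e]
  proof eventually_elim
    case (elim i)
    then obtain B1 B2 where B: "B1 \<in> sets M" "prob B1 < e / 2" "\<forall>z\<in>space M - B1. A i z"
       "B2 \<in> sets M" "prob B2 < e / 2" "\<forall>z\<in>space M - B2. B i z" by blast
    have "prob (B1 \<union> B2) < e" using measure_Un_le[OF B(1,4)] B(2,5) by simp
    then show ?case using B by (intro bexI[of _ "B1 \<union> B2"]) auto
  qed
qed

lemma (in prob_space) whp_AE:
  assumes "AE z in M. A z" shows "whp M F (\<lambda>_. A)"
proof -
  from AE_E[OF assms] obtain N where "{x\<in>space M. \<not> A x} \<subseteq> N" "emeasure M N = 0" "N \<in> sets M" by auto
  then show ?thesis unfolding whp_def by (intro allI impI always_eventually bexI[of _ N]) (auto simp: measure_def)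
qed

lemma (in prob_space) whp_finite:
  assumes "finite J" "\<And>j. j \<in> J \<Longrightarrow> whp M F (A j)"
  shows "whp M F (\<lambda>i z. \<forall>j\<in>J. A j i z)"
  using assms
proof (induction J rule: finite_induct)
  case empty
  show ?case using whp_AE[of "\<lambda>_. True" F] by simp
next
  case (insert x J)
  show ?case using whp_conj[OF insert.prems[of x] insert.IH] insert.prems by simp
qed

lemma (in prob_space) whp_lim0:
  assumes "\<And>i. \<exists>B\<in>sets M. measure M B \<le> b i \<and> (\<forall>z\<in>space M - B. A i z)" "(b \<longlongrightarrow> 0) F"
  shows "whp M F A"
  unfolding whp_def
proof (intro allI impI)
  fix e :: real assume "e > 0"
  have "\<forall>\<^sub>F i in F. b i < e" using assms(2) \<open>e > 0\<close> by (rule order_tendstoD)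
  then show "\<forall>\<^sub>F i in F. \<exists>B\<in>sets M. prob B < e \<and> (\<forall>z\<in>space M - B. A i z)"
    by eventually_elim (meson assms(1) le_less_trans)
qed

lemma (in prob_space) Markov_bad_set:
  assumes [measurable]: "g \<in> borel_measurable M" and "(\<integral>\<^sup>+z. g z \<partial>M) \<le> ennreal K" "0 \<le> K" "0 < \<eta>"
  shows "\<exists>B\<in>sets M. measure M B \<le> K / \<eta> \<and> (\<forall>z\<in>space M - B. g z < ennreal \<eta>)"
proof (intro bexI conjI)
  let ?B = "{z\<in>space M. 1 \<le> ennreal (1 / \<eta>) * g z}"
  show B: "?B \<in> sets M" by measurable
  have "emeasure M ?B \<le> ennreal (1 / \<eta>) * (\<integral>\<^sup>+z. g z * indicator (space M) z \<partial>M)"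
    by (rule nn_integral_Markov_inequality) auto
  also have "(\<integral>\<^sup>+z. g z * indicator (space M) z \<partial>M) = (\<integral>\<^sup>+z. g z \<partial>M)"
    by (rule nn_integral_cong) simp
  also have "ennreal (1 / \<eta>) * \<dots> \<le> ennreal (1 / \<eta>) * ennreal K"
    by (intro mult_left_mono assms) auto
  also have "\<dots> = ennreal (K / \<eta>)" using assms by (simp add: ennreal_mult[symmetric])
  finally show "measure M ?B \<le> K / \<eta>"
    using assms by (simp add: emeasure_eq_measure)
  show "\<forall>z\<in>space M - ?B. g z < ennreal \<eta>"
  proof
    fix z assume "z \<in> space M - ?B"
    then have "ennreal (1 / \<eta>) * g z < 1" by auto
    then have "ennreal \<eta> * (ennreal (1 / \<eta>) * g z) < ennreal \<eta> * 1"
      using assms by (intro ennreal_mult_strict_left_mono) auto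
    then show "g z < ennreal \<eta>"
      using assms by (simp add: mult.assoc[symmetric] ennreal_mult[symmetric])
  qed
qed

section \<open>Words, box probabilities and sums over a level\<close>

abbreviation words :: "nat \<Rightarrow> nat list set" where
  "words l \<equiv> {v. length v = l}"

lemma words_Suc_image:
  "{v \<in> words (Suc l). R v} = (\<lambda>(w, k). w @ [k]) ` Sigma {w \<in> words l. \<exists>k. R (w @ [k])} (\<lambda>w. {k. R (w @ [k])})"
proof (intro set_eqI iffI)
  fix v assume v: "v \<in> {v \<in> words (Suc l). R v}"
  then obtain w k where "v = w @ [k]" by (metis (mono_tags, lifting) length_Suc_conv_rev mem_Collect_eq)
  then show "v \<in> (\<lambda>(w, k). w @ [k]) ` Sigma {w \<in> words l. \<exists>k. R (w @ [k])} (\<lambda>w. {k. R (w @ [k])})"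
    using v by (intro image_eqI[of _ _ "(w, k)"]) auto
qed auto

locale nested_fragmentation = fragmentation \<mu> c \<omega> \<epsilon> \<gamma> + M: prob_space M
  for \<mu> c \<omega> \<epsilon> \<gamma> and M :: "'w measure" +
  fixes Q :: "nat list \<Rightarrow> nat \<Rightarrow> 'w \<Rightarrow> real"
  assumes Q_indep: "M.indep_vars (\<lambda>_. \<Pi>\<^sub>M k\<in>UNIV. (borel :: real measure)) (\<lambda>v z k. Q v k z) UNIV"
    and Q_distr: "\<And>v. distr M (\<Pi>\<^sub>M k\<in>UNIV. borel) (\<lambda>z k. Q v k z) = \<mu>"
begin

abbreviation S where "S \<equiv> (\<Pi>\<^sub>M k\<in>UNIV. (borel :: real measure)) :: (nat \<Rightarrow> real) measure"

lemma Q_seq_measurable [measurable]: "(\<lambda>z k. Q v k z) \<in> M \<rightarrow>\<^sub>M S"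
  using Q_indep unfolding M.indep_vars_def by auto

lemma Q_measurable [measurable]: "Q v k \<in> borel_measurable M"
  using measurable_compose[OF Q_seq_measurable[of v] measurable_component_singleton[of k UNIV "\<lambda>_. borel"]] by simp

lemma box_prob_measurable [measurable]: "box_prob Q v \<in> borel_measurable M"
  unfolding box_prob_def by measurable

definition good :: "'w \<Rightarrow> bool" where
  "good z \<longleftrightarrow> (\<forall>v. subprob UNIV (\<lambda>k. Q v k z) \<and> (\<forall>k. Q v k z < 1))"

lemma AE_good: "AE z in M. good z"
  unfolding good_def AE_all_countable
proof
  fix v
  have "AE q in distr M S (\<lambda>z k. Q v k z). subprob UNIV q \<and> (\<forall>k. q k < 1)"
    unfolding Q_distr by (rule AE_subprob)
  from AE_distrD[OF Q_seq_measurable this]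
  show "AE z in M. subprob UNIV (\<lambda>k. Q v k z) \<and> (\<forall>k. Q v k z < 1)" by simp
qed

text \<open>A finite set of words is enlarged to a product of parents and last letters, over which
  the mass can be summed letter by letter.\<close>

lemma subprob_words: "good z \<Longrightarrow> subprob (words l) (\<lambda>v. box_prob Q v z)"
proof (induction l)
  case 0
  have "sum (\<lambda>v. box_prob Q v z) F \<le> 1" if "finite F" "F \<subseteq> {[]}" for F
    using that by (cases "F = {}") (auto simp: box_prob_Nil subset_singleton_iff)
  then show ?case by (auto simp: subprob_def box_prob_Nil)
next
  case (Suc l)
  note IH = Suc.IH[OF Suc.prems]
  have pos: "box_prob Q v z > 0" for v
    unfolding box_prob_def using Suc.prems by (intro prod_pos) (auto simp: good_def subprob_def)
  have "sum (\<lambda>v. box_prob Q v z) F \<le> 1" if F: "finite F" "F \<subseteq> words (Suc l)" for F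
  proof -
    let ?W = "butlast ` F" and ?K = "last ` F"
    have "F \<subseteq> (\<lambda>(w, k). w @ [k]) ` (?W \<times> ?K)"
    proof
      fix v assume "v \<in> F"
      then have "v = butlast v @ [last v]" using F by (intro append_butlast_last_id[symmetric]) auto
      then show "v \<in> (\<lambda>(w, k). w @ [k]) ` (?W \<times> ?K)"
        using \<open>v \<in> F\<close> by (intro image_eqI[of _ _ "(butlast v, last v)"]) auto
    qed
    then have "sum (\<lambda>v. box_prob Q v z) F \<le> sum (\<lambda>v. box_prob Q v z) ((\<lambda>(w, k). w @ [k]) ` (?W \<times> ?K))"
      using F pos by (intro sum_mono2) (auto intro: less_imp_le)
    also have "\<dots> = (\<Sum>(w, k)\<in>?W \<times> ?K. box_prob Q (w @ [k]) z)"
      by (subst sum.reindex) (auto simp: inj_on_def case_prod_beta)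
    also have "\<dots> = (\<Sum>w\<in>?W. box_prob Q w z * (\<Sum>k\<in>?K. Q w k z))"
      by (simp add: sum.cartesian_product[symmetric] box_prob_snoc sum_distrib_left)
    also have "\<dots> \<le> (\<Sum>w\<in>?W. box_prob Q w z * 1)"
      using Suc.prems F pos by (intro sum_mono mult_left_mono) (auto simp: good_def subprob_def intro: less_imp_le)
    also have "\<dots> \<le> 1"
    proof -
      have "?W \<subseteq> words l" using F by auto
      then show ?thesis using IH F unfolding subprob_def by auto
    qed
    finally show ?thesis .
  qed
  then show ?case using pos by (auto simp: subprob_def)
qed

lemma box_prob_pos: "good z \<Longrightarrow> box_prob Q v z > 0"
  using subprob_words[of z "length v"] by (auto simp: subprob_def)

lemma box_prob_le_1: "good z \<Longrightarrow> box_prob Q v z \<le> 1"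
  using subprob_le_1[OF subprob_words[of z "length v"]] by auto

lemma box_prob_less_1: "good z \<Longrightarrow> v \<noteq> [] \<Longrightarrow> box_prob Q v z < 1"
proof -
  assume z: "good z" and "v \<noteq> []"
  then obtain w k where v: "v = w @ [k]" by (metis rev_exhaust)
  have "box_prob Q v z = box_prob Q w z * Q w k z" by (simp add: v box_prob_snoc)
  also have "\<dots> \<le> 1 * Q w k z" 
    using z box_prob_le_1[OF z, of w] by (intro mult_right_mono) (auto simp: good_def subprob_def intro: less_imp_le)
  also have "\<dots> < 1" using z by (simp add: good_def)
  finally show ?thesis .
qed

text \<open>On \<open>good\<close>, this is the conditional mean, given the first \<open>l\<close>
  levels, of the number of boxes of level \<open>l + m\<close> with probability at least
  \<open>exp (- u)\<close>. For \<open>m = 0\<close> it is that number itself; lowering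
  \<open>l\<close> while keeping \<open>l + m\<close> replaces true subtrees by their means, one
  level at a time.\<close>

definition level_sum :: "nat \<Rightarrow> nat \<Rightarrow> 'w \<Rightarrow> real \<Rightarrow> real" where
  "level_sum l m z u = log_sum (V m) (words l) (\<lambda>v. box_prob Q v z) u"

lemma box_prob_snoc_ge:
  assumes "good z" shows "box_prob Q (w @ [k]) z \<ge> exp (- u) \<longleftrightarrow> Q w k z \<ge> exp (- (u + ln (box_prob Q w z)))"
proof -
  have "exp (- (u + ln (box_prob Q w z))) = exp (-u) / box_prob Q w z"
    using box_prob_pos[OF assms, of w] by (simp add: exp_diff)
  then show ?thesis using box_prob_pos[OF assms, of w]
    by (simp add: box_prob_snoc pos_divide_le_eq mult.commute)
qed

text \<open>Factors are below one, so a child above the threshold has its parent above it, and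
  grouping by such parents loses nothing.\<close>

lemma level_sum_Suc:
  assumes z: "good z"
  shows "level_sum (Suc l) m z u = (\<Sum>w\<in>{w\<in>words l. box_prob Q w z \<ge> exp (-u)}. log_sum (V m) UNIV (\<lambda>k. Q w k z) (u + ln (box_prob Q w z)))"
proof -
  let ?R = "\<lambda>v. box_prob Q v z \<ge> exp (-u)"
  let ?W = "{w\<in>words l. ?R w}"
  let ?K = "\<lambda>w. {k. Q w k z \<ge> exp (- (u + ln (box_prob Q w z)))}"
  have sub: "{w \<in> words l. \<exists>k. ?R (w @ [k])} \<subseteq> ?W"
  proof safe
    fix w k assume "?R (w @ [k])"
    also have "box_prob Q (w @ [k]) z = box_prob Q w z * Q w k z" by (simp add: box_prob_snoc)
    also have "\<dots> \<le> box_prob Q w z * 1"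
      using z box_prob_pos[OF z, of w] by (intro mult_left_mono) (auto simp: good_def intro: less_imp_le)
    finally show "?R w" by simp
  qed
  have fW: "finite ?W" by (rule subprob_finite(1)[OF subprob_words[OF z]])
  have fK: "finite (?K w)" for w 
    using subprob_finite(1)[of UNIV "\<lambda>k. Q w k z" "u + ln (box_prob Q w z)"] z by (simp add: good_def)
  have eq: "{v \<in> words (Suc l). ?R v} = (\<lambda>(w, k). w @ [k]) ` Sigma ?W ?K"
    unfolding words_Suc_image[of l ?R] box_prob_snoc_ge[OF z]
    using sub[unfolded box_prob_snoc_ge[OF z]] by (intro arg_cong[where f = "image _"]) blast
  have "level_sum (Suc l) m z u = (\<Sum>(w, k)\<in>Sigma ?W ?K. V m (u + ln (box_prob Q (w @ [k]) z)))"
    unfolding level_sum_def log_sum_def eq by (subst sum.reindex) (auto simp: inj_on_def case_prod_beta)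
  also have "\<dots> = (\<Sum>w\<in>?W. \<Sum>k\<in>?K w. V m (u + ln (box_prob Q (w @ [k]) z)))"
    using fW fK by (subst sum.Sigma) auto
  also have "\<dots> = (\<Sum>w\<in>?W. log_sum (V m) UNIV (\<lambda>k. Q w k z) (u + ln (box_prob Q w z)))"
    unfolding log_sum_def
  proof (intro sum.cong refl)
    fix w k
    have "Q w k z > 0" using z by (auto simp: good_def subprob_def)
    then show "V m (u + ln (box_prob Q (w @ [k]) z)) = V m (u + ln (box_prob Q w z) + ln (Q w k z))"
      using box_prob_pos[OF z, of w] by (simp add: box_prob_snoc ln_mult add.assoc)
  qed auto
  finally show ?thesis .
qed

lemma level_sum_diff:
  assumes z: "good z"
  shows "level_sum (Suc l) m z u - level_sum l (Suc m) z u =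
    (\<Sum>w\<in>{w\<in>words l. box_prob Q w z \<ge> exp (-u)}. frag_dev m (u + ln (box_prob Q w z)) (\<lambda>k. Q w k z))"
  unfolding level_sum_Suc[OF z] level_sum_def[of l] log_sum_def[of _ "words l"] frag_dev_def by (simp add: sum_subtractf)

lemma level_sum_1: 
  assumes z: "good z" "u \<ge> 0"
  shows "level_sum 1 m z u = log_sum (V m) UNIV (\<lambda>k. Q [] k z) u"
proof -
  have "{w \<in> words 0. exp (- u) \<le> box_prob Q w z} = {[]}" using assms by (auto simp: box_prob_Nil)
  then show ?thesis using level_sum_Suc[OF z(1), of 0 m u] by (simp add: box_prob_Nil)
qed

section \<open>Integrating out the fragmentation of one box\<close>

abbreviation rest :: "nat list \<Rightarrow> 'w \<Rightarrow> nat list \<Rightarrow> nat \<Rightarrow> real" where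
  "rest v z \<equiv> restrict (\<lambda>w k. Q w k z) (- {v})"

abbreviation RS where "RS v \<equiv> PiM (- {v}) (\<lambda>_::nat list. S)"

lemma rest_measurable [measurable]: "rest v \<in> M \<rightarrow>\<^sub>M RS v"
  by (rule measurable_restrict) simp

text \<open>An independent family has independent restrictions to \<open>{v}\<close> and to its
  complement; a function on the one-point set is then identified with its value.\<close>

lemma distr_rest: "distr M (RS v \<Otimes>\<^sub>M S) (\<lambda>z. (rest v z, \<lambda>k. Q v k z)) = distr M (RS v) (rest v) \<Otimes>\<^sub>M \<mu>"
proof -
  let ?one = "\<lambda>z. restrict (\<lambda>w k. Q w k z) {v}"
  have "M.indep_var (RS v) (rest v) (PiM {v} (\<lambda>_::nat list. S)) ?one"
    by (rule M.indep_var_restrict[OF Q_indep]) auto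
  then have eq: "distr M (RS v) (rest v) \<Otimes>\<^sub>M distr M (PiM {v} (\<lambda>_. S)) ?one = distr M (RS v \<Otimes>\<^sub>M PiM {v} (\<lambda>_. S)) (\<lambda>z. (rest v z, ?one z))"
    unfolding M.indep_var_distribution_eq by blast
  have one [measurable]: "?one \<in> M \<rightarrow>\<^sub>M PiM {v} (\<lambda>_. S)" by (rule measurable_restrict) simp
  have mu: "\<mu> = distr (distr M (PiM {v} (\<lambda>_. S)) ?one) S (\<lambda>g. g v)"
    by (subst distr_distr) (auto simp: comp_def Q_distr)
  interpret R: prob_space "distr M (RS v) (rest v)" by (rule M.prob_space_distr) simp
  have "distr M (RS v) (rest v) \<Otimes>\<^sub>M \<mu> = distr (distr M (RS v) (rest v)) (RS v) (\<lambda>r. r) \<Otimes>\<^sub>M distr (distr M (PiM {v} (\<lambda>_. S)) ?one) S (\<lambda>g. g v)"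
    unfolding mu[symmetric] by (subst distr_id2) auto
  also have "\<dots> = distr (distr M (RS v) (rest v) \<Otimes>\<^sub>M distr M (PiM {v} (\<lambda>_. S)) ?one) (RS v \<Otimes>\<^sub>M S) (\<lambda>(r, g). (r, g v))"
    by (rule pair_measure_distr) (auto simp: mu[symmetric] sigma_finite_measure_axioms)
  also have "\<dots> = distr M (RS v \<Otimes>\<^sub>M S) (\<lambda>z. (rest v z, \<lambda>k. Q v k z))"
    unfolding eq by (subst distr_distr) (auto simp: comp_def)
  finally show ?thesis ..
qed

abbreviation rbox :: "nat list \<Rightarrow> (nat list \<Rightarrow> nat \<Rightarrow> real) \<Rightarrow> real" where
  "rbox v r \<equiv> box_prob (\<lambda>w k r. r w k) v r"

text \<open>The product runs over proper prefixes of \<open>w\<close>, which are shorter than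
  \<open>v\<close>. So box probabilities up to the level of \<open>v\<close> do not depend on the
  fragmentation of \<open>v\<close> itself.\<close>

lemma rbox_rest: "length w \<le> length v \<Longrightarrow> rbox w (rest v z) = box_prob Q w z"
  unfolding box_prob_def by (intro prod.cong) auto

lemma rcomp_measurable: "w \<noteq> v \<Longrightarrow> (\<lambda>r. r w k) \<in> borel_measurable (RS v)"
  using measurable_compose[OF measurable_component_singleton[of w "- {v}" "\<lambda>_. S"] measurable_component_singleton[of k UNIV "\<lambda>_. borel"]] by simp

lemma rbox_measurable: "length w \<le> length v \<Longrightarrow> rbox w \<in> borel_measurable (RS v)"
  unfolding box_prob_def by (intro borel_measurable_prod rcomp_measurable) auto

lemma prob_rest: "prob_space (distr M (RS v) (rest v))"
  by (rule M.prob_space_distr) simp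

lemma nn_integral_rest:
  assumes [measurable]: "f \<in> borel_measurable (RS v \<Otimes>\<^sub>M S)"
  shows "(\<integral>\<^sup>+z. f (rest v z, \<lambda>k. Q v k z) \<partial>M) = (\<integral>\<^sup>+z. \<integral>\<^sup>+q. f (rest v z, q) \<partial>\<mu> \<partial>M)"
proof -
  have S: "sets S = sets \<mu>" by (simp add: sets_mu)
  have f2 [measurable]: "f \<in> borel_measurable (RS v \<Otimes>\<^sub>M \<mu>)"
    using assms by (simp cong: measurable_cong_sets add: sets_pair_measure_cong[OF refl S])
  have "(\<integral>\<^sup>+z. f (rest v z, \<lambda>k. Q v k z) \<partial>M) = (\<integral>\<^sup>+x. f x \<partial>distr M (RS v \<Otimes>\<^sub>M S) (\<lambda>z. (rest v z, \<lambda>k. Q v k z)))"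
    by (subst nn_integral_distr) auto
  also have "\<dots> = (\<integral>\<^sup>+r. \<integral>\<^sup>+q. f (r, q) \<partial>\<mu> \<partial>distr M (RS v) (rest v))"
    unfolding distr_rest by (subst nn_integral_fst[symmetric]) (auto cong: measurable_cong_sets)
  also have "\<dots> = (\<integral>\<^sup>+z. \<integral>\<^sup>+q. f (rest v z, q) \<partial>\<mu> \<partial>M)"
    by (subst nn_integral_distr) auto
  finally show ?thesis .
qed

lemma integral_rest:
  fixes f :: "_ \<Rightarrow> real"
  assumes [measurable]: "f \<in> borel_measurable (RS v \<Otimes>\<^sub>M S)"
    and int: "integrable M (\<lambda>z. f (rest v z, \<lambda>k. Q v k z))"
  shows "(\<integral>z. f (rest v z, \<lambda>k. Q v k z) \<partial>M) = (\<integral>z. \<integral>q. f (rest v z, q) \<partial>\<mu> \<partial>M)"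
proof -
  interpret R: prob_space "distr M (RS v) (rest v)" by (rule prob_rest)
  interpret P: pair_sigma_finite "distr M (RS v) (rest v)" \<mu> ..
  have S: "sets S = sets \<mu>" by (simp add: sets_mu)
  have f2 [measurable]: "f \<in> borel_measurable (RS v \<Otimes>\<^sub>M \<mu>)"
    using assms by (simp cong: measurable_cong_sets add: sets_pair_measure_cong[OF refl S])
  have i: "integrable (distr M (RS v) (rest v) \<Otimes>\<^sub>M \<mu>) f"
    unfolding distr_rest[symmetric] using int by (subst integrable_distr_eq) auto
  have "(\<integral>z. f (rest v z, \<lambda>k. Q v k z) \<partial>M) = (\<integral>x. f x \<partial>distr M (RS v \<Otimes>\<^sub>M S) (\<lambda>z. (rest v z, \<lambda>k. Q v k z)))"
    by (subst integral_distr) auto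
  also have "\<dots> = (\<integral>r. \<integral>q. f (r, q) \<partial>\<mu> \<partial>distr M (RS v) (rest v))"
    unfolding distr_rest using P.integral_fst'[OF i] by simp
  also have "\<dots> = (\<integral>z. \<integral>q. f (rest v z, q) \<partial>\<mu> \<partial>M)"
    by (subst integral_distr) auto
  finally show ?thesis .
qed

end

context nested_fragmentation begin

lemma level_sum_nn_integral:
  assumes z: "good z"
  shows "ennreal (level_sum l m z u) = (\<integral>\<^sup>+v. ennreal (if box_prob Q v z \<ge> exp (-u) then V m (u + ln (box_prob Q v z)) else 0) \<partial>count_space (words l))"
proof -
  let ?W = "{w\<in>words l. box_prob Q w z \<ge> exp (-u)}"
  have "(\<integral>\<^sup>+v. ennreal (if box_prob Q v z \<ge> exp (-u) then V m (u + ln (box_prob Q v z)) else 0) \<partial>count_space (words l))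
    = (\<Sum>v\<in>?W. ennreal (if box_prob Q v z \<ge> exp (-u) then V m (u + ln (box_prob Q v z)) else 0))"
    by (rule nn_integral_count_space') (use subprob_finite(1)[OF subprob_words[OF z]] in auto)
  also have "\<dots> = (\<Sum>v\<in>?W. ennreal (V m (u + ln (box_prob Q v z))))" by (rule sum.cong) auto
  also have "\<dots> = ennreal (level_sum l m z u)" by (simp add: level_sum_def log_sum_def sum_ennreal)
  finally show ?thesis ..
qed

lemma level_sum_Suc_nn_integral:
  assumes z: "good z"
  shows "ennreal (level_sum (Suc l) m z u) = (\<integral>\<^sup>+w. ennreal (if box_prob Q w z \<ge> exp (-u) then log_sum (V m) UNIV (\<lambda>k. Q w k z) (u + ln (box_prob Q w z)) else 0) \<partial>count_space (words l))"
proof -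
  let ?W = "{w\<in>words l. box_prob Q w z \<ge> exp (-u)}"
  let ?f = "\<lambda>w. log_sum (V m) UNIV (\<lambda>k. Q w k z) (u + ln (box_prob Q w z))"
  have "(\<integral>\<^sup>+w. ennreal (if box_prob Q w z \<ge> exp (-u) then ?f w else 0) \<partial>count_space (words l))
    = (\<Sum>v\<in>?W. ennreal (if box_prob Q v z \<ge> exp (-u) then ?f v else 0))"
    by (rule nn_integral_count_space') (use subprob_finite(1)[OF subprob_words[OF z]] in auto)
  also have "\<dots> = (\<Sum>v\<in>?W. ennreal (?f v))" by (rule sum.cong) auto
  also have "\<dots> = ennreal (level_sum (Suc l) m z u)" by (simp add: level_sum_Suc[OF z] sum_ennreal log_sum_nonneg)
  finally show ?thesis ..
qed

text \<open>The martingale property: integrating out the fragmentation of a box of level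
  \<open>l\<close> turns the sum over its children into \<open>V (Suc m)\<close>. All terms are
  nonnegative, so sums over words and expectations commute.\<close>

lemma level_sum_mean:
  "u \<ge> 0 \<Longrightarrow> (\<integral>\<^sup>+z. ennreal (level_sum l m z u) \<partial>M) = ennreal (V (l + m) u)"
proof (induction l arbitrary: m)
  case 0
  have "level_sum 0 m z u = V m u" for z
  proof -
    have "{w \<in> words 0. exp (- u) \<le> box_prob Q w z} = {[]}" using 0 by (auto simp: box_prob_Nil)
    then show ?thesis by (simp add: level_sum_def log_sum_def box_prob_Nil)
  qed
  then show ?case by (simp add: M.emeasure_space_1)
next
  case (Suc l)
  have step: "(\<integral>\<^sup>+z. ennreal (if box_prob Q w z \<ge> exp (-u) then log_sum (V m) UNIV (\<lambda>k. Q w k z) (u + ln (box_prob Q w z)) else 0) \<partial>M)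
    = (\<integral>\<^sup>+z. ennreal (if box_prob Q w z \<ge> exp (-u) then V (Suc m) (u + ln (box_prob Q w z)) else 0) \<partial>M)" for w
  proof -
    define f where "f = (\<lambda>(r, q :: nat \<Rightarrow> real). ennreal (if rbox w r \<ge> exp (-u) then log_sum (V m) UNIV q (u + ln (rbox w r)) else 0))"
    have [measurable]: "rbox w \<in> borel_measurable (RS w)" by (rule rbox_measurable) simp
    have "f \<in> borel_measurable (RS w \<Otimes>\<^sub>M S)" unfolding f_def by measurable
    from nn_integral_rest[OF this]
    have "(\<integral>\<^sup>+z. ennreal (if box_prob Q w z \<ge> exp (-u) then log_sum (V m) UNIV (\<lambda>k. Q w k z) (u + ln (box_prob Q w z)) else 0) \<partial>M)
      = (\<integral>\<^sup>+z. \<integral>\<^sup>+q. ennreal (if box_prob Q w z \<ge> exp (-u) then log_sum (V m) UNIV q (u + ln (box_prob Q w z)) else 0) \<partial>\<mu> \<partial>M)"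
      by (simp only: f_def prod.case rbox_rest order_refl)
    also have "\<dots> = (\<integral>\<^sup>+z. ennreal (if box_prob Q w z \<ge> exp (-u) then V (Suc m) (u + ln (box_prob Q w z)) else 0) \<partial>M)"
    proof (rule nn_integral_cong)
      fix z
      have "(\<integral>\<^sup>+q. ennreal (log_sum (V m) UNIV q x) \<partial>\<mu>) = ennreal (V (Suc m) x)" for x
        unfolding level_mean.simps by (rule nn_integral_eq_integral[OF log_sum_V_integrable]) (simp add: log_sum_nonneg)
      then show "(\<integral>\<^sup>+q. ennreal (if box_prob Q w z \<ge> exp (-u) then log_sum (V m) UNIV q (u + ln (box_prob Q w z)) else 0) \<partial>\<mu>)
        = ennreal (if box_prob Q w z \<ge> exp (-u) then V (Suc m) (u + ln (box_prob Q w z)) else 0)" by simp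
    qed
    finally show ?thesis .
  qed
  have "(\<integral>\<^sup>+z. ennreal (level_sum (Suc l) m z u) \<partial>M) = 
     (\<integral>\<^sup>+z. \<integral>\<^sup>+w. ennreal (if box_prob Q w z \<ge> exp (-u) then log_sum (V m) UNIV (\<lambda>k. Q w k z) (u + ln (box_prob Q w z)) else 0) \<partial>count_space (words l) \<partial>M)"
    by (rule nn_integral_cong_AE, use AE_good in eventually_elim) (rule level_sum_Suc_nn_integral)
  also have "\<dots> = (\<integral>\<^sup>+w. \<integral>\<^sup>+z. ennreal (if box_prob Q w z \<ge> exp (-u) then log_sum (V m) UNIV (\<lambda>k. Q w k z) (u + ln (box_prob Q w z)) else 0) \<partial>M \<partial>count_space (words l))"
    by (rule nn_integral_count_space_nn_integral) auto
  also have "\<dots> = (\<integral>\<^sup>+w. \<integral>\<^sup>+z. ennreal (if box_prob Q w z \<ge> exp (-u) then V (Suc m) (u + ln (box_prob Q w z)) else 0) \<partial>M \<partial>count_space (words l))"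
    unfolding step ..
  also have "\<dots> = (\<integral>\<^sup>+z. \<integral>\<^sup>+w. ennreal (if box_prob Q w z \<ge> exp (-u) then V (Suc m) (u + ln (box_prob Q w z)) else 0) \<partial>count_space (words l) \<partial>M)"
    by (rule nn_integral_count_space_nn_integral[symmetric]) auto
  also have "\<dots> = (\<integral>\<^sup>+z. ennreal (level_sum l (Suc m) z u) \<partial>M)"
    by (rule nn_integral_cong_AE, use AE_good in eventually_elim) (rule level_sum_nn_integral[symmetric])
  finally show ?case using Suc by simp
qed

lemma words_prob_sum:
  assumes "u \<ge> 0" "finite F" "F \<subseteq> words l"
  shows "(\<Sum>v\<in>F. emeasure M {z\<in>space M. box_prob Q v z \<ge> exp (-u)}) \<le> ennreal (V l u)"
proof -
  have "(\<Sum>v\<in>F. emeasure M {z\<in>space M. box_prob Q v z \<ge> exp (-u)}) = (\<integral>\<^sup>+z. (\<Sum>v\<in>F. indicator {z\<in>space M. box_prob Q v z \<ge> exp (-u)} z) \<partial>M)"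
    by (subst nn_integral_sum) auto
  also have "\<dots> \<le> (\<integral>\<^sup>+z. ennreal (level_sum l 0 z u) \<partial>M)"
  proof (rule nn_integral_mono_AE)
    show "AE z in M. (\<Sum>v\<in>F. indicator {z\<in>space M. box_prob Q v z \<ge> exp (-u)} z) \<le> ennreal (level_sum l 0 z u)"
      using AE_good AE_space
    proof eventually_elim
      case (elim z)
      have "(\<Sum>v\<in>F. indicator {z\<in>space M. box_prob Q v z \<ge> exp (-u)} z) = (\<Sum>v\<in>{v\<in>F. box_prob Q v z \<ge> exp (-u)}. 1::ennreal)"
        by (rule sum.mono_neutral_cong_right) (use elim assms(2) in \<open>auto simp: indicator_def\<close>)
      also have "\<dots> = ennreal (real (card {v\<in>F. box_prob Q v z \<ge> exp (-u)}))" by (simp add: ennreal_of_nat_eq_real_of_nat)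
      also have "\<dots> \<le> ennreal (level_sum l 0 z u)"
        unfolding level_sum_def level_mean_0 log_sum_1
        by (intro ennreal_leI of_nat_mono card_mono subprob_finite(1)[OF subprob_words[OF elim(1)]]) (use assms(3) in auto)
      finally show ?case .
    qed
  qed
  also have "\<dots> = ennreal (V l u)" using level_sum_mean[OF assms(1), of l 0] by simp
  finally show ?thesis .
qed

section \<open>Orthogonality of the boxes of one level and the telescoping variance bound\<close>

definition box_dev :: "nat \<Rightarrow> real \<Rightarrow> nat list \<Rightarrow> 'w \<Rightarrow> real" where
  "box_dev m u v z = (if box_prob Q v z \<ge> exp (-u) then frag_dev m (u + ln (box_prob Q v z)) (\<lambda>k. Q v k z) else 0)"

lemma box_dev_measurable [measurable]: "box_dev m u v \<in> borel_measurable M"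
  unfolding box_dev_def by measurable

lemma box_dev_bound: "good z \<Longrightarrow> \<bar>box_dev m u v z\<bar> \<le> V m u * exp u + V (Suc m) u"
proof -
  assume z: "good z"
  have "u + ln (box_prob Q v z) \<le> u" using box_prob_le_1[OF z, of v] box_prob_pos[OF z, of v] by simp
  from frag_dev_bound[OF _ this, of "\<lambda>k. Q v k z" m] show ?thesis using z 
    by (auto simp: box_dev_def good_def intro: order_trans)
qed

lemma box_dev_prod_integrable: "integrable M (\<lambda>z. box_dev m u v z * box_dev m u w z)"
proof (rule M.integrable_const_bound[where B = "(V m u * exp u + V (Suc m) u) * (V m u * exp u + V (Suc m) u)"])
  show "AE z in M. norm (box_dev m u v z * box_dev m u w z) \<le> (V m u * exp u + V (Suc m) u) * (V m u * exp u + V (Suc m) u)"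
    using AE_good by eventually_elim (auto simp: abs_mult intro!: mult_mono box_dev_bound)
qed measurable

text \<open>With all fragmentations except that of \<open>v\<close> fixed, the factor of
  \<open>w\<close> is a constant, since \<open>w\<close> is different from \<open>v\<close> and of
  the same length, and the factor of \<open>v\<close> has mean zero.\<close>

lemma box_dev_orthogonal:
  assumes "length v = length w" "v \<noteq> w"
  shows "(\<integral>z. box_dev m u v z * box_dev m u w z \<partial>M) = 0"
proof -
  define h where "h x r q = (if rbox x r \<ge> exp (-u) then frag_dev m (u + ln (rbox x r)) q else 0)" for x :: "nat list" and r q
  define f where "f = (\<lambda>(r, q). h v r q * h w r (r w))"
  have [measurable]: "rbox v \<in> borel_measurable (RS v)" "rbox w \<in> borel_measurable (RS v)"
    using assms by (auto intro!: rbox_measurable)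
  have [measurable]: "(\<lambda>r. r w k) \<in> borel_measurable (RS v)" for k
    using assms by (intro rcomp_measurable) auto
  have fm: "f \<in> borel_measurable (RS v \<Otimes>\<^sub>M S)" unfolding f_def h_def by measurable
  have eq: "f (rest v z, \<lambda>k. Q v k z) = box_dev m u v z * box_dev m u w z" for z
    using assms by (simp add: f_def h_def box_dev_def rbox_rest)
  have "(\<integral>z. box_dev m u v z * box_dev m u w z \<partial>M) = (\<integral>z. \<integral>q. f (rest v z, q) \<partial>\<mu> \<partial>M)"
    using integral_rest[OF fm] box_dev_prod_integrable[of m u v w] by (simp add: eq)
  also have "\<dots> = (\<integral>z. 0 \<partial>M)"
  proof (rule Bochner_Integration.integral_cong[OF refl])
    fix z
    have "(\<integral>q. h v (rest v z) q \<partial>\<mu>) = 0" by (cases "rbox v (rest v z) \<ge> exp (-u)") (simp_all add: h_def frag_dev_mean)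
    then show "(\<integral>q. f (rest v z, q) \<partial>\<mu>) = 0" by (simp add: f_def)
  qed
  finally show ?thesis by simp
qed

lemma box_dev_second_moment:
  assumes C: "C \<ge> 0" "\<And>x. x \<ge> 0 \<Longrightarrow> (\<integral>\<^sup>+q. ennreal ((frag_dev m x q)\<^sup>2) \<partial>\<mu>) \<le> ennreal (C * (1 + x) powr (2 * (\<omega> * real m + \<gamma>)))"
    and u: "u \<ge> 0"
  shows "(\<integral>\<^sup>+z. ennreal ((box_dev m u v z)\<^sup>2) \<partial>M) \<le> ennreal (C * (1 + u) powr (2 * (\<omega> * real m + \<gamma>))) * emeasure M {z\<in>space M. box_prob Q v z \<ge> exp (-u)}"
proof -
  define f where "f = (\<lambda>(r, q). ennreal ((if rbox v r \<ge> exp (-u) then frag_dev m (u + ln (rbox v r)) q else 0)\<^sup>2))"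
  have [measurable]: "rbox v \<in> borel_measurable (RS v)" by (rule rbox_measurable) simp
  have "f \<in> borel_measurable (RS v \<Otimes>\<^sub>M S)" unfolding f_def by measurable
  from nn_integral_rest[OF this]
  have "(\<integral>\<^sup>+z. ennreal ((box_dev m u v z)\<^sup>2) \<partial>M) = (\<integral>\<^sup>+z. \<integral>\<^sup>+q. ennreal ((if box_prob Q v z \<ge> exp (-u) then frag_dev m (u + ln (box_prob Q v z)) q else 0)\<^sup>2) \<partial>\<mu> \<partial>M)"
    unfolding box_dev_def by (simp only: f_def prod.case rbox_rest order_refl)
  also have "\<dots> \<le> (\<integral>\<^sup>+z. ennreal (C * (1 + u) powr (2 * (\<omega> * real m + \<gamma>))) * indicator {z\<in>space M. box_prob Q v z \<ge> exp (-u)} z \<partial>M)"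
  proof (rule nn_integral_mono_AE)
    show "AE z in M. (\<integral>\<^sup>+q. ennreal ((if box_prob Q v z \<ge> exp (-u) then frag_dev m (u + ln (box_prob Q v z)) q else 0)\<^sup>2) \<partial>\<mu>)
       \<le> ennreal (C * (1 + u) powr (2 * (\<omega> * real m + \<gamma>))) * indicator {z\<in>space M. box_prob Q v z \<ge> exp (-u)} z"
      using AE_good AE_space
    proof eventually_elim
      case (elim z)
      show ?case
      proof (cases "box_prob Q v z \<ge> exp (-u)")
        case True
        have x: "0 \<le> u + ln (box_prob Q v z)" "u + ln (box_prob Q v z) \<le> u"
          using True box_prob_le_1[OF elim(1), of v] box_prob_pos[OF elim(1), of v] by (auto simp: exp_le_iff_ln)
        have "(\<integral>\<^sup>+q. ennreal ((frag_dev m (u + ln (box_prob Q v z)) q)\<^sup>2) \<partial>\<mu>) \<le> ennreal (C * (1 + (u + ln (box_prob Q v z))) powr (2 * (\<omega> * real m + \<gamma>)))"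
          by (rule C(2)[OF x(1)])
        also have "\<dots> \<le> ennreal (C * (1 + u) powr (2 * (\<omega> * real m + \<gamma>)))"
          using x C(1) pos gamma_pos by (intro ennreal_leI mult_left_mono powr_mono2) auto
        finally show ?thesis using True elim by simp
      qed simp
    qed
  qed
  also have "\<dots> = ennreal (C * (1 + u) powr (2 * (\<omega> * real m + \<gamma>))) * emeasure M {z\<in>space M. box_prob Q v z \<ge> exp (-u)}"
    by (rule nn_integral_cmult_indicator) measurable
  finally show ?thesis .
qed

lemma finite_short_words: "finite {v\<in>words l. to_nat v < n}"
proof -
  have "to_nat ` {v\<in>words l. to_nat v < n} \<subseteq> {..<n}" by auto
  then have "finite (to_nat ` {v\<in>words l. to_nat v < n})" by (rule finite_subset) simp
  then show ?thesis by (rule finite_imageD) (rule inj_on_subset[OF inj_to_nat], simp)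
qed

text \<open>
  The sum over infinitely many boxes is reached by Fatou's lemma from finite sums, whose terms are orthogonal.
\<close>

lemma level_sum_diff_bad_set:
  "\<exists>K\<ge>0. \<forall>u\<ge>0. \<forall>\<eta>>0. \<exists>B\<in>sets M. measure M B \<le> K * (1 + u) powr (2 * (\<omega> * real m + \<gamma>)) * V l u / \<eta>\<^sup>2 \<and>
     (\<forall>z\<in>space M - B. \<bar>level_sum (Suc l) m z u - level_sum l (Suc m) z u\<bar> < \<eta>)"
proof -
  obtain C where C: "C \<ge> 0" "\<And>x. x \<ge> 0 \<Longrightarrow> (\<integral>\<^sup>+q. ennreal ((frag_dev m x q)\<^sup>2) \<partial>\<mu>) \<le> ennreal (C * (1 + x) powr (2 * (\<omega> * real m + \<gamma>)))"
    using frag_dev_second_moment[of m] by blast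
  have "\<exists>B\<in>sets M. measure M B \<le> C * (1 + u) powr (2 * (\<omega> * real m + \<gamma>)) * V l u / \<eta>\<^sup>2 \<and>
     (\<forall>z\<in>space M - B. \<bar>level_sum (Suc l) m z u - level_sum l (Suc m) z u\<bar> < \<eta>)" if u: "u \<ge> 0" and \<eta>: "\<eta> > 0" for u \<eta>
  proof -
    let ?D = "C * (1 + u) powr (2 * (\<omega> * real m + \<gamma>))"
    define F where "F n = {v\<in>words l. to_nat v < n}" for n
    have F: "finite (F n)" "F n \<subseteq> words l" for n
      unfolding F_def by (rule finite_short_words) auto
    define R where "R n z = (\<Sum>v\<in>F n. box_dev m u v z)" for n z
    have [measurable]: "R n \<in> borel_measurable M" for n unfolding R_def by measurable
    have R2: "(\<integral>\<^sup>+z. ennreal ((R n z)\<^sup>2) \<partial>M) \<le> ennreal (?D * V l u)" for n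
    proof -
      have i2: "integrable M (\<lambda>z. (R n z)\<^sup>2)"
        unfolding R_def power2_eq_square sum_product by (intro Bochner_Integration.integrable_sum box_dev_prod_integrable)
      have sqi: "integrable M (\<lambda>z. (box_dev m u v z)\<^sup>2)" for v unfolding power2_eq_square by (rule box_dev_prod_integrable)
      have "(\<integral>z. (R n z)\<^sup>2 \<partial>M) = (\<Sum>v\<in>F n. \<Sum>w\<in>F n. \<integral>z. box_dev m u v z * box_dev m u w z \<partial>M)"
        unfolding R_def power2_eq_square sum_product by (simp add: Bochner_Integration.integral_sum box_dev_prod_integrable)
      also have "\<dots> = (\<Sum>v\<in>F n. \<Sum>w\<in>F n. if w = v then \<integral>z. (box_dev m u v z)\<^sup>2 \<partial>M else 0)"
      proof (intro sum.cong refl)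
        fix v w assume "v \<in> F n" "w \<in> F n"
        then show "(\<integral>z. box_dev m u v z * box_dev m u w z \<partial>M) = (if w = v then \<integral>z. (box_dev m u v z)\<^sup>2 \<partial>M else 0)"
          using box_dev_orthogonal[of v w m u] F(2) by (auto simp: power2_eq_square)
      qed
      also have "\<dots> = (\<Sum>v\<in>F n. \<integral>z. (box_dev m u v z)\<^sup>2 \<partial>M)" using F(1) by simp
      finally have "(\<integral>\<^sup>+z. ennreal ((R n z)\<^sup>2) \<partial>M) = ennreal (\<Sum>v\<in>F n. \<integral>z. (box_dev m u v z)\<^sup>2 \<partial>M)"
        by (simp add: nn_integral_eq_integral[OF i2])
      also have "\<dots> = (\<Sum>v\<in>F n. \<integral>\<^sup>+z. ennreal ((box_dev m u v z)\<^sup>2) \<partial>M)"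
        by (simp add: nn_integral_eq_integral[OF sqi] sum_ennreal)
      also have "\<dots> \<le> (\<Sum>v\<in>F n. ennreal ?D * emeasure M {z\<in>space M. box_prob Q v z \<ge> exp (-u)})"
        by (intro sum_mono box_dev_second_moment C u)
      also have "\<dots> \<le> ennreal ?D * ennreal (V l u)"
        unfolding sum_distrib_left[symmetric] by (intro mult_left_mono words_prob_sum u F) auto
      also have "\<dots> = ennreal (?D * V l u)" using C(1) by (simp add: ennreal_mult)
      finally show ?thesis .
    qed
    have "(\<integral>\<^sup>+z. liminf (\<lambda>n. ennreal ((R n z)\<^sup>2)) \<partial>M) \<le> liminf (\<lambda>n. \<integral>\<^sup>+z. ennreal ((R n z)\<^sup>2) \<partial>M)"
      by (rule nn_integral_liminf) measurable
    also have "\<dots> \<le> liminf (\<lambda>n. ennreal (?D * V l u))"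
      by (rule Liminf_mono) (simp only: R2 eventually_True)
    also have "\<dots> = ennreal (?D * V l u)" by (rule Liminf_const) simp
    finally have "\<exists>B\<in>sets M. measure M B \<le> ?D * V l u / \<eta>\<^sup>2 \<and> (\<forall>z\<in>space M - B. liminf (\<lambda>n. ennreal ((R n z)\<^sup>2)) < ennreal (\<eta>\<^sup>2))"
      by (intro M.Markov_bad_set) (use C(1) \<eta> in auto)
    then obtain B where B: "B \<in> sets M" "measure M B \<le> ?D * V l u / \<eta>\<^sup>2" "\<And>z. z \<in> space M - B \<Longrightarrow> liminf (\<lambda>n. ennreal ((R n z)\<^sup>2)) < ennreal (\<eta>\<^sup>2)"
      by blast
    from AE_E[OF AE_good] obtain N where N: "{x\<in>space M. \<not> good x} \<subseteq> N" "emeasure M N = 0" "N \<in> sets M" by auto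
    show ?thesis
    proof (intro bexI[of _ "B \<union> N"] conjI ballI)
      have "measure M N = 0" using N(2) by (simp add: measure_def)
      then show "measure M (B \<union> N) \<le> ?D * V l u / \<eta>\<^sup>2" using measure_Un_le[OF B(1) N(3)] B(2) by simp
      fix z assume z: "z \<in> space M - (B \<union> N)"
      then have g: "good z" using N(1) by auto
      let ?W = "{w\<in>words l. box_prob Q w z \<ge> exp (-u)}"
      have fW: "finite ?W" by (rule subprob_finite(1)[OF subprob_words[OF g]])
      have "\<forall>\<^sub>F n in sequentially. R n z = level_sum (Suc l) m z u - level_sum l (Suc m) z u"
        unfolding eventually_sequentially
      proof (intro exI allI impI)
        \<comment> \<open>The boxes above the threshold are finitely many and all lie in
          \<open>F n\<close> from this index on, so the partial sums become constant.\<close>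
        fix n assume n: "Suc (Max (to_nat ` ?W)) \<le> n"
        have "?W \<subseteq> F n"
        proof
          fix w assume "w \<in> ?W"
          then have "to_nat w \<le> Max (to_nat ` ?W)" using fW by (intro Max_ge) auto
          then show "w \<in> F n" using \<open>w \<in> ?W\<close> n by (auto simp: F_def)
        qed
        have "R n z = (\<Sum>w\<in>?W. frag_dev m (u + ln (box_prob Q w z)) (\<lambda>k. Q w k z))"
          unfolding R_def by (rule sum.mono_neutral_cong_right) (use F \<open>?W \<subseteq> F n\<close> in \<open>auto simp: box_dev_def\<close>)
        then show "R n z = level_sum (Suc l) m z u - level_sum l (Suc m) z u" unfolding level_sum_diff[OF g] .
      qed
      then have "\<forall>\<^sub>F n in sequentially. ennreal ((R n z)\<^sup>2) = ennreal ((level_sum (Suc l) m z u - level_sum l (Suc m) z u)\<^sup>2)"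
        by eventually_elim simp
      then have "liminf (\<lambda>n. ennreal ((R n z)\<^sup>2)) = liminf (\<lambda>n. ennreal ((level_sum (Suc l) m z u - level_sum l (Suc m) z u)\<^sup>2))"
        by (rule Liminf_eq)
      also have "\<dots> = ennreal ((level_sum (Suc l) m z u - level_sum l (Suc m) z u)\<^sup>2)" by (simp add: Liminf_const)
      finally have "(level_sum (Suc l) m z u - level_sum l (Suc m) z u)\<^sup>2 < \<eta>\<^sup>2"
        using B(3)[of z] z by (simp add: ennreal_less_iff)
      then show "\<bar>level_sum (Suc l) m z u - level_sum l (Suc m) z u\<bar> < \<eta>"
        using \<eta> by (intro power2_less_imp_less[of "\<bar>_\<bar>"]) auto
    qed (use B N in auto)
  qed
  then show ?thesis using C(1) by blast
qed

text \<open>The exponent is that of the squared norming of level \<open>Suc (d + m)\<close> less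
  \<open>\<omega>\<close>. A variance over orthogonal boxes of level \<open>l\<close> counts them
  once and gives \<open>\<omega> * l\<close>, where the square of their number would give
  \<open>2 * \<omega> * l\<close>. The gain \<open>\<omega> * l\<close> is least at
  \<open>l = 1\<close>, the last step of the telescope, and this fixes the stated exponent.\<close>

lemma level_sum_first_level_bad_set:
  "\<exists>K\<ge>0. \<forall>u\<ge>0. \<forall>\<eta>>0. \<exists>B\<in>sets M. measure M B \<le> K * (1 + u) powr (2 * \<gamma> + 2 * \<omega> * real (d + m) - \<omega>) / \<eta>\<^sup>2 \<and>
     (\<forall>z\<in>space M - B. \<bar>level_sum (Suc d) m z u - level_sum 1 (d + m) z u\<bar> < \<eta>)"
proof (induction d arbitrary: m)
  case 0
  then show ?case by (intro exI[of _ 0]) (auto intro!: bexI[of _ "{}"])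
next
  case (Suc d)
  let ?E = "\<lambda>u. (1 + u) powr (2 * \<gamma> + 2 * \<omega> * real (Suc d + m) - \<omega>)"
  obtain K1 where K1: "K1 \<ge> 0" "\<And>u \<eta>. u \<ge> 0 \<Longrightarrow> \<eta> > 0 \<Longrightarrow> \<exists>B\<in>sets M. measure M B \<le> K1 * ?E u / \<eta>\<^sup>2 \<and>
     (\<forall>z\<in>space M - B. \<bar>level_sum (Suc d) (Suc m) z u - level_sum 1 (d + Suc m) z u\<bar> < \<eta>)"
    using Suc.IH[of "Suc m"] by auto
  obtain K2 where K2: "K2 \<ge> 0" "\<And>u \<eta>. u \<ge> 0 \<Longrightarrow> \<eta> > 0 \<Longrightarrow> \<exists>B\<in>sets M. measure M B \<le> K2 * (1 + u) powr (2 * (\<omega> * real m + \<gamma>)) * V (Suc d) u / \<eta>\<^sup>2 \<and>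
     (\<forall>z\<in>space M - B. \<bar>level_sum (Suc (Suc d)) m z u - level_sum (Suc d) (Suc m) z u\<bar> < \<eta>)"
    using level_sum_diff_bad_set[of m "Suc d"] by blast
  obtain D where D: "D \<ge> 0" "\<And>x. x \<ge> 0 \<Longrightarrow> V (Suc d) x \<le> D * (1 + x) powr (\<omega> * real (Suc d))"
    using V_upper[of "Suc d"] by blast
  have "\<exists>B\<in>sets M. measure M B \<le> (4 * K1 + 4 * K2 * D) * ?E u / \<eta>\<^sup>2 \<and>
     (\<forall>z\<in>space M - B. \<bar>level_sum (Suc (Suc d)) m z u - level_sum 1 (Suc d + m) z u\<bar> < \<eta>)" if u: "u \<ge> 0" and \<eta>: "\<eta> > 0" for u \<eta>
  proof -
    have h: "\<eta> / 2 > 0" using \<eta> by simp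
    obtain B1 where B1: "B1 \<in> sets M" "measure M B1 \<le> K1 * ?E u / (\<eta>/2)\<^sup>2"
     "\<forall>z\<in>space M - B1. \<bar>level_sum (Suc d) (Suc m) z u - level_sum 1 (d + Suc m) z u\<bar> < \<eta>/2" using K1(2)[OF u h] by blast
    obtain B2 where B2: "B2 \<in> sets M" "measure M B2 \<le> K2 * (1 + u) powr (2 * (\<omega> * real m + \<gamma>)) * V (Suc d) u / (\<eta>/2)\<^sup>2"
     "\<forall>z\<in>space M - B2. \<bar>level_sum (Suc (Suc d)) m z u - level_sum (Suc d) (Suc m) z u\<bar> < \<eta>/2" using K2(2)[OF u h] by blast
    have "(1 + u) powr (2 * (\<omega> * real m + \<gamma>)) * V (Suc d) u \<le> (1 + u) powr (2 * (\<omega> * real m + \<gamma>)) * (D * (1 + u) powr (\<omega> * real (Suc d)))"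
      using D(2)[OF u] by (intro mult_left_mono) auto
    also have "\<dots> = D * (1 + u) powr (2 * (\<omega> * real m + \<gamma>) + \<omega> * real (Suc d))" by (simp add: powr_add)
    also have "\<dots> \<le> D * ?E u"
      using u D(1) pos by (intro mult_left_mono powr_mono) (auto simp: algebra_simps)
    finally have "K2 * ((1 + u) powr (2 * (\<omega> * real m + \<gamma>)) * V (Suc d) u) / (\<eta>/2)\<^sup>2 \<le> K2 * (D * ?E u) / (\<eta>/2)\<^sup>2"
      using K2(1) by (intro divide_right_mono mult_left_mono) auto
    then have m2: "measure M B2 \<le> 4 * (K2 * D) * ?E u / \<eta>\<^sup>2"
      using B2(2) by (simp add: power_divide mult_ac)
    have m1: "measure M B1 \<le> 4 * K1 * ?E u / \<eta>\<^sup>2"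
      using B1(2) by (simp add: power_divide mult_ac)
    show ?thesis
    proof (intro bexI[of _ "B1 \<union> B2"] conjI ballI)
      show "measure M (B1 \<union> B2) \<le> (4 * K1 + 4 * K2 * D) * ?E u / \<eta>\<^sup>2"
        using measure_Un_le[OF B1(1) B2(1)] m1 m2 by (simp add: add_divide_distrib distrib_right)
      fix z assume z: "z \<in> space M - (B1 \<union> B2)"
      then have "\<bar>level_sum (Suc d) (Suc m) z u - level_sum 1 (d + Suc m) z u\<bar> < \<eta>/2" "\<bar>level_sum (Suc (Suc d)) m z u - level_sum (Suc d) (Suc m) z u\<bar> < \<eta>/2"
        using B1(3) B2(3) by auto
      then have "\<bar>level_sum (Suc (Suc d)) m z u - level_sum 1 (d + Suc m) z u\<bar> < \<eta>" by linarith
      then show "\<bar>level_sum (Suc (Suc d)) m z u - level_sum 1 (Suc d + m) z u\<bar> < \<eta>" by simp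
    qed (use B1 B2 in auto)
  qed
  then show ?case using K1(1) K2(1) D(1) by (intro exI[of _ "4 * K1 + 4 * K2 * D"]) auto
qed

end

section \<open>Occupancy counts given the environment\<close>

locale occupancy = nested_fragmentation \<mu> c \<omega> \<epsilon> \<gamma> M Q
  for \<mu> c \<omega> \<epsilon> \<gamma> and M :: "'w measure" and Q +
  fixes X :: "nat \<Rightarrow> nat \<Rightarrow> 'w \<Rightarrow> nat"
  assumes X_measurable [measurable]: "\<And>i m. X i m \<in> M \<rightarrow>\<^sub>M count_space UNIV"
    and balls: "\<And>n (v :: nat \<Rightarrow> nat list). AE z in M.
        real_cond_exp M (env_algebra M Q)
          (indicator {z \<in> space M. \<forall>i<n. ball_box X i (length (v i)) z = v i}) z
        = (\<Prod>i<n. box_prob Q (v i) z)"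
begin

lemma subalgebra_env: "subalgebra M (env_algebra M Q)"
proof -
  have m: "(\<lambda>x. x) \<in> M \<rightarrow>\<^sub>M env_algebra M Q"
    unfolding env_algebra_def by (rule measurable_vimage_algebra2) (auto intro!: measurable_PiM_single')
  have "E \<in> sets M" if "E \<in> sets (env_algebra M Q)" for E
  proof -
    have "E \<subseteq> space M" using sets.sets_into_space[OF that] by (simp add: env_algebra_def)
    then show ?thesis using measurable_sets[OF m that] by (simp add: Int_absorb2)
  qed
  then show ?thesis unfolding subalgebra_def by (auto simp: env_algebra_def)
qed

sublocale env: finite_measure_subalgebra M "env_algebra M Q"
  by unfold_locales (rule subalgebra_env)

lemma box_prob_env [measurable]: "box_prob Q v \<in> borel_measurable (env_algebra M Q)"
proof -
  have "(\<lambda>z v. box_prob Q v z) \<in> env_algebra M Q \<rightarrow>\<^sub>M (\<Pi>\<^sub>M v\<in>UNIV. (borel :: real measure))"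
    unfolding env_algebra_def by (rule measurable_vimage_algebra1) (auto simp: space_PiM)
  from measurable_compose[OF this measurable_component_singleton[of v UNIV]] show ?thesis by simp
qed

lemma ball_box_measurable [measurable]: "(\<lambda>z. ball_box X i j z) \<in> M \<rightarrow>\<^sub>M count_space UNIV"
proof (induction j)
  case 0
  then show ?case by (simp add: ball_box_def)
next
  case (Suc j)
  have "(\<lambda>z. ball_box X i (Suc j) z) = (\<lambda>z. ball_box X i j z @ [X i j z])" by (simp add: ball_box_def)
  moreover have "(\<lambda>z. ball_box X i j z @ [X i j z]) \<in> M \<rightarrow>\<^sub>M count_space UNIV"
    using Suc by measurable
  ultimately show ?case by simp
qed

lemma length_ball_box [simp]: "length (ball_box X i j z) = j"
  by (simp add: ball_box_def)

abbreviation hit :: "nat \<Rightarrow> nat list \<Rightarrow> 'w \<Rightarrow> bool" where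
  "hit i v z \<equiv> ball_box X i (length v) z = v"

text \<open>The empty word is hit by every ball and has probability one. Prescribing it for all
  other balls extracts an event for two balls from the hypothesis on the first \<open>n\<close> of
  them. For \<open>i = i'\<close> the event concerns one ball, hence the exponent.\<close>

lemma hit_pair_expectation:
  assumes g [measurable]: "g \<in> borel_measurable (env_algebra M Q)" and gb: "AE z in M. \<bar>g z\<bar> \<le> B"
  shows "(\<integral>z. g z * of_bool (hit i v z \<and> hit i' v z) \<partial>M) = (\<integral>z. g z * box_prob Q v z ^ (if i = i' then 1 else 2) \<partial>M)"
proof -
  define n where "n = Suc (max i i')"
  define w where "w k = (if k = i \<or> k = i' then v else [])" for k
  have gM [measurable]: "g \<in> borel_measurable M" by (rule measurable_from_subalg[OF subalgebra_env g])
  let ?E = "{z \<in> space M. \<forall>i<n. ball_box X i (length (w i)) z = w i}"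
  have E: "z \<in> ?E \<longleftrightarrow> z \<in> space M \<and> hit i v z \<and> hit i' v z" for z
  proof -
    have "(\<forall>k<n. ball_box X k (length (w k)) z = w k) \<longleftrightarrow> hit i v z \<and> hit i' v z"
      by (auto simp: w_def n_def ball_box_def[of _ _ 0] less_Suc_eq_le)
    then show ?thesis by simp
  qed
  have "(\<Prod>k<n. box_prob Q (w k) z) = (\<Prod>k\<in>{i, i'}. box_prob Q v z)" for z
    by (rule prod.mono_neutral_cong_right) (auto simp: n_def w_def box_prob_Nil)
  then have P: "(\<Prod>k<n. box_prob Q (w k) z) = box_prob Q v z ^ (if i = i' then 1 else 2)" for z
    by (cases "i = i'") (simp_all add: power2_eq_square)
  have [measurable]: "?E \<in> sets M" by measurable
  have int: "integrable M (\<lambda>z. g z * indicator ?E z)"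
    by (rule M.integrable_const_bound[where B = B]) (use gb in \<open>eventually_elim, auto simp: indicator_def\<close>, measurable)
  have "(\<integral>z. g z * of_bool (hit i v z \<and> hit i' v z) \<partial>M) = (\<integral>z. g z * indicator ?E z \<partial>M)"
    by (rule Bochner_Integration.integral_cong[OF refl]) (use E in \<open>auto simp: indicator_def\<close>)
  also have "\<dots> = (\<integral>z. g z * real_cond_exp M (env_algebra M Q) (indicator ?E) z \<partial>M)"
    using env.real_cond_exp_intg(2)[OF int g] by simp
  also have "\<dots> = (\<integral>z. g z * box_prob Q v z ^ (if i = i' then 1 else 2) \<partial>M)"
  proof (rule integral_cong_AE)
    show "AE z in M. g z * real_cond_exp M (env_algebra M Q) (indicator ?E) z = g z * box_prob Q v z ^ (if i = i' then 1 else 2)"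
      using balls[where n = n and v = w] by eventually_elim (simp add: P)
  qed measurable
  finally show ?thesis .
qed

section \<open>Conditional moments and deviations of the number of balls in a box\<close>

definition ball_count :: "nat \<Rightarrow> nat list \<Rightarrow> 'w \<Rightarrow> real" where
  "ball_count n v z = (\<Sum>i<n. of_bool (hit i v z))"

lemma ball_count_card: "ball_count n v z = real (card {i. i < n \<and> hit i v z})"
  unfolding ball_count_def of_bool_def by (subst sum.inter_filter[symmetric]) (auto simp: lessThan_def)

lemma ball_count_measurable [measurable]: "ball_count n v \<in> borel_measurable M"
  unfolding ball_count_def by measurable

lemma ball_count_bounds: "0 \<le> ball_count n v z" "ball_count n v z \<le> real n"
  using card_mono[of "{..<n}" "{i. i < n \<and> hit i v z}"] by (auto simp: ball_count_card)

lemma of_bool_integrable: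
  fixes g :: "'w \<Rightarrow> real"
  assumes g [measurable]: "g \<in> borel_measurable M" and gb: "AE z in M. \<bar>g z\<bar> \<le> B" and "Measurable.pred M R"
  shows "integrable M (\<lambda>z. g z * of_bool (R z))"
proof (rule M.integrable_const_bound[where B = B])
  show "AE z in M. norm (g z * of_bool (R z)) \<le> B" using gb by eventually_elim auto
qed (use assms(3) in measurable)

text \<open>Given the environment the count is binomial. The moments are recorded in integrated
  form, against bounded test functions \<open>g\<close> of the environment, so that later bounds can
  divide by the conditional mean on events where it is not small.\<close>

lemma ball_count_moments:
  assumes g [measurable]: "g \<in> borel_measurable (env_algebra M Q)" and gb: "AE z in M. \<bar>g z\<bar> \<le> B"
  shows "(\<integral>z. g z * ball_count n v z \<partial>M) = real n * (\<integral>z. g z * box_prob Q v z \<partial>M)"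
    "(\<integral>z. g z * (ball_count n v z)\<^sup>2 \<partial>M) = real n * (\<integral>z. g z * box_prob Q v z \<partial>M) + real n * (real n - 1) * (\<integral>z. g z * (box_prob Q v z)\<^sup>2 \<partial>M)"
    "integrable M (\<lambda>z. g z * ball_count n v z)" "integrable M (\<lambda>z. g z * (ball_count n v z)\<^sup>2)"
    "integrable M (\<lambda>z. g z * box_prob Q v z)" "integrable M (\<lambda>z. g z * (box_prob Q v z)\<^sup>2)"
proof -
  have gM [measurable]: "g \<in> borel_measurable M" by (rule measurable_from_subalg[OF subalgebra_env g])
  have i1: "integrable M (\<lambda>z. g z * of_bool (hit i v z \<and> hit i' v z))" for i i'
    by (rule of_bool_integrable[OF gM gb]) measurable
  have e1: "g z * ball_count n v z = (\<Sum>i<n. g z * of_bool (hit i v z \<and> hit i v z))" for z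
    by (simp add: ball_count_def sum_distrib_left)
  have e2: "g z * (ball_count n v z)\<^sup>2 = (\<Sum>i<n. \<Sum>i'<n. g z * of_bool (hit i v z \<and> hit i' v z))" for z
  proof -
    have "(ball_count n v z)\<^sup>2 = (\<Sum>i<n. \<Sum>i'<n. of_bool (hit i v z) * of_bool (hit i' v z))"
      by (simp only: ball_count_def power2_eq_square sum_product)
    then show ?thesis by (simp only: sum_distrib_left of_bool_conj)
  qed
  show "integrable M (\<lambda>z. g z * ball_count n v z)" unfolding e1 by (intro Bochner_Integration.integrable_sum i1)
  show "integrable M (\<lambda>z. g z * (ball_count n v z)\<^sup>2)" unfolding e2 by (intro Bochner_Integration.integrable_sum i1)
  show "integrable M (\<lambda>z. g z * box_prob Q v z)" "integrable M (\<lambda>z. g z * (box_prob Q v z)\<^sup>2)"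
  proof -
    have "AE z in M. norm (g z * box_prob Q v z) \<le> B \<and> norm (g z * (box_prob Q v z)\<^sup>2) \<le> B"
      using gb AE_good
    proof eventually_elim
      case (elim z)
      have p: "0 \<le> box_prob Q v z" "box_prob Q v z \<le> 1" using box_prob_pos[of z v] box_prob_le_1[of z v] elim by auto
      have "B \<ge> 0" using elim by auto
      have "\<bar>g z\<bar> * box_prob Q v z \<le> B * 1" using elim p \<open>B \<ge> 0\<close> by (intro mult_mono) auto
      moreover have "\<bar>g z\<bar> * (box_prob Q v z)\<^sup>2 \<le> B * 1" using elim p \<open>B \<ge> 0\<close> by (intro mult_mono power_le_one) auto
      ultimately show ?case using p by (simp add: abs_mult)
    qed
    then show "integrable M (\<lambda>z. g z * box_prob Q v z)" "integrable M (\<lambda>z. g z * (box_prob Q v z)\<^sup>2)"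
      by (auto intro!: M.integrable_const_bound[where B = B])
  qed
  show "(\<integral>z. g z * ball_count n v z \<partial>M) = real n * (\<integral>z. g z * box_prob Q v z \<partial>M)"
    unfolding e1 by (subst Bochner_Integration.integral_sum[OF i1]) (simp add: hit_pair_expectation[OF g gb, of _ v, of i i for i, simplified])
  have "(\<integral>z. g z * (ball_count n v z)\<^sup>2 \<partial>M) = (\<Sum>i<n. \<Sum>i'<n. \<integral>z. g z * of_bool (hit i v z \<and> hit i' v z) \<partial>M)"
    unfolding e2
    by (subst Bochner_Integration.integral_sum, intro Bochner_Integration.integrable_sum i1)
       (intro sum.cong refl Bochner_Integration.integral_sum i1)
  also have "\<dots> = (\<Sum>i<n. \<Sum>i'<n. (\<integral>z. g z * (box_prob Q v z)\<^sup>2 \<partial>M) + (if i' = i then (\<integral>z. g z * box_prob Q v z \<partial>M) - (\<integral>z. g z * (box_prob Q v z)\<^sup>2 \<partial>M) else 0))"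
    by (intro sum.cong refl) (auto simp: hit_pair_expectation[OF g gb])
  also have "\<dots> = (\<Sum>i<n. real n * (\<integral>z. g z * (box_prob Q v z)\<^sup>2 \<partial>M) + ((\<integral>z. g z * box_prob Q v z \<partial>M) - (\<integral>z. g z * (box_prob Q v z)\<^sup>2 \<partial>M)))"
    by (simp add: sum.distrib)
  also have "\<dots> = real n * (\<integral>z. g z * box_prob Q v z \<partial>M) + real n * (real n - 1) * (\<integral>z. g z * (box_prob Q v z)\<^sup>2 \<partial>M)"
    by (simp add: algebra_simps)
  finally show "(\<integral>z. g z * (ball_count n v z)\<^sup>2 \<partial>M) = real n * (\<integral>z. g z * box_prob Q v z \<partial>M) + real n * (real n - 1) * (\<integral>z. g z * (box_prob Q v z)\<^sup>2 \<partial>M)" .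
qed

text \<open>Chebyshev's inequality given the environment. Where \<open>n * p \<ge> exp x\<close>,
  the relative count has conditional variance at most \<open>1 / (n * p) \<le> exp (- x)\<close>,
  and \<open>x \<ge> ln 2\<close> puts the event at distance at least \<open>1/2\<close> from the
  mean, whence the factor \<open>4\<close>. The probability that the box is large is kept, since the
  bound will be summed over infinitely many boxes.\<close>

lemma box_lower:
  assumes n: "n \<ge> 1" and x: "x \<ge> ln 2"
  shows "emeasure M {z\<in>space M. real n * box_prob Q v z \<ge> exp x \<and> ball_count n v z < exp (- x) * (real n * box_prob Q v z)}
    \<le> ennreal (4 * exp (- x)) * emeasure M {z\<in>space M. box_prob Q v z \<ge> exp (- ln (real n))}"
proof -
  let ?p = "box_prob Q v"
  define g where "g z = (if real n * ?p z \<ge> exp x then 1 else 0 :: real)" for z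
  \<comment> \<open>\<open>g1\<close> and \<open>g2\<close> are truncated reciprocals of the
    conditional mean and of its square, so \<open>g1 * ball_count - g\<close> is the truncated
    relative deviation.\<close>
  define g1 where "g1 z = g z / (real n * ?p z)" for z
  define g2 where "g2 z = g z / (real n * ?p z)\<^sup>2" for z
  have [measurable]: "g \<in> borel_measurable (env_algebra M Q)" "g1 \<in> borel_measurable (env_algebra M Q)"
     "g2 \<in> borel_measurable (env_algebra M Q)" unfolding g_def g1_def g2_def by measurable
  have [measurable]: "g \<in> borel_measurable M" unfolding g_def by measurable
  have x0: "x \<ge> 0" using x ln_gt_zero[of 2] by linarith
  have ex: "exp x \<ge> 2" using x by (metis exp_le_cancel_iff exp_ln zero_less_numeral)
  have b1: "g1 z \<le> exp (-x)" "0 \<le> g1 z" for z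
  proof -
    have "g1 z \<le> exp (-x) \<and> 0 \<le> g1 z"
    proof (cases "real n * ?p z \<ge> exp x")
      case True
      moreover have "exp x > 0" by simp
      ultimately have "real n * ?p z > 0" by linarith
      then have "1 / (real n * ?p z) \<le> 1 / exp x" using mult_pos_pos[OF \<open>real n * ?p z > 0\<close> exp_gt_zero[of x]] by (intro divide_left_mono True) auto
      then show ?thesis using True \<open>real n * ?p z > 0\<close> by (simp add: g1_def g_def exp_minus inverse_eq_divide)
    qed (simp add: g1_def g_def)
    then show "g1 z \<le> exp (-x)" "0 \<le> g1 z" by auto
  qed
  have e1: "exp (-x) \<le> 1" using x0 by simp
  have g12: "g2 z = g1 z * g1 z" for z by (simp add: g2_def g1_def g_def power2_eq_square)
  have b2: "\<bar>g1 z\<bar> \<le> 1" "\<bar>g2 z\<bar> \<le> 1" "\<bar>g z\<bar> \<le> 1" for z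
  proof -
    show 1: "\<bar>g1 z\<bar> \<le> 1" unfolding abs_le_iff using b1[of z] e1 by linarith
    show "\<bar>g2 z\<bar> \<le> 1" unfolding g12 abs_mult using 1 by (intro mult_le_one) auto
  qed (simp add: g_def)
  note m1 = ball_count_moments(1-4)[of g1 1 n v] and m2 = ball_count_moments(1-4)[of g2 1 n v]
  have p1: "g1 z * (real n * ?p z) = g z" "g2 z * (real n * ?p z) = g1 z" for z
    using exp_gt_zero[of x] by (auto simp: g1_def g2_def g_def power2_eq_square simp del: exp_gt_zero)
  have gi: "integrable M g" by (rule M.integrable_const_bound[where B = 1]) (use b2 in auto)
  have g1i: "integrable M g1"
  proof (rule M.integrable_const_bound[where B = 1])
    show "g1 \<in> borel_measurable M" by (rule measurable_from_subalg[OF subalgebra_env]) measurable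
  qed (use b2 in auto)
  have "(\<integral>z. g2 z * (ball_count n v z)\<^sup>2 - 2 * (g1 z * ball_count n v z) + g z \<partial>M) =
    (\<integral>z. g2 z * (ball_count n v z)\<^sup>2 \<partial>M) - 2 * (\<integral>z. g1 z * ball_count n v z \<partial>M) + (\<integral>z. g z \<partial>M)"
    using m1(3) m2(4) gi b2 by simp
  also have "(\<integral>z. g1 z * ball_count n v z \<partial>M) = (\<integral>z. g z \<partial>M)"
  proof -
    have "(\<integral>z. g1 z * ball_count n v z \<partial>M) = (\<integral>z. real n * (g1 z * ?p z) \<partial>M)" using m1(1) b2 by simp
    also have "\<dots> = (\<integral>z. g z \<partial>M)" using p1(1) by (intro Bochner_Integration.integral_cong) (auto simp: mult_ac)
    finally show ?thesis .
  qed
  also have "(\<integral>z. g2 z * (ball_count n v z)\<^sup>2 \<partial>M) \<le> (\<integral>z. g1 z \<partial>M) + (\<integral>z. g z \<partial>M)"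
  proof -
    have "real n * (\<integral>z. g2 z * ?p z \<partial>M) = (\<integral>z. real n * (g2 z * ?p z) \<partial>M)" by simp
    also have "\<dots> = (\<integral>z. g1 z \<partial>M)" using p1(2) by (intro Bochner_Integration.integral_cong) (auto simp: mult_ac)
    finally have a: "real n * (\<integral>z. g2 z * ?p z \<partial>M) = (\<integral>z. g1 z \<partial>M)" .
    have "real n * real n * (\<integral>z. g2 z * (?p z)\<^sup>2 \<partial>M) = (\<integral>z. real n * real n * (g2 z * (?p z)\<^sup>2) \<partial>M)" by simp
    also have "\<dots> = (\<integral>z. g z \<partial>M)"
    proof (rule Bochner_Integration.integral_cong[OF refl])
      fix z
      have "real n * real n * (g2 z * (?p z)\<^sup>2) = (g2 z * (real n * ?p z)) * (real n * ?p z)" by (simp add: power2_eq_square)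
      then show "real n * real n * (g2 z * (?p z)\<^sup>2) = g z" by (simp only: p1)
    qed
    finally have b: "real n * real n * (\<integral>z. g2 z * (?p z)\<^sup>2 \<partial>M) = (\<integral>z. g z \<partial>M)" .
    have "real n * (real n - 1) * (\<integral>z. g2 z * (?p z)\<^sup>2 \<partial>M) \<le> real n * real n * (\<integral>z. g2 z * (?p z)\<^sup>2 \<partial>M)"
    proof (rule mult_right_mono)
      show "0 \<le> (\<integral>z. g2 z * (?p z)\<^sup>2 \<partial>M)" by (rule integral_nonneg_AE) (simp add: g2_def g_def)
    qed (simp add: mult_left_mono)
    then show ?thesis using m2(2) b2 a b by simp
  qed
  finally have I: "(\<integral>z. g2 z * (ball_count n v z)\<^sup>2 - 2 * (g1 z * ball_count n v z) + g z \<partial>M) \<le> (\<integral>z. g1 z \<partial>M)" by simp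
  have sq: "g2 z * (ball_count n v z)\<^sup>2 - 2 * (g1 z * ball_count n v z) + g z = (g1 z * ball_count n v z - g z)\<^sup>2" for z
    by (simp add: g12 power2_eq_square algebra_simps) (simp add: g1_def g_def)
  have sqi: "integrable M (\<lambda>z. (g1 z * ball_count n v z - g z)\<^sup>2)"
    unfolding sq[symmetric] using m1(3) m2(4) gi b2 by (intro Bochner_Integration.integrable_add Bochner_Integration.integrable_diff) auto
  have sub: "z \<in> space M \<Longrightarrow> real n * ?p z \<ge> exp x \<Longrightarrow> ball_count n v z < exp (- x) * (real n * ?p z) \<Longrightarrow> 1 \<le> 4 * (g1 z * ball_count n v z - g z)\<^sup>2" for z
  proof -
    assume a: "real n * ?p z \<ge> exp x" "ball_count n v z < exp (- x) * (real n * ?p z)"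
    have pp: "real n * ?p z > 0" using a(1) exp_gt_zero[of x] by linarith
    have "exp (-x) \<le> 1/2" using ex by (simp add: exp_minus field_simps)
    then have "exp (- x) * (real n * ?p z) \<le> 1/2 * (real n * ?p z)" using pp by (intro mult_right_mono) auto
    then have "ball_count n v z < 1/2 * (real n * ?p z)" using a by linarith
    then have "g1 z * ball_count n v z \<le> 1 / 2" using a(1) pp by (simp add: g1_def g_def field_simps)
    then have "1/2 \<le> g z - g1 z * ball_count n v z" using a(1) by (simp add: g_def)
    then have "(1/2)\<^sup>2 \<le> (g z - g1 z * ball_count n v z)\<^sup>2" by (intro power_mono) auto
    then show ?thesis by (simp add: power2_commute power_divide)
  qed
  have "emeasure M {z\<in>space M. real n * ?p z \<ge> exp x \<and> ball_count n v z < exp (- x) * (real n * ?p z)}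
     \<le> (\<integral>\<^sup>+z. ennreal (4 * (g1 z * ball_count n v z - g z)\<^sup>2) \<partial>M)"
  proof (subst nn_integral_indicator[symmetric])
    show "{z\<in>space M. real n * ?p z \<ge> exp x \<and> ball_count n v z < exp (- x) * (real n * ?p z)} \<in> sets M" by measurable
    show "(\<integral>\<^sup>+z. indicator {z\<in>space M. real n * ?p z \<ge> exp x \<and> ball_count n v z < exp (- x) * (real n * ?p z)} z \<partial>M) \<le> (\<integral>\<^sup>+z. ennreal (4 * (g1 z * ball_count n v z - g z)\<^sup>2) \<partial>M)"
    proof (rule nn_integral_mono)
      fix z assume "z \<in> space M"
      then show "indicator {z\<in>space M. real n * ?p z \<ge> exp x \<and> ball_count n v z < exp (- x) * (real n * ?p z)} z \<le> ennreal (4 * (g1 z * ball_count n v z - g z)\<^sup>2)"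
        using sub[of z] by (auto simp: indicator_def simp flip: ennreal_1 intro!: ennreal_leI)
    qed
  qed
  also have "\<dots> = ennreal (4 * (\<integral>z. (g1 z * ball_count n v z - g z)\<^sup>2 \<partial>M))"
    using sqi by (subst nn_integral_eq_integral) auto
  also have "\<dots> \<le> ennreal (4 * (\<integral>z. g1 z \<partial>M))" using I unfolding sq by (intro ennreal_leI) simp
  also have "\<dots> = ennreal 4 * (\<integral>\<^sup>+z. ennreal (g1 z) \<partial>M)"
    using g1i b1 by (subst nn_integral_eq_integral) (auto simp: ennreal_mult)
  also have "\<dots> \<le> ennreal 4 * (\<integral>\<^sup>+z. ennreal (exp (-x)) * indicator {z\<in>space M. ?p z \<ge> exp (- ln (real n))} z \<partial>M)"
  proof (intro mult_left_mono nn_integral_mono)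
    fix z assume z: "z \<in> space M"
    show "ennreal (g1 z) \<le> ennreal (exp (-x)) * indicator {z\<in>space M. ?p z \<ge> exp (- ln (real n))} z"
    proof (cases "real n * ?p z \<ge> exp x")
      case True
      then have "1 \<le> real n * ?p z" using x0 by (meson one_le_exp_iff order_trans)
      then have "?p z \<ge> exp (- ln (real n))" using n by (simp add: exp_minus field_simps)
      then show ?thesis using b1[of z] z by (simp add: ennreal_leI)
    qed (simp add: g1_def g_def)
  qed simp
  also have "\<dots> = ennreal (4 * exp (-x)) * emeasure M {z\<in>space M. ?p z \<ge> exp (- ln (real n))}"
    by (subst nn_integral_cmult_indicator) (auto simp: ennreal_mult mult.assoc)
  finally show ?thesis .
qed

text \<open>Markov's inequality for the count divided by its conditional mean; the lower bound
  \<open>exp (- L)\<close> for the box probability keeps the divisor away from zero.\<close>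

lemma box_upper:
  assumes n: "n \<ge> 1"
  shows "emeasure M {z\<in>space M. box_prob Q v z \<ge> exp (-L) \<and> ball_count n v z > exp x * (real n * box_prob Q v z)}
    \<le> ennreal (exp (- x)) * emeasure M {z\<in>space M. box_prob Q v z \<ge> exp (-L)}"
proof -
  let ?p = "box_prob Q v"
  define g where "g z = (if ?p z \<ge> exp (-L) then 1 / (real n * ?p z) else 0)" for z
  have [measurable]: "g \<in> borel_measurable (env_algebra M Q)" unfolding g_def by measurable
  have [measurable]: "g \<in> borel_measurable M" unfolding g_def by measurable
  have g0: "0 \<le> g z" for z using exp_gt_zero[of "-L"] by (auto simp: g_def simp del: exp_gt_zero)
  have gb: "\<bar>g z\<bar> \<le> exp L" for z
  proof (cases "?p z \<ge> exp (-L)")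
    case True
    have "exp (-L) \<le> 1 * ?p z" using True by simp
    also have "\<dots> \<le> real n * ?p z" using n True exp_gt_zero[of "-L"] by (intro mult_right_mono) (auto simp del: exp_gt_zero)
    finally have "1 / (real n * ?p z) \<le> 1 / exp (-L)" by (intro divide_left_mono mult_pos_pos) (use True exp_gt_zero[of "-L"] n in \<open>auto simp del: exp_gt_zero\<close>)
    then show ?thesis using True g0[of z] by (simp add: g_def exp_minus inverse_eq_divide)
  qed (simp add: g_def)
  note m = ball_count_moments(1-4)[of g "exp L" n v]
  have pg: "real n * (g z * ?p z) = (if ?p z \<ge> exp (-L) then 1 else 0)" for z
    using n exp_gt_zero[of "-L"] by (auto simp: g_def simp del: exp_gt_zero)
  have i1: "integrable M (\<lambda>z. exp (-x) * (g z * ball_count n v z))" using m(3) gb by simp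
  have "emeasure M {z\<in>space M. ?p z \<ge> exp (-L) \<and> ball_count n v z > exp x * (real n * ?p z)} \<le> (\<integral>\<^sup>+z. ennreal (exp (-x) * (g z * ball_count n v z)) \<partial>M)"
  proof (subst nn_integral_indicator[symmetric])
    show "{z\<in>space M. ?p z \<ge> exp (-L) \<and> ball_count n v z > exp x * (real n * ?p z)} \<in> sets M" by measurable
    show "(\<integral>\<^sup>+z. indicator {z\<in>space M. ?p z \<ge> exp (-L) \<and> ball_count n v z > exp x * (real n * ?p z)} z \<partial>M) \<le> (\<integral>\<^sup>+z. ennreal (exp (-x) * (g z * ball_count n v z)) \<partial>M)"
    proof (rule nn_integral_mono)
      fix z assume "z \<in> space M"
      have "1 \<le> exp (-x) * (g z * ball_count n v z)" if a: "?p z \<ge> exp (-L)" "ball_count n v z > exp x * (real n * ?p z)"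
      proof -
        have "real n * ?p z > 0" using a(1) exp_gt_zero[of "-L"] n by (auto simp del: exp_gt_zero)
        then have "exp x < ball_count n v z / (real n * ?p z)" using a(2) by (simp only: pos_less_divide_eq)
        then have "exp (-x) * exp x \<le> exp (-x) * (ball_count n v z / (real n * ?p z))" by (intro mult_left_mono) auto
        then show ?thesis using a(1) by (simp add: g_def mult_exp_exp)
      qed
      then show "indicator {z\<in>space M. ?p z \<ge> exp (-L) \<and> ball_count n v z > exp x * (real n * ?p z)} z \<le> ennreal (exp (-x) * (g z * ball_count n v z))"
        by (auto simp: indicator_def simp flip: ennreal_1 intro!: ennreal_leI)
    qed
  qed
  also have "\<dots> = ennreal (\<integral>z. exp (-x) * (g z * ball_count n v z) \<partial>M)"
    by (rule nn_integral_eq_integral[OF i1]) (simp add: g0 ball_count_bounds)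
  also have "(\<integral>z. exp (-x) * (g z * ball_count n v z) \<partial>M) = exp (-x) * (\<integral>z. real n * (g z * ?p z) \<partial>M)"
    using m(1) gb by simp
  also have "(\<integral>z. real n * (g z * ?p z) \<partial>M) = (\<integral>z. indicator {z\<in>space M. ?p z \<ge> exp (-L)} z \<partial>M)"
    unfolding pg by (rule Bochner_Integration.integral_cong) (auto simp: indicator_def)
  also have "\<dots> = measure M {z\<in>space M. ?p z \<ge> exp (-L)}" by simp
  also have "ennreal (exp (-x) * \<dots>) = ennreal (exp (-x)) * emeasure M {z\<in>space M. ?p z \<ge> exp (-L)}"
    by (simp add: ennreal_mult M.emeasure_eq_measure)
  finally show ?thesis .
qed

text \<open>First moment only: given the environment a box is hit with probability at most
  \<open>n * p\<close>.\<close>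

lemma box_tail:
  shows "emeasure M {z\<in>space M. box_prob Q v z < exp (-L) \<and> ball_count n v z \<ge> 1}
    \<le> ennreal (real n) * (\<integral>\<^sup>+z. ennreal (box_prob Q v z * of_bool (box_prob Q v z < exp (-L))) \<partial>M)"
proof -
  let ?p = "box_prob Q v"
  define g where "g z = (if ?p z < exp (-L) then 1 else 0 :: real)" for z
  have [measurable]: "g \<in> borel_measurable (env_algebra M Q)" unfolding g_def by measurable
  have gb: "\<bar>g z\<bar> \<le> 1" for z by (simp add: g_def)
  note m = ball_count_moments(1-4)[of g 1 n v] and m5 = ball_count_moments(5)[of g 1 v]
  have "emeasure M {z\<in>space M. ?p z < exp (-L) \<and> ball_count n v z \<ge> 1} \<le> (\<integral>\<^sup>+z. ennreal (g z * ball_count n v z) \<partial>M)"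
  proof (subst nn_integral_indicator[symmetric])
    show "{z\<in>space M. ?p z < exp (-L) \<and> ball_count n v z \<ge> 1} \<in> sets M" by measurable
    show "(\<integral>\<^sup>+z. indicator {z\<in>space M. ?p z < exp (-L) \<and> ball_count n v z \<ge> 1} z \<partial>M) \<le> (\<integral>\<^sup>+z. ennreal (g z * ball_count n v z) \<partial>M)"
      by (rule nn_integral_mono) (auto simp: indicator_def g_def simp flip: ennreal_1 intro!: ennreal_leI)
  qed
  also have "\<dots> = ennreal (\<integral>z. g z * ball_count n v z \<partial>M)"
    by (rule nn_integral_eq_integral) (use m(3) gb in \<open>auto simp: g_def ball_count_bounds\<close>)
  also have "(\<integral>z. g z * ball_count n v z \<partial>M) = real n * (\<integral>z. g z * ?p z \<partial>M)" using m(1) gb by simp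
  also have "ennreal \<dots> = ennreal (real n) * (\<integral>\<^sup>+z. ennreal (g z * ?p z) \<partial>M)"
  proof -
    have nn: "AE z in M. 0 \<le> g z * ?p z" using AE_good by eventually_elim (simp add: g_def less_imp_le box_prob_pos)
    show ?thesis using m5 gb nn by (subst nn_integral_eq_integral) (auto simp: ennreal_mult integral_nonneg_AE)
  qed
  also have "(\<integral>\<^sup>+z. ennreal (g z * ?p z) \<partial>M) = (\<integral>\<^sup>+z. ennreal (?p z * of_bool (?p z < exp (-L))) \<partial>M)"
    by (rule nn_integral_cong) (simp add: g_def)
  finally show ?thesis .
qed

end

context nested_fragmentation begin

section \<open>Union bounds over all boxes of one level\<close>

lemma words_prob_total:
  assumes "u \<ge> 0"
  shows "(\<integral>\<^sup>+v. emeasure M {z\<in>space M. box_prob Q v z \<ge> exp (-u)} \<partial>count_space (words l)) = ennreal (V l u)"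
proof -
  have "(\<integral>\<^sup>+v. emeasure M {z\<in>space M. box_prob Q v z \<ge> exp (-u)} \<partial>count_space (words l))
    = (\<integral>\<^sup>+v. \<integral>\<^sup>+z. ennreal (if box_prob Q v z \<ge> exp (-u) then V 0 (u + ln (box_prob Q v z)) else 0) \<partial>M \<partial>count_space (words l))"
  proof (rule nn_integral_cong)
    fix v
    have "(\<integral>\<^sup>+z. ennreal (if box_prob Q v z \<ge> exp (-u) then V 0 (u + ln (box_prob Q v z)) else 0) \<partial>M) = (\<integral>\<^sup>+z. indicator {z\<in>space M. box_prob Q v z \<ge> exp (-u)} z \<partial>M)"
      by (rule nn_integral_cong) (auto simp: indicator_def)
    then show "emeasure M {z\<in>space M. box_prob Q v z \<ge> exp (-u)} = (\<integral>\<^sup>+z. ennreal (if box_prob Q v z \<ge> exp (-u) then V 0 (u + ln (box_prob Q v z)) else 0) \<partial>M)"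
      by simp
  qed
  also have "\<dots> = (\<integral>\<^sup>+z. \<integral>\<^sup>+v. ennreal (if box_prob Q v z \<ge> exp (-u) then V 0 (u + ln (box_prob Q v z)) else 0) \<partial>count_space (words l) \<partial>M)"
    by (rule nn_integral_count_space_nn_integral[symmetric]) auto
  also have "\<dots> = (\<integral>\<^sup>+z. ennreal (level_sum l 0 z u) \<partial>M)"
    by (rule nn_integral_cong_AE, use AE_good in eventually_elim) (rule level_sum_nn_integral[symmetric])
  also have "\<dots> = ennreal (V l u)" using level_sum_mean[OF assms, of l 0] by simp
  finally show ?thesis .
qed

text \<open>The union bound, with the sum over words written as an integral over counting measure so
  that it can be exchanged with the expectation.\<close>

lemma union_bad_set:
  assumes "\<And>v. v \<in> words l \<Longrightarrow> {z\<in>space M. R v z} \<in> sets M"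
    and "(\<integral>\<^sup>+v. emeasure M {z\<in>space M. R v z} \<partial>count_space (words l)) \<le> ennreal b" "b \<ge> 0"
  shows "\<exists>B\<in>sets M. measure M B \<le> b \<and> (\<forall>z\<in>space M - B. \<forall>v\<in>words l. \<not> R v z)"
proof (intro bexI conjI)
  let ?B = "\<Union>v\<in>words l. {z\<in>space M. R v z}"
  show B: "?B \<in> sets M" using assms(1) by (intro sets.countable_UN') auto
  have "emeasure M ?B = (\<integral>\<^sup>+z. indicator ?B z \<partial>M)" using B by simp
  also have "\<dots> \<le> (\<integral>\<^sup>+z. \<integral>\<^sup>+v. indicator {z\<in>space M. R v z} z \<partial>count_space (words l) \<partial>M)"
  proof (rule nn_integral_mono)
    fix z
    show "indicator ?B z \<le> (\<integral>\<^sup>+v. indicator {z\<in>space M. R v z} z \<partial>count_space (words l))"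
    proof (cases "z \<in> ?B")
      case True
      then obtain v where v: "v \<in> words l" "z \<in> {z\<in>space M. R v z}" by blast
      have "(\<integral>\<^sup>+w. indicator {v} w \<partial>count_space (words l)) \<le> (\<integral>\<^sup>+v. indicator {z\<in>space M. R v z} z \<partial>count_space (words l))"
        using v by (intro nn_integral_mono) (auto simp: indicator_def)
      then show ?thesis using v True by simp
    qed simp
  qed
  also have "\<dots> = (\<integral>\<^sup>+v. \<integral>\<^sup>+z. indicator {z\<in>space M. R v z} z \<partial>M \<partial>count_space (words l))"
    using assms(1) by (intro nn_integral_count_space_nn_integral) auto
  also have "\<dots> = (\<integral>\<^sup>+v. emeasure M {z\<in>space M. R v z} \<partial>count_space (words l))"
    using assms(1) by (intro nn_integral_cong) auto
  also note assms(2)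
  finally show "measure M ?B \<le> b" using assms(3) by (simp add: M.emeasure_eq_measure)
qed auto

text \<open>Polynomial growth, compared with one term of the exponential series. The rate
  \<open>1/2\<close> stays below the rate one at which box probabilities decay, which leaves a
  convergent geometric series.\<close>

lemma V_exp_bound: "\<exists>C\<ge>0. \<forall>x\<ge>0. V m x \<le> C * exp (x / 2)"
proof -
  obtain C where C: "C \<ge> 0" "\<And>x. x \<ge> 0 \<Longrightarrow> V m x \<le> C * (1 + x) powr (\<omega> * real m)" using V_upper by blast
  define k where "k = nat \<lceil>\<omega> * real m\<rceil>"
  have k: "\<omega> * real m \<le> real k" unfolding k_def by linarith
  have "V m x \<le> C * (fact k * 2 ^ k * exp (1/2)) * exp (x / 2)" if x: "x \<ge> 0" for x
  proof -
    have "(1 + x) powr (\<omega> * real m) \<le> (1 + x) powr real k" using x k by (intro powr_mono) auto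
    also have "\<dots> = (1 + x) ^ k" using x by (simp add: powr_realpow)
    also have "\<dots> = fact k * 2 ^ k * (((1 + x) / 2) ^ k / fact k)" by (simp add: power_divide)
    also have "\<dots> \<le> fact k * 2 ^ k * exp ((1 + x) / 2)"
    proof (intro mult_left_mono)
      define h where "h i = ((1 + x) / 2) ^ i /\<^sub>R fact i" for i
      have "r / fact k = inverse (fact k) * r" for r :: real by (simp add: divide_inverse_commute)
      then have "((1 + x) / 2) ^ k / fact k = h k" unfolding h_def real_scaleR_def .
      also have "h k = sum h {k}" by simp
      also have "\<dots> \<le> (\<Sum>i. h i)"
        unfolding h_def using x by (intro sum_le_suminf summable_exp_generic) auto
      finally show "((1 + x) / 2) ^ k / fact k \<le> exp ((1 + x) / 2)" unfolding h_def exp_def .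
    qed auto
    also have "exp ((1 + x) / 2) = exp (1/2) * exp (x / 2)" by (simp add: exp_add[symmetric] add_divide_distrib)
    finally have "C * (1 + x) powr (\<omega> * real m) \<le> C * (fact k * 2 ^ k * (exp (1/2) * exp (x / 2)))"
      using C(1) by (intro mult_left_mono)
    then show ?thesis using C(2)[OF x] by (simp add: mult_ac)
  qed
  then show ?thesis using C(1) by (intro exI[of _ "C * (fact k * 2 ^ k * exp (1/2))"]) auto
qed

text \<open>The mass is cut into slices with probabilities between
  \<open>exp (- (L + i + 1))\<close> and \<open>exp (- (L + i))\<close>. The mean mass of a slice is
  at most \<open>exp (- (L + i)) * V l (L + i + 1)\<close>, and half of the exponential decay
  survives \<open>V_exp_bound\<close>.\<close>

lemma small_box_mass:
  "\<exists>C\<ge>0. \<forall>L\<ge>0. (\<integral>\<^sup>+v. \<integral>\<^sup>+z. ennreal (box_prob Q v z * of_bool (box_prob Q v z < exp (-L))) \<partial>M \<partial>count_space (words l)) \<le> ennreal (C * exp (- L / 2))"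
proof -
  obtain C where C: "C \<ge> 0" "\<And>x. x \<ge> 0 \<Longrightarrow> V l x \<le> C * exp (x / 2)" using V_exp_bound by blast
  define G where "G = (\<Sum>i. exp (- 1 / 2 :: real) ^ i)"
  have sG: "summable (\<lambda>i. exp (- 1 / 2 :: real) ^ i)" by (rule summable_geometric) simp
  have G0: "G \<ge> 0" unfolding G_def by (rule suminf_nonneg[OF sG]) simp
  have "(\<integral>\<^sup>+v. \<integral>\<^sup>+z. ennreal (box_prob Q v z * of_bool (box_prob Q v z < exp (-L))) \<partial>M \<partial>count_space (words l)) \<le> ennreal (C * exp (1/2) * G * exp (- L / 2))"
    if L: "L \<ge> 0" for L
  proof -
    have "(\<integral>\<^sup>+z. ennreal (box_prob Q v z * of_bool (box_prob Q v z < exp (-L))) \<partial>M)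
       \<le> (\<Sum>i. ennreal (exp (- (L + real i))) * emeasure M {z\<in>space M. box_prob Q v z \<ge> exp (- (L + real i + 1))})" for v
    proof -
      have "(\<integral>\<^sup>+z. ennreal (box_prob Q v z * of_bool (box_prob Q v z < exp (-L))) \<partial>M)
        \<le> (\<integral>\<^sup>+z. (\<Sum>i. ennreal (exp (- (L + real i))) * indicator {z\<in>space M. box_prob Q v z \<ge> exp (- (L + real i + 1))} z) \<partial>M)"
      proof (rule nn_integral_mono_AE)
        show "AE z in M. ennreal (box_prob Q v z * of_bool (box_prob Q v z < exp (-L))) \<le> (\<Sum>i. ennreal (exp (- (L + real i))) * indicator {z\<in>space M. box_prob Q v z \<ge> exp (- (L + real i + 1))} z)"
          using AE_good AE_space
        proof eventually_elim
          case (elim z)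
          let ?p = "box_prob Q v z"
          show ?case
          proof (cases "?p < exp (-L)")
            case True
            have p: "?p > 0" using box_prob_pos elim by blast
            define i where "i = nat \<lfloor>- ln ?p - L\<rfloor>"
            have "ln ?p < - L" using True p by (metis exp_less_cancel_iff exp_ln)
            then have i: "real i \<le> - ln ?p - L" "- ln ?p - L < real i + 1"
              unfolding i_def by linarith+
            have "exp (ln ?p) \<le> exp (- (L + real i))" using i(1) by (subst exp_le_cancel_iff) linarith
            then have 1: "?p \<le> exp (- (L + real i))" using p by simp
            have 2: "exp (- (L + real i + 1)) \<le> ?p" unfolding exp_le_iff_ln[OF p] using i(2) by linarith
            define f where "f i = ennreal (exp (- (L + real i))) * indicator {z\<in>space M. box_prob Q v z \<ge> exp (- (L + real i + 1))} z" for i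
            have "ennreal ?p \<le> f i"
              using elim 1 2 unfolding f_def by (simp add: ennreal_leI)
            also have "f i = sum f {i}" by simp
            also have "\<dots> \<le> (\<Sum>i. f i)"
              by (rule sum_le_suminf) auto
            finally have "ennreal ?p \<le> (\<Sum>i. f i)" .
            then show ?thesis using True unfolding f_def by simp
          qed simp
        qed
      qed
      also have "\<dots> = (\<Sum>i. ennreal (exp (- (L + real i))) * emeasure M {z\<in>space M. box_prob Q v z \<ge> exp (- (L + real i + 1))})"
        by (subst nn_integral_suminf) (auto simp: nn_integral_cmult_indicator)
      finally show ?thesis .
    qed
    then have "(\<integral>\<^sup>+v. \<integral>\<^sup>+z. ennreal (box_prob Q v z * of_bool (box_prob Q v z < exp (-L))) \<partial>M \<partial>count_space (words l))
      \<le> (\<integral>\<^sup>+v. (\<Sum>i. ennreal (exp (- (L + real i))) * emeasure M {z\<in>space M. box_prob Q v z \<ge> exp (- (L + real i + 1))}) \<partial>count_space (words l))"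
      by (intro nn_integral_mono)
    also have "\<dots> = (\<Sum>i. ennreal (exp (- (L + real i))) * ennreal (V l (L + real i + 1)))"
    proof -
      have "0 \<le> L + real i + 1" for i using L by simp
      note words_prob_total[OF this, of l]
      then show ?thesis by (subst nn_integral_suminf) (simp_all only: nn_integral_cmult measurable_count_space_eq1 space_borel Pi_UNIV UNIV_I)
    qed
    also have "\<dots> \<le> (\<Sum>i. ennreal (C * exp (1/2) * exp (- L / 2) * exp (- 1 / 2) ^ i))"
    proof (rule suminf_le)
      fix i
      have "exp (- (L + real i)) * V l (L + real i + 1) \<le> exp (- (L + real i)) * (C * exp ((L + real i + 1) / 2))"
        using L by (intro mult_left_mono C) auto
      also have "\<dots> = C * exp (- (L + real i) + (L + real i + 1) / 2)" by (simp add: exp_add)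
      also have "- (L + real i) + (L + real i + 1) / 2 = 1/2 + (- L / 2) + real i * (- 1 / 2)" by (simp add: field_simps)
      also have "C * exp \<dots> = C * exp (1/2) * exp (- L / 2) * exp (- 1 / 2) ^ i"
        by (simp only: exp_add exp_of_nat_mult mult.assoc)
      finally show "ennreal (exp (- (L + real i))) * ennreal (V l (L + real i + 1)) \<le> ennreal (C * exp (1/2) * exp (- L / 2) * exp (- 1 / 2) ^ i)"
        by (simp add: ennreal_mult[symmetric] ennreal_leI)
    qed auto
    also have "\<dots> = ennreal (\<Sum>i. C * exp (1/2) * exp (- L / 2) * exp (- 1 / 2) ^ i)"
      using C(1) by (intro suminf_ennreal2 summable_mult sG) auto
    also have "(\<Sum>i. C * exp (1/2) * exp (- L / 2) * exp (- 1 / 2) ^ i) = C * exp (1/2) * G * exp (- L / 2)"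
      using sG by (subst suminf_mult) (auto simp: G_def)
    finally show ?thesis .
  qed
  then show ?thesis using C(1) G0 by (intro exI[of _ "C * exp (1/2) * G"]) auto
qed

end

context occupancy begin

text \<open>For \<open>s \<le> 1\<close> the threshold is at least one, so only occupied boxes
  enter. There are at most \<open>n\<close> of these, and the sum over \<open>r\<close> merges into
  one cardinality.\<close>

lemma cum_occupancy_card:
  assumes n: "n \<ge> 1" and s: "s \<le> 1"
  shows "cum_occupancy X n j s z = real (card {v\<in>words j. ball_count n v z \<ge> real n powr (1 - s)})"
    "finite {v\<in>words j. ball_count n v z \<ge> real n powr (1 - s)}"
proof -
  let ?m = "nat \<lceil>real n powr (1 - s)\<rceil>"
  let ?c = "\<lambda>v. card {i. i < n \<and> ball_box X i j z = v}"
  have Zc: "ball_count n v z = real (?c v)" if "v \<in> words j" for v using that by (simp add: ball_count_card)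
  have ge1: "real n powr (1 - s) \<ge> 1" using n s by (intro ge_one_powr_ge_zero) auto
  have cn: "?c v \<le> n" for v using card_mono[of "{..<n}" "{i. i < n \<and> ball_box X i j z = v}"] by auto
  have fin: "finite {v \<in> words j. ?c v \<ge> 1}"
  proof (rule finite_subset)
    show "{v \<in> words j. ?c v \<ge> 1} \<subseteq> (\<lambda>i. ball_box X i j z) ` {..<n}"
    proof
      fix v assume "v \<in> {v \<in> words j. ?c v \<ge> 1}"
      then have "{i. i < n \<and> ball_box X i j z = v} \<noteq> {}" by (metis (mono_tags, lifting) card.empty mem_Collect_eq not_one_le_zero)
      then show "v \<in> (\<lambda>i. ball_box X i j z) ` {..<n}" by auto
    qed
  qed simp
  have iff: "ball_count n v z \<ge> real n powr (1 - s) \<longleftrightarrow> ?m \<le> ?c v" if "v \<in> words j" for v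
    unfolding Zc[OF that] by (simp add: nat_le_iff ceiling_le_iff)
  have m1: "?m \<ge> 1" using ge1 by linarith
  have eq: "{v\<in>words j. ball_count n v z \<ge> real n powr (1 - s)} = (\<Union>r\<in>{?m..n}. {v. length v = j \<and> ?c v = r})"
    using iff cn by auto
  show fin': "finite {v\<in>words j. ball_count n v z \<ge> real n powr (1 - s)}"
  proof (rule finite_subset[OF _ fin])
    show "{v\<in>words j. ball_count n v z \<ge> real n powr (1 - s)} \<subseteq> {v \<in> words j. ?c v \<ge> 1}"
      using iff m1 le_trans by blast
  qed
  have "card {v\<in>words j. ball_count n v z \<ge> real n powr (1 - s)} = (\<Sum>r\<in>{?m..n}. card {v. length v = j \<and> ?c v = r})"
    unfolding eq
  proof (rule card_UN_disjoint)
    show "\<forall>r\<in>{?m..n}. finite {v. length v = j \<and> ?c v = r}"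
    proof
      fix r assume "r \<in> {?m..n}"
      then have "r \<ge> 1" using m1 by (meson atLeastAtMost_iff le_trans)
      then show "finite {v. length v = j \<and> ?c v = r}" by (intro finite_subset[OF _ fin]) auto
    qed
  qed auto
  then show "cum_occupancy X n j s z = real (card {v\<in>words j. ball_count n v z \<ge> real n powr (1 - s)})"
    by (simp add: cum_occupancy_def occupancy_count_def)
qed

text \<open>
  Boxes of probability below \<open>n powr (- 3)\<close> are unlikely to be hit at all, and there are at most polynomially in \<open>ln n\<close>
  many others; each of these deviates by a factor \<open>exp x\<close> with probability at most \<open>4 * exp (- x)\<close>.
\<close>

lemma occupancy_bad_set:
  assumes j: "j \<ge> 1"
  shows "\<exists>C\<ge>0. \<forall>n\<ge>1. \<forall>x\<ge>ln 2. \<exists>B\<in>sets M. measure M B \<le> 5 * exp (-x) * V j (3 * ln (real n)) + C * real n powr (- 1 / 2) \<and>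
    (\<forall>z\<in>space M - B. good z \<and> (\<forall>s\<in>{0..1}. level_sum j 0 z (max 0 (s * ln (real n) - x)) \<le> cum_occupancy X n j s z
       \<and> cum_occupancy X n j s z \<le> level_sum j 0 z (s * ln (real n) + x)))"
proof -
  obtain C where C: "C \<ge> 0" "\<And>L. L \<ge> 0 \<Longrightarrow> (\<integral>\<^sup>+v. \<integral>\<^sup>+z. ennreal (box_prob Q v z * of_bool (box_prob Q v z < exp (-L))) \<partial>M \<partial>count_space (words j)) \<le> ennreal (C * exp (- L / 2))"
    using small_box_mass[of j] by blast
  have "\<exists>B\<in>sets M. measure M B \<le> 5 * exp (-x) * V j (3 * ln (real n)) + C * real n powr (- 1 / 2) \<and>
    (\<forall>z\<in>space M - B. good z \<and> (\<forall>s\<in>{0..1}. level_sum j 0 z (max 0 (s * ln (real n) - x)) \<le> cum_occupancy X n j s z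
       \<and> cum_occupancy X n j s z \<le> level_sum j 0 z (s * ln (real n) + x)))" if n: "n \<ge> 1" and x: "x \<ge> ln 2" for n x
  proof -
    define t where "t = ln (real n)"
    have t: "t \<ge> 0" using n by (simp add: t_def)
    have et: "exp t = real n" using n by (simp add: t_def)
    have "\<exists>B\<in>sets M. measure M B \<le> 4 * exp (-x) * V j t \<and> (\<forall>z\<in>space M - B. \<forall>v\<in>words j. \<not> (real n * box_prob Q v z \<ge> exp x \<and> ball_count n v z < exp (- x) * (real n * box_prob Q v z)))"
    proof (rule union_bad_set)
      have "(\<integral>\<^sup>+v. emeasure M {z\<in>space M. real n * box_prob Q v z \<ge> exp x \<and> ball_count n v z < exp (- x) * (real n * box_prob Q v z)} \<partial>count_space (words j))
        \<le> (\<integral>\<^sup>+v. ennreal (4 * exp (- x)) * emeasure M {z\<in>space M. box_prob Q v z \<ge> exp (- t)} \<partial>count_space (words j))"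
        unfolding t_def by (intro nn_integral_mono box_lower n x)
      also have "\<dots> = ennreal (4 * exp (- x) * V j t)" using t by (simp add: nn_integral_cmult words_prob_total ennreal_mult)
      finally show "(\<integral>\<^sup>+v. emeasure M {z\<in>space M. real n * box_prob Q v z \<ge> exp x \<and> ball_count n v z < exp (- x) * (real n * box_prob Q v z)} \<partial>count_space (words j)) \<le> ennreal (4 * exp (- x) * V j t)" .
    qed (auto, measurable)
    then obtain B1 where B1: "B1 \<in> sets M" "measure M B1 \<le> 4 * exp (-x) * V j t"
      "\<And>z v. z \<in> space M - B1 \<Longrightarrow> v \<in> words j \<Longrightarrow> real n * box_prob Q v z \<ge> exp x \<Longrightarrow> ball_count n v z \<ge> exp (- x) * (real n * box_prob Q v z)"
      by (meson not_less)
    have "\<exists>B\<in>sets M. measure M B \<le> exp (-x) * V j (3 * t) \<and> (\<forall>z\<in>space M - B. \<forall>v\<in>words j. \<not> (box_prob Q v z \<ge> exp (- (3 * t)) \<and> ball_count n v z > exp x * (real n * box_prob Q v z)))"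
    proof (rule union_bad_set)
      have "(\<integral>\<^sup>+v. emeasure M {z\<in>space M. box_prob Q v z \<ge> exp (- (3 * t)) \<and> ball_count n v z > exp x * (real n * box_prob Q v z)} \<partial>count_space (words j))
        \<le> (\<integral>\<^sup>+v. ennreal (exp (- x)) * emeasure M {z\<in>space M. box_prob Q v z \<ge> exp (- (3 * t))} \<partial>count_space (words j))"
        by (intro nn_integral_mono box_upper n)
      also have "\<dots> = ennreal (exp (- x) * V j (3 * t))" using t by (simp add: nn_integral_cmult words_prob_total ennreal_mult)
      finally show "(\<integral>\<^sup>+v. emeasure M {z\<in>space M. box_prob Q v z \<ge> exp (- (3 * t)) \<and> ball_count n v z > exp x * (real n * box_prob Q v z)} \<partial>count_space (words j)) \<le> ennreal (exp (- x) * V j (3 * t))" .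
    qed (auto, measurable)
    then obtain B2 where B2: "B2 \<in> sets M" "measure M B2 \<le> exp (-x) * V j (3 * t)"
      "\<And>z v. z \<in> space M - B2 \<Longrightarrow> v \<in> words j \<Longrightarrow> box_prob Q v z \<ge> exp (- (3 * t)) \<Longrightarrow> ball_count n v z \<le> exp x * (real n * box_prob Q v z)"
      by (meson not_less)
    \<comment> \<open>This is where the cut-off \<open>exp (- (3 * t)) = n powr (- 3)\<close> pays:
      the mean mass of smaller boxes is of order \<open>n powr (- 3 / 2)\<close>, small enough for
      \<open>n\<close> balls.\<close>
    have ht: "real n * (C * exp (- (3 * t) / 2)) = C * real n powr (- 1 / 2)"
    proof -
      have "real n * exp (- (3 * t) / 2) = exp (t + (- (3 * t) / 2))" by (simp only: exp_add et)
      also have "\<dots> = real n powr (- 1 / 2)" using n by (simp add: powr_def t_def field_simps)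
      finally show ?thesis by simp
    qed
    have "\<exists>B\<in>sets M. measure M B \<le> C * real n powr (- 1 / 2) \<and> (\<forall>z\<in>space M - B. \<forall>v\<in>words j. \<not> (box_prob Q v z < exp (- (3 * t)) \<and> ball_count n v z \<ge> 1))"
    proof (rule union_bad_set)
      have "(\<integral>\<^sup>+v. emeasure M {z\<in>space M. box_prob Q v z < exp (- (3 * t)) \<and> ball_count n v z \<ge> 1} \<partial>count_space (words j))
        \<le> (\<integral>\<^sup>+v. ennreal (real n) * (\<integral>\<^sup>+z. ennreal (box_prob Q v z * of_bool (box_prob Q v z < exp (- (3 * t)))) \<partial>M) \<partial>count_space (words j))"
        by (intro nn_integral_mono box_tail)
      also have "\<dots> = ennreal (real n) * (\<integral>\<^sup>+v. \<integral>\<^sup>+z. ennreal (box_prob Q v z * of_bool (box_prob Q v z < exp (- (3 * t)))) \<partial>M \<partial>count_space (words j))"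
        by (rule nn_integral_cmult) simp
      also have "\<dots> \<le> ennreal (real n) * ennreal (C * exp (- (3 * t) / 2))" using t by (intro mult_left_mono C) auto
      also have "\<dots> = ennreal (C * real n powr (- 1 / 2))" unfolding ht[symmetric] using C(1) by (subst ennreal_mult[symmetric]) auto
      finally show "(\<integral>\<^sup>+v. emeasure M {z\<in>space M. box_prob Q v z < exp (- (3 * t)) \<and> ball_count n v z \<ge> 1} \<partial>count_space (words j)) \<le> ennreal (C * real n powr (- 1 / 2))" .
    qed (use C(1) in \<open>auto, measurable\<close>)
    then obtain B3 where B3: "B3 \<in> sets M" "measure M B3 \<le> C * real n powr (- 1 / 2)"
      "\<And>z v. z \<in> space M - B3 \<Longrightarrow> v \<in> words j \<Longrightarrow> box_prob Q v z < exp (- (3 * t)) \<Longrightarrow> ball_count n v z < 1"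
      by (meson not_less)
    from AE_E[OF AE_good] obtain N where N: "{x\<in>space M. \<not> good x} \<subseteq> N" "emeasure M N = 0" "N \<in> sets M" by auto
    show ?thesis
    proof (intro bexI[of _ "B1 \<union> B2 \<union> B3 \<union> N"] conjI ballI)
      have "measure M N = 0" using N(2) by (simp add: measure_def)
      moreover have "measure M (B1 \<union> B2 \<union> B3 \<union> N) \<le> measure M B1 + measure M B2 + measure M B3 + measure M N"
        using B1(1) B2(1) B3(1) N(3) by (intro order_trans[OF measure_Un_le] add_mono) auto
      moreover have "4 * exp (-x) * V j t \<le> 4 * exp (-x) * V j (3 * t)" using t by (intro mult_left_mono V_mono) auto
      ultimately show "measure M (B1 \<union> B2 \<union> B3 \<union> N) \<le> 5 * exp (-x) * V j (3 * ln (real n)) + C * real n powr (- 1 / 2)"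
        using B1(2) B2(2) B3(2) unfolding t_def by linarith
      fix z assume z: "z \<in> space M - (B1 \<union> B2 \<union> B3 \<union> N)"
      show g: "good z" using z N(1) by auto
      fix s :: real assume s: "s \<in> {0..1}"
      have ns: "real n powr (1 - s) = exp (t - s * t)" using n by (simp add: powr_def t_def algebra_simps)
      note K = cum_occupancy_card[OF n, of s j z]
      have Nc: "level_sum j 0 z u = real (card {v\<in>words j. box_prob Q v z \<ge> exp (-u)})" for u
        unfolding level_sum_def level_mean_0 log_sum_1 ..
      show "level_sum j 0 z (max 0 (s * ln (real n) - x)) \<le> cum_occupancy X n j s z"
      proof (cases "s * t - x \<ge> 0")
        case True
        have "{v\<in>words j. box_prob Q v z \<ge> exp (-(s * t - x))} \<subseteq> {v\<in>words j. ball_count n v z \<ge> real n powr (1 - s)}"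
        proof safe
          fix v :: "nat list" assume v: "box_prob Q v z \<ge> exp (-(s * t - x))" and j: "j = length v"
          have "exp t * exp (-(s * t - x)) \<le> real n * box_prob Q v z" unfolding et using v by (intro mult_left_mono) auto
          then have e: "exp (x + (t - s * t)) \<le> real n * box_prob Q v z" by (simp add: exp_add[symmetric] algebra_simps)
          moreover have "s * t \<le> t" using s t mult_right_mono[of s 1 t] by auto
          then have "exp x \<le> exp (x + (t - s * t))" by simp
          ultimately have "exp x \<le> real n * box_prob Q v z" by linarith
          then have "exp (- x) * (real n * box_prob Q v z) \<le> ball_count n v z" using B1(3)[of z v] z j by auto
          moreover have "exp (-x) * exp (x + (t - s * t)) \<le> exp (- x) * (real n * box_prob Q v z)" using e by (intro mult_left_mono) auto
          ultimately show "real n powr (1 - s) \<le> ball_count n v z" unfolding ns by (simp add: exp_add[symmetric] mult_exp_exp)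
        qed
        then show ?thesis using True K s unfolding Nc t_def by (auto intro: card_mono)
      next
        case False
        \<comment> \<open>Here the argument has been clipped to \<open>0\<close>, where the count
          vanishes: at level \<open>j \<ge> 1\<close> every box probability is strictly below
          one.\<close>
        have "{v\<in>words j. box_prob Q v z \<ge> exp (-0)} = {}"
        proof (intro equals0I)
          fix v :: "nat list" assume v: "v \<in> {v\<in>words j. box_prob Q v z \<ge> exp (-0)}"
          then have "v \<noteq> []" using j by auto
          from box_prob_less_1[OF g this] v show False by simp
        qed
        then have "level_sum j 0 z 0 = 0" unfolding Nc by (simp only: card.empty of_nat_0)
        then show ?thesis using False K(1) s unfolding t_def by auto
      qed
      have "{v\<in>words j. ball_count n v z \<ge> real n powr (1 - s)} \<subseteq> {v\<in>words j. box_prob Q v z \<ge> exp (-(s * t + x))}"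
      proof safe
        fix v :: "nat list" assume v: "real n powr (1 - s) \<le> ball_count n v z" and j: "j = length v"
        have Z1: "ball_count n v z \<ge> 1" using v n s by (intro order_trans[OF ge_one_powr_ge_zero v]) auto
        have "box_prob Q v z \<ge> exp (- (3 * t))"
        proof (rule ccontr)
          assume "\<not> box_prob Q v z \<ge> exp (- (3 * t))"
          then have "ball_count n v z < 1" using B3(3)[of z v] z j by simp
          then show False using Z1 by simp
        qed
        then have "ball_count n v z \<le> exp x * (real n * box_prob Q v z)" using B2(3)[of z v] z j by auto
        then have "exp (t - s * t) \<le> exp (x + t) * box_prob Q v z" using v unfolding ns by (simp add: exp_add et)
        then have "exp (- (x + t)) * exp (t - s * t) \<le> exp (- (x + t)) * (exp (x + t) * box_prob Q v z)" by (intro mult_left_mono) auto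
        moreover have "exp (- (x + t)) * exp (t - s * t) = exp (-(s * t + x))"
          unfolding mult_exp_exp by (rule arg_cong[where f = exp]) simp
        moreover have "exp (- (x + t)) * (exp (x + t) * box_prob Q v z) = box_prob Q v z"
          by (simp only: mult.assoc[symmetric] mult_exp_exp) simp
        ultimately show "exp (-(s * t + x)) \<le> box_prob Q v z" by metis
      qed
      then show "cum_occupancy X n j s z \<le> level_sum j 0 z (s * ln (real n) + x)"
        using K s subprob_finite(1)[OF subprob_words[OF g, of j], of "s * t + x"] unfolding Nc t_def by (auto intro: card_mono)
    qed (use B1 B2 B3 N in auto)
  qed
  then show ?thesis using C(1) by blast
qed

end

section \<open>Comparison of all levels with the first level\<close>

text \<open>For \<open>p \<le> 1\<close> the power is subadditive; for \<open>p > 1\<close> the mean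
  value theorem applies with an intermediate point below \<open>2\<close>. Adding both bounds covers
  every \<open>p\<close> by one statement.\<close>

lemma powr_increment_le:
  fixes s \<tau> p :: real
  assumes "0 \<le> s" "s \<le> 1" "0 \<le> \<tau>" "\<tau> \<le> 1" "p > 0"
  shows "(s + \<tau>) powr p - s powr p \<le> \<tau> powr p + p * 2 powr p * \<tau>"
proof (cases "s = 0 \<or> \<tau> = 0")
  case True
  then show ?thesis using assms by auto
next
  case False
  then have s: "s > 0" and \<tau>: "\<tau> > 0" using assms by auto
  show ?thesis
  proof (cases "p \<le> 1")
    case True
    have le: "x \<le> x powr p" if "0 \<le> x" "x \<le> 1" for x
      using powr_mono'[of p 1 x] that True by (cases "x = 0") auto
    have "1 = s / (s + \<tau>) + \<tau> / (s + \<tau>)" using s \<tau> by (simp add: add_divide_distrib[symmetric])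
    also have "\<dots> \<le> (s / (s + \<tau>)) powr p + (\<tau> / (s + \<tau>)) powr p"
      using s \<tau> by (intro add_mono le) auto
    also have "\<dots> = (s powr p + \<tau> powr p) / (s + \<tau>) powr p"
      using s \<tau> by (simp add: powr_divide add_divide_distrib)
    finally have "(s + \<tau>) powr p \<le> s powr p + \<tau> powr p" using s \<tau> by (simp add: field_simps)
    moreover have "0 \<le> p * 2 powr p * \<tau>" using assms by simp
    ultimately show ?thesis by linarith
  next
    case False
    have "\<exists>x>s. x < s + \<tau> \<and> (s + \<tau>) powr p - s powr p = (s + \<tau> - s) * (p * x powr (p - 1))"
      by (rule MVT2) (use s \<tau> in \<open>auto intro!: has_real_derivative_powr\<close>)
    then obtain x where x: "s < x" "x < s + \<tau>" "(s + \<tau>) powr p - s powr p = \<tau> * (p * x powr (p - 1))" by auto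
    have "x powr (p - 1) \<le> 2 powr (p - 1)" using x s assms False by (intro powr_mono2) auto
    also have "\<dots> \<le> 2 powr p" by (intro powr_mono) auto
    finally have "\<tau> * (p * x powr (p - 1)) \<le> \<tau> * (p * 2 powr p)" using assms by (intro mult_left_mono) auto
    moreover have "0 \<le> \<tau> powr p" by simp
    moreover have "p * 2 powr p * \<tau> = \<tau> * (p * 2 powr p)" by simp
    ultimately show ?thesis unfolding x(3) by linarith
  qed
qed

text \<open>
  The grid is equidistant in \<open>s powr p\<close>, so that the drift \<open>\<kappa> * (t * s) powr p\<close> has equal increments between
  neighbours.
\<close>

lemma monotone_sandwich:
  fixes F K \<Phi> :: "real \<Rightarrow> real" and G :: nat
  assumes F: "mono F" and t: "t > 0" and p: "p > 0" and G: "G \<ge> 1" and b: "b > 0" and \<kappa>: "\<kappa> \<ge> 0"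
    and grid: "\<And>i. i \<le> G \<Longrightarrow> \<bar>F (t * (2 * (real i / real G) powr (1 / p))) - \<kappa> * (t * (2 * (real i / real G) powr (1 / p))) powr p
        - b * \<Phi> (2 * (real i / real G) powr (1 / p))\<bar> \<le> 2 * \<eta> * b"
    and osc: "\<And>s s'. s \<in> {0..2} \<Longrightarrow> s' \<in> {0..2} \<Longrightarrow> \<bar>s - s'\<bar> < \<delta> \<Longrightarrow> \<bar>\<Phi> s - \<Phi> s'\<bar> < \<eta>"
    and K: "\<And>s. s \<in> {0..1} \<Longrightarrow> F (max 0 (s * t - x)) \<le> K s" "\<And>s. s \<in> {0..1} \<Longrightarrow> K s \<le> F (s * t + x)"
    and x: "0 \<le> x" "x < t" "x / t < \<delta> / 2"
    and drift: "\<kappa> * t powr p * ((x / t) powr p + p * 2 powr p * (x / t) + 2 powr p / real G) \<le> \<eta> * b"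
    and gap: "\<And>i. i < G \<Longrightarrow> 2 * (real (Suc i) / real G) powr (1 / p) - 2 * (real i / real G) powr (1 / p) < \<delta> / 2"
    and s: "s \<in> {0..1}"
  shows "\<bar>(K s - \<kappa> * (s * t) powr p) / b - \<Phi> s\<bar> \<le> 4 * \<eta>"
proof -
  define \<tau> where "\<tau> = x / t"
  define r where "r i = 2 * (real i / real G) powr (1 / p)" for i :: nat
  have \<tau>: "0 \<le> \<tau>" "\<tau> < 1" "\<tau> < \<delta> / 2" "x = t * \<tau>" using x t by (auto simp: \<tau>_def)
  have rp: "r i powr p = 2 powr p * (real i / real G)" for i
    using p by (simp add: r_def powr_mult powr_powr)
  have r_range: "r i \<in> {0..2}" if "i \<le> G" for i
  proof -
    have "(real i / real G) powr (1 / p) \<le> 1 powr (1 / p)" using that G p by (intro powr_mono2) auto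
    then show ?thesis by (simp add: r_def)
  qed
  have bracket: "\<exists>i<G. r i \<le> v \<and> v < r (Suc i) \<and> r (Suc i) powr p \<le> v powr p + 2 powr p / real G \<and> v powr p - 2 powr p / real G \<le> r i powr p"
    if v: "0 \<le> v" "v < 2" for v
  proof -
    \<comment> \<open>In the coordinate \<open>(v / 2) powr p\<close> the grid is equidistant, so
      the bracketing index is an integer part. The grid covers \<open>[0, 2]\<close> because the
      shifted argument \<open>s + \<tau>\<close> can exceed \<open>1\<close>.\<close>
    define w where "w = real G * (v / 2) powr p"
    define i where "i = nat \<lfloor>w\<rfloor>"
    have w0: "w \<ge> 0" by (simp add: w_def)
    have "(v / 2) powr p < 1 powr p" using v p by (intro powr_less_mono2) auto
    then have "w < real G" using G by (simp add: w_def)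
    have i: "real i \<le> w" "w < real i + 1" using w0 unfolding i_def by linarith+
    have iG: "i < G" using i \<open>w < real G\<close> by linarith
    have vp: "v powr p = 2 powr p * (w / real G)" using G v by (simp add: w_def powr_divide)
    have "real i / real G \<le> w / real G" using i by (intro divide_right_mono) auto
    then have "2 powr p * (real i / real G) \<le> 2 powr p * (w / real G)" by (intro mult_left_mono) auto
    then have "r i powr p \<le> v powr p" by (simp only: rp vp)
    then have 1: "r i \<le> v" using p v r_range[of i] iG by (metis not_le powr_less_mono2)
    have "w / real G < real (Suc i) / real G" using i G by (intro divide_strict_right_mono) auto
    then have "2 powr p * (w / real G) < 2 powr p * (real (Suc i) / real G)" by (intro mult_strict_left_mono) auto
    then have "v powr p < r (Suc i) powr p" by (simp only: rp vp)
    then have 2: "v < r (Suc i)" using p v r_range[of "Suc i"] iG by (metis atLeastAtMost_iff not_le powr_mono2 less_imp_le Suc_leI)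
    have 3: "r (Suc i) powr p = r i powr p + 2 powr p / real G" unfolding rp by (simp add: add_divide_distrib distrib_left)
    show ?thesis using iG 1 2 3 \<open>r i powr p \<le> v powr p\<close> \<open>v powr p < r (Suc i) powr p\<close> by (intro exI[of _ i]) auto
  qed
  have tp: "(t * y) powr p = t powr p * y powr p" if "y \<ge> 0" for y using t that by (simp add: powr_mult)
  have kt: "\<kappa> * t powr p \<ge> 0" using \<kappa> by simp
  have incr: "\<kappa> * t powr p * ((y + \<tau>) powr p - y powr p + 2 powr p / real G) \<le> \<eta> * b" if "0 \<le> y" "y \<le> 1" for y
  proof -
    have "(y + \<tau>) powr p - y powr p + 2 powr p / real G \<le> \<tau> powr p + p * 2 powr p * \<tau> + 2 powr p / real G"
      using powr_increment_le[of y \<tau> p] that \<tau> p by simp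
    from mult_left_mono[OF this kt] show ?thesis using drift unfolding \<tau>_def by linarith
  qed
  have upper: "K s - \<kappa> * (s * t) powr p \<le> b * \<Phi> s + 4 * \<eta> * b"
  proof -
    obtain i where i: "i < G" "r i \<le> s + \<tau>" "s + \<tau> < r (Suc i)" "r (Suc i) powr p \<le> (s + \<tau>) powr p + 2 powr p / real G"
      using bracket[of "s + \<tau>"] s \<tau> by auto
    have "s * t + x = t * (s + \<tau>)" using \<tau>(4) by (simp add: algebra_simps)
    also have "\<dots> \<le> t * r (Suc i)" using i t by (intro mult_left_mono) auto
    finally have "K s \<le> F (t * r (Suc i))" using K(2)[OF s] monoD[OF F] by (meson order_trans)
    also have "\<dots> \<le> \<kappa> * (t * r (Suc i)) powr p + b * \<Phi> (r (Suc i)) + 2 * \<eta> * b"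
      using grid[of "Suc i"] i(1) unfolding r_def[symmetric] by linarith
    also have "\<kappa> * (t * r (Suc i)) powr p = \<kappa> * t powr p * r (Suc i) powr p" using tp[of "r (Suc i)"] r_range[of "Suc i"] i(1) by simp
    also have "\<kappa> * t powr p * r (Suc i) powr p \<le> \<kappa> * t powr p * ((s + \<tau>) powr p + 2 powr p / real G)" using i(4) kt by (rule mult_left_mono)
    finally have 1: "K s \<le> \<kappa> * t powr p * ((s + \<tau>) powr p + 2 powr p / real G) + b * \<Phi> (r (Suc i)) + 2 * \<eta> * b" by simp
    have "r (Suc i) - r i < \<delta> / 2" using gap[OF i(1)] by (simp add: r_def)
    then have "\<bar>r (Suc i) - s\<bar> < \<delta>" using i \<tau> by linarith
    then have "\<Phi> (r (Suc i)) \<le> \<Phi> s + \<eta>" using osc[of "r (Suc i)" s] r_range[of "Suc i"] i(1) s by force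
    then have 2: "b * \<Phi> (r (Suc i)) \<le> b * (\<Phi> s + \<eta>)" using b by (intro mult_left_mono) auto
    have 3: "\<kappa> * t powr p * ((s + \<tau>) powr p + 2 powr p / real G) \<le> \<kappa> * t powr p * s powr p + \<eta> * b"
      using incr[of s] s by (simp add: algebra_simps)
    have 4: "\<kappa> * (s * t) powr p = \<kappa> * t powr p * s powr p" using tp[of s] s by (simp add: mult.commute[of s])
    show ?thesis using 1 2 3 unfolding 4 by (simp add: algebra_simps)
  qed
  have lower: "K s - \<kappa> * (s * t) powr p \<ge> b * \<Phi> s - 4 * \<eta> * b"
  proof -
    \<comment> \<open>Near zero the shifted argument is clipped; \<open>s \<le> v + \<tau>\<close>
      still holds and bounds the drift between \<open>v\<close> and \<open>s\<close>.\<close>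
    define v where "v = max 0 (s - \<tau>)"
    have v: "0 \<le> v" "v \<le> 1" "s \<le> v + \<tau>" "v \<le> s" using s \<tau> by (auto simp: v_def)
    obtain i where i: "i < G" "r i \<le> v" "v < r (Suc i)" "v powr p - 2 powr p / real G \<le> r i powr p"
      using bracket[of v] v by auto
    have "t * r i \<le> t * v" using i t by (intro mult_left_mono) auto
    also have "t * v = max 0 (s * t - x)" using \<tau>(4) t by (auto simp: v_def max_def algebra_simps zero_le_mult_iff mult_le_0_iff)
    finally have "F (t * r i) \<le> K s" using K(1)[OF s] monoD[OF F] by (meson order_trans)
    moreover have "F (t * r i) \<ge> \<kappa> * (t * r i) powr p + b * \<Phi> (r i) - 2 * \<eta> * b"
      using grid[of i] i(1) unfolding r_def[symmetric] by linarith
    moreover have "\<kappa> * (t * r i) powr p = \<kappa> * t powr p * r i powr p" using tp[of "r i"] r_range[of i] i(1) by simp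
    moreover have "\<kappa> * t powr p * r i powr p \<ge> \<kappa> * t powr p * (v powr p - 2 powr p / real G)" using i(4) kt by (rule mult_left_mono)
    ultimately have 1: "K s \<ge> \<kappa> * t powr p * (v powr p - 2 powr p / real G) + b * \<Phi> (r i) - 2 * \<eta> * b" by linarith
    have "r (Suc i) - r i < \<delta> / 2" using gap[OF i(1)] by (simp add: r_def)
    then have "\<bar>r i - s\<bar> < \<delta>" using i v \<tau> by linarith
    then have "\<Phi> (r i) \<ge> \<Phi> s - \<eta>" using osc[of "r i" s] r_range[of i] i(1) s by force
    then have 2: "b * \<Phi> (r i) \<ge> b * (\<Phi> s - \<eta>)" using b by (intro mult_left_mono) auto
    have "s powr p \<le> (v + \<tau>) powr p" using v s p by (intro powr_mono2) auto
    then have "\<kappa> * t powr p * s powr p \<le> \<kappa> * t powr p * (v + \<tau>) powr p" using kt by (rule mult_left_mono)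
    then have 3: "\<kappa> * t powr p * (v powr p - 2 powr p / real G) \<ge> \<kappa> * t powr p * s powr p - \<eta> * b"
      using incr[of v] v by (simp add: algebra_simps)
    have 4: "\<kappa> * (s * t) powr p = \<kappa> * t powr p * s powr p" using tp[of s] s by (simp add: mult.commute[of s])
    show ?thesis using 1 2 3 unfolding 4 by (simp add: algebra_simps)
  qed
  have "(K s - \<kappa> * (s * t) powr p) / b \<le> \<Phi> s + 4 * \<eta>" "\<Phi> s - 4 * \<eta> \<le> (K s - \<kappa> * (s * t) powr p) / b"
    using upper lower b by (simp_all add: field_simps)
  then show ?thesis by (simp add: abs_le_iff)
qed

text \<open>Equal steps in \<open>s powr p\<close> are uneven in \<open>s\<close>, widest near zero
  when \<open>p > 1\<close>; uniform continuity of the root makes all of them small at once.\<close>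

lemma powr_grid_gap:
  assumes "p > 0" "\<delta> > (0::real)"
  shows "\<exists>G0. \<forall>G\<ge>G0. \<forall>i<G. 2 * (real (Suc i) / real G) powr (1 / p) - 2 * (real i / real G) powr (1 / p) < \<delta>"
proof -
  have "uniformly_continuous_on {0..1} (\<lambda>x::real. x powr (1 / p))"
    using assms by (intro compact_uniformly_continuous continuous_on_powr' continuous_intros) auto
  moreover have "\<delta> / 2 > 0" using assms by simp
  ultimately obtain d where d: "d > 0" "\<And>x y. x \<in> {0..1} \<Longrightarrow> y \<in> {0..1} \<Longrightarrow> dist y x < d \<Longrightarrow> dist (y powr (1 / p)) (x powr (1 / p)) < \<delta> / 2"
    unfolding uniformly_continuous_on_def by meson
  obtain G0 where G0: "real G0 > 1 / d" using reals_Archimedean2 by blast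
  show ?thesis
  proof (intro exI allI impI)
    fix G i assume G: "G0 \<le> G" "i < G"
    have "real G > 1 / d" using G0 G by linarith
    then have "1 / real G < d" using d(1) G by (simp add: field_simps)
    then have "dist (real (Suc i) / real G) (real i / real G) < d" using G by (simp add: dist_real_def diff_divide_distrib[symmetric])
    then have "dist ((real (Suc i) / real G) powr (1 / p)) ((real i / real G) powr (1 / p)) < \<delta> / 2"
      using G by (intro d(2)) auto
    then show "2 * (real (Suc i) / real G) powr (1 / p) - 2 * (real i / real G) powr (1 / p) < \<delta>"
      unfolding dist_real_def by linarith
  qed
qed

lemma powr_neg_tendsto_0: "s < 0 \<Longrightarrow> ((\<lambda>t::real. C * t powr s) \<longlongrightarrow> 0) at_top"
  by (rule tendsto_mult_right_zero) (rule tendsto_neg_powr[OF _ filterlim_ident])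

context occupancy begin

section \<open>The first-level approximation as a functional of the root process\<close>

definition root_frag :: "'w \<Rightarrow> nat \<Rightarrow> real" where "root_frag z = (\<lambda>k. Q [] k z)"

definition scaled_count :: "real \<Rightarrow> real \<Rightarrow> (nat \<Rightarrow> real) \<Rightarrow> real \<Rightarrow> real" where
  "scaled_count a t q s = (cnt q (t * s) - c * (t * s) powr \<omega>) / (a * t powr \<gamma>)"

definition norming :: "real \<Rightarrow> nat \<Rightarrow> real \<Rightarrow> real" where
  "norming a j t = a * cc (j - 1) * t powr (\<gamma> + \<omega> * (real j - 1))"

lemma norming_pos: "a > 0 \<Longrightarrow> t > 0 \<Longrightarrow> norming a j t > 0"
  by (simp add: norming_def cc_pos)

lemma good_root_frag: "good z \<Longrightarrow> subprob UNIV (root_frag z)"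
  by (simp add: good_def root_frag_def)

text \<open>An exact identity: the fractional integral is linear, and \<open>cc (j - 1)\<close>
  times the integral of the centring \<open>c * x powr \<omega>\<close> is
  \<open>cc j * x powr (\<omega> * j)\<close>. Only the error of the mean \<open>V (j - 1)\<close>
  is left over.\<close>

lemma first_level_path:
  assumes j: "j \<ge> 1" and q: "subprob UNIV q" and t: "t > 0" and s: "s \<ge> 0" and a: "a > 0"
  shows "log_sum (V (j - 1)) UNIV q (t * s) - cc j * (t * s) powr (\<omega> * real j) - norming a j t * lim_path \<omega> j (scaled_count a t q) s
     = (if j = 1 then 0 else log_sum (V_err (j - 1)) UNIV q (t * s))"
proof (cases "j = 1")
  case True
  have "cc 1 = c"
  proof -
    have "Gamma (\<omega> + 1) > 0" using pos by (intro Gamma_real_pos) auto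
    then show ?thesis by (simp add: lim_const_def)
  qed
  then show ?thesis using True a t by (simp add: level_mean_0 lim_path_def norming_def cc_0 scaled_count_def)
next
  case False
  define m where "m = j - 1"
  have m: "j = Suc m" "m \<ge> 1" using j False by (auto simp: m_def)
  let ?p = "\<omega> * real m"
  have p: "?p > 0" using pos m by simp
  have u: "t * s \<ge> 0" using t s by simp
  have [measurable]: "cnt q \<in> borel_measurable borel" by (rule cnt_borel[OF q])
  have f1: "frac_int ?p (\<lambda>x. cnt q x + - c * x powr \<omega>) (t * s) = frac_int ?p (cnt q) (t * s) + - c * frac_int ?p (\<lambda>x. x powr \<omega>) (t * s)"
  proof (rule frac_int_add_cmult[OF p u, where B = "cnt q (t * s)" and B' = "(t * s) powr \<omega>"])
    show "\<bar>cnt q x\<bar> \<le> cnt q (t * s)" if "0 \<le> x" "x \<le> t * s" for x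
      using monoD[OF cnt_mono[OF q] that(2)] cnt_nonneg[of UNIV q x] by simp
    show "\<bar>x powr \<omega>\<bar> \<le> (t * s) powr \<omega>" if "0 \<le> x" "x \<le> t * s" for x
      using that pos by (simp add: powr_mono2)
  qed measurable
  have f2: "frac_int ?p (\<lambda>x. cnt q x + - c * x powr \<omega>) (t * s) = t powr ?p * (a * t powr \<gamma> * frac_int ?p (scaled_count a t q) s)"
  proof -
    have "cnt q (t * x) + - c * (t * x) powr \<omega> = a * t powr \<gamma> * scaled_count a t q x" for x
      using a t by (simp add: scaled_count_def)
    then show ?thesis using frac_int_rescale[OF p s t, of "\<lambda>x. cnt q x + - c * x powr \<omega>"]
      by (simp only: frac_int_cmult)
  qed
  have f3: "cc m * (c * frac_int ?p (\<lambda>x. x powr \<omega>) (t * s)) = cc j * (t * s) powr (\<omega> * real j)"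
    using frac_int_powr[OF p u pos(2)] unfolding m(1) by (simp add: cc_Suc algebra_simps)
  have f4: "norming a j t = cc m * (t powr ?p * (a * t powr \<gamma>))"
    by (simp add: norming_def m powr_add algebra_simps)
  have f5: "lim_path \<omega> j (scaled_count a t q) s = frac_int ?p (scaled_count a t q) s" using m by (simp add: lim_path_eq)
  have "norming a j t * lim_path \<omega> j (scaled_count a t q) s = cc m * frac_int ?p (\<lambda>x. cnt q x + - c * x powr \<omega>) (t * s)"
    by (simp only: f2 f4 f5 mult.assoc)
  also have "\<dots> = cc m * frac_int ?p (cnt q) (t * s) - cc m * (c * frac_int ?p (\<lambda>x. x powr \<omega>) (t * s))"
    unfolding f1 by (simp add: right_diff_distrib)
  finally show ?thesis
    using log_sum_V_decomp[OF q u m(2)] False unfolding m_def[symmetric] f3 by simp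
qed

text \<open>The remainder is dominated by a quantity increasing in \<open>s\<close>, so its value at
  \<open>s = 2\<close> controls all times and Markov's inequality suffices. Relative to the norming,
  its mean has the negative exponent \<open>\<omega> - \<epsilon> - \<gamma>\<close>.\<close>

lemma first_level_whp:
  assumes j: "j \<ge> 1" and a: "a > 0" and \<eta>: "\<eta> > 0"
  shows "whp M at_top (\<lambda>t z. good z \<and> (\<forall>s\<in>{0..2}. \<bar>level_sum 1 (j - 1) z (t * s) - cc j * (t * s) powr (\<omega> * real j) - norming a j t * lim_path \<omega> j (scaled_count a t (root_frag z)) s\<bar> \<le> \<eta> * norming a j t))"
proof -
  have red: "level_sum 1 (j - 1) z (t * s) - cc j * (t * s) powr (\<omega> * real j) - norming a j t * lim_path \<omega> j (scaled_count a t (root_frag z)) s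
     = (if j = 1 then 0 else log_sum (V_err (j - 1)) UNIV (root_frag z) (t * s))" if "good z" "t > 0" "s \<ge> 0" for z t s
    using first_level_path[OF j good_root_frag[OF that(1)] that(2,3) a] level_sum_1[OF that(1), of "t * s" "j - 1"] that by (simp add: root_frag_def)
  show ?thesis
  proof (cases "j = 1")
    case True
    show ?thesis
    proof (rule whp_mono[OF M.whp_AE[OF AE_good]])
      show "\<forall>\<^sub>F t in at_top. \<forall>z\<in>space M. good z \<longrightarrow> (good z \<and> (\<forall>s\<in>{0..2}. \<bar>level_sum 1 (j - 1) z (t * s) - cc j * (t * s) powr (\<omega> * real j) - norming a j t * lim_path \<omega> j (scaled_count a t (root_frag z)) s\<bar> \<le> \<eta> * norming a j t))"
        using eventually_gt_at_top[of 0]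
      proof eventually_elim
        case (elim t)
        have "0 \<le> \<eta> * norming a j t" using norming_pos[OF a elim, of j] \<eta> by simp
        then show ?case using red elim True by simp
      qed
    qed
  next
    case False
    define m where "m = j - 1"
    have m: "j = Suc m" "m \<ge> 1" using j False by (auto simp: m_def)
    let ?p = "\<omega> * real m"
    obtain C where C: "C \<ge> 0" "\<And>x. 0 \<le> x \<Longrightarrow> \<bar>V_err m x\<bar> \<le> C * (1 + x) powr (?p - \<epsilon>)"
      using V_asymp[OF m(2)] by auto
    obtain D where D: "D \<ge> 0" "\<And>x. 0 \<le> x \<Longrightarrow> V 1 x \<le> D * (1 + x) powr \<omega>"
      using V_upper[of 1] by auto
    define E where "E t = C * (1 + 2 * t) powr (?p - \<epsilon>)" for t
    have E0: "E t \<ge> 0" for t using C(1) by (simp add: E_def)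
    have good: "whp M at_top (\<lambda>t z. good z)" by (rule M.whp_AE[OF AE_good])
    have cnt: "whp M at_top (\<lambda>t z. t \<ge> 1 \<longrightarrow> ennreal (E t * cnt (root_frag z) (2 * t)) < ennreal (\<eta> * norming a j t))"
    proof (rule M.whp_lim0)
      fix t :: real
      show "\<exists>B\<in>sets M. M.prob B \<le> C * D * 3 powr (?p - \<epsilon> + \<omega>) / (\<eta> * a * cc m) * t powr (\<omega> - \<epsilon> - \<gamma>) \<and> (\<forall>z\<in>space M - B. t \<ge> 1 \<longrightarrow> ennreal (E t * cnt (root_frag z) (2 * t)) < ennreal (\<eta> * norming a j t))"
      proof (cases "t \<ge> 1")
        case t: True
        have np: "\<eta> * norming a j t > 0" using norming_pos[OF a, of t j] \<eta> t by simp
        have "\<exists>B\<in>sets M. M.prob B \<le> E t * V 1 (2 * t) / (\<eta> * norming a j t) \<and> (\<forall>z\<in>space M - B. ennreal (E t * cnt (root_frag z) (2 * t)) < ennreal (\<eta> * norming a j t))"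
        proof (rule M.Markov_bad_set[OF _ _ _ np])
          show "(\<lambda>z. ennreal (E t * cnt (root_frag z) (2 * t))) \<in> borel_measurable M" unfolding root_frag_def by measurable
          have "(\<integral>\<^sup>+z. ennreal (cnt (root_frag z) (2 * t)) \<partial>M) = (\<integral>\<^sup>+z. ennreal (level_sum 1 0 z (2 * t)) \<partial>M)"
          proof (rule nn_integral_cong_AE, use AE_good in eventually_elim)
            fix z assume "good z"
            then show "ennreal (cnt (root_frag z) (2 * t)) = ennreal (level_sum 1 0 z (2 * t))"
              using level_sum_1[of z "2 * t" 0] t by (simp add: root_frag_def level_mean_0)
          qed
          also have "\<dots> = ennreal (V 1 (2 * t))" using level_sum_mean[of "2 * t" 1 0] t by simp
          finally have e: "(\<integral>\<^sup>+z. ennreal (cnt (root_frag z) (2 * t)) \<partial>M) = ennreal (V 1 (2 * t))" .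
          have [measurable]: "(\<lambda>z. cnt (root_frag z) (2 * t)) \<in> borel_measurable M" unfolding root_frag_def by measurable
          have "(\<integral>\<^sup>+z. ennreal (E t * cnt (root_frag z) (2 * t)) \<partial>M) = ennreal (E t) * (\<integral>\<^sup>+z. ennreal (cnt (root_frag z) (2 * t)) \<partial>M)"
            by (subst nn_integral_cmult[symmetric]) (auto simp: ennreal_mult'[OF E0])
          then show "(\<integral>\<^sup>+z. ennreal (E t * cnt (root_frag z) (2 * t)) \<partial>M) \<le> ennreal (E t * V 1 (2 * t))"
            unfolding e by (simp add: ennreal_mult'[OF E0])
          show "0 \<le> E t * V 1 (2 * t)" using E0[of t] by simp
        qed
        moreover have "E t * V 1 (2 * t) / (\<eta> * norming a j t) \<le> C * D * 3 powr (?p - \<epsilon> + \<omega>) / (\<eta> * a * cc m) * t powr (\<omega> - \<epsilon> - \<gamma>)"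
        proof -
          have "E t * V 1 (2 * t) \<le> E t * (D * (1 + 2 * t) powr \<omega>)" using D(2)[of "2 * t"] E0 t by (intro mult_left_mono) auto
          also have "\<dots> = C * D * (1 + 2 * t) powr (?p - \<epsilon> + \<omega>)" by (simp add: E_def powr_add mult_ac)
          also have "\<dots> \<le> C * D * (3 * t) powr (?p - \<epsilon> + \<omega>)"
            using t C(1) D(1) om_eps_nonneg[OF m(2)] pos by (intro mult_left_mono powr_mono2) auto
          also have "(3 * t) powr (?p - \<epsilon> + \<omega>) = 3 powr (?p - \<epsilon> + \<omega>) * t powr (?p - \<epsilon> + \<omega>)" using t by (simp add: powr_mult)
          finally have "E t * V 1 (2 * t) / (\<eta> * norming a j t) \<le> C * D * (3 powr (?p - \<epsilon> + \<omega>) * t powr (?p - \<epsilon> + \<omega>)) / (\<eta> * norming a j t)"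
            using np by (intro divide_right_mono) auto
          also have "\<dots> = C * D * 3 powr (?p - \<epsilon> + \<omega>) / (\<eta> * a * cc m) * (t powr (?p - \<epsilon> + \<omega>) / t powr (\<gamma> + ?p))"
            by (simp add: norming_def m)
          also have "t powr (?p - \<epsilon> + \<omega>) / t powr (\<gamma> + ?p) = t powr (\<omega> - \<epsilon> - \<gamma>)"
            by (simp add: powr_diff[symmetric] algebra_simps)
          finally show ?thesis .
        qed
        ultimately show ?thesis using t by (meson order_trans)
      next
        case False
        have "0 \<le> C * D * 3 powr (?p - \<epsilon> + \<omega>) / (\<eta> * a * cc m) * t powr (\<omega> - \<epsilon> - \<gamma>)"
          using C(1) D(1) a \<eta> cc_pos[of m] by simp
        then show ?thesis using False by (intro bexI[of _ "{}"]) auto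
      qed
    next
      show "((\<lambda>t. C * D * 3 powr (?p - \<epsilon> + \<omega>) / (\<eta> * a * cc m) * t powr (\<omega> - \<epsilon> - \<gamma>)) \<longlongrightarrow> 0) at_top"
        using gamma by (intro powr_neg_tendsto_0) auto
    qed
    show ?thesis
    proof (rule whp_mono[OF M.whp_conj[OF good cnt]])
      show "\<forall>\<^sub>F t in at_top. \<forall>z\<in>space M. good z \<and> (t \<ge> 1 \<longrightarrow> ennreal (E t * cnt (root_frag z) (2 * t)) < ennreal (\<eta> * norming a j t)) \<longrightarrow> (good z \<and> (\<forall>s\<in>{0..2}. \<bar>level_sum 1 (j - 1) z (t * s) - cc j * (t * s) powr (\<omega> * real j) - norming a j t * lim_path \<omega> j (scaled_count a t (root_frag z)) s\<bar> \<le> \<eta> * norming a j t))"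
        using eventually_ge_at_top[of 1]
      proof eventually_elim
        case (elim t)
        show ?case
        proof (intro ballI impI conjI)
          fix z assume z: "good z \<and> (t \<ge> 1 \<longrightarrow> ennreal (E t * cnt (root_frag z) (2 * t)) < ennreal (\<eta> * norming a j t))"
          then show "good z" by blast
          fix s :: real assume s: "s \<in> {0..2}"
          have q: "subprob UNIV (root_frag z)" using z good_root_frag by blast
          have ts: "0 \<le> t * s" "t * s \<le> 2 * t" using elim s by (auto simp: mult.commute)
          have "\<bar>log_sum (V_err m) UNIV (root_frag z) (t * s)\<bar> \<le> C * (1 + t * s) powr (?p - \<epsilon>) * cnt (root_frag z) (t * s)"
            by (rule log_sum_V_err_le[OF q ts(1) om_eps_nonneg[OF m(2)] C(2,1)])
          also have "\<dots> \<le> E t * cnt (root_frag z) (2 * t)"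
            unfolding E_def using ts C(1) om_eps_nonneg[OF m(2)] monoD[OF cnt_mono[OF q] ts(2)] cnt_nonneg[of UNIV "root_frag z"]
            by (intro mult_mono mult_left_mono powr_mono2) auto
          also have "\<dots> \<le> \<eta> * norming a j t"
            using z elim E0[of t] cnt_nonneg[of UNIV "root_frag z" "2 * t"] by (auto simp: ennreal_less_iff)
          finally show "\<bar>level_sum 1 (j - 1) z (t * s) - cc j * (t * s) powr (\<omega> * real j) - norming a j t * lim_path \<omega> j (scaled_count a t (root_frag z)) s\<bar> \<le> \<eta> * norming a j t"
            using red[of z t s] z elim s False unfolding m_def by simp
        qed
      qed
    qed
  qed
qed

end

section \<open>Comparison on a grid and the size of the shift\<close>

context occupancy begin

text \<open>Any exponent strictly between \<open>\<omega> - \<gamma>\<close> and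
  \<open>\<omega>\<close> would serve. The midpoint makes the union bound and the relative drift
  between neighbours both of order \<open>t powr (- \<gamma> / 2)\<close>.\<close>

definition grid_size :: "real \<Rightarrow> nat" where "grid_size t = nat \<lceil>t powr (\<omega> - \<gamma> / 2)\<rceil>"

lemma grid_size_bounds:
  assumes "t \<ge> 1" shows "grid_size t \<ge> 1" "t powr (\<omega> - \<gamma> / 2) \<le> real (grid_size t)" "real (grid_size t) + 1 \<le> 3 * t powr (\<omega> - \<gamma> / 2)"
proof -
  have "t powr (\<omega> - \<gamma> / 2) \<ge> 1" using assms gamma gamma_pos by (intro ge_one_powr_ge_zero) auto
  then show "grid_size t \<ge> 1" "t powr (\<omega> - \<gamma> / 2) \<le> real (grid_size t)" "real (grid_size t) + 1 \<le> 3 * t powr (\<omega> - \<gamma> / 2)"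
    unfolding grid_size_def by linarith+
qed

text \<open>A union bound: of order \<open>t powr (\<omega> - \<gamma> / 2)\<close> points, each
  failing with probability of order \<open>t powr (- \<omega>)\<close>. The points
  \<open>r t i\<close> stay arbitrary in \<open>[0, 2]\<close>; their spacing matters only for the
  sandwich.\<close>

lemma grid_whp:
  assumes j: "j \<ge> 1" and a: "a > 0" and \<eta>: "\<eta> > 0" and r: "\<And>t i. t \<ge> 1 \<Longrightarrow> i \<le> grid_size t \<Longrightarrow> 0 \<le> r t i \<and> r t i \<le> (2::real)"
  shows "whp M at_top (\<lambda>t z. t \<ge> 1 \<longrightarrow> (\<forall>i\<le>grid_size t. \<bar>level_sum j 0 z (t * r t i) - level_sum 1 (j - 1) z (t * r t i)\<bar> < \<eta> * norming a j t))"
proof (cases "j = 1")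
  case True
  have "\<eta> * norming a j t > 0" if "t \<ge> 1" for t using norming_pos[OF a, of t j] \<eta> that by simp
  then have "AE z in M. \<forall>t\<ge>1. \<forall>i\<le>grid_size t. \<bar>level_sum j 0 z (t * r t i) - level_sum 1 (j - 1) z (t * r t i)\<bar> < \<eta> * norming a j t"
    using True by simp
  then show ?thesis by (rule whp_mono[OF M.whp_AE]) simp
next
  case False
  define d where "d = j - 1"
  have d: "j = Suc d" "d \<ge> 1" using j False by (auto simp: d_def)
  let ?E = "2 * \<gamma> + 2 * \<omega> * real d - \<omega>"
  have "\<omega> * 1 \<le> \<omega> * real d" using d pos by (intro mult_left_mono) auto
  then have E: "?E > 0" using gamma_pos pos by linarith
  obtain K where K: "K \<ge> 0" "\<And>u \<eta>. u \<ge> 0 \<Longrightarrow> \<eta> > 0 \<Longrightarrow> \<exists>B\<in>sets M. measure M B \<le> K * (1 + u) powr ?E / \<eta>\<^sup>2 \<and>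
     (\<forall>z\<in>space M - B. \<bar>level_sum (Suc d) 0 z u - level_sum 1 d z u\<bar> < \<eta>)"
    using level_sum_first_level_bad_set[of d 0] by auto
  show ?thesis
  proof (rule M.whp_lim0)
    fix t :: real
    show "\<exists>B\<in>sets M. measure M B \<le> 3 * K * 3 powr ?E / (\<eta>\<^sup>2 * a\<^sup>2 * (cc d)\<^sup>2) * t powr (- \<gamma> / 2) \<and>
      (\<forall>z\<in>space M - B. t \<ge> 1 \<longrightarrow> (\<forall>i\<le>grid_size t. \<bar>level_sum j 0 z (t * r t i) - level_sum 1 (j - 1) z (t * r t i)\<bar> < \<eta> * norming a j t))"
    proof (cases "t \<ge> 1")
      case t: True
      have np: "\<eta> * norming a j t > 0" using norming_pos[OF a, of t j] \<eta> t by simp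
      have "\<exists>B\<in>sets M. measure M B \<le> K * (3 * t) powr ?E / (\<eta> * norming a j t)\<^sup>2 \<and>
        (\<forall>z\<in>space M - B. \<bar>level_sum (Suc d) 0 z (t * r t i) - level_sum 1 d z (t * r t i)\<bar> < \<eta> * norming a j t)" if i: "i \<le> grid_size t" for i
      proof -
        have u: "0 \<le> t * r t i" "t * r t i \<le> 2 * t" using r[OF t i] t by auto
        obtain B where B: "B \<in> sets M" "measure M B \<le> K * (1 + t * r t i) powr ?E / (\<eta> * norming a j t)\<^sup>2"
          "\<forall>z\<in>space M - B. \<bar>level_sum (Suc d) 0 z (t * r t i) - level_sum 1 d z (t * r t i)\<bar> < \<eta> * norming a j t"
          using K(2)[OF u(1) np] by blast
        have "1 + t * r t i \<le> 3 * t" using u t by linarith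
        then have "(1 + t * r t i) powr ?E \<le> (3 * t) powr ?E" using u(1) E by (intro powr_mono2) auto
        then have "K * (1 + t * r t i) powr ?E / (\<eta> * norming a j t)\<^sup>2 \<le> K * (3 * t) powr ?E / (\<eta> * norming a j t)\<^sup>2"
          using K(1) by (intro divide_right_mono mult_left_mono) auto
        then show ?thesis using B by (intro bexI[of _ B]) auto
      qed
      then obtain B where B: "\<And>i. i \<le> grid_size t \<Longrightarrow> B i \<in> sets M" "\<And>i. i \<le> grid_size t \<Longrightarrow> measure M (B i) \<le> K * (3 * t) powr ?E / (\<eta> * norming a j t)\<^sup>2"
        "\<And>i z. i \<le> grid_size t \<Longrightarrow> z \<in> space M - B i \<Longrightarrow> \<bar>level_sum (Suc d) 0 z (t * r t i) - level_sum 1 d z (t * r t i)\<bar> < \<eta> * norming a j t"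
        by metis
      show ?thesis
      proof (intro bexI[of _ "\<Union>i\<in>{..grid_size t}. B i"] conjI ballI impI allI)
        have "measure M (\<Union>i\<in>{..grid_size t}. B i) \<le> (\<Sum>i\<in>{..grid_size t}. measure M (B i))"
          using B(1) by (intro M.finite_measure_subadditive_finite) auto
        also have "\<dots> \<le> (\<Sum>i\<in>{..grid_size t}. K * (3 * t) powr ?E / (\<eta> * norming a j t)\<^sup>2)" using B(2) by (intro sum_mono) auto
        also have "\<dots> = (real (grid_size t) + 1) * (K * (3 * t) powr ?E / (\<eta> * norming a j t)\<^sup>2)" by simp
        also have "\<dots> \<le> 3 * t powr (\<omega> - \<gamma> / 2) * (K * (3 * t) powr ?E / (\<eta> * norming a j t)\<^sup>2)"
          using grid_size_bounds(3)[OF t] K(1) by (intro mult_right_mono) auto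
        also have "\<dots> = 3 * K * 3 powr ?E / (\<eta>\<^sup>2 * a\<^sup>2 * (cc d)\<^sup>2) * t powr (- \<gamma> / 2)"
        proof -
          have 1: "(norming a j t)\<^sup>2 = a\<^sup>2 * (cc d)\<^sup>2 * t powr (2 * (\<gamma> + \<omega> * real d))"
            using t by (simp add: norming_def d power_mult_distrib powr_power mult.commute)
          have 2: "t powr (\<omega> - \<gamma> / 2) * t powr ?E / t powr (2 * (\<gamma> + \<omega> * real d)) = t powr (- \<gamma> / 2)"
            using t by (simp add: powr_add[symmetric] powr_diff[symmetric] algebra_simps)
          have 3: "(3 * t) powr ?E = 3 powr ?E * t powr ?E" using t by (simp add: powr_mult)
          have 4: "3 * T * (K * (h * e) / (E1 * (A1 * A2 * x))) = 3 * K * h / (E1 * A1 * A2) * (T * e / x)" for T h e E1 A1 A2 x :: real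
            by (simp add: mult_ac)
          show ?thesis unfolding power_mult_distrib 1 3 4 2 ..
        qed
        finally show "measure M (\<Union>i\<in>{..grid_size t}. B i) \<le> 3 * K * 3 powr ?E / (\<eta>\<^sup>2 * a\<^sup>2 * (cc d)\<^sup>2) * t powr (- \<gamma> / 2)" .
        fix z i assume "z \<in> space M - (\<Union>i\<in>{..grid_size t}. B i)" "i \<le> grid_size t"
        then show "\<bar>level_sum j 0 z (t * r t i) - level_sum 1 (j - 1) z (t * r t i)\<bar> < \<eta> * norming a j t" using B(3)[of i z] d by auto
      qed (use B in auto)
    next
      case False
      then show ?thesis using K(1) by (intro bexI[of _ "{}"]) auto
    qed
  next
    show "((\<lambda>t. 3 * K * 3 powr ?E / (\<eta>\<^sup>2 * a\<^sup>2 * (cc d)\<^sup>2) * t powr (- \<gamma> / 2)) \<longlongrightarrow> 0) at_top"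
      using gamma_pos by (intro powr_neg_tendsto_0) auto
  qed
qed

lemma margin_asymp:
  assumes j: "j \<ge> 1" and a: "a > 0" and \<eta>: "\<eta> > 0" and \<delta>: "\<delta> > 0" and \<rho>: "\<rho> > 0"
  shows "\<forall>\<^sub>F t in at_top. \<rho> * ln t \<ge> ln 2 \<and> \<rho> * ln t < t \<and> \<rho> * ln t / t < \<delta> / 2 \<and>
    cc j * t powr (\<omega> * real j) * ((\<rho> * ln t / t) powr (\<omega> * real j) + \<omega> * real j * 2 powr (\<omega> * real j) * (\<rho> * ln t / t) + 2 powr (\<omega> * real j) / real (grid_size t)) \<le> \<eta> * norming a j t"
proof -
  let ?p = "\<omega> * real j"
  have p: "?p > 0" using pos j by simp
  have "\<omega> * 1 \<le> \<omega> * real j" using j pos by (intro mult_left_mono) auto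
  then have p\<omega>: "\<omega> \<le> ?p" by simp
  \<comment> \<open>The logarithm will be bounded by \<open>t powr d / d\<close>. The condition
    \<open>d < 1 + \<gamma> - \<omega>\<close> makes the exponent \<open>e2\<close> of the linear
    term negative; \<open>d * \<omega> < \<gamma>\<close> and \<open>d < 1\<close> do this for
    \<open>e1\<close>, whose worst case is \<open>j = 1\<close>.\<close>
  define d where "d = min ((1 + \<gamma> - \<omega>) / 2) (\<gamma> / \<omega> / 2)"
  have d: "d > 0" "d < 1 + \<gamma> - \<omega>" "d * \<omega> < \<gamma>" "d < 1"
  proof -
    show "d > 0" "d < 1 + \<gamma> - \<omega>" using gamma gamma_pos pos by (auto simp: d_def min_less_iff_disj)
    have dd: "d \<le> \<gamma> / \<omega> / 2" by (simp add: d_def)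
    have half: "g / 2 < g" if "0 < g" for g :: real using that by simp
    have "\<gamma> / \<omega> / 2 < \<gamma> / \<omega>" by (rule half) (use gamma_pos pos in simp)
    with dd have "d < \<gamma> / \<omega>" by (rule le_less_trans)
    moreover have "\<gamma> / \<omega> < 1" using gamma gamma_pos pos by auto
    ultimately have "d < \<gamma> / \<omega> \<and> d < 1" by (meson less_trans)
    then show "d * \<omega> < \<gamma>" "d < 1" using pos by (auto simp: field_simps)
  qed
  define k where "k = \<rho> / d"
  have k: "k > 0" using \<rho> d by (simp add: k_def)
  define e1 where "e1 = \<omega> - \<gamma> + (d - 1) * ?p"
  define e2 where "e2 = \<omega> - \<gamma> + (d - 1)"
  have "(d - 1) * ?p \<le> (d - 1) * \<omega>" using d p\<omega> by (intro mult_left_mono_neg) auto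
  then have e: "e1 < 0" "e2 < 0" using d unfolding e1_def e2_def by (auto simp: algebra_simps)
  define bnd where "bnd t = cc j / (a * cc (j - 1)) * (k powr ?p * t powr e1 + ?p * 2 powr ?p * k * t powr e2 + 2 powr ?p * t powr (- \<gamma> / 2))" for t
  have "(bnd \<longlongrightarrow> cc j / (a * cc (j - 1)) * (0 + 0 + 0)) at_top"
    unfolding bnd_def using e gamma_pos by (intro tendsto_intros powr_neg_tendsto_0) auto
  then have ev1: "\<forall>\<^sub>F t in at_top. bnd t < \<eta>" using \<eta> by (intro order_tendstoD) auto
  have "((\<lambda>t. k * t powr (d - 1)) \<longlongrightarrow> 0) at_top" using d by (intro powr_neg_tendsto_0) auto
  then have ev2: "\<forall>\<^sub>F t in at_top. k * t powr (d - 1) < min 1 (\<delta> / 2)" using \<delta> by (intro order_tendstoD) auto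
  have "filterlim (\<lambda>t::real. \<rho> * ln t) at_top at_top"
    using \<rho> by (intro filterlim_tendsto_pos_mult_at_top[OF tendsto_const] ln_at_top) auto
  then have ev3: "\<forall>\<^sub>F t in at_top. \<rho> * ln t \<ge> ln 2" by (simp add: filterlim_at_top)
  show ?thesis
    using ev1 ev2 ev3 eventually_ge_at_top[of 1]
  proof eventually_elim
    case (elim t)
    define \<tau> where "\<tau> = \<rho> * ln t / t"
    have t: "t > 0" using elim by simp
    have \<tau>0: "\<tau> \<ge> 0" using elim \<rho> by (simp add: \<tau>_def)
    have "ln t \<le> t powr d / d" using elim d by (intro ln_powr_bound) auto
    then have "\<rho> * ln t / t \<le> \<rho> * (t powr d / d) / t" using \<rho> t by (intro divide_right_mono mult_left_mono) auto
    also have "\<dots> = k * t powr (d - 1)" using t by (simp add: k_def powr_diff)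
    finally have \<tau>: "\<tau> \<le> k * t powr (d - 1)" by (simp add: \<tau>_def)
    have tn: "t powr ?p = t powr (\<omega> - \<gamma>) / (a * cc (j - 1)) * norming a j t"
      using a cc_pos[of "j - 1"] t by (simp add: norming_def powr_add[symmetric] algebra_simps)
    have "\<tau> powr ?p \<le> (k * t powr (d - 1)) powr ?p" using \<tau> \<tau>0 p by (intro powr_mono2) auto
    also have "\<dots> = k powr ?p * t powr ((d - 1) * ?p)" using k t by (simp add: powr_mult powr_powr)
    finally have b1: "\<tau> powr ?p \<le> k powr ?p * t powr ((d - 1) * ?p)" .
    have b2: "?p * 2 powr ?p * \<tau> \<le> ?p * 2 powr ?p * (k * t powr (d - 1))" using \<tau> p by (intro mult_left_mono) auto
    have b3: "2 powr ?p / real (grid_size t) \<le> 2 powr ?p / t powr (\<omega> - \<gamma> / 2)"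
      using grid_size_bounds(1,2)[of t] elim t by (intro divide_left_mono mult_pos_pos) auto
    have "t powr (\<omega> - \<gamma>) * (\<tau> powr ?p + ?p * 2 powr ?p * \<tau> + 2 powr ?p / real (grid_size t))
      \<le> t powr (\<omega> - \<gamma>) * (k powr ?p * t powr ((d - 1) * ?p) + ?p * 2 powr ?p * (k * t powr (d - 1)) + 2 powr ?p / t powr (\<omega> - \<gamma> / 2))"
      by (rule mult_left_mono[OF add_mono[OF add_mono[OF b1 b2] b3]]) simp
    also have "\<dots> = k powr ?p * t powr e1 + ?p * 2 powr ?p * k * t powr e2 + 2 powr ?p * t powr (- \<gamma> / 2)"
    proof -
      have 1: "t powr (\<omega> - \<gamma>) / t powr (\<omega> - \<gamma> / 2) = t powr (- \<gamma> / 2)" using t by (simp add: powr_diff[symmetric])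
      have 2: "T * (A1 * x1 + B1 * (k1 * x2) + W / X1) = A1 * (T * x1) + B1 * k1 * (T * x2) + W * (T / X1)"
        for T A1 x1 B1 k1 x2 W X1 :: real by (simp add: algebra_simps)
      show ?thesis unfolding 2 1 e1_def e2_def powr_add[of t "\<omega> - \<gamma>"] ..
    qed
    finally have "cc j / (a * cc (j - 1)) * (t powr (\<omega> - \<gamma>) * (\<tau> powr ?p + ?p * 2 powr ?p * \<tau> + 2 powr ?p / real (grid_size t))) \<le> bnd t"
      unfolding bnd_def using a cc_pos by (intro mult_left_mono) (auto intro: less_imp_le)
    then have le: "cc j / (a * cc (j - 1)) * (t powr (\<omega> - \<gamma>) * (\<tau> powr ?p + ?p * 2 powr ?p * \<tau> + 2 powr ?p / real (grid_size t))) \<le> \<eta>"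
      using elim by simp
    have "cc j * t powr ?p * (\<tau> powr ?p + ?p * 2 powr ?p * \<tau> + 2 powr ?p / real (grid_size t)) 
      = cc j / (a * cc (j - 1)) * (t powr (\<omega> - \<gamma>) * (\<tau> powr ?p + ?p * 2 powr ?p * \<tau> + 2 powr ?p / real (grid_size t))) * norming a j t"
      unfolding tn by simp
    also have "\<dots> \<le> \<eta> * norming a j t" using norming_pos[OF a t, of j] by (intro mult_right_mono[OF le]) auto
    finally have "cc j * t powr ?p * (\<tau> powr ?p + ?p * 2 powr ?p * \<tau> + 2 powr ?p / real (grid_size t)) \<le> \<eta> * norming a j t" .
    moreover have "\<tau> < 1" "\<tau> < \<delta> / 2" using \<tau> elim by auto
    then have "\<rho> * ln t < t" using t by (simp add: \<tau>_def)
    ultimately show ?case using elim \<open>\<tau> < \<delta> / 2\<close> unfolding \<tau>_def by simp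
  qed
qed

lemma ln_at_top_seq: "filterlim (\<lambda>n. ln (real n)) at_top sequentially"
  by (rule filterlim_compose[OF ln_at_top filterlim_real_sequentially])

lemma eventually_ln: "eventually P at_top \<Longrightarrow> \<forall>\<^sub>F n in sequentially. P (ln (real n))"
  using ln_at_top_seq unfolding filterlim_iff by blast

text \<open>Four exceptional sets, each of probability below \<open>e / 4\<close>, are collected
  before the sandwich is applied path by path. The equicontinuity \<open>osc\<close> stays a
  hypothesis here because it will come from the first-level limit theorem, whereas the other three
  ingredients concern the scheme alone.\<close>

lemma occupancy_whp:
  assumes j: "j \<ge> 1" and a: "a > 0" and \<eta>: "\<eta> > 0"
    and osc: "\<And>e \<eta>. e > 0 \<Longrightarrow> \<eta> > 0 \<Longrightarrow> \<exists>\<delta>>0. \<forall>\<^sub>F t in at_top. \<exists>B\<in>sets M. measure M B < e \<and>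
      (\<forall>z\<in>space M - B. \<forall>s\<in>{0..2}. \<forall>s'\<in>{0..2}. \<bar>s - s'\<bar> < \<delta> \<longrightarrow> \<bar>lim_path \<omega> j (scaled_count a t (root_frag z)) s - lim_path \<omega> j (scaled_count a t (root_frag z)) s'\<bar> < \<eta>)"
  shows "whp M sequentially (\<lambda>n z. \<forall>s\<in>{0..1}. \<bar>(cum_occupancy X n j s z - cc j * (s * ln (real n)) powr (\<omega> * real j)) / norming a j (ln (real n))
     - lim_path \<omega> j (scaled_count a (ln (real n)) (root_frag z)) s\<bar> \<le> 4 * \<eta>)"
  unfolding whp_def
proof (intro allI impI)
  fix e :: real assume e: "e > 0"
  let ?p = "\<omega> * real j"
  have p: "?p > 0" using pos j by simp
  \<comment> \<open>One more than the growth exponent of \<open>V j\<close>, so that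
    \<open>exp (- x) * V j (3 * t)\<close> with \<open>x = \<rho> * ln t\<close> is of order
    \<open>1 / t\<close>.\<close>
  define \<rho> where "\<rho> = ?p + 1"
  have \<rho>: "\<rho> > 0" using p by (simp add: \<rho>_def)
  have e4: "e / 4 > 0" using e by simp
  from osc[OF e4 \<eta>] obtain \<delta> where \<delta>: "\<delta> > 0" and ev_osc: "\<forall>\<^sub>F t in at_top. \<exists>B\<in>sets M. measure M B < e / 4 \<and>
      (\<forall>z\<in>space M - B. \<forall>s\<in>{0..2}. \<forall>s'\<in>{0..2}. \<bar>s - s'\<bar> < \<delta> \<longrightarrow> \<bar>lim_path \<omega> j (scaled_count a t (root_frag z)) s - lim_path \<omega> j (scaled_count a t (root_frag z)) s'\<bar> < \<eta>)" by blast
  define r where "r t i = 2 * (real i / real (grid_size t)) powr (1 / ?p)" for t and i :: nat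
  have r: "0 \<le> r t i \<and> r t i \<le> 2" if "t \<ge> 1" "i \<le> grid_size t" for t i
  proof -
    have "(real i / real (grid_size t)) powr (1 / ?p) \<le> 1 powr (1 / ?p)" using that grid_size_bounds(1)[OF that(1)] p by (intro powr_mono2) auto
    then show ?thesis by (simp add: r_def)
  qed
  have ev_first: "\<forall>\<^sub>F t in at_top. \<exists>B\<in>sets M. measure M B < e / 4 \<and> (\<forall>z\<in>space M - B. good z \<and> (\<forall>s\<in>{0..2}. \<bar>level_sum 1 (j - 1) z (t * s) - cc j * (t * s) powr (\<omega> * real j) - norming a j t * lim_path \<omega> j (scaled_count a t (root_frag z)) s\<bar> \<le> \<eta> * norming a j t))"
    by (rule whpD[OF first_level_whp[OF j a \<eta>] e4])
  have ev_grid: "\<forall>\<^sub>F t in at_top. \<exists>B\<in>sets M. measure M B < e / 4 \<and> (\<forall>z\<in>space M - B. t \<ge> 1 \<longrightarrow> (\<forall>i\<le>grid_size t. \<bar>level_sum j 0 z (t * r t i) - level_sum 1 (j - 1) z (t * r t i)\<bar> < \<eta> * norming a j t))"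
    by (rule whpD[OF grid_whp[OF j a \<eta> r] e4])
  obtain C where C: "C \<ge> 0" "\<And>n x. n \<ge> 1 \<Longrightarrow> x \<ge> ln 2 \<Longrightarrow> \<exists>B\<in>sets M. measure M B \<le> 5 * exp (-x) * V j (3 * ln (real n)) + C * real n powr (- 1 / 2) \<and>
    (\<forall>z\<in>space M - B. good z \<and> (\<forall>s\<in>{0..1}. level_sum j 0 z (max 0 (s * ln (real n) - x)) \<le> cum_occupancy X n j s z
       \<and> cum_occupancy X n j s z \<le> level_sum j 0 z (s * ln (real n) + x)))"
    using occupancy_bad_set[OF j] by blast
  obtain D where D: "D \<ge> 0" "\<And>x. x \<ge> 0 \<Longrightarrow> V j x \<le> D * (1 + x) powr ?p" using V_upper[of j] by blast
  have "((\<lambda>t. 5 * D * 4 powr ?p * t powr (- 1)) \<longlongrightarrow> 0) at_top" by (intro powr_neg_tendsto_0) auto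
  then have "\<forall>\<^sub>F t in at_top. 5 * D * 4 powr ?p * t powr (- 1) < e / 8" using e by (intro order_tendstoD) auto
  then have ev_V: "\<forall>\<^sub>F t in at_top. 5 * exp (- (\<rho> * ln t)) * V j (3 * t) < e / 8"
    using eventually_ge_at_top[of 1]
  proof eventually_elim
    case (elim t)
    have "exp (- (\<rho> * ln t)) = t powr (- \<rho>)" using elim by (simp add: powr_def)
    moreover have "V j (3 * t) \<le> D * (4 * t) powr ?p"
      using elim D p by (intro order_trans[OF D(2)] mult_left_mono powr_mono2) auto
    ultimately have "5 * exp (- (\<rho> * ln t)) * V j (3 * t) \<le> 5 * t powr (- \<rho>) * (D * (4 * t) powr ?p)" by (auto intro: mult_left_mono)
    also have "\<dots> = 5 * D * 4 powr ?p * (t powr (- \<rho>) * t powr ?p)" using elim by (simp add: powr_mult)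
    also have "t powr (- \<rho>) * t powr ?p = t powr (- 1)" by (simp add: powr_add[symmetric] \<rho>_def)
    finally show ?case using elim by simp
  qed
  have "((\<lambda>t. C * t powr (- 1 / 2)) \<longlongrightarrow> 0) at_top" by (intro powr_neg_tendsto_0) auto
  then have "((\<lambda>n. C * real n powr (- 1 / 2)) \<longlongrightarrow> 0) sequentially"
    by (rule filterlim_compose) (rule filterlim_real_sequentially)
  then have ev_C: "\<forall>\<^sub>F n in sequentially. C * real n powr (- 1 / 2) < e / 8" using e by (intro order_tendstoD) auto
  obtain G0 where G0: "\<And>G i. G \<ge> G0 \<Longrightarrow> i < G \<Longrightarrow> 2 * (real (Suc i) / real G) powr (1 / ?p) - 2 * (real i / real G) powr (1 / ?p) < \<delta> / 2"
    using powr_grid_gap[OF p, of "\<delta> / 2"] \<delta> by auto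
  have ev_G: "\<forall>\<^sub>F t in at_top. real G0 \<le> t powr (\<omega> - \<gamma> / 2)"
    using eventually_ge_at_top[of "real G0 powr (1 / (\<omega> - \<gamma> / 2))"]
  proof eventually_elim
    case (elim t)
    then have "(real G0 powr (1 / (\<omega> - \<gamma> / 2))) powr (\<omega> - \<gamma> / 2) \<le> t powr (\<omega> - \<gamma> / 2)"
      using gamma gamma_pos by (intro powr_mono2) auto
    moreover have "\<omega> - \<gamma> / 2 \<noteq> 0" using gamma gamma_pos by simp
    ultimately show ?case by (simp add: powr_powr)
  qed
  show "\<forall>\<^sub>F n in sequentially. \<exists>B\<in>sets M. M.prob B < e \<and>
     (\<forall>z\<in>space M - B. \<forall>s\<in>{0..1}. \<bar>(cum_occupancy X n j s z - cc j * (s * ln (real n)) powr (\<omega> * real j)) / norming a j (ln (real n))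
     - lim_path \<omega> j (scaled_count a (ln (real n)) (root_frag z)) s\<bar> \<le> 4 * \<eta>)"
    using eventually_ln[OF ev_osc] eventually_ln[OF ev_first] eventually_ln[OF ev_grid] eventually_ln[OF ev_V] ev_C
      eventually_ln[OF ev_G] eventually_ln[OF margin_asymp[OF j a \<eta> \<delta> \<rho>]] eventually_ln[OF eventually_ge_at_top[of 1]] eventually_ge_at_top[of 1]
  proof eventually_elim
    case (elim n)
    define t where "t = ln (real n)"
    define x where "x = \<rho> * ln t"
    note el = elim[folded t_def]
    have t1: "t \<ge> 1" using el by simp
    obtain B1 where B1: "B1 \<in> sets M" "measure M B1 < e / 4" 
      "\<forall>z\<in>space M - B1. \<forall>s\<in>{0..2}. \<forall>s'\<in>{0..2}. \<bar>s - s'\<bar> < \<delta> \<longrightarrow> \<bar>lim_path \<omega> j (scaled_count a t (root_frag z)) s - lim_path \<omega> j (scaled_count a t (root_frag z)) s'\<bar> < \<eta>"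
      using el(1) by (elim bexE conjE) (rule that)
    obtain B2 where B2: "B2 \<in> sets M" "measure M B2 < e / 4" "\<And>z. z \<in> space M - B2 \<Longrightarrow> good z"
      "\<And>z s. z \<in> space M - B2 \<Longrightarrow> s \<in> {0..2} \<Longrightarrow> \<bar>level_sum 1 (j - 1) z (t * s) - cc j * (t * s) powr (\<omega> * real j) - norming a j t * lim_path \<omega> j (scaled_count a t (root_frag z)) s\<bar> \<le> \<eta> * norming a j t"
      using el(2) by blast
    obtain B3 where B3: "B3 \<in> sets M" "measure M B3 < e / 4"
      "\<And>z i. z \<in> space M - B3 \<Longrightarrow> i \<le> grid_size t \<Longrightarrow> \<bar>level_sum j 0 z (t * r t i) - level_sum 1 (j - 1) z (t * r t i)\<bar> < \<eta> * norming a j t"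
      using el(3) t1 by blast
    have "x \<ge> ln 2" using el by (simp add: x_def)
    have n1: "n \<ge> 1" using el(9) .
    obtain B4 where B4: "B4 \<in> sets M" "measure M B4 \<le> 5 * exp (-x) * V j (3 * t) + C * real n powr (- 1 / 2)"
      "\<forall>z\<in>space M - B4. good z \<and> (\<forall>s\<in>{0..1}. level_sum j 0 z (max 0 (s * t - x)) \<le> cum_occupancy X n j s z \<and> cum_occupancy X n j s z \<le> level_sum j 0 z (s * t + x))"
      using C(2)[OF n1 \<open>x \<ge> ln 2\<close>] unfolding t_def[symmetric] by (elim bexE conjE) (rule that)
    have c1: "5 * exp (-x) * V j (3 * t) < e / 8" using el(4) by (simp only: x_def)
    have "measure M B4 < e / 8 + e / 8"
      by (rule le_less_trans[OF B4(2)], rule add_strict_mono[OF c1 el(5)])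
    then have m4: "measure M B4 < e / 4" by simp
    show ?case
    proof (intro bexI[of _ "B1 \<union> B2 \<union> B3 \<union> B4"] conjI ballI)
      have "measure M (B1 \<union> B2 \<union> B3 \<union> B4) \<le> measure M B1 + measure M B2 + measure M B3 + measure M B4"
        using B1(1) B2(1) B3(1) B4(1) by (intro order_trans[OF measure_Un_le] add_mono) auto
      then show "M.prob (B1 \<union> B2 \<union> B3 \<union> B4) < e" using B1(2) B2(2) B3(2) m4 by linarith
      fix z s assume z: "z \<in> space M - (B1 \<union> B2 \<union> B3 \<union> B4)" and s: "s \<in> {0..1::real}"
      have g: "good z" using B2(3) z by blast
      show "\<bar>(cum_occupancy X n j s z - cc j * (s * ln (real n)) powr (\<omega> * real j)) / norming a j (ln (real n))
        - lim_path \<omega> j (scaled_count a (ln (real n)) (root_frag z)) s\<bar> \<le> 4 * \<eta>"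
        unfolding t_def[symmetric]
      proof (rule monotone_sandwich[where F = "level_sum j 0 z" and K = "\<lambda>s. cum_occupancy X n j s z" and \<Phi> = "lim_path \<omega> j (scaled_count a t (root_frag z))" and G = "grid_size t" and \<delta> = \<delta> and x = x])
        show "mono (level_sum j 0 z)" unfolding level_sum_def level_mean_0 by (rule cnt_mono[OF subprob_words[OF g]])
        show "0 < t" using t1 by simp
        show "1 \<le> grid_size t" using grid_size_bounds t1 by blast
        show "0 < norming a j t" using norming_pos a t1 by simp
        show "0 \<le> cc j" using cc_pos[of j] by simp
        show "0 \<le> x" using \<open>x \<ge> ln 2\<close> ln_gt_zero[of 2] by linarith
        show "x < t" "x / t < \<delta> / 2" 
          "cc j * t powr ?p * ((x / t) powr ?p + ?p * 2 powr ?p * (x / t) + 2 powr ?p / real (grid_size t)) \<le> \<eta> * norming a j t"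
          using el by (auto simp: x_def)
        show "\<bar>level_sum j 0 z (t * (2 * (real i / real (grid_size t)) powr (1 / ?p))) - cc j * (t * (2 * (real i / real (grid_size t)) powr (1 / ?p))) powr ?p
          - norming a j t * lim_path \<omega> j (scaled_count a t (root_frag z)) (2 * (real i / real (grid_size t)) powr (1 / ?p))\<bar> \<le> 2 * \<eta> * norming a j t" if "i \<le> grid_size t" for i
        proof -
          have "r t i \<in> {0..2}" using r[OF t1 that] by auto
          then show ?thesis using B3(3)[of z i] B2(4)[of z "r t i"] z that unfolding r_def[symmetric] by auto
        qed
        have "real G0 \<le> real (grid_size t)" using el(6) grid_size_bounds(2)[OF t1] by linarith
        then show "2 * (real (Suc i) / real (grid_size t)) powr (1 / ?p) - 2 * (real i / real (grid_size t)) powr (1 / ?p) < \<delta> / 2" if "i < grid_size t" for i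
          using G0[of "grid_size t" i] that by auto
        show "\<And>s. s \<in> {0..1} \<Longrightarrow> level_sum j 0 z (max 0 (s * t - x)) \<le> cum_occupancy X n j s z"
          "\<And>s. s \<in> {0..1} \<Longrightarrow> cum_occupancy X n j s z \<le> level_sum j 0 z (s * t + x)"
          using B4(3) z by simp_all
        show "\<And>s s'. s \<in> {0..2} \<Longrightarrow> s' \<in> {0..2} \<Longrightarrow> \<bar>s - s'\<bar> < \<delta> \<Longrightarrow> \<bar>lim_path \<omega> j (scaled_count a t (root_frag z)) s - lim_path \<omega> j (scaled_count a t (root_frag z)) s'\<bar> < \<eta>"
          using B1(3) z by simp
      qed (use p s in auto)
    qed (use B1 B2 B3 B4 in auto)
  qed
qed

end

section \<open>Tools for the Skorokhod topology\<close>

text \<open>Rational coefficients make the family countable; the division by \<open>3\<close> moves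
  the Bernstein basis from \<open>[0, 1]\<close> to \<open>[0, 3]\<close>.\<close>

definition rat_bernstein :: "rat list \<Rightarrow> real \<Rightarrow> real" where
  "rat_bernstein rs x = (\<Sum>k\<le>length rs - 1. of_rat (rs ! k) * Bernstein (length rs - 1) k (x / 3))"

lemma rat_bernstein_continuous: "continuous_on UNIV (rat_bernstein rs)"
  unfolding rat_bernstein_def Bernstein_def by (intro continuous_intros) auto

text \<open>The Bernstein basis is a nonnegative partition of unity, so rounding the coefficients
  moves the polynomial by no more than the largest rounding error.\<close>

lemma rat_bernstein_dense:
  assumes w: "continuous_on UNIV w" and \<delta>: "\<delta> > 0"
  shows "\<exists>rs. \<forall>x\<in>{0..3}. \<bar>w x - rat_bernstein rs x\<bar> < \<delta>"
proof -
  have c: "continuous_on {0..1} (\<lambda>x. w (3 * x))"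
    using continuous_on_subset[OF w] by (intro continuous_on_compose2[OF w] continuous_intros) auto
  have "\<delta> / 2 > 0" using \<delta> by simp
  from Bernstein_Weierstrass[OF c this] obtain n where
    n: "\<And>x. x \<in> {0..1} \<Longrightarrow> \<bar>w (3 * x) - (\<Sum>k\<le>n. w (3 * (k/n)) * Bernstein n k x)\<bar> < \<delta> / 2" by blast
  have "\<exists>r. \<bar>w (3 * (real k / real n)) - real_of_rat r\<bar> < \<delta> / 2" for k
  proof -
    obtain r where "w (3 * (real k / real n)) - \<delta> / 2 < real_of_rat r" "real_of_rat r < w (3 * (real k / real n)) + \<delta> / 2"
      using of_rat_dense[of "w (3 * (real k / real n)) - \<delta> / 2" "w (3 * (real k / real n)) + \<delta> / 2"] \<delta> by auto
    then show ?thesis by (intro exI[of _ r]) linarith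
  qed
  then obtain r where r: "\<And>k. \<bar>w (3 * (real k / real n)) - real_of_rat (r k)\<bar> < \<delta> / 2" by metis
  define rs where "rs = map r [0..<Suc n]"
  have rs: "length rs - 1 = n" "\<And>k. k \<le> n \<Longrightarrow> rs ! k = r k" by (auto simp: rs_def simp del: upt_Suc)
  have "\<bar>w x - rat_bernstein rs x\<bar> < \<delta>" if x: "x \<in> {0..3}" for x
  proof -
    have x3: "x / 3 \<in> {0..1}" using x by auto
    have "\<bar>(\<Sum>k\<le>n. w (3 * (k/n)) * Bernstein n k (x / 3)) - rat_bernstein rs x\<bar>
       = \<bar>\<Sum>k\<le>n. (w (3 * (k/n)) - real_of_rat (r k)) * Bernstein n k (x / 3)\<bar>"
      unfolding rat_bernstein_def rs(1) by (simp add: rs(2) sum_subtractf[symmetric] left_diff_distrib)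
    also have "\<dots> \<le> (\<Sum>k\<le>n. \<bar>w (3 * (k/n)) - real_of_rat (r k)\<bar> * Bernstein n k (x / 3))"
      using x3 by (intro order_trans[OF sum_abs] sum_mono) (auto simp: abs_mult Bernstein_nonneg)
    also have "\<dots> \<le> (\<Sum>k\<le>n. (\<delta> / 2) * Bernstein n k (x / 3))"
      using x3 r by (intro sum_mono mult_right_mono) (auto simp: Bernstein_nonneg intro: less_imp_le)
    also have "\<dots> = \<delta> / 2" by (simp only: sum_distrib_left[symmetric] sum_Bernstein)
    finally have "\<bar>(\<Sum>k\<le>n. w (3 * (k/n)) * Bernstein n k (x / 3)) - rat_bernstein rs x\<bar> \<le> \<delta> / 2" .
    moreover have "\<bar>w x - (\<Sum>k\<le>n. w (3 * (k/n)) * Bernstein n k (x / 3))\<bar> < \<delta> / 2" using n[OF x3] by simp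
    ultimately show ?thesis by linarith
  qed
  then show ?thesis by blast
qed

text \<open>The start value \<open>0\<close> suits the nonnegative functions to which it is applied.
  Finite maxima preserve continuity, and their suprema are reached by monotone limits.\<close>

primrec rmax :: "(nat \<Rightarrow> real) \<Rightarrow> nat \<Rightarrow> real" where
  "rmax f 0 = 0"
| "rmax f (Suc n) = max (rmax f n) (f n)"

lemma rmax_nonneg: "0 \<le> rmax f n"
  by (induction n) auto

lemma rmax_ge: "l < n \<Longrightarrow> f l \<le> rmax f n"
  by (induction n) (auto simp: less_Suc_eq le_max_iff_disj)

lemma rmax_le: "0 \<le> B \<Longrightarrow> (\<And>l. l < n \<Longrightarrow> f l \<le> B) \<Longrightarrow> rmax f n \<le> B"
  by (induction n) auto

lemma rmax_mono: "(\<And>l. l < n \<Longrightarrow> f l \<le> g l) \<Longrightarrow> rmax f n \<le> rmax g n"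
proof (induction n)
  case (Suc n)
  then show ?case unfolding rmax.simps by (intro max.mono) auto
qed simp

lemma rmax_incseq: "incseq (rmax f)"
  by (rule incseq_SucI) simp

lemma rmax_measurable [measurable (raw)]:
  "(\<And>l. (\<lambda>x. f x l) \<in> borel_measurable M) \<Longrightarrow> (\<lambda>x. rmax (f x) n) \<in> borel_measurable M"
  by (induction n) auto

lemma rmax_continuous_map:
  "(\<And>l. continuous_map T euclideanreal (\<lambda>x. f x l)) \<Longrightarrow> continuous_map T euclideanreal (\<lambda>x. rmax (f x) n)"
  by (induction n) (auto intro: continuous_map_real_max)

text \<open>The cap at \<open>1\<close> makes the supremum meaningful for arbitrary, possibly
  unbounded paths; it does not matter for tubes of radius at most \<open>1\<close>.\<close>

definition unif_dev :: "(real \<Rightarrow> real) \<Rightarrow> (real \<Rightarrow> real) \<Rightarrow> real \<Rightarrow> real" where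
  "unif_dev w y T = (SUP s\<in>{0..T}. min 1 \<bar>y s - w s\<bar>)"

lemma unif_dev_bdd:
  fixes y w :: "real \<Rightarrow> real"
  shows "bdd_above ((\<lambda>s. min 1 \<bar>y s - w s\<bar>) ` {0..T::real})"
  by (rule bdd_aboveI2[of _ _ 1]) simp

lemma unif_dev_upper: "s \<in> {0..T} \<Longrightarrow> min 1 \<bar>y s - w s\<bar> \<le> unif_dev w y T"
  unfolding unif_dev_def by (rule cSUP_upper[OF _ unif_dev_bdd])

lemma unif_dev_least: "T \<ge> 0 \<Longrightarrow> (\<And>s. s \<in> {0..T} \<Longrightarrow> min 1 \<bar>y s - w s\<bar> \<le> B) \<Longrightarrow> unif_dev w y T \<le> B"
  unfolding unif_dev_def by (rule cSUP_least) auto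

lemma unif_dev_bounds: "T \<ge> 0 \<Longrightarrow> 0 \<le> unif_dev w y T" "T \<ge> 0 \<Longrightarrow> unif_dev w y T \<le> 1"
  subgoal using unif_dev_upper[of 0 T y w] by auto
  subgoal by (rule unif_dev_least) simp_all
  done

lemma unif_dev_mono: "0 \<le> T \<Longrightarrow> T \<le> T' \<Longrightarrow> unif_dev w y T \<le> unif_dev w y T'"
  by (rule unif_dev_least) (auto intro: unif_dev_upper)

text \<open>
  The uniform distance on a fixed interval is not continuous in the \<open>J\<^sub>1\<close>-topology since a path may jump near the end
  point.  Minimizing over the end point with a penalty of slope one makes it continuous, because a time change
  close to the identity moves the end point only a little.
\<close>

definition soft_dev :: "(real \<Rightarrow> real) \<Rightarrow> (real \<Rightarrow> real) \<Rightarrow> real" where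
  "soft_dev w y = (INF T\<in>{2..3}. max (unif_dev w y T) (3 - T))"

lemma soft_dev_lower: "T \<in> {2..3} \<Longrightarrow> soft_dev w y \<le> max (unif_dev w y T) (3 - T)"
  unfolding soft_dev_def by (rule cINF_lower) (auto intro!: bdd_belowI2[of _ 0] simp: le_max_iff_disj)

lemma soft_dev_greatest: "(\<And>T. T \<in> {2..3} \<Longrightarrow> B \<le> max (unif_dev w y T) (3 - T)) \<Longrightarrow> B \<le> soft_dev w y"
  unfolding soft_dev_def by (rule cINF_greatest) auto

lemma soft_dev_le: "soft_dev w y \<le> unif_dev w y 3"
  using soft_dev_lower[of 3 w y] unif_dev_bounds(1)[of 3 w y] by simp

lemma soft_dev_le_1: "soft_dev w y \<le> 1"
  using soft_dev_le[of w y] unif_dev_bounds(2)[of 3 w y] by simp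

lemma soft_dev_ge: "unif_dev w y 2 \<le> soft_dev w y"
  by (rule soft_dev_greatest) (auto simp: le_max_iff_disj intro: unif_dev_mono)

lemma soft_dev_cong: "(\<And>s. s \<in> {0..3} \<Longrightarrow> y s = y' s) \<Longrightarrow> soft_dev w y = soft_dev w y'"
  unfolding soft_dev_def unif_dev_def
  by (intro INF_cong refl arg_cong2[where f = max] SUP_cong) auto

lemma soft_dev_shift:
  assumes e: "0 \<le> e" "e \<le> 1" and "\<kappa> \<ge> 0"
    and le: "\<And>T. T \<in> {2..3} \<Longrightarrow> T - e \<ge> 2 \<Longrightarrow> unif_dev w y (T - e) \<le> unif_dev w y' T + \<kappa>"
  shows "soft_dev w y \<le> soft_dev w y' + (e + \<kappa>)"
proof -
  have "soft_dev w y - (e + \<kappa>) \<le> soft_dev w y'"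
  proof (rule soft_dev_greatest)
    fix T :: real assume T: "T \<in> {2..3}"
    show "soft_dev w y - (e + \<kappa>) \<le> max (unif_dev w y' T) (3 - T)"
    proof (cases "T - e \<ge> 2")
      case True
      then have "soft_dev w y \<le> max (unif_dev w y (T - e)) (3 - (T - e))" using T e by (intro soft_dev_lower) auto
      also have "\<dots> \<le> max (unif_dev w y' T + \<kappa>) (3 - T + e)" using le[OF T True] by (auto simp: le_max_iff_disj)
      also have "\<dots> \<le> max (unif_dev w y' T) (3 - T) + (e + \<kappa>)" using e assms(3) by (auto simp: max_def)
      finally show ?thesis by simp
    next
      \<comment> \<open>An end point that would fall below \<open>2\<close> already carries a
        penalty above \<open>1 - e\<close>, and \<open>soft_dev\<close> never exceeds
        \<open>1\<close>.\<close>
      case False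
      then have "1 - e \<le> 3 - T" by simp
      then show ?thesis using soft_dev_le_1[of w y] assms(3) by (simp add: le_max_iff_disj)
    qed
  qed
  then show ?thesis by simp
qed

text \<open>A time change moves end points by less than \<open>e\<close>, which costs
  \<open>e\<close> in the penalty, and moves the reference path \<open>w\<close> by its modulus of
  continuity. The horizon \<open>4\<close> leaves room around end points up to \<open>3\<close>;
  \<open>w\<close> is controlled on \<open>[0, 5]\<close> because \<open>\<tau>\<close> may pass
  \<open>4\<close>.\<close>

lemma soft_dev_J1:
  assumes w: "continuous_on UNIV w" and \<delta>: "\<delta> > 0"
  shows "\<exists>e>0. \<forall>g\<in>J1_nbhd {0..} y e 4. \<bar>soft_dev w g - soft_dev w y\<bar> < \<delta>"
proof -
  have "uniformly_continuous_on {0..5} w"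
    by (intro compact_uniformly_continuous continuous_on_subset[OF w]) auto
  moreover have "\<delta> / 4 > 0" using \<delta> by simp
  ultimately obtain d where d: "d > 0" "\<And>x x'. x \<in> {0..5} \<Longrightarrow> x' \<in> {0..5} \<Longrightarrow> dist x' x < d \<Longrightarrow> dist (w x') (w x) < \<delta> / 4"
    unfolding uniformly_continuous_on_def by meson
  define e where "e = min (min (d / 2) (\<delta> / 8)) (1 / 2)"
  have e: "e > 0" "e \<le> 1/2" "e < d" "e \<le> \<delta> / 8" using d(1) \<delta> by (auto simp: e_def)
  define \<kappa> where "\<kappa> = e + \<delta> / 4"
  have k: "\<kappa> \<ge> 0" using e \<delta> by (simp add: \<kappa>_def)
  show ?thesis
  proof (intro exI[of _ e] conjI ballI e(1))
    fix g assume "g \<in> J1_nbhd {0..} y e 4"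
    then obtain \<tau> where \<tau>: "strict_mono_on {0..} \<tau>" "bij_betw \<tau> {0..} {0..}" "\<And>s. s \<ge> 0 \<Longrightarrow> \<bar>\<tau> s - s\<bar> < e"
      "\<And>s. s \<ge> 0 \<Longrightarrow> s \<le> 4 \<Longrightarrow> \<bar>g (\<tau> s) - y s\<bar> < e"
      unfolding J1_nbhd_def time_changes_def by auto
    have \<tau>0: "\<tau> s \<ge> 0" if "s \<ge> 0" for s using bij_betwE[OF \<tau>(2)] that by auto
    have key: "\<bar>(g (\<tau> s) - w (\<tau> s)) - (y s - w s)\<bar> \<le> \<kappa>" if s: "s \<ge> 0" "s \<le> 4" for s
    proof -
      have "dist (w (\<tau> s)) (w s) < \<delta> / 4" 
        using s \<tau>0[OF s(1)] \<tau>(3)[OF s(1)] e by (intro d(2)) (auto simp: dist_real_def)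
      then show ?thesis using \<tau>(4)[OF s] unfolding \<kappa>_def dist_real_def by linarith
    qed
    have "soft_dev w g \<le> soft_dev w y + (e + \<kappa>)"
    proof (rule soft_dev_shift[OF _ _ k])
      fix T assume T: "T \<in> {2..3}" "T - e \<ge> (2::real)"
      show "unif_dev w g (T - e) \<le> unif_dev w y T + \<kappa>"
      proof (rule unif_dev_least)
        fix r assume r: "r \<in> {0..T - e}"
        then obtain s where s: "s \<ge> 0" "r = \<tau> s" using \<tau>(2) unfolding bij_betw_def by force
        have "s \<le> T" using \<tau>(3)[OF s(1)] s r by auto
        then have "min 1 \<bar>y s - w s\<bar> \<le> unif_dev w y T" using s by (intro unif_dev_upper) auto
        moreover have "\<bar>(g r - w r) - (y s - w s)\<bar> \<le> \<kappa>" using key[of s] s \<open>s \<le> T\<close> T by auto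
        ultimately show "min 1 \<bar>g r - w r\<bar> \<le> unif_dev w y T + \<kappa>" using k by linarith
      qed (use T in auto)
    qed (use e in auto)
    moreover have "soft_dev w y \<le> soft_dev w g + (e + \<kappa>)"
    proof (rule soft_dev_shift[OF _ _ k])
      fix T assume T: "T \<in> {2..3}" "T - e \<ge> (2::real)"
      show "unif_dev w y (T - e) \<le> unif_dev w g T + \<kappa>"
      proof (rule unif_dev_least)
        fix s assume s: "s \<in> {0..T - e}"
        have "\<tau> s \<in> {0..T}" using \<tau>(3)[of s] \<tau>0[of s] s by auto
        then have "min 1 \<bar>g (\<tau> s) - w (\<tau> s)\<bar> \<le> unif_dev w g T" by (rule unif_dev_upper)
        moreover have "\<bar>(g (\<tau> s) - w (\<tau> s)) - (y s - w s)\<bar> \<le> \<kappa>" using key[of s] s e T by auto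
        ultimately show "min 1 \<bar>y s - w s\<bar> \<le> unif_dev w g T + \<kappa>" using k by linarith
      qed (use T in auto)
    qed (use e in auto)
    moreover have "e + \<kappa> < \<delta>" using e \<delta> by (simp add: \<kappa>_def)
    ultimately show "\<bar>soft_dev w g - soft_dev w y\<bar> < \<delta>" by linarith
  qed
qed

lemma soft_dev_continuous_map:
  assumes "continuous_on UNIV w"
  shows "continuous_map (J1_topology {0..}) euclideanreal (soft_dev w)"
  unfolding continuous_map_def
proof (intro conjI allI impI)
  fix U :: "real set" assume "openin euclidean U"
  then have U: "open U" by simp
  show "openin (J1_topology {0..}) {x \<in> topspace (J1_topology {0..}). soft_dev w x \<in> U}"
    unfolding openin_J1_topology
  proof (intro conjI ballI)
    fix y assume "y \<in> {x \<in> topspace (J1_topology {0..}). soft_dev w x \<in> U}"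
    then obtain \<delta> where \<delta>: "\<delta> > 0" "ball (soft_dev w y) \<delta> \<subseteq> U" using U by (auto simp: open_contains_ball)
    obtain e where e: "e > 0" "\<And>g. g \<in> J1_nbhd {0..} y e 4 \<Longrightarrow> \<bar>soft_dev w g - soft_dev w y\<bar> < \<delta>"
      using soft_dev_J1[OF assms \<delta>(1), of y] by blast
    have "J1_nbhd {0..} y e 4 \<subseteq> {x \<in> topspace (J1_topology {0..}). soft_dev w x \<in> U}"
    proof
      fix g assume g: "g \<in> J1_nbhd {0..} y e 4"
      then have "soft_dev w g \<in> ball (soft_dev w y) \<delta>" using e(2) by (simp add: dist_real_def abs_minus_commute)
      then show "g \<in> {x \<in> topspace (J1_topology {0..}). soft_dev w x \<in> U}" using g \<delta>(2) by (auto simp: J1_nbhd_def)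
    qed
    then show "\<exists>e>0. \<exists>T. J1_nbhd {0..} y e T \<subseteq> {x \<in> topspace (J1_topology {0..}). soft_dev w x \<in> U}" using e(1) by blast
  qed auto
qed auto

section \<open>Measurability and one-sided weak limits\<close>

lemma borel_of_topology_measurable_continuous:
  assumes f: "continuous_map T euclideanreal f"
  shows "f \<in> borel_measurable (borel_of_topology T)"
proof (rule borel_measurableI)
  fix U :: "real set" assume "open U"
  then have "openin T {x \<in> topspace T. f x \<in> U}" using f by (auto simp: continuous_map_def)
  moreover have "{U. openin T U} \<subseteq> Pow (topspace T)" by (auto dest: openin_subset)
  moreover have "f -` U \<inter> topspace T = {x \<in> topspace T. f x \<in> U}" by auto
  ultimately show "f -` U \<inter> space (borel_of_topology T) \<in> sets (borel_of_topology T)"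
    unfolding borel_of_topology_def by (simp add: sets_measure_of)
qed

lemma space_borel_of_topology [simp]: "space (borel_of_topology T) = topspace T"
  unfolding borel_of_topology_def by (rule space_measure_of) (auto dest: openin_subset)

lemma measurable_borel_of_topologyI:
  assumes "\<And>x. x \<in> space M \<Longrightarrow> f x \<in> topspace T" "\<And>U. openin T U \<Longrightarrow> f -` U \<inter> space M \<in> sets M"
  shows "f \<in> M \<rightarrow>\<^sub>M borel_of_topology T"
  unfolding borel_of_topology_def
  by (rule measurable_measure_of) (use assms in \<open>auto dest: openin_subset\<close>)

lemma closed_event_rational:
  fixes f :: "real \<Rightarrow> real"
  assumes "continuous_on UNIV f" "a < b"
  shows "(\<forall>s\<in>{a..b}. \<bar>f s\<bar> \<le> \<eta>) \<longleftrightarrow> (\<forall>s\<in>{a..b} \<inter> \<rat>. \<bar>f s\<bar> \<le> \<eta>)"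
proof (intro iffI)
  assume r: "\<forall>s\<in>{a..b} \<inter> \<rat>. \<bar>f s\<bar> \<le> \<eta>"
  show "\<forall>s\<in>{a..b}. \<bar>f s\<bar> \<le> \<eta>"
  proof (rule ccontr)
    assume "\<not> (\<forall>s\<in>{a..b}. \<bar>f s\<bar> \<le> \<eta>)"
    then obtain s where s: "s \<in> {a..b}" "s \<in> {s. \<eta> < \<bar>f s\<bar>}" by (auto simp: not_le)
    have o: "open {s. \<eta> < \<bar>f s\<bar>}" using assms(1) by (intro open_Collect_less continuous_intros) auto
    have "s \<in> closure {a<..<b}" using s assms(2) by simp
    then have "{s. \<eta> < \<bar>f s\<bar>} \<inter> {a<..<b} \<noteq> {}" using open_Int_closure_eq_empty[OF o] s by blast
    then obtain x where x: "x \<in> {s. \<eta> < \<bar>f s\<bar>} \<inter> {a<..<b}" by blast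
    moreover have "open ({s. \<eta> < \<bar>f s\<bar>} \<inter> {a<..<b})" using o by auto
    ultimately obtain d where d: "d > 0" "ball x d \<subseteq> {s. \<eta> < \<bar>f s\<bar>} \<inter> {a<..<b}" by (meson open_contains_ball)
    obtain q where q: "q \<in> \<rat>" "x < q" "q < x + d" using Rats_dense_in_real[of x "x + d"] d by auto
    then have "q \<in> ball x d" by (simp add: dist_real_def)
    then have "q \<in> {a..b} \<inter> \<rat>" "\<eta> < \<bar>f q\<bar>" using d(2) q by auto
    moreover from this(1) have "\<bar>f q\<bar> \<le> \<eta>" using r by blast
    ultimately show False by simp
  qed
qed auto

text \<open>The lower half of a portmanteau theorem for tubes. Tubes for the limit have half the
  radius and the longer interval \<open>[0, 3]\<close>, those for the converging process the full
  radius and \<open>[0, 2]\<close>; a \<open>J1\<close>-continuous functional fits between the two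
  indicators. By \<open>cover\<close> the weighted maxima rise to at least \<open>g\<close> as
  \<open>L\<close> grows, and dominated convergence selects one finite \<open>L\<close>. Rational
  times keep the events of the converging process measurable.\<close>

lemma clt_lower_bound:
  fixes M0 :: "'f measure" and MW :: "'g measure" and yy :: "real \<Rightarrow> 'f \<Rightarrow> real \<Rightarrow> real" and Wh :: "'g \<Rightarrow> real \<Rightarrow> real"
  assumes "prob_space M0" "prob_space MW"
    and conv: "converges_weakly (J1_topology {0..}) at_top M0 (\<lambda>t x. restrict (yy t x) {0..}) MW (\<lambda>x. restrict (W x) {0..})"
    and yym [measurable]: "\<And>t s. (\<lambda>x. yy t x s) \<in> borel_measurable M0"
    and Whc: "\<And>x. continuous_on UNIV (Wh x)" and Whm [measurable]: "\<And>s. (\<lambda>x. Wh x s) \<in> borel_measurable MW"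
    and WhW: "AE x in MW. \<forall>s\<ge>0. Wh x s = W x s"
    and \<phi>: "\<And>l. 0 \<le> \<phi> l" "\<And>l. \<phi> l \<le> Bd" and w: "\<And>l. continuous_on UNIV (w l)" and \<eta>: "\<And>l. 0 < \<eta> l" "\<And>l. \<eta> l \<le> 1"
    and g [measurable]: "g \<in> borel_measurable MW" and gb: "\<And>x. x \<in> space MW \<Longrightarrow> \<bar>g x\<bar> \<le> Bd"
    and cover: "\<And>x \<delta>. x \<in> space MW \<Longrightarrow> \<delta> > 0 \<Longrightarrow> \<exists>l. \<phi> l > g x - \<delta> \<and> (\<forall>s\<in>{0..3}. \<bar>Wh x s - w l s\<bar> \<le> \<eta> l / 2)"
    and e: "e > 0"
  shows "\<exists>L. \<forall>\<^sub>F t in at_top. (\<integral>x. rmax (\<lambda>l. \<phi> l * of_bool (\<forall>s\<in>{0..2} \<inter> \<rat>. \<bar>yy t x s - w l s\<bar> \<le> \<eta> l)) L \<partial>M0) \<ge> (\<integral>x. g x \<partial>MW) - e"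
proof -
  interpret M0: prob_space M0 by fact
  interpret MW: prob_space MW by fact
  have Bd: "Bd \<ge> 0" using \<phi>(1)[of 0] \<phi>(2)[of 0] by linarith
  define GW where "GW L x = rmax (\<lambda>l. \<phi> l * of_bool (\<forall>s\<in>{0..3}. \<bar>Wh x s - w l s\<bar> \<le> \<eta> l / 2)) L" for L x
  have ev: "(\<forall>s\<in>{0..3}. \<bar>Wh x s - w l s\<bar> \<le> \<eta> l / 2) \<longleftrightarrow> (\<forall>s\<in>{0..3} \<inter> \<rat>. \<bar>Wh x s - w l s\<bar> \<le> \<eta> l / 2)" for x l
    by (rule closed_event_rational) (auto intro!: continuous_intros Whc w)
  have cR: "countable ({0..3} \<inter> \<rat> :: real set)" "countable ({0..2} \<inter> \<rat> :: real set)" by (auto intro: countable_Int2 countable_rat)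
  have GWm [measurable]: "GW L \<in> borel_measurable MW" for L
    unfolding GW_def ev using cR by measurable
  have GWb: "0 \<le> GW L x" "GW L x \<le> Bd" for L x
    unfolding GW_def using \<phi> Bd by (auto intro!: rmax_nonneg rmax_le simp: of_bool_def)
  define GS where "GS x = (SUP L. GW L x)" for x
  have bdd: "bdd_above (range (\<lambda>L. GW L x))" for x using GWb by (auto intro!: bdd_aboveI2)
  have lim: "(\<lambda>L. GW L x) \<longlonglongrightarrow> GS x" for x
    unfolding GS_def by (rule LIMSEQ_incseq_SUP[OF bdd]) (unfold GW_def, rule rmax_incseq)
  have GSm [measurable]: "GS \<in> borel_measurable MW"
    by (rule borel_measurable_LIMSEQ_real[OF lim]) measurable
  have GSb: "0 \<le> GS x" "GS x \<le> Bd" for x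
    using GWb by (auto intro: LIMSEQ_le_const[OF lim] LIMSEQ_le_const2[OF lim])
  have gGS: "g x \<le> GS x" if x: "x \<in> space MW" for x
  proof (rule field_le_epsilon)
    fix \<delta> :: real assume "\<delta> > 0"
    from cover[OF x this] obtain l where l: "\<phi> l > g x - \<delta>" "\<forall>s\<in>{0..3}. \<bar>Wh x s - w l s\<bar> \<le> \<eta> l / 2" by blast
    have "\<phi> l \<le> GW (Suc l) x" unfolding GW_def using l(2) by (intro order_trans[OF _ rmax_ge[of l]]) auto
    also have "\<dots> \<le> GS x" unfolding GS_def by (rule cSUP_upper[OF _ bdd]) simp
    finally show "g x \<le> GS x + \<delta>" using l(1) by simp
  qed
  have "(\<lambda>L. \<integral>x. GW L x \<partial>MW) \<longlonglongrightarrow> (\<integral>x. GS x \<partial>MW)"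
    by (rule integral_dominated_convergence[where w = "\<lambda>_. Bd"]) (use lim GWb in auto)
  moreover have "(\<integral>x. g x \<partial>MW) \<le> (\<integral>x. GS x \<partial>MW)"
    by (rule integral_mono) (use gGS gb GSb in \<open>auto intro!: MW.integrable_const_bound[where B = Bd]\<close>)
  ultimately have "\<forall>\<^sub>F L in sequentially. (\<integral>x. GW L x \<partial>MW) > (\<integral>x. g x \<partial>MW) - e / 2"
    using e by (intro order_tendstoD) auto
  then obtain L where L: "(\<integral>x. GW L x \<partial>MW) > (\<integral>x. g x \<partial>MW) - e / 2" by (auto simp: eventually_sequentially)
  \<comment> \<open>Equal to \<open>1\<close> up to \<open>1/2\<close> and to \<open>0\<close> from
    \<open>1\<close> on, matching the two radii.\<close>
  define ramp where "ramp r = max 0 (min 1 (2 - 2 * r))" for r :: real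
  define F where "F v = rmax (\<lambda>l. \<phi> l * ramp (soft_dev (w l) v / \<eta> l)) L" for v
  have ramp_c: "continuous_on UNIV ramp" unfolding ramp_def by (intro continuous_intros)
  have Fc: "continuous_map (J1_topology {0..}) euclideanreal F"
    unfolding F_def
  proof (rule rmax_continuous_map)
    fix l
    have "continuous_on UNIV (\<lambda>r. \<phi> l * ramp (r / \<eta> l))"
      using \<eta>(1)[of l] by (intro continuous_intros continuous_on_compose2[OF ramp_c]) auto
    then have "continuous_map euclideanreal euclideanreal (\<lambda>r. \<phi> l * ramp (r / \<eta> l))" by simp
    from continuous_map_compose[OF soft_dev_continuous_map[OF w[of l]] this]
    show "continuous_map (J1_topology {0..}) euclideanreal (\<lambda>v. \<phi> l * ramp (soft_dev (w l) v / \<eta> l))" by (simp add: comp_def)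
  qed
  have ramp: "0 \<le> ramp r" "ramp r \<le> 1" "r \<le> 1/2 \<Longrightarrow> ramp r = 1" "r \<ge> 1 \<Longrightarrow> ramp r = 0" for r by (auto simp: ramp_def)
  have Fb: "0 \<le> F v" "F v \<le> Bd" for v
    unfolding F_def using \<phi> Bd ramp by (auto intro!: rmax_nonneg rmax_le mult_le_one order_trans[OF mult_right_le_one_le])
  have Fbd: "bounded (F ` topspace (J1_topology {0..}))"
    unfolding bounded_iff using Fb by (intro exI[of _ Bd]) auto
  from conv obtain X' Y' where X': "\<forall>\<^sub>F t in at_top. random_element_version M0 (J1_topology {0..}) (\<lambda>x. restrict (yy t x) {0..}) (X' t)"
    and Y': "random_element_version MW (J1_topology {0..}) (\<lambda>x. restrict (W x) {0..}) Y'"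
    and cv: "\<forall>f. continuous_map (J1_topology {0..}) euclideanreal f \<and> bounded (f ` topspace (J1_topology {0..})) \<longrightarrow>
           ((\<lambda>i. \<integral>\<omega>. f (X' i \<omega>) \<partial>M0) \<longlongrightarrow> (\<integral>\<omega>. f (Y' \<omega>) \<partial>MW)) at_top"
    unfolding converges_weakly_def by blast
  have Fm: "F \<in> borel_measurable (borel_of_topology (J1_topology {0..}))"
    by (rule borel_of_topology_measurable_continuous[OF Fc])
  have Y'm: "Y' \<in> MW \<rightarrow>\<^sub>M borel_of_topology (J1_topology {0..})" "AE x in MW. restrict (W x) {0..} = Y' x"
    using Y' by (auto simp: random_element_version_def)
  have "(\<integral>x. GW L x \<partial>MW) \<le> (\<integral>x. F (Y' x) \<partial>MW)"
  proof (rule integral_mono_AE)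
    show "integrable MW (GW L)" using GWb by (intro MW.integrable_const_bound[where B = Bd]) auto
    show "integrable MW (\<lambda>x. F (Y' x))" using Fb measurable_compose[OF Y'm(1) Fm] by (intro MW.integrable_const_bound[where B = Bd]) auto
    show "AE x in MW. GW L x \<le> F (Y' x)"
      using WhW Y'm(2)
    proof eventually_elim
      case (elim x)
      show ?case unfolding GW_def F_def
      proof (rule rmax_mono)
        fix l
        show "\<phi> l * of_bool (\<forall>s\<in>{0..3}. \<bar>Wh x s - w l s\<bar> \<le> \<eta> l / 2) \<le> \<phi> l * ramp (soft_dev (w l) (Y' x) / \<eta> l)"
        proof (cases "\<forall>s\<in>{0..3}. \<bar>Wh x s - w l s\<bar> \<le> \<eta> l / 2")
          case True
          have "soft_dev (w l) (Y' x) = soft_dev (w l) (Wh x)"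
            unfolding elim(2)[symmetric] using elim(1) by (intro soft_dev_cong) simp
          also have "\<dots> \<le> unif_dev (w l) (Wh x) 3" by (rule soft_dev_le)
          also have "\<dots> \<le> \<eta> l / 2" 
          proof (rule unif_dev_least)
            fix s :: real assume "s \<in> {0..3}"
            with True have "\<bar>Wh x s - w l s\<bar> \<le> \<eta> l / 2" by blast
            then show "min 1 \<bar>Wh x s - w l s\<bar> \<le> \<eta> l / 2" by linarith
          qed simp
          finally have "soft_dev (w l) (Y' x) / \<eta> l \<le> 1 / 2" using \<eta>(1)[of l] by (simp add: field_simps)
          then show ?thesis using True ramp by simp
        qed (use \<phi> ramp in auto)
      qed
    qed
  qed
  with L have "(\<integral>x. F (Y' x) \<partial>MW) > (\<integral>x. g x \<partial>MW) - e / 2" by linarith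
  moreover have "((\<lambda>t. \<integral>x. F (X' t x) \<partial>M0) \<longlongrightarrow> (\<integral>x. F (Y' x) \<partial>MW)) at_top" using cv Fc Fbd by blast
  ultimately have "\<forall>\<^sub>F t in at_top. (\<integral>x. F (X' t x) \<partial>M0) > (\<integral>x. g x \<partial>MW) - e / 2" by (intro order_tendstoD)
  with X' have "\<forall>\<^sub>F t in at_top. (\<integral>x. rmax (\<lambda>l. \<phi> l * of_bool (\<forall>s\<in>{0..2} \<inter> \<rat>. \<bar>yy t x s - w l s\<bar> \<le> \<eta> l)) L \<partial>M0) \<ge> (\<integral>x. g x \<partial>MW) - e"
  proof eventually_elim
    case (elim t)
    then have X'm: "X' t \<in> M0 \<rightarrow>\<^sub>M borel_of_topology (J1_topology {0..})" "AE x in M0. restrict (yy t x) {0..} = X' t x"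
      by (auto simp: random_element_version_def)
    have "(\<integral>x. F (X' t x) \<partial>M0) \<le> (\<integral>x. rmax (\<lambda>l. \<phi> l * of_bool (\<forall>s\<in>{0..2} \<inter> \<rat>. \<bar>yy t x s - w l s\<bar> \<le> \<eta> l)) L \<partial>M0)"
    proof (rule integral_mono_AE)
      show "integrable M0 (\<lambda>x. F (X' t x))" using Fb measurable_compose[OF X'm(1) Fm] by (intro M0.integrable_const_bound[where B = Bd]) auto
      show "integrable M0 (\<lambda>x. rmax (\<lambda>l. \<phi> l * of_bool (\<forall>s\<in>{0..2} \<inter> \<rat>. \<bar>yy t x s - w l s\<bar> \<le> \<eta> l)) L)"
      proof (rule M0.integrable_const_bound[where B = Bd])
        show "(\<lambda>x. rmax (\<lambda>l. \<phi> l * of_bool (\<forall>s\<in>{0..2} \<inter> \<rat>. \<bar>yy t x s - w l s\<bar> \<le> \<eta> l)) L) \<in> borel_measurable M0"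
          using cR by measurable
        have "rmax (\<lambda>l. \<phi> l * of_bool (\<forall>s\<in>{0..2} \<inter> \<rat>. \<bar>yy t x s - w l s\<bar> \<le> \<eta> l)) L \<le> Bd" for x
          using \<phi> Bd by (intro rmax_le) (auto simp: of_bool_def)
        then show "AE x in M0. norm (rmax (\<lambda>l. \<phi> l * of_bool (\<forall>s\<in>{0..2} \<inter> \<rat>. \<bar>yy t x s - w l s\<bar> \<le> \<eta> l)) L) \<le> Bd"
          by (intro AE_I2) (simp only: real_norm_def abs_of_nonneg[OF rmax_nonneg])
      qed
      show "AE x in M0. F (X' t x) \<le> rmax (\<lambda>l. \<phi> l * of_bool (\<forall>s\<in>{0..2} \<inter> \<rat>. \<bar>yy t x s - w l s\<bar> \<le> \<eta> l)) L"
        using X'm(2)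
      proof eventually_elim
        case (elim x)
        show ?case unfolding F_def
        proof (rule rmax_mono)
          fix l
          show "\<phi> l * ramp (soft_dev (w l) (X' t x) / \<eta> l) \<le> \<phi> l * of_bool (\<forall>s\<in>{0..2} \<inter> \<rat>. \<bar>yy t x s - w l s\<bar> \<le> \<eta> l)"
          proof (cases "soft_dev (w l) (X' t x) < \<eta> l")
            case True
            have "soft_dev (w l) (X' t x) = soft_dev (w l) (yy t x)"
              unfolding elim[symmetric] by (intro soft_dev_cong) simp
            then have u: "unif_dev (w l) (yy t x) 2 < \<eta> l" using soft_dev_ge[of "w l" "yy t x"] True by linarith
            have "\<bar>yy t x s - w l s\<bar> \<le> \<eta> l" if "s \<in> {0..2}" for s
              using unif_dev_upper[OF that, of "yy t x" "w l"] u \<eta>(2)[of l] by linarith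
            then show ?thesis using \<phi>[of l] ramp(2) by (simp add: mult_left_le)
          next
            case False
            then have "soft_dev (w l) (X' t x) / \<eta> l \<ge> 1" using \<eta>(1)[of l] by simp
            then show ?thesis using ramp(4) \<phi> by simp
          qed
        qed
      qed
    qed
    then show ?case using elim e by linarith
  qed
  then show ?thesis by blast
qed

text \<open>An open set of the product restricts finitely many coordinates near \<open>v\<close>,
  and the identity as time change turns uniform closeness into \<open>J1\<close> closeness. One
  index \<open>m\<close> serves both as the number of levels and as the inverse radius.\<close>

lemma tube_in_open:
  assumes U: "openin (product_topology (\<lambda>j. J1_topology {0..1}) {1..}) U" and v: "v \<in> U"
  shows "\<exists>m. \<forall>z \<in> topspace (product_topology (\<lambda>j. J1_topology {0..1}) {1::nat..}).
     (\<forall>j\<in>{1..Suc m}. \<forall>s\<in>{0..1}. \<bar>z j s - v j s\<bar> < 2 / real (Suc m)) \<longrightarrow> z \<in> U"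
proof -
  have "\<exists>B. finite {i \<in> {1::nat..}. B i \<noteq> topspace (J1_topology {0..1})} \<and> (\<forall>i \<in> {1..}. openin (J1_topology {0..1}) (B i)) \<and>
    v \<in> PiE {1..} B \<and> PiE {1..} B \<subseteq> U"
    using U unfolding openin_product_topology_alt by (rule bspec[OF _ v])
  then obtain B where B: "finite {i \<in> {1::nat..}. B i \<noteq> topspace (J1_topology {0..1})}" "\<And>i. i \<in> {1..} \<Longrightarrow> openin (J1_topology {0..1}) (B i)"
    "v \<in> PiE {1..} B" "PiE {1..} B \<subseteq> U"
    by (elim exE conjE) (rule that, simp_all)
  let ?F = "{i \<in> {1::nat..}. B i \<noteq> topspace (J1_topology {0..1})}"
  have "\<exists>e>0. \<exists>T. J1_nbhd {0..1} (v i) e T \<subseteq> B i" if "i \<in> {1..}" for i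
    using B(2)[OF that] PiE_mem[OF B(3) that] unfolding openin_J1_topology by blast
  then obtain e T where eT: "\<And>i. i \<in> {1..} \<Longrightarrow> e i > 0" "\<And>i. i \<in> {1..} \<Longrightarrow> J1_nbhd {0..1} (v i) (e i) (T i) \<subseteq> B i" by metis
  define e0 where "e0 = Min (insert 1 (e ` ?F))"
  have e0: "e0 > 0" "\<And>i. i \<in> ?F \<Longrightarrow> e0 \<le> e i" unfolding e0_def using B(1) eT(1) by (auto simp: Min_gr_iff)
  obtain m1 :: nat where m1: "real m1 > 2 / e0" using reals_Archimedean2 by blast
  define m where "m = max m1 (Max (insert 0 ?F))"
  have m: "2 / real (Suc m) < e0" "\<And>i. i \<in> ?F \<Longrightarrow> i \<le> Suc m"
  proof -
    have "real (Suc m) > 2 / e0" using m1 by (auto simp: m_def)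
    then show "2 / real (Suc m) < e0" using e0(1) by (simp add: field_simps)
    fix i assume "i \<in> ?F"
    then have "i \<le> Max (insert 0 ?F)" using B(1) by (intro Max_ge) auto
    then show "i \<le> Suc m" by (auto simp: m_def)
  qed
  show ?thesis
  proof (intro exI[of _ m] ballI impI)
    fix z assume z: "z \<in> topspace (product_topology (\<lambda>j. J1_topology {0..1}) {1::nat..})"
      and cl: "\<forall>j\<in>{1..Suc m}. \<forall>s\<in>{0..1}. \<bar>z j s - v j s\<bar> < 2 / real (Suc m)"
    have zc: "z \<in> PiE {1..} (\<lambda>_. cadlag_paths {0..1})" using z by simp
    have "z i \<in> B i" if i: "i \<in> {1..}" for i
    proof (cases "i \<in> ?F")
      case True
      have "z i \<in> J1_nbhd {0..1} (v i) (e i) (T i)"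
        unfolding J1_nbhd_def
      proof (intro CollectI conjI bexI[of _ "\<lambda>s. s"])
        show "z i \<in> cadlag_paths {0..1}" using zc i by auto
        show "(\<lambda>s. s) \<in> time_changes {0..1}" by (auto simp: time_changes_def strict_mono_on_def bij_betw_def)
        show "\<forall>s\<in>{0..1}. \<bar>s - s\<bar> < e i" using eT(1)[OF i] by simp
        have "2 / real (Suc m) < e i" using m(1) e0(2)[OF True] by linarith
        moreover have "i \<in> {1..Suc m}" using m(2)[OF True] i by simp
        ultimately show "\<forall>s\<in>{0..1}. s \<le> T i \<longrightarrow> \<bar>z i s - v i s\<bar> < e i" using cl by (meson less_trans)
      qed
      then show ?thesis using eT(2)[OF i] by blast
    next
      case False
      then have "B i = cadlag_paths {0..1}" using i by simp
      then show ?thesis using zc i by auto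
    qed
    then have "z \<in> PiE {1..} B" using zc by (auto simp: PiE_iff)
    then show "z \<in> U" using B(4) by blast
  qed
qed

text \<open>The Borel sets of a product topology may exceed the product of the Borel sets, so open
  sets are treated directly. The data \<open>b j\<close> have countably many values, hence a
  preimage is a union of events fixing finitely many of them, and there are only countably many such
  events.\<close>

lemma countable_coordinates_measurable:
  fixes b :: "nat \<Rightarrow> 'a \<Rightarrow> 'b :: countable" and f :: "nat \<Rightarrow> 'b \<Rightarrow> 'c"
  assumes bm [measurable]: "\<And>j. b j \<in> M \<rightarrow>\<^sub>M count_space UNIV"
    and top: "\<And>j x. j \<in> J \<Longrightarrow> x \<in> space M \<Longrightarrow> f j (b j x) \<in> topspace (T j)"
  shows "(\<lambda>x. \<lambda>j\<in>J. f j (b j x)) \<in> M \<rightarrow>\<^sub>M borel_of_topology (product_topology T J)"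
proof (rule measurable_borel_of_topologyI)
  show "(\<lambda>j\<in>J. f j (b j x)) \<in> topspace (product_topology T J)" if "x \<in> space M" for x
    using top that by auto
  fix U assume U: "openin (product_topology T J) U"
  define cyl where "cyl F = {x\<in>space M. \<forall>(j, v)\<in>set F. b j x = v}" for F
  let ?g = "\<lambda>x. \<lambda>j\<in>J. f j (b j x)"
  define \<F> where "\<F> = {F :: (nat \<times> 'b) list. cyl F \<subseteq> ?g -` U}"
  have cm: "cyl F \<in> sets M" for F
  proof -
    have "cyl F = {x\<in>space M. \<forall>p\<in>set F. b (fst p) x = snd p}" by (auto simp: cyl_def)
    also have "\<dots> \<in> sets M" by measurable
    finally show ?thesis .
  qed
  have "?g -` U \<inter> space M = (\<Union>F\<in>\<F>. cyl F)"
  proof (intro equalityI subsetI)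
    fix x assume x: "x \<in> ?g -` U \<inter> space M"
    then obtain B where B: "finite {i \<in> J. B i \<noteq> topspace (T i)}" "?g x \<in> PiE J B" "PiE J B \<subseteq> U"
      using U unfolding openin_product_topology_alt by blast
    obtain js where js: "set js = {i \<in> J. B i \<noteq> topspace (T i)}" using finite_list[OF B(1)] by blast
    define F where "F = map (\<lambda>j. (j, b j x)) js"
    have "x \<in> cyl F" using x by (auto simp: cyl_def F_def)
    moreover have "cyl F \<subseteq> ?g -` U"
    proof
      fix x' assume x': "x' \<in> cyl F"
      have "f j (b j x') \<in> B j" if j: "j \<in> J" for j
      proof (cases "B j = topspace (T j)")
        case True
        then show ?thesis using top[OF j, of x'] x' by (auto simp: cyl_def)
      next
        case False
        then have "b j x' = b j x" using x' js j by (auto simp: cyl_def F_def)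
        then show ?thesis using PiE_mem[OF B(2) j] j by simp
      qed
      then have "?g x' \<in> PiE J B" by auto
      then show "x' \<in> ?g -` U" using B(3) by blast
    qed
    ultimately show "x \<in> (\<Union>F\<in>\<F>. cyl F)" by (auto simp: \<F>_def)
  next
    fix x assume "x \<in> (\<Union>F\<in>\<F>. cyl F)"
    then show "x \<in> ?g -` U \<inter> space M" by (auto simp: \<F>_def cyl_def)
  qed
  moreover have "(\<Union>F\<in>\<F>. cyl F) \<in> sets M" by (rule sets.countable_UN''[OF _ cm]) auto
  ultimately show "?g -` U \<inter> space M \<in> sets M" by simp
qed

text \<open>The fractional integral over \<open>[0, s]\<close> has total weight
  \<open>s powr p\<close>, while level one is evaluated directly with weight \<open>1\<close>; the
  maximum covers both.\<close>

lemma lim_path_close: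
  assumes "\<omega> > 0" "j \<ge> 1" "0 \<le> s" "f \<in> borel_measurable borel" "w \<in> borel_measurable borel"
    and fb: "\<And>x. 0 \<le> x \<Longrightarrow> x \<le> s \<Longrightarrow> \<bar>f x\<bar> \<le> Bf" and wb: "\<And>x. 0 \<le> x \<Longrightarrow> x \<le> s \<Longrightarrow> \<bar>w x\<bar> \<le> Bw"
    and d: "\<And>x. 0 \<le> x \<Longrightarrow> x \<le> s \<Longrightarrow> \<bar>f x - w x\<bar> \<le> B"
  shows "\<bar>lim_path \<omega> j f s - lim_path \<omega> j w s\<bar> \<le> max 1 (s powr (\<omega> * (real j - 1))) * B"
proof (cases "j = 1")
  case True
  have "\<bar>f s - w s\<bar> \<le> B" using d[of s] assms by simp
  moreover have "B \<le> max 1 (s powr 0) * B" using d[of s] assms by (simp add: max_def mult_le_cancel_right1)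
  ultimately show ?thesis using True by (simp add: lim_path_def)
next
  case False
  define p where "p = \<omega> * (real j - 1)"
  have p: "p > 0" using assms False by (simp add: p_def)
  have B: "B \<ge> 0" using d[of 0] assms by force
  have "frac_int p (\<lambda>x. f x + - 1 * w x) s = frac_int p f s + - 1 * frac_int p w s"
    by (rule frac_int_add_cmult[OF p assms(3-5) fb wb])
  moreover have "\<bar>frac_int p (\<lambda>x. f x + - 1 * w x) s\<bar> \<le> s powr p * B"
    by (rule frac_int_bound[OF p assms(3)]) (use assms in auto)
  moreover have "s powr p * B \<le> max 1 (s powr p) * B" using B by (intro mult_right_mono) auto
  ultimately show ?thesis using False unfolding lim_path_eq p_def by simp
qed

lemma lim_path_continuous:
  assumes "\<omega> > 0" "j \<ge> 1" "continuous_on UNIV w"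
  shows "continuous_on {0..b} (lim_path \<omega> j w)"
proof (cases "j = 1")
  case True
  then show ?thesis using continuous_on_subset[OF assms(3)] by (simp add: lim_path_def)
next
  case False
  then have "continuous_on {0..b} (frac_int (\<omega> * (real j - 1)) w)" using assms by (intro frac_int_continuous) auto
  then show ?thesis using False by (simp add: lim_path_eq[abs_def])
qed

lemma lim_path_cong:
  assumes "\<And>x. 0 \<le> x \<Longrightarrow> x \<le> s \<Longrightarrow> f x = w x" "0 \<le> s"
  shows "lim_path \<omega> j f s = lim_path \<omega> j w s"
  using assms frac_int_cong[of s f w] by (simp add: lim_path_eq)

lemma continuous_bounded_on:
  fixes w :: "real \<Rightarrow> real"
  assumes "continuous_on UNIV w" shows "\<exists>B. \<forall>x\<in>{0..b}. \<bar>w x\<bar> \<le> B"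
proof -
  have "bounded (w ` {0..b})"
    by (intro compact_imp_bounded compact_continuous_image continuous_on_subset[OF assms]) auto
  then show ?thesis unfolding bounded_iff by auto
qed

lemma step_function_cadlag:
  fixes h :: "real \<Rightarrow> real"
  assumes F: "finite F" and h: "continuous_on {0..1} h"
  shows "(\<lambda>s\<in>{0..1}. (\<Sum>v\<in>F. indicator {\<theta> v..} s) * k + h s) \<in> cadlag_paths {0..1}"
proof -
  let ?f = "\<lambda>s. (\<Sum>v\<in>F. indicator {\<theta> v..} s) * k + h s"
  have res: "(restrict ?f {0..1} \<longlongrightarrow> l) (at t within {0..1} \<inter> A)" if "(?f \<longlongrightarrow> l) (at t within {0..1} \<inter> A)" for l t A
  proof (rule Lim_transform_eventually[OF that])
    show "\<forall>\<^sub>F x in at t within {0..1} \<inter> A. ?f x = restrict ?f {0..1} x"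
      by (auto simp: eventually_at_filter)
  qed
  have hl: "(h \<longlongrightarrow> h t) (at t within {0..1} \<inter> A)" if "t \<in> {0..1}" for t A
    using h that by (auto simp: continuous_on_def intro: tendsto_within_subset)
  have right: "((\<lambda>s. indicator {\<theta> v..} s) \<longlongrightarrow> (indicator {\<theta> v..} t :: real)) (at t within {0..1} \<inter> {t<..})" for v t
  proof (rule tendsto_eventually)
    show "\<forall>\<^sub>F s in at t within {0..1} \<inter> {t<..}. indicator {\<theta> v..} s = (indicator {\<theta> v..} t :: real)"
    proof (cases "\<theta> v \<le> t")
      case True
      then show ?thesis by (auto simp: eventually_at_filter indicator_def)
    next
      case False
      then have "\<forall>\<^sub>F s in nhds t. s < \<theta> v" by (intro order_tendstoD(2)[OF filterlim_ident]) auto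
      then have "\<forall>\<^sub>F s in at t within {0..1} \<inter> {t<..}. s < \<theta> v" by (auto simp: eventually_at_filter elim: eventually_mono)
      then show ?thesis by eventually_elim (use False in auto)
    qed
  qed
  have left: "((\<lambda>s. indicator {\<theta> v..} s) \<longlongrightarrow> (if \<theta> v < t then 1 else 0 :: real)) (at t within {0..1} \<inter> {..<t})" for v t
  proof (rule tendsto_eventually)
    show "\<forall>\<^sub>F s in at t within {0..1} \<inter> {..<t}. indicator {\<theta> v..} s = (if \<theta> v < t then 1 else 0 :: real)"
    proof (cases "\<theta> v < t")
      case False
      then show ?thesis by (auto simp: eventually_at_filter indicator_def)
    next
      case True
      then have "\<forall>\<^sub>F s in nhds t. \<theta> v < s" by (intro order_tendstoD(1)[OF filterlim_ident]) auto
      then have "\<forall>\<^sub>F s in at t within {0..1} \<inter> {..<t}. \<theta> v < s" by (auto simp: eventually_at_filter elim: eventually_mono)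
      then show ?thesis by eventually_elim (use True in auto)
    qed
  qed
  show ?thesis
    unfolding cadlag_paths_def
  proof (intro CollectI conjI ballI)
    fix t :: real assume t: "t \<in> {0..1}"
    have "(?f \<longlongrightarrow> ?f t) (at t within {0..1} \<inter> {t<..})"
      by (intro tendsto_intros right hl t)
    then show "(restrict ?f {0..1} \<longlongrightarrow> restrict ?f {0..1} t) (at t within {0..1} \<inter> {t<..})"
      using res t by simp
    have "(?f \<longlongrightarrow> (\<Sum>v\<in>F. if \<theta> v < t then 1 else 0) * k + h t) (at t within {0..1} \<inter> {..<t})"
      by (intro tendsto_intros left hl t)
    then show "\<exists>l. (restrict ?f {0..1} \<longlongrightarrow> l) (at t within {0..1} \<inter> {..<t})"
      using res by blast
  qed simp
qed

lemma continuous_cadlag: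
  assumes "continuous_on {0..1} h" shows "restrict h {0..1} \<in> cadlag_paths {0..1}"
  using step_function_cadlag[OF finite.emptyI assms, of "\<lambda>_::unit. 0" 0] by simp

text \<open>
  The polynomials \<open>net_w l\<close> are dense among the continuous functions on \<open>{0..3}\<close>, and each of them occurs with every
  radius \<open>net_r l = 1 / (m + 1)\<close>.
\<close>

definition net_w :: "nat \<Rightarrow> real \<Rightarrow> real" where
  "net_w l = rat_bernstein (fst (from_nat l :: rat list \<times> nat))"

definition net_m :: "nat \<Rightarrow> nat" where
  "net_m l = snd (from_nat l :: rat list \<times> nat)"

definition net_r :: "nat \<Rightarrow> real" where "net_r l = 1 / real (Suc (net_m l))"

lemma net_w_continuous: "continuous_on UNIV (net_w l)"
  unfolding net_w_def by (rule rat_bernstein_continuous)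

lemma net_r: "0 < net_r l" "net_r l \<le> 1"
  by (auto simp: net_r_def)

lemma net_dense:
  assumes w: "continuous_on UNIV w"
  shows "\<exists>l. net_m l = m \<and> (\<forall>s\<in>{0..3}. \<bar>w s - net_w l s\<bar> \<le> net_r l / 2)"
proof -
  obtain rs where rs: "\<forall>x\<in>{0..3}. \<bar>w x - rat_bernstein rs x\<bar> < 1 / real (Suc m) / 2"
    using rat_bernstein_dense[OF w, of "1 / real (Suc m) / 2"] by auto
  show ?thesis
    by (intro exI[of _ "to_nat (rs, m)"]) (use rs in \<open>auto simp: net_m_def net_w_def net_r_def intro: less_imp_le\<close>)
qed

section \<open>Tubes around the countable net and measurability of the limit\<close>

abbreviation (input) path_top :: "(nat \<Rightarrow> real \<Rightarrow> real) topology" where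
  "path_top \<equiv> product_topology (\<lambda>j. J1_topology {0..1}) {1..}"

definition limit_paths :: "real \<Rightarrow> (real \<Rightarrow> real) \<Rightarrow> nat \<Rightarrow> real \<Rightarrow> real" where
  "limit_paths \<omega> w = (\<lambda>j\<in>{1::nat..}. \<lambda>s\<in>{0..1}. lim_path \<omega> j w s)"

text \<open>The slack \<open>3 / 2\<close> consists of one radius for the distance of the
  first-level process to \<open>net_w l\<close> and half a radius for replacing occupancy counts by
  functionals of that process. Radius and number of controlled levels are tied to the same
  \<open>net_m l\<close>.\<close>

definition tube :: "real \<Rightarrow> nat \<Rightarrow> (nat \<Rightarrow> real \<Rightarrow> real) set" where
  "tube \<omega> l = {z \<in> topspace path_top. \<forall>j\<in>{1..Suc (net_m l)}. \<forall>s\<in>{0..1}. \<bar>z j s - lim_path \<omega> j (net_w l) s\<bar> \<le> 3 / 2 * net_r l}"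

lemma limit_paths_topspace:
  assumes "\<omega> > 0" "continuous_on UNIV w" shows "limit_paths \<omega> w \<in> topspace path_top"
  using continuous_cadlag[OF lim_path_continuous[OF assms(1) _ assms(2)]] by (auto simp: limit_paths_def)

lemma lim_path_close_unit:
  assumes "\<omega> > 0" "j \<ge> 1" "s \<in> {0..1}" "f \<in> borel_measurable borel" "continuous_on UNIV w"
    and "\<And>x. x \<in> {0..1} \<Longrightarrow> \<bar>f x\<bar> \<le> Bf" and "\<And>x. x \<in> {0..1} \<Longrightarrow> \<bar>f x - w x\<bar> \<le> B"
  shows "\<bar>lim_path \<omega> j f s - lim_path \<omega> j w s\<bar> \<le> B"
proof -
  obtain B2 where B2: "\<forall>x\<in>{0..1}. \<bar>w x\<bar> \<le> B2" using continuous_bounded_on[OF assms(5)] by blast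
  have "\<bar>lim_path \<omega> j f s - lim_path \<omega> j w s\<bar> \<le> max 1 (s powr (\<omega> * (real j - 1))) * B"
    by (rule lim_path_close[where Bf = Bf and Bw = B2]) (use assms B2 in \<open>auto intro: borel_measurable_continuous_onI\<close>)
  also have "s powr (\<omega> * (real j - 1)) \<le> 1" using assms by (intro powr_le1) auto
  then have "max 1 (s powr (\<omega> * (real j - 1))) = 1" by simp
  finally show ?thesis by simp
qed

lemma limit_paths_in_tube:
  assumes "\<omega> > 0" "continuous_on UNIV w" "\<forall>s\<in>{0..3}. \<bar>w s - net_w l s\<bar> \<le> net_r l / 2"
  shows "limit_paths \<omega> w \<in> tube \<omega> l"
  unfolding tube_def
proof (intro CollectI conjI ballI)
  obtain B1 where B1: "\<forall>x\<in>{0..1}. \<bar>w x\<bar> \<le> B1" using continuous_bounded_on[OF assms(2)] by blast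
  fix j s assume j: "j \<in> {1..Suc (net_m l)}" and s: "s \<in> {0..1::real}"
  have "\<bar>lim_path \<omega> j w s - lim_path \<omega> j (net_w l) s\<bar> \<le> net_r l / 2"
    by (rule lim_path_close_unit[where Bf = B1])
       (use assms j s B1 net_w_continuous in \<open>auto intro: borel_measurable_continuous_onI\<close>)
  then show "\<bar>limit_paths \<omega> w j s - lim_path \<omega> j (net_w l) s\<bar> \<le> 3 / 2 * net_r l"
    using j s net_r[of l] by (simp add: limit_paths_def)
qed (rule limit_paths_topspace[OF assms(1,2)])

lemma tube_cover:
  assumes "\<omega> > 0" "openin path_top U" "continuous_on UNIV w" "limit_paths \<omega> w \<in> U"
  shows "\<exists>l. tube \<omega> l \<subseteq> U \<and> (\<forall>s\<in>{0..3}. \<bar>w s - net_w l s\<bar> \<le> net_r l / 2)"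
proof -
  obtain m where m: "\<forall>z \<in> topspace path_top.
     (\<forall>j\<in>{1..Suc m}. \<forall>s\<in>{0..1}. \<bar>z j s - limit_paths \<omega> w j s\<bar> < 2 / real (Suc m)) \<longrightarrow> z \<in> U"
    using tube_in_open[OF assms(2,4)] by blast
  \<comment> \<open>One step beyond \<open>m\<close>: the radius is then below
    \<open>1 / Suc m\<close>, and the half radius of the limit path plus the \<open>3 / 2\<close>
    radii of the tube stay below \<open>2 / Suc m\<close>.\<close>
  obtain l where l: "net_m l = Suc m" "\<forall>s\<in>{0..3}. \<bar>w s - net_w l s\<bar> \<le> net_r l / 2"
    using net_dense[OF assms(3)] by blast
  obtain B1 where B1: "\<forall>x\<in>{0..1}. \<bar>w x\<bar> \<le> B1" using continuous_bounded_on[OF assms(3)] by blast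
  have r: "net_r l < 1 / real (Suc m)" unfolding net_r_def l(1) by (intro divide_strict_left_mono) auto
  have "tube \<omega> l \<subseteq> U"
  proof
    fix z assume z: "z \<in> tube \<omega> l"
    have "\<bar>z j s - limit_paths \<omega> w j s\<bar> < 2 / real (Suc m)" if j: "j \<in> {1..Suc m}" and s: "s \<in> {0..1}" for j s
    proof -
      have "\<bar>lim_path \<omega> j w s - lim_path \<omega> j (net_w l) s\<bar> \<le> net_r l / 2"
        by (rule lim_path_close_unit[where Bf = B1])
           (use assms j s B1 l net_w_continuous in \<open>auto intro: borel_measurable_continuous_onI\<close>)
      moreover have "\<bar>z j s - lim_path \<omega> j (net_w l) s\<bar> \<le> 3 / 2 * net_r l" using z j s l(1) by (auto simp: tube_def)
      moreover have "limit_paths \<omega> w j s = lim_path \<omega> j w s" using j s by (simp add: limit_paths_def)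
      moreover have "2 / real (Suc m) = 2 * (1 / real (Suc m))" by simp
      ultimately show ?thesis using r by linarith
    qed
    then show "z \<in> U" using m z by (auto simp: tube_def)
  qed
  then show ?thesis using l(2) by blast
qed

lemma hoelder_continuous:
  assumes "locally_hoelder \<beta> w" "\<beta> > 0"
  shows "continuous_on UNIV (\<lambda>s. w (max 0 s))"
  unfolding continuous_on_eq_continuous_at[OF open_UNIV]
proof
  fix s0 :: real
  define T where "T = \<bar>s0\<bar> + 1"
  have "T > 0" by (simp add: T_def)
  then obtain C where C: "\<And>s t. s \<in> {0..T} \<Longrightarrow> t \<in> {0..T} \<Longrightarrow> \<bar>w s - w t\<bar> \<le> C * \<bar>s - t\<bar> powr \<beta>"
    using assms(1) unfolding locally_hoelder_def by blast
  have "((\<lambda>s. \<bar>C\<bar> * \<bar>s - s0\<bar> powr \<beta>) \<longlongrightarrow> \<bar>C\<bar> * \<bar>s0 - s0\<bar> powr \<beta>) (at s0)"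
    using assms(2) by (intro tendsto_mult tendsto_const tendsto_powr' tendsto_rabs tendsto_diff tendsto_ident_at) auto
  then have lim: "((\<lambda>s. \<bar>C\<bar> * \<bar>s - s0\<bar> powr \<beta>) \<longlongrightarrow> 0) (at s0)" using assms(2) by simp
  have ev: "\<forall>\<^sub>F s in at s0. norm (w (max 0 s) - w (max 0 s0)) \<le> \<bar>C\<bar> * \<bar>s - s0\<bar> powr \<beta>"
    unfolding eventually_at
  proof (intro exI[of _ 1] conjI ballI impI)
    fix s :: real assume "s \<noteq> s0 \<and> dist s s0 < 1"
    then have "max 0 s \<in> {0..T}" "max 0 s0 \<in> {0..T}" by (auto simp: T_def dist_real_def)
    from C[OF this] have "\<bar>w (max 0 s) - w (max 0 s0)\<bar> \<le> C * \<bar>max 0 s - max 0 s0\<bar> powr \<beta>" .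
    also have "\<dots> \<le> \<bar>C\<bar> * \<bar>s - s0\<bar> powr \<beta>" using assms(2) by (intro mult_mono powr_mono2) auto
    finally show "norm (w (max 0 s) - w (max 0 s0)) \<le> \<bar>C\<bar> * \<bar>s - s0\<bar> powr \<beta>" by simp
  qed auto
  have "((\<lambda>s. w (max 0 s) - w (max 0 s0)) \<longlongrightarrow> 0) (at s0)" by (rule Lim_null_comparison[OF ev lim])
  then show "isCont (\<lambda>s. w (max 0 s)) s0" unfolding isCont_def by (simp add: LIM_zero_iff)
qed

text \<open>By \<open>tube_cover\<close> and \<open>limit_paths_in_tube\<close>, the preimage of an
  open set of paths is exactly a countable union of events that \<open>Wh\<close> is uniformly close
  to some \<open>net_w l\<close>; by continuity each of these is decided at rational times.\<close>

lemma limit_paths_measurable: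
  assumes "\<omega> > 0" and c: "\<And>x. continuous_on UNIV (Wh x)" and m [measurable]: "\<And>s. (\<lambda>x. Wh x s) \<in> borel_measurable MW"
  shows "(\<lambda>x. limit_paths \<omega> (Wh x)) \<in> MW \<rightarrow>\<^sub>M borel_of_topology path_top"
proof (rule measurable_borel_of_topologyI)
  show "limit_paths \<omega> (Wh x) \<in> topspace path_top" for x by (rule limit_paths_topspace[OF assms(1) c])
  fix U assume U: "openin path_top U"
  define E where "E l = {x\<in>space MW. \<forall>s\<in>{0..3}. \<bar>Wh x s - net_w l s\<bar> \<le> net_r l / 2}" for l
  have Em: "E l \<in> sets MW" for l
  proof -
    have "E l = {x\<in>space MW. \<forall>s\<in>{0..3} \<inter> \<rat>. \<bar>Wh x s - net_w l s\<bar> \<le> net_r l / 2}"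
      unfolding E_def by (intro Collect_cong conj_cong refl closed_event_rational) (auto intro!: continuous_intros c net_w_continuous)
    moreover have "countable ({0..3} \<inter> \<rat> :: real set)" by (auto intro: countable_Int2 countable_rat)
    ultimately show ?thesis by simp
  qed
  have "(\<lambda>x. limit_paths \<omega> (Wh x)) -` U \<inter> space MW = (\<Union>l\<in>{l. tube \<omega> l \<subseteq> U}. E l)"
  proof (intro equalityI subsetI)
    fix x assume x: "x \<in> (\<lambda>x. limit_paths \<omega> (Wh x)) -` U \<inter> space MW"
    then have "limit_paths \<omega> (Wh x) \<in> U" by simp
    from tube_cover[OF assms(1) U c this] x show "x \<in> (\<Union>l\<in>{l. tube \<omega> l \<subseteq> U}. E l)" unfolding E_def by auto
  next
    fix x assume "x \<in> (\<Union>l\<in>{l. tube \<omega> l \<subseteq> U}. E l)"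
    then obtain l where l: "tube \<omega> l \<subseteq> U" "x \<in> E l" by blast
    then have "limit_paths \<omega> (Wh x) \<in> tube \<omega> l" unfolding E_def by (intro limit_paths_in_tube[OF assms(1) c]) blast
    then show "x \<in> (\<lambda>x. limit_paths \<omega> (Wh x)) -` U \<inter> space MW" using l by (auto simp: E_def)
  qed
  then show "(\<lambda>x. limit_paths \<omega> (Wh x)) -` U \<inter> space MW \<in> sets MW" using Em by auto
qed

section \<open>Regularity and measurability of the normalised counts\<close>

context occupancy begin

lemma scaled_count_measurable: "subprob UNIV q \<Longrightarrow> scaled_count a t q \<in> borel_measurable borel"
proof -
  assume "subprob UNIV q"
  then have [measurable]: "cnt q \<in> borel_measurable borel" by (rule cnt_borel)
  show ?thesis unfolding scaled_count_def[abs_def] by measurable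
qed

lemma scaled_count_bounded:
  assumes q: "subprob UNIV q" and "t > 0" "a > 0"
  shows "\<exists>B. \<forall>s\<in>{0..2}. \<bar>scaled_count a t q s\<bar> \<le> B"
proof (intro exI ballI)
  fix s :: real assume s: "s \<in> {0..2}"
  have ts: "0 \<le> t * s" "t * s \<le> t * 2" using s assms by auto
  have "\<bar>cnt q (t * s) - c * (t * s) powr \<omega>\<bar> \<le> cnt q (t * 2) + c * (t * 2) powr \<omega>"
  proof -
    have "0 \<le> c * (t * s) powr \<omega>" "c * (t * s) powr \<omega> \<le> c * (t * 2) powr \<omega>" using pos ts by (auto intro!: mult_left_mono powr_mono2)
    then show ?thesis using monoD[OF cnt_mono[OF q] ts(2)] cnt_nonneg[of UNIV q "t * s"] by linarith
  qed
  then show "\<bar>scaled_count a t q s\<bar> \<le> (cnt q (t * 2) + c * (t * 2) powr \<omega>) / (a * t powr \<gamma>)"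
    unfolding scaled_count_def using assms by (simp add: abs_divide divide_right_mono abs_mult)
qed

text \<open>A violation at \<open>s\<close> persists at rational times slightly to the right, where
  the count is unchanged and the other terms are continuous; the end point \<open>2\<close> is
  itself rational.\<close>

lemma scaled_count_rational_dev:
  assumes q: "subprob UNIV q" and "t > 0" "a > 0" and w: "continuous_on UNIV w"
    and r: "\<forall>s\<in>{0..2} \<inter> \<rat>. \<bar>scaled_count a t q s - w s\<bar> \<le> \<eta>"
  shows "\<forall>s\<in>{0..2}. \<bar>scaled_count a t q s - w s\<bar> \<le> \<eta>"
proof (rule ccontr)
  assume "\<not> (\<forall>s\<in>{0..2}. \<bar>scaled_count a t q s - w s\<bar> \<le> \<eta>)"
  then obtain s where s: "s \<in> {0..2}" "\<eta> < \<bar>scaled_count a t q s - w s\<bar>" by (auto simp: not_le)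
  have "s \<noteq> 2" using s r by (metis IntI Rats_number_of not_le)
  then have s2: "s < 2" using s by simp
  obtain d where d: "d > 0" "\<And>u'. t * s \<le> u' \<Longrightarrow> u' < t * s + d \<Longrightarrow> cnt q u' = cnt q (t * s)"
    using cnt_right_const[OF q, of "t * s"] by blast
  \<comment> \<open>The count is frozen at its value in \<open>s\<close>, which leaves a continuous
    function that agrees with the deviation just to the right of \<open>s\<close>.\<close>
  define k where "k x = (cnt q (t * s) - c * (t * max 0 x) powr \<omega>) / (a * t powr \<gamma>) - w x" for x
  have kc: "continuous_on UNIV k" unfolding k_def using pos assms
    by (intro continuous_intros continuous_on_powr' w) auto
  have o: "open {x. \<eta> < \<bar>k x\<bar>}" using kc by (intro open_Collect_less continuous_intros) auto
  have ks: "k s = scaled_count a t q s - w s" using s by (simp add: k_def scaled_count_def)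
  then have "s \<in> {x. \<eta> < \<bar>k x\<bar>}" using s(2) by simp
  with o obtain d' where d': "d' > 0" "ball s d' \<subseteq> {x. \<eta> < \<bar>k x\<bar>}" by (meson open_contains_ball)
  define m where "m = min (min d' (d / t)) (2 - s)"
  have "m > 0" using d d' s2 assms by (simp add: m_def)
  then obtain x where x: "x \<in> \<rat>" "s < x" "x < s + m" using Rats_dense_in_real[of s "s + m"] by auto
  have "x \<in> ball s d'" using x by (auto simp: dist_real_def m_def)
  then have "\<eta> < \<bar>k x\<bar>" using d'(2) by auto
  moreover have "x < s + d / t" using x by (auto simp: m_def)
  then have "t * x < t * s + d" using assms by (simp add: field_simps)
  then have "cnt q (t * x) = cnt q (t * s)" using x assms by (intro d) auto
  then have "k x = scaled_count a t q x - w x" using x s by (simp add: k_def scaled_count_def)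
  moreover have "x \<in> {0..2} \<inter> \<rat>" using x s by (auto simp: m_def)
  moreover from r this have "\<bar>scaled_count a t q x - w x\<bar> \<le> \<eta>" by (rule bspec)
  ultimately show False by simp
qed

lemma ball_count_path_cadlag:
  assumes n: "n \<ge> 2" and j: "j \<ge> 1"
  shows "(\<lambda>s\<in>{0..1}. (cum_occupancy X n j s z - k1 * (s * ln (real n)) powr (\<omega> * real j)) / k2) \<in> cadlag_paths {0..1}"
proof -
  let ?F = "{v\<in>words j. ball_count n v z \<ge> real n powr (1 - 1)}"
  \<comment> \<open>The smallest \<open>s\<close> at which box \<open>v\<close> is counted, from
    solving \<open>n powr (1 - s) = ball_count n v z\<close>; \<open>n \<ge> 2\<close> makes the
    divisor positive.\<close>
  define \<theta> where "\<theta> v = 1 - ln (ball_count n v z) / ln (real n)" for v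
  have n1: "n \<ge> 1" using n by simp
  have ln: "ln (real n) > 0" using n by simp
  have F: "finite ?F" by (rule cum_occupancy_card(2)[OF n1]) simp
  have "cum_occupancy X n j s z = (\<Sum>v\<in>?F. indicator {\<theta> v..} s)" if s: "s \<in> {0..1}" for s
  proof -
    have iff: "ball_count n v z \<ge> real n powr (1 - s) \<longleftrightarrow> ball_count n v z \<ge> real n powr (1 - 1) \<and> \<theta> v \<le> s" for v
    proof -
      have 1: "real n powr (1 - s) \<ge> 1" using s n by (intro ge_one_powr_ge_zero) auto
      have 2: "real n powr (1 - s) \<le> ball_count n v z \<longleftrightarrow> \<theta> v \<le> s" if "ball_count n v z \<ge> 1"
      proof -
        have "real n powr (1 - s) \<le> ball_count n v z \<longleftrightarrow> (1 - s) * ln (real n) \<le> ln (ball_count n v z)"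
          using that n by (simp add: powr_def ln_ge_iff[symmetric])
        also have "\<dots> \<longleftrightarrow> \<theta> v \<le> s" using ln by (simp add: \<theta>_def field_simps)
        finally show ?thesis .
      qed
      show ?thesis using 1 2 n by auto
    qed
    have "cum_occupancy X n j s z = real (card {v\<in>words j. ball_count n v z \<ge> real n powr (1 - s)})"
      using cum_occupancy_card(1)[OF n1] s by simp
    also have "{v\<in>words j. ball_count n v z \<ge> real n powr (1 - s)} = {v\<in>?F. \<theta> v \<le> s}" using iff by auto
    also have "real (card {v\<in>?F. \<theta> v \<le> s}) = (\<Sum>v\<in>{v\<in>?F. \<theta> v \<le> s}. 1)" by simp
    also have "\<dots> = (\<Sum>v\<in>?F. indicator {\<theta> v..} s)"
      by (rule sum.mono_neutral_cong_left) (use F in \<open>auto simp: indicator_def\<close>)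
    finally show ?thesis .
  qed
  then have "(\<lambda>s\<in>{0..1}. (cum_occupancy X n j s z - k1 * (s * ln (real n)) powr (\<omega> * real j)) / k2)
    = (\<lambda>s\<in>{0..1}. (\<Sum>v\<in>?F. indicator {\<theta> v..} s) * (1 / k2) + (- k1 * (s * ln (real n)) powr (\<omega> * real j) / k2))"
    by (intro restrict_ext) (simp add: diff_divide_distrib)
  also have "\<dots> \<in> cadlag_paths {0..1}"
  proof (rule step_function_cadlag[OF F])
    show "continuous_on {0..1} (\<lambda>s. - k1 * (s * ln (real n)) powr (\<omega> * real j) / k2)"
      unfolding divide_inverse using pos j ln by (intro continuous_on_mult continuous_on_powr' continuous_intros) auto
  qed
  finally show ?thesis .
qed

definition occupancy_path :: "real \<Rightarrow> nat \<Rightarrow> 'w \<Rightarrow> nat \<Rightarrow> real \<Rightarrow> real" where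
  "occupancy_path a n z = (\<lambda>j\<in>{1::nat..}. \<lambda>s\<in>{0..1}. (cum_occupancy X n j s z - cc j * (s * ln (real n)) powr (\<omega> * real j)) / norming a j (ln (real n)))"

text \<open>At each level the path is a function of the list of boxes hit by the \<open>n\<close>
  balls. Such lists form a countable set, so \<open>countable_coordinates_measurable\<close>
  applies.\<close>

lemma occupancy_path_measurable:
  assumes n: "n \<ge> 2"
  shows "occupancy_path a n \<in> M \<rightarrow>\<^sub>M borel_of_topology path_top" "occupancy_path a n z \<in> topspace path_top"
proof -
  define K where "K j b s = (\<Sum>r = nat \<lceil>real n powr (1 - s)\<rceil>..n. real (card {v. length v = j \<and> card {i. i < n \<and> b ! i = v} = r}))"
    for j :: nat and b :: "nat list list" and s :: real
  define f where "f j b = (\<lambda>s\<in>{0..1}. (K j b s - cc j * (s * ln (real n)) powr (\<omega> * real j)) / norming a j (ln (real n)))"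
    for j :: nat and b :: "nat list list"
  define b where "b j z = map (\<lambda>i. ball_box X i j z) [0..<n]" for j z
  have K: "cum_occupancy X n j s z = K j (b j z) s" for j s z
  proof -
    have "{i. i < n \<and> ball_box X i j z = v} = {i. i < n \<and> b j z ! i = v}" for v by (auto simp: b_def)
    then show ?thesis by (simp add: cum_occupancy_def occupancy_count_def K_def)
  qed
  have occupancy_path: "occupancy_path a n = (\<lambda>z. \<lambda>j\<in>{1::nat..}. f j (b j z))"
    by (simp add: occupancy_path_def[abs_def] f_def K)
  have top: "f j (b j z) \<in> topspace (J1_topology {0..1})" if "j \<in> {1..}" for j z
    using ball_count_path_cadlag[OF n, of j z "cc j" "norming a j (ln (real n))"] that by (simp add: f_def K)
  have bm: "b j \<in> M \<rightarrow>\<^sub>M count_space UNIV" for j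
  proof -
    have "(\<lambda>z. map (\<lambda>i. ball_box X i j z) [0..<k]) \<in> M \<rightarrow>\<^sub>M count_space UNIV" for k
    proof (induction k)
      case (Suc k)
      then show ?case by simp measurable
    qed simp
    then show ?thesis unfolding b_def .
  qed
  show "occupancy_path a n \<in> M \<rightarrow>\<^sub>M borel_of_topology path_top"
    unfolding occupancy_path
    by (rule countable_coordinates_measurable[where b = b and f = f and J = "{1..}" and T = "\<lambda>_. J1_topology {0..1}", OF bm]) (rule top)
  show "occupancy_path a n z \<in> topspace path_top" unfolding occupancy_path using top by auto
qed

end

section \<open>Weak convergence\<close>

text \<open>The limit theorem is given on \<open>M0\<close> and the scheme lives on
  \<open>M\<close>; the law \<open>\<mu>\<close> of a sequence of fragments is their only link.
  \<open>Wh\<close> is a version of the limit with every path continuous on the whole line, so that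
  the net and the tubes apply without an exceptional set.\<close>

locale occupancy_clt = occupancy \<mu> c \<omega> \<epsilon> \<gamma> M Q X + M0: prob_space M0 + MW: prob_space MW
  for \<mu> c \<omega> \<epsilon> \<gamma> and M :: "'w measure" and Q X and M0 :: "'f measure" and MW :: "'g measure" +
  fixes P :: "nat \<Rightarrow> 'f \<Rightarrow> real" and W Wh :: "'g \<Rightarrow> real \<Rightarrow> real" and a :: real
  assumes a_pos: "a > 0"
    and P_measurable [measurable]: "\<And>k. P k \<in> borel_measurable M0"
    and P_distr: "distr M0 (\<Pi>\<^sub>M k\<in>UNIV. borel) (\<lambda>x k. P k x) = \<mu>"
    and conv: "converges_weakly (J1_topology {0..}) at_top M0 (\<lambda>t x. restrict (scaled_count a t (\<lambda>k. P k x)) {0..}) MW (\<lambda>x. restrict (W x) {0..})"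
    and Wh_continuous: "\<And>x. continuous_on UNIV (Wh x)"
    and Wh_measurable [measurable]: "\<And>s. (\<lambda>x. Wh x s) \<in> borel_measurable MW"
    and Wh_version: "AE x in MW. \<forall>s\<ge>0. Wh x s = W x s"
begin

definition near :: "nat \<Rightarrow> real \<Rightarrow> (nat \<Rightarrow> real) \<Rightarrow> bool" where
  "near l t q \<longleftrightarrow> (\<forall>s\<in>{0..2} \<inter> \<rat>. \<bar>scaled_count a t q s - net_w l s\<bar> \<le> net_r l)"

lemma near_pred [measurable]: "Measurable.pred S (near l t)"
proof -
  have "countable ({0..2} \<inter> \<rat> :: real set)" by (auto intro: countable_Int2 countable_rat)
  moreover have [measurable]: "(\<lambda>q. scaled_count a t q s) \<in> borel_measurable S" for s
    unfolding scaled_count_def by measurable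
  ultimately show ?thesis unfolding near_def by measurable
qed

lemma P_seq_measurable [measurable]: "(\<lambda>x k. P k x) \<in> M0 \<rightarrow>\<^sub>M S"
  by (rule measurable_PiM_single') auto

lemma root_frag_measurable [measurable]: "root_frag \<in> M \<rightarrow>\<^sub>M S"
  unfolding root_frag_def[abs_def] by measurable

text \<open>Transfers \<open>clt_lower_bound\<close> to the root of the tree: the integrand is a
  measurable function of the fragment sequence, and that sequence has law \<open>\<mu>\<close> on
  both spaces. Measurability is the reason why \<open>near\<close> looks at rational times
  only.\<close>

lemma paths_lower_bound:
  assumes \<phi>: "\<And>l. 0 \<le> \<phi> l" "\<And>l. \<phi> l \<le> Bd"
    and g [measurable]: "g \<in> borel_measurable MW" and gb: "\<And>x. x \<in> space MW \<Longrightarrow> \<bar>g x\<bar> \<le> Bd"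
    and cover: "\<And>x \<delta>. x \<in> space MW \<Longrightarrow> \<delta> > 0 \<Longrightarrow> \<exists>l. \<phi> l > g x - \<delta> \<and> (\<forall>s\<in>{0..3}. \<bar>Wh x s - net_w l s\<bar> \<le> net_r l / 2)"
    and e: "e > 0"
  shows "\<exists>L. \<forall>\<^sub>F t in at_top. (\<integral>z. rmax (\<lambda>l. \<phi> l * of_bool (near l t (root_frag z))) L \<partial>M) \<ge> (\<integral>x. g x \<partial>MW) - e"
proof -
  have "\<exists>L. \<forall>\<^sub>F t in at_top. (\<integral>x. rmax (\<lambda>l. \<phi> l * of_bool (\<forall>s\<in>{0..2} \<inter> \<rat>. \<bar>scaled_count a t (\<lambda>k. P k x) s - net_w l s\<bar> \<le> net_r l)) L \<partial>M0) \<ge> (\<integral>x. g x \<partial>MW) - e"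
  proof (rule clt_lower_bound[OF M0.prob_space_axioms MW.prob_space_axioms conv _ Wh_continuous Wh_measurable Wh_version \<phi> net_w_continuous net_r g gb cover e])
    show "(\<lambda>x. scaled_count a t (\<lambda>k. P k x) s) \<in> borel_measurable M0" for t s unfolding scaled_count_def by measurable
  qed
  moreover have "(\<integral>x. rmax (\<lambda>l. \<phi> l * of_bool (near l t (\<lambda>k. P k x))) L \<partial>M0) = (\<integral>z. rmax (\<lambda>l. \<phi> l * of_bool (near l t (root_frag z))) L \<partial>M)" for t L
  proof -
    have [measurable]: "(\<lambda>q. rmax (\<lambda>l. \<phi> l * of_bool (near l t q)) L) \<in> borel_measurable S" by measurable
    have "(\<integral>x. rmax (\<lambda>l. \<phi> l * of_bool (near l t (\<lambda>k. P k x))) L \<partial>M0) = (\<integral>q. rmax (\<lambda>l. \<phi> l * of_bool (near l t q)) L \<partial>\<mu>)"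
      unfolding P_distr[symmetric] by (subst integral_distr) auto
    also have "\<dots> = (\<integral>z. rmax (\<lambda>l. \<phi> l * of_bool (near l t (root_frag z))) L \<partial>M)"
      unfolding Q_distr[of "[]", symmetric] by (subst integral_distr) (auto simp: root_frag_def)
    finally show ?thesis .
  qed
  ultimately show ?thesis unfolding near_def by simp
qed

lemma near_all:
  assumes "good z" "t > 0" "near l t (root_frag z)" "s \<in> {0..2}"
  shows "\<bar>scaled_count a t (root_frag z) s - net_w l s\<bar> \<le> net_r l"
  using scaled_count_rational_dev[OF good_root_frag[OF assms(1)] assms(2) a_pos net_w_continuous] assms(3,4) unfolding near_def by blast

lemma near_limit_path:
  assumes "good z" "t > 0" "near l t (root_frag z)" "j \<ge> 1" "s \<in> {0..2}"
  shows "\<bar>lim_path \<omega> j (scaled_count a t (root_frag z)) s - lim_path \<omega> j (net_w l) s\<bar> \<le> max 1 (s powr (\<omega> * (real j - 1))) * net_r l"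
proof -
  have q: "subprob UNIV (root_frag z)" by (rule good_root_frag[OF assms(1)])
  obtain B1 where B1: "\<forall>s\<in>{0..2}. \<bar>scaled_count a t (root_frag z) s\<bar> \<le> B1" using scaled_count_bounded[OF q assms(2) a_pos] by blast
  obtain B2 where B2: "\<forall>x\<in>{0..2}. \<bar>net_w l x\<bar> \<le> B2" using continuous_bounded_on[OF net_w_continuous] by blast
  show ?thesis
  proof (rule lim_path_close[where Bf = B1 and Bw = B2])
    show "scaled_count a t (root_frag z) \<in> borel_measurable borel" by (rule scaled_count_measurable[OF q])
    show "net_w l \<in> borel_measurable borel" by (rule borel_measurable_continuous_onI[OF net_w_continuous])
    show "\<bar>scaled_count a t (root_frag z) x - net_w l x\<bar> \<le> net_r l" if "0 \<le> x" "x \<le> s" for x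
      using near_all[OF assms(1-3), of x] that assms(5) by simp
  qed (use pos assms B1 B2 in auto)
qed

text \<open>The lower bound with \<open>g = 1\<close> and weights selecting small radii: with
  probability close to one the root process is near one of finitely many \<open>net_w l\<close> with
  \<open>l < L\<close>, and finitely many continuous functions are equicontinuous. Tightness thus
  enters only through the finite \<open>L\<close>.\<close>

lemma oscillation:
  assumes e: "e > 0" and \<eta>: "\<eta> > 0" and j: "j \<ge> 1"
  shows "\<exists>\<delta>>0. \<forall>\<^sub>F t in at_top. \<exists>B\<in>sets M. measure M B < e \<and>
      (\<forall>z\<in>space M - B. \<forall>s\<in>{0..2}. \<forall>s'\<in>{0..2}. \<bar>s - s'\<bar> < \<delta> \<longrightarrow> \<bar>lim_path \<omega> j (scaled_count a t (root_frag z)) s - lim_path \<omega> j (scaled_count a t (root_frag z)) s'\<bar> < \<eta>)"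
proof -
  define \<kappa> where "\<kappa> = max 1 (2 powr (\<omega> * (real j - 1)))"
  have \<kappa>: "\<kappa> \<ge> 1" by (simp add: \<kappa>_def)
  have \<kappa>s: "max 1 (s powr (\<omega> * (real j - 1))) \<le> \<kappa>" if "s \<in> {0..2}" for s
  proof -
    have "s powr (\<omega> * (real j - 1)) \<le> 2 powr (\<omega> * (real j - 1))" using that pos j by (intro powr_mono2) auto
    then show ?thesis by (auto simp: \<kappa>_def)
  qed
  \<comment> \<open>\<open>\<kappa>\<close> bounds the amplification of uniform errors by
    \<open>lim_path\<close> on \<open>[0, 2]\<close>. Two approximation errors of
    \<open>\<eta> / 8\<close> and an oscillation of \<open>\<eta> / 2\<close> stay below
    \<open>\<eta>\<close>.\<close>
  define \<rho> where "\<rho> = \<eta> / (8 * \<kappa>)"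
  have \<rho>: "\<rho> > 0" using \<eta> \<kappa> by (simp add: \<rho>_def)
  obtain m where m: "1 / real (Suc m) < \<rho>" using nat_approx_posE[OF \<rho>] by blast
  define \<phi> where "\<phi> l = (of_bool (net_r l \<le> \<rho>) :: real)" for l
  have "\<exists>L. \<forall>\<^sub>F t in at_top. (\<integral>z. rmax (\<lambda>l. \<phi> l * of_bool (near l t (root_frag z))) L \<partial>M) \<ge> (\<integral>x. 1 \<partial>MW) - e / 2"
  proof (rule paths_lower_bound[where Bd = 1])
    fix x :: 'g and \<delta> :: real assume "\<delta> > 0"
    obtain l where l: "net_m l = m" "\<forall>s\<in>{0..3}. \<bar>Wh x s - net_w l s\<bar> \<le> net_r l / 2"
      using net_dense[OF Wh_continuous] by blast
    have "\<phi> l = 1" using m l(1) by (simp add: \<phi>_def net_r_def)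
    then show "\<exists>l. \<phi> l > 1 - \<delta> \<and> (\<forall>s\<in>{0..3}. \<bar>Wh x s - net_w l s\<bar> \<le> net_r l / 2)" using l(2) \<open>\<delta> > 0\<close> by (intro exI[of _ l]) auto
  qed (use e in \<open>auto simp: \<phi>_def\<close>)
  then obtain L where L: "\<forall>\<^sub>F t in at_top. (\<integral>z. rmax (\<lambda>l. \<phi> l * of_bool (near l t (root_frag z))) L \<partial>M) \<ge> 1 - e / 2"
    by (auto simp: MW.prob_space)
  have "\<exists>d>0. \<forall>s\<in>{0..2}. \<forall>s'\<in>{0..2}. \<bar>s - s'\<bar> < d \<longrightarrow> \<bar>lim_path \<omega> j (net_w l) s - lim_path \<omega> j (net_w l) s'\<bar> < \<eta> / 2" for l
  proof -
    have "uniformly_continuous_on {0..2} (lim_path \<omega> j (net_w l))"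
      using pos j by (intro compact_uniformly_continuous lim_path_continuous net_w_continuous) auto
    then show ?thesis using \<eta> unfolding uniformly_continuous_on_def dist_real_def by (metis half_gt_zero)
  qed
  then obtain d where d: "\<And>l. d l > 0" "\<And>l s s'. s \<in> {0..2} \<Longrightarrow> s' \<in> {0..2} \<Longrightarrow> \<bar>s - s'\<bar> < d l \<Longrightarrow> \<bar>lim_path \<omega> j (net_w l) s - lim_path \<omega> j (net_w l) s'\<bar> < \<eta> / 2"
    by metis
  define \<delta> where "\<delta> = Min (insert 1 (d ` {..<L}))"
  have \<delta>: "\<delta> > 0" "\<And>l. l < L \<Longrightarrow> \<delta> \<le> d l" unfolding \<delta>_def using d(1) by (auto simp: Min_gr_iff)
  from AE_E[OF AE_good] obtain N where N: "{x\<in>space M. \<not> good x} \<subseteq> N" "emeasure M N = 0" "N \<in> sets M" by auto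
  have N0: "measure M N = 0" using N(2) by (simp add: measure_def)
  show ?thesis
  proof (intro exI[of _ \<delta>] conjI \<delta>(1))
    show "\<forall>\<^sub>F t in at_top. \<exists>B\<in>sets M. measure M B < e \<and>
      (\<forall>z\<in>space M - B. \<forall>s\<in>{0..2}. \<forall>s'\<in>{0..2}. \<bar>s - s'\<bar> < \<delta> \<longrightarrow> \<bar>lim_path \<omega> j (scaled_count a t (root_frag z)) s - lim_path \<omega> j (scaled_count a t (root_frag z)) s'\<bar> < \<eta>)"
      using L eventually_gt_at_top[of 0]
    proof eventually_elim
      case (elim t)
      define B where "B = {z\<in>space M. \<not> (\<exists>l\<in>{..<L}. net_r l \<le> \<rho> \<and> near l t (root_frag z))}"
      have Bm: "B \<in> sets M" unfolding B_def by measurable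
      have "rmax (\<lambda>l. \<phi> l * of_bool (near l t (root_frag z))) L \<le> 1 - indicator B z" if "z \<in> space M" for z
        using that by (intro rmax_le) (auto simp: B_def indicator_def \<phi>_def)
      then have "(\<integral>z. rmax (\<lambda>l. \<phi> l * of_bool (near l t (root_frag z))) L \<partial>M) \<le> (\<integral>z. 1 - indicator B z \<partial>M)"
      proof (intro integral_mono)
        show "integrable M (\<lambda>z. rmax (\<lambda>l. \<phi> l * of_bool (near l t (root_frag z))) L)"
        proof (rule M.integrable_const_bound[where B = 1])
          have "rmax (\<lambda>l. \<phi> l * of_bool (near l t (root_frag z))) L \<le> 1" for z by (rule rmax_le) (auto simp: \<phi>_def)
          then show "AE z in M. norm (rmax (\<lambda>l. \<phi> l * of_bool (near l t (root_frag z))) L) \<le> 1"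
            by (intro AE_I2) (simp only: real_norm_def abs_of_nonneg[OF rmax_nonneg])
        qed measurable
        show "integrable M (\<lambda>z. 1 - indicator B z :: real)" using Bm by (intro Bochner_Integration.integrable_diff) (auto simp: M.emeasure_eq_measure)
      qed
      also have "\<dots> = 1 - measure M B" using Bm by (simp add: M.prob_space M.emeasure_eq_measure)
      finally have mB: "measure M B < e" using elim(1) e by linarith
      show ?case
      proof (intro bexI[of _ "B \<union> N"] conjI ballI impI)
        show "measure M (B \<union> N) < e" using measure_Un_le[OF Bm N(3)] N0 mB by simp
        show "B \<union> N \<in> sets M" using Bm N by auto
        fix z s s' assume z: "z \<in> space M - (B \<union> N)" and s: "s \<in> {0..2}" "s' \<in> {0..2}" "\<bar>s - s'\<bar> < \<delta>"
        have g: "good z" using z N(1) by auto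
        obtain l where l: "l < L" "net_r l \<le> \<rho>" "near l t (root_frag z)" using z unfolding B_def by auto
        have "\<bar>lim_path \<omega> j (scaled_count a t (root_frag z)) r - lim_path \<omega> j (net_w l) r\<bar> \<le> \<eta> / 8" if "r \<in> {0..2}" for r
        proof -
          have "max 1 (r powr (\<omega> * (real j - 1))) * net_r l \<le> \<kappa> * \<rho>"
            using \<kappa>s[OF that] l(2) net_r[of l] \<kappa> by (intro mult_mono) auto
          also have "\<kappa> * \<rho> = \<eta> / 8" using \<kappa> by (simp add: \<rho>_def)
          finally show ?thesis using near_limit_path[OF g elim(2) l(3) j that] by linarith
        qed
        from this[OF s(1)] this[OF s(2)] d(2)[OF s(1,2), of l] s(3) \<delta>(2)[OF l(1)] \<eta>
        show "\<bar>lim_path \<omega> j (scaled_count a t (root_frag z)) s - lim_path \<omega> j (scaled_count a t (root_frag z)) s'\<bar> < \<eta>" by linarith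
      qed
    qed
  qed
qed

text \<open>If the root process is near \<open>net_w l\<close>, then off an exceptional set the
  occupancy path lies in the tube of \<open>l\<close>, where \<open>f\<close> is at least its
  infimum over the tube. On the side of the limit, small tubes around a path recover
  \<open>f\<close> by continuity.\<close>

lemma liminf_bound:
  assumes f: "continuous_map path_top euclideanreal f" and fb: "\<And>v. v \<in> topspace path_top \<Longrightarrow> \<bar>f v\<bar> \<le> Bd" and e: "e > 0"
  shows "\<forall>\<^sub>F n in sequentially. (\<integral>z. f (occupancy_path a n z) \<partial>M) \<ge> (\<integral>x. f (limit_paths \<omega> (Wh x)) \<partial>MW) - e"
proof -
  have fm [measurable]: "f \<in> borel_measurable (borel_of_topology path_top)" by (rule borel_of_topology_measurable_continuous[OF f])
  have Ptop: "limit_paths \<omega> (Wh x) \<in> topspace path_top" for x by (rule limit_paths_topspace[OF pos(2) Wh_continuous])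
  have Pm [measurable]: "(\<lambda>x. limit_paths \<omega> (Wh x)) \<in> MW \<rightarrow>\<^sub>M borel_of_topology path_top"
    by (rule limit_paths_measurable[OF pos(2) Wh_continuous Wh_measurable])
  have Bd: "Bd \<ge> 0" using fb[OF Ptop] by (meson abs_ge_zero order_trans)
  have tube_top: "tube \<omega> l \<subseteq> topspace path_top" for l by (auto simp: tube_def)
  have tube_ne: "tube \<omega> l \<noteq> {}" for l
    using limit_paths_in_tube[OF pos(2) net_w_continuous, of l l] net_r[of l] by auto
  \<comment> \<open>The shift by \<open>Bd\<close> makes the weights nonnegative, as maxima starting
    from \<open>0\<close> require.\<close>
  define \<phi> where "\<phi> l = (INF v\<in>tube \<omega> l. f v + Bd)" for l
  have bdd: "bdd_below ((\<lambda>v. f v + Bd) ` tube \<omega> l)" for l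
  proof (rule bdd_belowI2[of _ 0])
    fix v assume "v \<in> tube \<omega> l"
    then have "\<bar>f v\<bar> \<le> Bd" using tube_top fb by blast
    then show "0 \<le> f v + Bd" by linarith
  qed
  have \<phi>_le: "\<phi> l \<le> f v + Bd" if "v \<in> tube \<omega> l" for l v unfolding \<phi>_def by (rule cINF_lower[OF bdd that])
  have \<phi>: "0 \<le> \<phi> l" "\<phi> l \<le> 2 * Bd" for l
  proof -
    show "0 \<le> \<phi> l" unfolding \<phi>_def
    proof (rule cINF_greatest[OF tube_ne])
      fix v assume "v \<in> tube \<omega> l"
      then have "\<bar>f v\<bar> \<le> Bd" using tube_top fb by blast
      then show "0 \<le> f v + Bd" by linarith
    qed
    obtain v where v: "v \<in> tube \<omega> l" using tube_ne by blast
    then have "\<bar>f v\<bar> \<le> Bd" using tube_top fb by blast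
    then show "\<phi> l \<le> 2 * Bd" using \<phi>_le[OF v] by linarith
  qed
  define g where "g x = f (limit_paths \<omega> (Wh x)) + Bd" for x
  have gm: "g \<in> borel_measurable MW" unfolding g_def by measurable
  have gb: "\<bar>g x\<bar> \<le> 2 * Bd" for x using fb[OF Ptop[of x]] Bd unfolding g_def by linarith
  have "\<exists>L. \<forall>\<^sub>F t in at_top. (\<integral>z. rmax (\<lambda>l. \<phi> l * of_bool (near l t (root_frag z))) L \<partial>M) \<ge> (\<integral>x. g x \<partial>MW) - e / 2"
  proof (rule paths_lower_bound[OF \<phi> gm gb])
    fix x and \<delta> :: real assume \<delta>: "\<delta> > 0"
    define U where "U = {v \<in> topspace path_top. f v \<in> {f (limit_paths \<omega> (Wh x)) - \<delta> / 2<..}}"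
    have "openin path_top U" unfolding U_def by (rule openin_continuous_map_preimage[OF f]) (simp add: open_greaterThan)
    moreover have "limit_paths \<omega> (Wh x) \<in> U" using Ptop[of x] \<delta> by (auto simp: U_def simp del: topspace_product_topology)
    ultimately obtain l where l: "tube \<omega> l \<subseteq> U" "\<forall>s\<in>{0..3}. \<bar>Wh x s - net_w l s\<bar> \<le> net_r l / 2"
      using tube_cover[OF pos(2) _ Wh_continuous] by blast
    have "f (limit_paths \<omega> (Wh x)) - \<delta> / 2 + Bd \<le> \<phi> l" unfolding \<phi>_def
      by (rule cINF_greatest[OF tube_ne]) (use l(1) in \<open>auto simp: U_def\<close>)
    then show "\<exists>l. \<phi> l > g x - \<delta> \<and> (\<forall>s\<in>{0..3}. \<bar>Wh x s - net_w l s\<bar> \<le> net_r l / 2)"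
      using l(2) \<delta> by (intro exI[of _ l]) (auto simp: g_def)
  qed (use e in auto)
  then obtain L where L: "\<forall>\<^sub>F t in at_top. (\<integral>z. rmax (\<lambda>l. \<phi> l * of_bool (near l t (root_frag z))) L \<partial>M) \<ge> (\<integral>x. g x \<partial>MW) - e / 2" by blast
  \<comment> \<open>Chosen so that the error \<open>4 * \<eta>\<close> of
    \<open>occupancy_whp\<close> is at most half of every radius in use; the inserted
    \<open>1\<close> covers an empty range.\<close>
  define \<eta> where "\<eta> = Min (insert 1 (net_r ` {..<L})) / 8"
  have \<eta>: "\<eta> > 0" "\<And>l. l < L \<Longrightarrow> 4 * \<eta> \<le> net_r l / 2"
  proof -
    have "Min (insert 1 (net_r ` {..<L})) > 0" using net_r by (auto simp: Min_gr_iff)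
    then show "\<eta> > 0" by (simp add: \<eta>_def)
    fix l assume "l < L"
    then have "Min (insert 1 (net_r ` {..<L})) \<le> net_r l" by (intro Min_le) auto
    then show "4 * \<eta> \<le> net_r l / 2" by (simp add: \<eta>_def)
  qed
  \<comment> \<open>Only the finitely many levels controlled by the tubes with \<open>l < L\<close>
    have to be compared, although the product has infinitely many.\<close>
  define J where "J = Max (insert 0 ((\<lambda>l. Suc (net_m l)) ` {..<L}))"
  have J: "Suc (net_m l) \<le> J" if "l < L" for l unfolding J_def using that by (intro Max_ge) auto
  have "whp M sequentially (\<lambda>n z. \<forall>j\<in>{1..J}. \<forall>s\<in>{0..1}. \<bar>(cum_occupancy X n j s z - cc j * (s * ln (real n)) powr (\<omega> * real j)) / norming a j (ln (real n))
     - lim_path \<omega> j (scaled_count a (ln (real n)) (root_frag z)) s\<bar> \<le> 4 * \<eta>)"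
    by (rule M.whp_finite) (auto intro!: occupancy_whp[OF _ a_pos \<eta>(1)] oscillation)
  from M.whp_conj[OF this M.whp_AE[OF AE_good]]
  have whp: "whp M sequentially (\<lambda>n z. (\<forall>j\<in>{1..J}. \<forall>s\<in>{0..1}. \<bar>(cum_occupancy X n j s z - cc j * (s * ln (real n)) powr (\<omega> * real j)) / norming a j (ln (real n))
     - lim_path \<omega> j (scaled_count a (ln (real n)) (root_frag z)) s\<bar> \<le> 4 * \<eta>) \<and> good z)" .
  \<comment> \<open>On the exceptional set \<open>f + Bd\<close> may fall short of the maximum by at
    most \<open>2 * Bd\<close>; this probability turns the loss into at most
    \<open>e / 2\<close>.\<close>
  have e': "e / (4 * (Bd + 1)) > 0" using e Bd by simp
  show ?thesis
    using whpD[OF whp e'] eventually_ln[OF L] eventually_ge_at_top[of 2]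
  proof eventually_elim
    case (elim n)
    define t where "t = ln (real n)"
    have t: "t > 0" using elim(3) by (simp add: t_def)
    obtain B where B: "B \<in> sets M" "measure M B < e / (4 * (Bd + 1))"
      "\<forall>z\<in>space M - B. (\<forall>j\<in>{1..J}. \<forall>s\<in>{0..1}. \<bar>(cum_occupancy X n j s z - cc j * (s * ln (real n)) powr (\<omega> * real j)) / norming a j (ln (real n))
     - lim_path \<omega> j (scaled_count a (ln (real n)) (root_frag z)) s\<bar> \<le> 4 * \<eta>) \<and> good z"
      using elim(1) by (elim bexE conjE) (rule that)
    define R where "R z = rmax (\<lambda>l. \<phi> l * of_bool (near l t (root_frag z))) L" for z
    have Rb: "0 \<le> R z" "R z \<le> 2 * Bd" for z
      unfolding R_def using \<phi> Bd by (auto intro!: rmax_nonneg rmax_le simp: of_bool_def)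
    have Rm [measurable]: "R \<in> borel_measurable M" unfolding R_def by measurable
    have Zm [measurable]: "occupancy_path a n \<in> M \<rightarrow>\<^sub>M borel_of_topology path_top" by (rule occupancy_path_measurable[OF elim(3)])
    have Ztop: "occupancy_path a n z \<in> topspace path_top" for z by (rule occupancy_path_measurable[OF elim(3)])
    have fZb: "\<bar>f (occupancy_path a n z)\<bar> \<le> Bd" for z by (rule fb[OF Ztop])
    have le: "R z \<le> f (occupancy_path a n z) + Bd + 2 * Bd * indicator B z" if z: "z \<in> space M" for z
    proof (cases "z \<in> B")
      case True
      then show ?thesis using Rb(2)[of z] fZb[of z] by (simp add: abs_le_iff)
    next
      case False
      then have zB: "\<forall>j\<in>{1..J}. \<forall>s\<in>{0..1}. \<bar>(cum_occupancy X n j s z - cc j * (s * t) powr (\<omega> * real j)) / norming a j t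
        - lim_path \<omega> j (scaled_count a t (root_frag z)) s\<bar> \<le> 4 * \<eta>" and g: "good z" using B(3) z unfolding t_def by auto
      have "R z \<le> f (occupancy_path a n z) + Bd" unfolding R_def
      proof (rule rmax_le)
        show "0 \<le> f (occupancy_path a n z) + Bd" using fZb[of z] by linarith
        fix l assume l: "l < L"
        show "\<phi> l * of_bool (near l t (root_frag z)) \<le> f (occupancy_path a n z) + Bd"
        proof (cases "near l t (root_frag z)")
          case True
          have "occupancy_path a n z \<in> tube \<omega> l" unfolding tube_def
          proof (intro CollectI conjI ballI Ztop)
            fix j s assume j: "j \<in> {1..Suc (net_m l)}" and s: "s \<in> {0..1::real}"
            have "j \<in> {1..J}" using j J[OF l] by auto
            then have 1: "\<bar>occupancy_path a n z j s - lim_path \<omega> j (scaled_count a t (root_frag z)) s\<bar> \<le> 4 * \<eta>"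
              using zB s j by (simp add: occupancy_path_def t_def)
            have "s powr (\<omega> * (real j - 1)) \<le> 1" using s j pos by (intro powr_le1) auto
            then have "max 1 (s powr (\<omega> * (real j - 1))) = 1" by simp
            then have "\<bar>lim_path \<omega> j (scaled_count a t (root_frag z)) s - lim_path \<omega> j (net_w l) s\<bar> \<le> net_r l"
              using near_limit_path[OF g t True, of j s] j s by simp
            then show "\<bar>occupancy_path a n z j s - lim_path \<omega> j (net_w l) s\<bar> \<le> 3 / 2 * net_r l"
              using 1 \<eta>(2)[OF l] by linarith
          qed
          then show ?thesis using \<phi>_le True by simp
        next
          case False
          then show ?thesis using fZb[of z] by (simp add: abs_le_iff)
        qed
      qed
      then show ?thesis using False by simp
    qed
    have fZi: "integrable M (\<lambda>z. f (occupancy_path a n z))" by (rule M.integrable_const_bound[where B = Bd]) (use fZb in auto)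
    have "(\<integral>z. R z \<partial>M) \<le> (\<integral>z. f (occupancy_path a n z) + Bd + 2 * Bd * indicator B z \<partial>M)"
    proof (rule integral_mono)
      show "integrable M R" by (rule M.integrable_const_bound[where B = "2 * Bd"]) (use Rb in auto)
      show "integrable M (\<lambda>z. f (occupancy_path a n z) + Bd + 2 * Bd * indicator B z)"
        using B(1) fZi by (intro Bochner_Integration.integrable_add integrable_mult_right) (auto simp: M.emeasure_eq_measure)
    qed (rule le)
    also have "\<dots> = (\<integral>z. f (occupancy_path a n z) \<partial>M) + Bd + 2 * Bd * measure M B"
      using B(1) fZi by (subst Bochner_Integration.integral_add) (auto simp: M.prob_space M.emeasure_eq_measure)
    finally have 1: "(\<integral>z. R z \<partial>M) \<le> (\<integral>z. f (occupancy_path a n z) \<partial>M) + Bd + 2 * Bd * measure M B" .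
    have "2 * Bd * measure M B \<le> 2 * (Bd + 1) * (e / (4 * (Bd + 1)))" using B(2) Bd by (intro mult_mono) auto
    also have "\<dots> = e / 2" using Bd by (simp add: field_simps)
    finally have 2: "2 * Bd * measure M B \<le> e / 2" .
    have fPi: "integrable MW (\<lambda>x. f (limit_paths \<omega> (Wh x)))" by (rule MW.integrable_const_bound[where B = Bd]) (use fb[OF Ptop] in auto)
    have 3: "(\<integral>x. g x \<partial>MW) = (\<integral>x. f (limit_paths \<omega> (Wh x)) \<partial>MW) + Bd"
      unfolding g_def using fPi by (simp add: MW.prob_space)
    show ?case using elim(2) 1 2 3 unfolding R_def t_def by linarith
  qed
qed

lemma occupancy_converges_weakly:
  "converges_weakly path_top sequentially M (occupancy_path a) MW (\<lambda>x. \<lambda>j\<in>{1::nat..}. \<lambda>s\<in>{0..1}. lim_path \<omega> j (W x) s)"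
  unfolding converges_weakly_def
proof (intro exI conjI allI impI)
  show "\<forall>\<^sub>F n in sequentially. random_element_version M path_top (occupancy_path a n) (occupancy_path a n)"
    using eventually_ge_at_top[of 2] 
    by eventually_elim (unfold random_element_version_def, intro conjI occupancy_path_measurable(1) AE_I2 refl)
  show "random_element_version MW path_top (\<lambda>x. \<lambda>j\<in>{1::nat..}. \<lambda>s\<in>{0..1}. lim_path \<omega> j (W x) s) (\<lambda>x. limit_paths \<omega> (Wh x))"
    unfolding random_element_version_def
  proof
    show "(\<lambda>x. limit_paths \<omega> (Wh x)) \<in> MW \<rightarrow>\<^sub>M borel_of_topology path_top"
      by (rule limit_paths_measurable[OF pos(2) Wh_continuous Wh_measurable])
    show "AE x in MW. (\<lambda>j\<in>{1::nat..}. \<lambda>s\<in>{0..1}. lim_path \<omega> j (W x) s) = limit_paths \<omega> (Wh x)"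
      using Wh_version
    proof eventually_elim
      case (elim x)
      show ?case unfolding limit_paths_def by (intro restrict_ext lim_path_cong) (use elim in auto)
    qed
  qed
  fix f assume f: "continuous_map path_top euclideanreal f \<and> bounded (f ` topspace path_top)"
  then obtain Bd where Bd: "\<And>v. v \<in> topspace path_top \<Longrightarrow> \<bar>f v\<bar> \<le> Bd" unfolding bounded_iff by auto
  have mf: "continuous_map path_top euclideanreal (\<lambda>v. - f v)" using f by (intro continuous_map_minus) auto
  show "(\<lambda>n. \<integral>z. f (occupancy_path a n z) \<partial>M) \<longlonglongrightarrow> (\<integral>x. f (limit_paths \<omega> (Wh x)) \<partial>MW)"
  proof (rule tendstoI)
    fix e :: real assume "e > 0"
    then have e2: "e / 2 > 0" by simp
    have lower: "\<forall>\<^sub>F n in sequentially. (\<integral>z. f (occupancy_path a n z) \<partial>M) \<ge> (\<integral>x. f (limit_paths \<omega> (Wh x)) \<partial>MW) - e / 2"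
      by (rule liminf_bound[OF conjunct1[OF f] Bd e2])
    have "\<forall>\<^sub>F n in sequentially. (\<integral>z. - f (occupancy_path a n z) \<partial>M) \<ge> (\<integral>x. - f (limit_paths \<omega> (Wh x)) \<partial>MW) - e / 2"
    proof (rule liminf_bound[OF mf _ e2])
      show "\<bar>- f v\<bar> \<le> Bd" if "v \<in> topspace path_top" for v using Bd[OF that] by (simp only: abs_minus_cancel)
    qed
    with lower show "\<forall>\<^sub>F n in sequentially. dist (\<integral>z. f (occupancy_path a n z) \<partial>M) (\<integral>x. f (limit_paths \<omega> (Wh x)) \<partial>MW) < e"
    proof eventually_elim
      case (elim n)
      then show ?case using \<open>e > 0\<close> unfolding dist_real_def Bochner_Integration.integral_minus by linarith
    qed
  qed
qed

end

section \<open>From the hypotheses on the fragmentation law and the Gaussian process to the abstract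
  setting\<close>

lemma rpow_le:
  assumes "t \<ge> 0" "0 \<le> r" "r \<le> r'" shows "rpow t r \<le> (1 + t) powr r'"
proof -
  have "rpow t r \<le> (1 + t) powr r" using assms by (auto simp: rpow_def intro: powr_mono2)
  also have "\<dots> \<le> (1 + t) powr r'" using assms by (intro powr_mono) auto
  finally show ?thesis .
qed

lemma rpow_nonneg: "0 \<le> rpow t r"
  by (simp add: rpow_def)

lemma cnt_eq_frag_count: "cnt (\<lambda>k. P k x) t = frag_count P t x"
  by (simp add: log_sum_1 frag_count_def)

lemma fragmentation_law_locale:
  fixes M0 :: "'f measure" and P :: "nat \<Rightarrow> 'f \<Rightarrow> real"
  assumes frag: "fragmentation_law M0 P"
    and params: "c > 0" "\<omega> > 0" "a0 > 0" "a1 > 0" "0 < \<epsilon>1" "\<epsilon>1 \<le> \<omega>" "0 < \<epsilon>2" "\<epsilon>2 \<le> \<omega>"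
    and mean_bounds: "\<And>t. t \<ge> 0 \<Longrightarrow>
      b0 + b1 * rpow t (\<omega> - \<epsilon>1) \<le> mean_frag_count M0 P t - c * t powr \<omega> \<and>
      mean_frag_count M0 P t - c * t powr \<omega> \<le> a0 + a1 * rpow t (\<omega> - \<epsilon>2)"
    and gamma: "\<omega> - min 1 (min \<epsilon>1 \<epsilon>2) < \<gamma>" "\<gamma> < \<omega>"
    and second_moment: "\<exists>C. \<forall>\<^sub>F t in at_top.
      (\<integral>\<^sup>+x. (SUP s\<in>{0..t}. ennreal ((frag_count P s x - mean_frag_count M0 P s)\<^sup>2)) \<partial>M0)
        \<le> ennreal (C * t powr (2 * \<gamma>))"
  shows "fragmentation (distr M0 (\<Pi>\<^sub>M k\<in>UNIV. borel) (\<lambda>x k. P k x)) c \<omega> (min \<epsilon>1 \<epsilon>2) \<gamma>"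
proof -
  interpret M0: prob_space M0 using frag by (simp add: fragmentation_law_def)
  have Pm [measurable]: "P k \<in> borel_measurable M0" for k using frag by (simp add: fragmentation_law_def)
  have Ps [measurable]: "(\<lambda>x k. P k x) \<in> M0 \<rightarrow>\<^sub>M (\<Pi>\<^sub>M k\<in>UNIV. borel)"
    by (rule measurable_PiM_single') auto
  define \<mu> where "\<mu> = distr M0 (\<Pi>\<^sub>M k\<in>UNIV. (borel :: real measure)) (\<lambda>x k. P k x)"
  let ?\<epsilon> = "min \<epsilon>1 \<epsilon>2"
  have sets_mu [measurable_cong]: "sets \<mu> = sets (\<Pi>\<^sub>M k\<in>UNIV. borel)" by (simp add: \<mu>_def)
  have cntm [measurable]: "(\<lambda>q. cnt q t) \<in> borel_measurable (\<Pi>\<^sub>M k\<in>UNIV. borel)" for t by measurable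
  have mean: "(\<integral>q. cnt q t \<partial>\<mu>) = mean_frag_count M0 P t" for t
    unfolding \<mu>_def mean_frag_count_def by (subst integral_distr) (auto simp: cnt_eq_frag_count)
  \<comment> \<open>Partial sums instead of the series make the event visibly measurable, so that it
    passes to the image measure.\<close>
  have AE1: "AE q in \<mu>. (\<forall>k. 0 < q k) \<and> (\<forall>n. (\<Sum>k<n. q k) \<le> 1)"
    unfolding \<mu>_def
  proof (subst AE_distr_iff)
    have "AE x in M0. (\<forall>k. P k x > 0) \<and> (\<lambda>k. P k x) sums 1" using frag by (simp add: fragmentation_law_def)
    then show "AE x in M0. (\<forall>k. 0 < P k x) \<and> (\<forall>n. (\<Sum>k<n. P k x) \<le> 1)"
    proof eventually_elim
      case (elim x)
      then have "(\<Sum>k<n. P k x) \<le> (\<Sum>k. P k x)" for n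
        by (intro sum_le_suminf) (auto simp: sums_iff less_imp_le)
      then show ?case using elim by (simp add: sums_iff)
    qed
    show "{q \<in> space (\<Pi>\<^sub>M k\<in>UNIV. borel). (\<forall>k. 0 < q k) \<and> (\<forall>n. (\<Sum>k<n. q k) \<le> (1::real))} \<in> sets (\<Pi>\<^sub>M k\<in>(UNIV::nat set). borel)"
      by measurable
  qed (rule Ps)
  show ?thesis unfolding \<mu>_def[symmetric]
  proof (intro fragmentation.intro fragmentation_axioms.intro)
    show "prob_space \<mu>" unfolding \<mu>_def by (rule M0.prob_space_distr[OF Ps])
    show "sets \<mu> = sets (\<Pi>\<^sub>M k\<in>UNIV. borel)" by (rule sets_mu)
    show "AE q in \<mu>. subprob UNIV q \<and> (\<forall>k. q k < 1)"
      using AE1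
    proof eventually_elim
      case (elim q)
      have le: "sum q F \<le> 1" if fin: "finite F" for F
      proof -
        obtain n where "F \<subseteq> {..<n}" using finite_nat_bounded[OF fin] by blast
        then have "sum q F \<le> (\<Sum>k<n. q k)" using elim by (intro sum_mono2) (auto intro: less_imp_le)
        then show ?thesis using elim by (meson order_trans)
      qed
      \<comment> \<open>A second positive fragment fits beside \<open>q k\<close> into total mass
        one.\<close>
      have "q k < 1" for k
      proof -
        have "q k + q (Suc k) \<le> 1" using le[of "{k, Suc k}"] by simp
        moreover have "q (Suc k) > 0" using elim by blast
        ultimately show ?thesis by linarith
      qed
      then show ?case using le elim by (auto simp: subprob_def)
    qed
    show "\<exists>C. \<forall>t\<ge>0. \<bar>(\<integral>q. cnt q t \<partial>\<mu>) - c * t powr \<omega>\<bar> \<le> C * (1 + t) powr (\<omega> - ?\<epsilon>)"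
    proof (intro exI allI impI)
      fix t :: real assume t: "t \<ge> 0"
      let ?r = "(1 + t) powr (\<omega> - ?\<epsilon>)"
      have r1: "1 \<le> ?r" using t params by (intro ge_one_powr_ge_zero) auto
      have 1: "rpow t (\<omega> - \<epsilon>1) \<le> ?r" "rpow t (\<omega> - \<epsilon>2) \<le> ?r" using t params by (auto intro!: rpow_le)
      have "a1 * rpow t (\<omega> - \<epsilon>2) \<le> a1 * ?r" using 1 params by (intro mult_left_mono) auto
      moreover have "a0 * 1 \<le> a0 * ?r" using r1 params by (intro mult_left_mono) auto
      moreover have "- (\<bar>b1\<bar> * ?r) \<le> b1 * rpow t (\<omega> - \<epsilon>1)"
      proof -
        have "\<bar>b1 * rpow t (\<omega> - \<epsilon>1)\<bar> \<le> \<bar>b1\<bar> * ?r" using 1 rpow_nonneg[of t "\<omega> - \<epsilon>1"] by (simp add: abs_mult mult_left_mono)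
        then show ?thesis by linarith
      qed
      moreover have "\<bar>b0\<bar> * 1 \<le> \<bar>b0\<bar> * ?r" using r1 by (intro mult_left_mono) auto
      moreover have "(a0 + a1 + \<bar>b0\<bar> + \<bar>b1\<bar>) * ?r = a0 * ?r + a1 * ?r + \<bar>b0\<bar> * ?r + \<bar>b1\<bar> * ?r" by (simp add: distrib_right)
      moreover have "0 \<le> a0 * ?r" "0 \<le> a1 * ?r" "0 \<le> \<bar>b0\<bar> * ?r" "0 \<le> \<bar>b1\<bar> * ?r" using params by auto
      ultimately show "\<bar>(\<integral>q. cnt q t \<partial>\<mu>) - c * t powr \<omega>\<bar> \<le> (a0 + a1 + \<bar>b0\<bar> + \<bar>b1\<bar>) * ?r"
        using mean_bounds[OF t] unfolding mean by linarith
    qed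
    obtain C where C: "\<forall>\<^sub>F t in at_top.
      (\<integral>\<^sup>+x. (SUP s\<in>{0..t}. ennreal ((frag_count P s x - mean_frag_count M0 P s)\<^sup>2)) \<partial>M0) \<le> ennreal (C * t powr (2 * \<gamma>))"
      using second_moment by blast
    show "\<exists>C. \<forall>\<^sub>F t in at_top. \<forall>G \<in> borel_measurable \<mu>.
      (AE q in \<mu>. G q \<le> (SUP s\<in>{0..t}. ennreal ((cnt q s - (\<integral>q. cnt q s \<partial>\<mu>))\<^sup>2))) \<longrightarrow>
      (\<integral>\<^sup>+q. G q \<partial>\<mu>) \<le> ennreal (C * t powr (2 * \<gamma>))"
    proof (rule exI[of _ C], use C in eventually_elim, intro ballI impI)
      fix t G assume t: "(\<integral>\<^sup>+x. (SUP s\<in>{0..t}. ennreal ((frag_count P s x - mean_frag_count M0 P s)\<^sup>2)) \<partial>M0) \<le> ennreal (C * t powr (2 * \<gamma>))"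
        and G: "G \<in> borel_measurable \<mu>" "AE q in \<mu>. G q \<le> (SUP s\<in>{0..t}. ennreal ((cnt q s - (\<integral>q. cnt q s \<partial>\<mu>))\<^sup>2))"
      have "AE x in M0. G (\<lambda>k. P k x) \<le> (SUP s\<in>{0..t}. ennreal ((cnt (\<lambda>k. P k x) s - (\<integral>q. cnt q s \<partial>\<mu>))\<^sup>2))"
      proof (rule AE_distrD[OF Ps, where P = "\<lambda>q. G q \<le> (SUP s\<in>{0..t}. ennreal ((cnt q s - (\<integral>q. cnt q s \<partial>\<mu>))\<^sup>2))"])
        show "AE q in distr M0 (\<Pi>\<^sub>M k\<in>UNIV. borel) (\<lambda>x k. P k x). G q \<le> (SUP s\<in>{0..t}. ennreal ((cnt q s - (\<integral>q. cnt q s \<partial>\<mu>))\<^sup>2))"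
          unfolding \<mu>_def[symmetric] by (rule G(2))
      qed
      then have "(\<integral>\<^sup>+x. G (\<lambda>k. P k x) \<partial>M0) \<le> (\<integral>\<^sup>+x. (SUP s\<in>{0..t}. ennreal ((frag_count P s x - mean_frag_count M0 P s)\<^sup>2)) \<partial>M0)"
        unfolding cnt_eq_frag_count mean by (rule nn_integral_mono_AE)
      also note t
      also have "(\<integral>\<^sup>+x. G (\<lambda>k. P k x) \<partial>M0) = (\<integral>\<^sup>+q. G q \<partial>\<mu>)"
        using G(1) unfolding \<mu>_def by (subst nn_integral_distr) auto
      finally show "(\<integral>\<^sup>+q. G q \<partial>\<mu>) \<le> ennreal (C * t powr (2 * \<gamma>))" .
    qed
  qed (use params gamma in auto)
qed

text \<open>The process is set to zero on a measurable null set containing the irregular paths and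
  is held constant before time \<open>0\<close>, so every path is continuous. Measurability of
  single values is the case of one time point in the Gaussian hypothesis.\<close>

lemma continuous_version:
  assumes gauss: "centered_gaussian_process MW {0..} W"
    and hoelder: "\<beta> > 0" "AE x in MW. locally_hoelder \<beta> (\<lambda>s. W s x)"
  shows "\<exists>Wh. (\<forall>x. continuous_on UNIV (Wh x)) \<and> (\<forall>s. (\<lambda>x. Wh x s) \<in> borel_measurable MW) \<and>
    (AE x in MW. \<forall>s\<ge>0. Wh x s = W s x)"
proof -
  have Wm: "W s \<in> borel_measurable MW" if "s \<ge> 0" for s
  proof -
    have "\<forall>S u. finite S \<and> S \<subseteq> {0..} \<longrightarrow> centered_gaussian MW (\<lambda>x. \<Sum>r\<in>S. u r * W r x)"
      using gauss unfolding centered_gaussian_process_def by (rule conjunct2)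
    from this[rule_format, of "{s}" "\<lambda>_. 1"] that
    have "centered_gaussian MW (\<lambda>x. \<Sum>r\<in>{s}. 1 * W r x)" by simp
    then show ?thesis unfolding centered_gaussian_def by simp
  qed
  from AE_E[OF hoelder(2)] obtain N where N: "{x\<in>space MW. \<not> locally_hoelder \<beta> (\<lambda>s. W s x)} \<subseteq> N" "emeasure MW N = 0" "N \<in> sets MW" by auto
  define Wh where "Wh x s = (if x \<in> space MW - N then W (max 0 s) x else 0)" for x s
  have "continuous_on UNIV (Wh x)" for x
  proof (cases "x \<in> space MW - N")
    case True
    then have "locally_hoelder \<beta> (\<lambda>s. W s x)" using N(1) by auto
    from hoelder_continuous[OF this hoelder(1)] show ?thesis using True by (simp add: Wh_def[abs_def])
  next
    case False
    then have "Wh x = (\<lambda>_. 0)" by (auto simp: Wh_def)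
    then show ?thesis by simp
  qed
  moreover have "(\<lambda>x. Wh x s) \<in> borel_measurable MW" for s
    unfolding Wh_def using Wm[of "max 0 s"] N(3) by measurable
  moreover have "AE x in MW. \<forall>s\<ge>0. Wh x s = W s x"
  proof -
    have "AE x in MW. x \<notin> N" using N by (intro AE_not_in) (simp add: null_sets_def)
    then show ?thesis using AE_space by eventually_elim (auto simp: Wh_def)
  qed
  ultimately show ?thesis by blast
qed

theorem theorem2p1:
  fixes M0 :: "'f measure" and P :: "nat \<Rightarrow> 'f \<Rightarrow> real"
    and M :: "'w measure" and Q :: "nat list \<Rightarrow> nat \<Rightarrow> 'w \<Rightarrow> real" and X :: "nat \<Rightarrow> nat \<Rightarrow> 'w \<Rightarrow> nat"
    and MW :: "'g measure" and W :: "real \<Rightarrow> 'g \<Rightarrow> real"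
    and \<beta> c \<omega> a0 a1 b0 b1 \<epsilon>1 \<epsilon>2 \<gamma> a :: real
  assumes frag: "fragmentation_law M0 P"
    and scheme: "nested_occupancy_scheme M0 P M Q X"
    and gauss: "centered_gaussian_process MW {0..} W"
    and W0: "AE x in MW. W 0 x = 0"
    and hoelder: "\<beta> > 0" "AE x in MW. locally_hoelder \<beta> (\<lambda>s. W s x)"
    and params: "c > 0" "\<omega> > 0" "a0 > 0" "a1 > 0"
      "0 < \<epsilon>1" "\<epsilon>1 \<le> \<omega>" "0 < \<epsilon>2" "\<epsilon>2 \<le> \<omega>"
    and mean_bounds: "\<And>t. t \<ge> 0 \<Longrightarrow>
      b0 + b1 * rpow t (\<omega> - \<epsilon>1) \<le> mean_frag_count M0 P t - c * t powr \<omega> \<and>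
      mean_frag_count M0 P t - c * t powr \<omega> \<le> a0 + a1 * rpow t (\<omega> - \<epsilon>2)"
    and gamma: "\<omega> - min 1 (min \<epsilon>1 \<epsilon>2) < \<gamma>" "\<gamma> < \<omega>"
    and second_moment: "\<exists>C. \<forall>\<^sub>F t in at_top.
      (\<integral>\<^sup>+x. (SUP s\<in>{0..t}. ennreal ((frag_count P s x - mean_frag_count M0 P s)\<^sup>2)) \<partial>M0)
        \<le> ennreal (C * t powr (2 * \<gamma>))"
    and a_pos: "a > 0"
    and clt: "converges_weakly (J1_topology {0..}) at_top
      M0 (\<lambda>t x. \<lambda>s\<in>{0..}. (frag_count P (t * s) x - c * (t * s) powr \<omega>) / (a * t powr \<gamma>))
      MW (\<lambda>x. \<lambda>s\<in>{0..}. W s x)"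
  shows "converges_weakly (product_topology (\<lambda>j. J1_topology {0..1}) {1..}) sequentially
      M (\<lambda>n x. \<lambda>j\<in>{1::nat..}. \<lambda>s\<in>{0..1}.
           (cum_occupancy X n j s x - lim_const c \<omega> j * (s * ln (real n)) powr (\<omega> * real j))
             / (a * lim_const c \<omega> (j - 1) * ln (real n) powr (\<gamma> + \<omega> * (real j - 1))))
      MW (\<lambda>x. \<lambda>j\<in>{1::nat..}. \<lambda>s\<in>{0..1}. lim_path \<omega> j (\<lambda>y. W y x) s)"
proof -
  define \<mu> where "\<mu> = distr M0 (\<Pi>\<^sub>M k\<in>UNIV. (borel :: real measure)) (\<lambda>x k. P k x)"
  interpret fragmentation \<mu> c \<omega> "min \<epsilon>1 \<epsilon>2" \<gamma>
    unfolding \<mu>_def by (rule fragmentation_law_locale[OF frag params mean_bounds gamma second_moment])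
  interpret MP: prob_space M using scheme by (simp add: nested_occupancy_scheme_def)
  interpret nested_fragmentation \<mu> c \<omega> "min \<epsilon>1 \<epsilon>2" \<gamma> M Q
    by unfold_locales (use scheme in \<open>auto simp: nested_occupancy_scheme_def \<mu>_def\<close>)
  interpret occupancy \<mu> c \<omega> "min \<epsilon>1 \<epsilon>2" \<gamma> M Q X
    by unfold_locales (use scheme in \<open>auto simp: nested_occupancy_scheme_def\<close>)
  obtain Wh where Wh: "\<And>x. continuous_on UNIV (Wh x)" "\<And>s. (\<lambda>x. Wh x s) \<in> borel_measurable MW"
    "AE x in MW. \<forall>s\<ge>0. Wh x s = W s x"
    using continuous_version[OF gauss hoelder] by blast
  have conv: "converges_weakly (J1_topology {0..}) at_top M0 (\<lambda>t x. restrict (scaled_count a t (\<lambda>k. P k x)) {0..}) MW (\<lambda>x. restrict (\<lambda>s. W s x) {0..})"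
    using clt by (simp add: scaled_count_def[abs_def] cnt_eq_frag_count)
  interpret M0: prob_space M0 using frag by (simp add: fragmentation_law_def)
  interpret MW: prob_space MW using gauss by (simp add: centered_gaussian_process_def)
  interpret occupancy_clt \<mu> c \<omega> "min \<epsilon>1 \<epsilon>2" \<gamma> M Q X M0 MW P "\<lambda>x s. W s x" Wh a
    by unfold_locales (use a_pos frag conv Wh in \<open>auto simp: fragmentation_law_def \<mu>_def\<close>)
  show ?thesis using occupancy_converges_weakly unfolding occupancy_path_def[abs_def] norming_def .
qed

end
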